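(* Let $E$ be a vector bundle with structure group $SO(m)$ over the disc $B\subset\mathbb{R}^2$. Then for every connection 1-form $\Omega\in L^2(B,\mathfrak{so}(m)\otimes\wedge^1\mathbb{R}^2)$ one can find $\xi\in W^{1,2}(B,\mathfrak{so}(m))$ and $S\in W^{1,2}(B,SO(m))$ such that $$\begin{cases}\nabla^\perp\xi=S^{-1}\nabla S+S^{-1}\Omega S, & x\in B,\\ \xi=0, & x\in\partial B.\end{cases}$$ Moreover, there exists a constant $C(m)$ (depending only on $m$) such that $$\|\xi\|_{1,2;B}+\|\nabla S\|_{2;B}\le C(m)\,\|\Omega\|_{2;B}.$$
   Context: $B$ is the unit disc in $\mathbb{R}^2$. $\mathfrak{so}(m)$ is the Lie algebra of skew-symmetric $m\times m$ matrices. $\|\cdot\|_{2;B}$ and $\|\cdot\|_{1,2;B}$ denote the $L^2(B)$ and $W^{1,2}(B)$ norms. $W^{1,2}(B,SO(m))$ is the set of $W^{1,2}$ matrix-valued functions with values in $SO(m)$ almost everywhere. $\nabla^\perp\xi=(-\partial_2\xi,\partial_1\xi)$ is the rotated gradient, and 1-forms are identified with vector fields via the Euclidean metric. The boundary condition $\xi=0$ is in the sense of traces. *)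

theory Defs
  imports "HOL-Analysis.Analysis"
begin

section \<open>Smooth functions\<close>

text \<open>Every directional derivative of a \<open>C\<^sup>k\<^sup>+\<^sup>1\<close> function is required to be \<open>C\<^sup>k\<close>;
  this already forces all derivatives up to order \<open>k + 1\<close> to be continuous.\<close>

primrec Ck :: "nat \<Rightarrow> ('a::euclidean_space \<Rightarrow> 'b::real_normed_vector) \<Rightarrow> bool" where
  "Ck 0 f \<longleftrightarrow> continuous_on UNIV f"
| "Ck (Suc k) f \<longleftrightarrow> f differentiable_on UNIV \<and>
     (\<forall>v. Ck k (\<lambda>x. frechet_derivative f (at x) v))"

definition smooth :: "('a::euclidean_space \<Rightarrow> 'b::real_normed_vector) \<Rightarrow> bool" where
  "smooth f \<longleftrightarrow> (\<forall>k. Ck k f)"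

definition test_function :: "'a::euclidean_space set \<Rightarrow> ('a \<Rightarrow> real) \<Rightarrow> bool" where
  "test_function U \<phi> \<longleftrightarrow>
     smooth \<phi> \<and> compact (closure {x. \<phi> x \<noteq> 0}) \<and> closure {x. \<phi> x \<noteq> 0} \<subseteq> U"

definition partial_deriv :: "'n::finite \<Rightarrow> (real^'n \<Rightarrow> real) \<Rightarrow> real^'n \<Rightarrow> real" where
  "partial_deriv i \<phi> x = frechet_derivative \<phi> (at x) (axis i 1)"

section \<open>Square integrable functions\<close>

definition square_integrable :: "'a measure \<Rightarrow> ('a \<Rightarrow> 'b::euclidean_space) \<Rightarrow> bool" where
  "square_integrable M f \<longleftrightarrow> f \<in> borel_measurable M \<and> integrable M (\<lambda>x. (norm (f x))\<^sup>2)"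

definition L2_norm :: "'a measure \<Rightarrow> ('a \<Rightarrow> 'b::euclidean_space) \<Rightarrow> real" where
  "L2_norm M f = sqrt (\<integral>x. (norm (f x))\<^sup>2 \<partial>M)"

section \<open>Weak gradients and Sobolev functions\<close>

definition locally_integrable_on ::
    "('a::euclidean_space \<Rightarrow> 'b::euclidean_space) \<Rightarrow> 'a set \<Rightarrow> bool" where
  "locally_integrable_on f U \<longleftrightarrow> (\<forall>K. compact K \<and> K \<subseteq> U \<longrightarrow> f absolutely_integrable_on K)"

definition has_weak_gradient ::
    "(real^'n \<Rightarrow> 'b::euclidean_space) \<Rightarrow> (real^'n \<Rightarrow> 'b^'n) \<Rightarrow> (real^'n) set \<Rightarrow> bool" where
  "has_weak_gradient u G U \<longleftrightarrow>
     locally_integrable_on u U \<and> locally_integrable_on G U \<and>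
     (\<forall>\<phi> i. test_function U \<phi> \<longrightarrow>
        (\<integral>x. partial_deriv i \<phi> x *\<^sub>R u x \<partial>lebesgue_on U) =
        - (\<integral>x. \<phi> x *\<^sub>R (G x $ i) \<partial>lebesgue_on U))"

text \<open>On an open set a weak gradient is unique only up to a null set, so \<open>weak_grad\<close> selects
  a representative; it may be used only in almost-everywhere statements and in integrals.\<close>

definition weak_grad ::
    "(real^'n) set \<Rightarrow> (real^'n \<Rightarrow> 'b::euclidean_space) \<Rightarrow> real^'n \<Rightarrow> 'b^'n" where
  "weak_grad U u = (SOME G. has_weak_gradient u G U)"

definition W12 :: "(real^'n) set \<Rightarrow> (real^'n \<Rightarrow> 'b::euclidean_space) set" where
  "W12 U = {u. square_integrable (lebesgue_on U) u \<and>
     (\<exists>G. has_weak_gradient u G U \<and> square_integrable (lebesgue_on U) G)}"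

definition W12_norm :: "(real^'n) set \<Rightarrow> (real^'n \<Rightarrow> 'b::euclidean_space) \<Rightarrow> real" where
  "W12_norm U u =
     sqrt ((L2_norm (lebesgue_on U) u)\<^sup>2 + (L2_norm (lebesgue_on U) (weak_grad U u))\<^sup>2)"

section \<open>The unit disc and boundary traces\<close>

abbreviation disc :: "(real^2) set" where
  "disc \<equiv> ball 0 1"

text \<open>Arc length measure on the unit circle.\<close>

definition circle_measure :: "(real^2) measure" where
  "circle_measure =
     distr (restrict_space lborel {0..<2 * pi}) borel (\<lambda>t. vector [cos t, sin t])"

text \<open>The trace is the continuous extension to \<open>W\<^sup>1\<^sup>,\<^sup>2\<close> of the restriction map
  \<open>v \<mapsto> v\<bar>\<^sub>\<partial>\<^sub>B\<close> on functions that are smooth up to the boundary, with values in \<open>L\<^sup>2(\<partial>B)\<close>.\<close>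

definition has_trace ::
    "(real^2 \<Rightarrow> 'b::euclidean_space) \<Rightarrow> (real^2 \<Rightarrow> 'b) \<Rightarrow> bool" where
  "has_trace u g \<longleftrightarrow> u \<in> W12 disc \<and> square_integrable circle_measure g \<and>
     (\<exists>v :: nat \<Rightarrow> real^2 \<Rightarrow> 'b. (\<forall>k. smooth (v k)) \<and>
        (\<lambda>k. W12_norm disc (\<lambda>x. v k x - u x)) \<longlonglongrightarrow> 0 \<and>
        (\<lambda>k. L2_norm circle_measure (\<lambda>x. v k x - g x)) \<longlonglongrightarrow> 0)"

section \<open>Rotated gradients and matrix-valued functions\<close>

text \<open>A 1-form on a planar domain with values in \<open>'b\<close> is the \<open>'b^2\<close>-valued function of its
  components with respect to \<open>dx\<^sub>1, dx\<^sub>2\<close>. For matrices, \<open>norm\<close> is the Frobenius norm.\<close>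

definition weak_perp_grad ::
    "(real^2) set \<Rightarrow> (real^2 \<Rightarrow> 'b::euclidean_space) \<Rightarrow> real^2 \<Rightarrow> 'b^2" where
  "weak_perp_grad U u x = vector [- (weak_grad U u x $ 2), weak_grad U u x $ 1]"

definition so_alg :: "(real^'m^'m) set" where
  "so_alg = {A. transpose A = - A}"

definition SO_grp :: "(real^'m^'m) set" where
  "SO_grp = {Q. rotation_matrix Q}"

definition L2_so_form :: "(real^2) set \<Rightarrow> (real^2 \<Rightarrow> real^'m^'m^2) set" where
  "L2_so_form U = {\<Omega>. square_integrable (lebesgue_on U) \<Omega> \<and>
     (AE x in lebesgue_on U. \<forall>i. \<Omega> x $ i \<in> so_alg)}"

definition W12_into :: "(real^'n) set \<Rightarrow> 'b::euclidean_space set \<Rightarrow> (real^'n \<Rightarrow> 'b) set" where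
  "W12_into U T = {u \<in> W12 U. AE x in lebesgue_on U. u x \<in> T}"

end

theory Submission
  imports Defs "HOL-Complex_Analysis.Great_Picard"
begin

text \<open>Among all \<open>P \<in> W\<^sup>1\<^sup>,\<^sup>2(B, SO(m))\<close> minimise \<open>\<parallel>\<nabla>P + \<Omega>P\<parallel>\<^sub>2\<close>; comparing with \<open>P = 1\<close>, the minimum is
  at most \<open>\<parallel>\<Omega>\<parallel>\<^sub>2\<close>, which already bounds \<open>\<nabla>P\<close>. A minimiser exists: Rellich compactness gives a minimising
  sequence that converges in \<open>L\<^sup>2\<close> to a field of rotations, and convexity of the functional in \<open>P\<close> upgrades
  the convergence of the gradients. Varying \<open>P\<close> to \<open>P exp(t f A)\<close> with a skew matrix \<open>A\<close> and
  a function \<open>f\<close> that need not vanish on the boundary shows that the skew form \<open>\<omega> = P\<^sup>-\<^sup>1\<nabla>P + P\<^sup>-\<^sup>1\<Omega>P\<close> is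
  divergence-free and has vanishing normal component. Hence the zero extension of \<open>\<omega>\<close> is divergence-free
  on the plane, its mollifications are rotated gradients of smooth functions vanishing outside the disc, and these
  potentials converge by the Poincare inequality.\<close>

text \<open>Since the gauge comes from minimisation and not from perturbing a small connection, no
  smallness of \<Omega> enters. The obstacle is that rotations do not form a convex set. It is met
  in two ways. The energy is taken of \<nabla>P + \<Omega>P, which is linear in the pair of P and
  its gradient and, for rotations, has the same Frobenius norm as the transformed connection. The
  pointwise constraint is relaxed to a norm bound, and it is recovered because the limit was already
  known to consist of rotations before the relaxed problem was posed. Gradients are carried as
  explicit L2 limits of classical gradients (\<open>strong_gradient\<close>); the weak gradients of
  the statement are tied to them by uniqueness. The constant is 5, independent of m because only
  norm-preserving multiplications occur. The transformed connection costs 1 times the norm of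
  \<Omega>; the Poincare constant 2 together with the gradient makes 3 for \<xi>, and the triangle
  inequality gives 2 for the gradient of S.\<close>

lemma norm_add_power2_le:
  fixes a b :: "'a::real_inner"
  shows "(norm (a + b))\<^sup>2 \<le> 2 * (norm a)\<^sup>2 + 2 * (norm b)\<^sup>2"
proof -
  have "0 \<le> (norm (a - b))\<^sup>2" by simp
  then show ?thesis unfolding power2_norm_eq_inner by (simp add: inner_add inner_diff inner_commute)
qed

text \<open>Nonpositivity of the discriminant. It serves twice: it yields the Cauchy-Schwarz
  inequality, and with C = 0 it is the variational argument that makes the linear coefficient
  vanish.\<close>

lemma quadratic_nonneg_imp:
  fixes A B C :: real
  assumes "\<And>t. 0 \<le> A * t\<^sup>2 + 2 * t * B + C"
  shows "B\<^sup>2 \<le> A * C"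
proof (cases "A = 0")
  case True
  have "B = 0"
  proof (rule ccontr)
    assume "B \<noteq> 0"
    \<comment> \<open>With A = 0 the polynomial takes the value -1 at this point.\<close>
    with assms[of "- (C + 1) / (2 * B)"] True show False by (simp add: field_simps)
  qed
  with True show ?thesis by simp
next
  case False
  have "A > 0"
  proof (rule ccontr)
    assume "\<not> A > 0"
    with False have A: "A < 0" by simp
    \<comment> \<open>Chosen so that \<open>A * t\<close> equals A - 2|B| - |C|. Multiplying by t
      \<ge> 1, the last two terms absorb the linear and the constant term, and the polynomial is at
      most A t < 0.\<close>
    define t where "t = 1 + (\<bar>B\<bar> * 2 + \<bar>C\<bar>) / (-A)"
    have t: "t \<ge> 1" using A by (simp add: t_def divide_nonneg_neg)
    have "A * t = A - (\<bar>B\<bar> * 2 + \<bar>C\<bar>)" using A by (simp add: t_def field_simps)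
    from arg_cong[OF this, of "\<lambda>y. y * t"]
    have "A * t * t = A * t - \<bar>B\<bar> * 2 * t - \<bar>C\<bar> * t"
      by (simp only: left_diff_distrib distrib_right)
    moreover have "2 * t * B \<le> \<bar>B\<bar> * 2 * t" using t by (simp add: mult.commute mult_left_mono)
    moreover have "C \<le> \<bar>C\<bar> * t" using t mult_left_mono[of 1 t "\<bar>C\<bar>"] by simp
    moreover have "A * t < 0" using A t by (simp add: mult_neg_pos)
    ultimately show False using assms[of t] by (simp add: power2_eq_square)
  qed
  have "A * (- B / A)\<^sup>2 + 2 * (- B / A) * B + C = C - B\<^sup>2 / A"
    using False by (simp add: power2_eq_square)
  with assms[of "- B / A"] have "B\<^sup>2 / A \<le> C" by simp
  with \<open>A > 0\<close> show ?thesis by (simp add: pos_divide_le_eq mult.commute)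
qed

text \<open>Adding the partial sums of the thresholds to the index gives a strictly increasing
  choice that dominates each of them. The property is kept for all later indices too, because the
  Cauchy estimate in \<open>L2_complete\<close> compares an index with everything after it.\<close>

lemma strict_mono_choice:
  fixes P :: "nat \<Rightarrow> nat \<Rightarrow> bool"
  assumes "\<And>n. \<exists>K. \<forall>k\<ge>K. P n k"
  shows "\<exists>r. strict_mono r \<and> (\<forall>n. \<forall>k\<ge>r n. P n k)"
proof -
  from assms obtain K where K: "\<And>n k. k \<ge> K n \<Longrightarrow> P n k" by metis
  define r where "r n = n + (\<Sum>i\<le>n. K i)" for n
  have "strict_mono r" by (rule strict_monoI_Suc) (simp add: r_def)
  moreover have "K n \<le> r n" for n
    unfolding r_def by (rule trans_le_add2) (rule member_le_sum, auto)
  ultimately show ?thesis using K by (meson order_trans)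
qed

section \<open>Square integrable functions\<close>

lemma square_integrable_measurable [measurable_dest]:
  "square_integrable M f \<Longrightarrow> f \<in> borel_measurable M"
  by (simp add: square_integrable_def)

lemma square_integrable_integrable:
  "square_integrable M f \<Longrightarrow> integrable M (\<lambda>x. (norm (f x))\<^sup>2)"
  by (simp add: square_integrable_def)

lemma L2_norm_nonneg [simp]: "0 \<le> L2_norm M f"
  by (simp add: L2_norm_def)

lemma L2_norm_power2: "(L2_norm M f)\<^sup>2 = (\<integral>x. (norm (f x))\<^sup>2 \<partial>M)"
  by (simp add: L2_norm_def)

lemma nn_integral_L2_norm:
  "square_integrable M f \<Longrightarrow> (\<integral>\<^sup>+x. ennreal ((norm (f x))\<^sup>2) \<partial>M) = ennreal ((L2_norm M f)\<^sup>2)"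
  unfolding L2_norm_power2 by (subst nn_integral_eq_integral) (auto simp: square_integrable_def)

text \<open>Fatou's lemma gives an estimate in the extended reals; finiteness of the bound turns it
  into integrability and a real inequality at once.\<close>

lemma L2_nn_integral_bound:
  assumes "f \<in> borel_measurable M" "(\<integral>\<^sup>+x. ennreal ((norm (f x))\<^sup>2) \<partial>M) \<le> ennreal c" "0 \<le> c"
  shows "square_integrable M f" "(L2_norm M f)\<^sup>2 \<le> c"
proof -
  show *: "square_integrable M f"
    unfolding square_integrable_def integrable_iff_bounded
    using assms by (auto intro: le_less_trans)
  show "(L2_norm M f)\<^sup>2 \<le> c"
    using assms(2,3) unfolding nn_integral_L2_norm[OF *] by (simp add: ennreal_le_iff)
qed

lemma square_integrable_bound:
  fixes f :: "'a \<Rightarrow> 'b::euclidean_space" and g :: "'a \<Rightarrow> 'c::euclidean_space"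
  assumes "square_integrable M g" "f \<in> borel_measurable M"
    and "AE x in M. norm (f x) \<le> c * norm (g x)"
  shows "square_integrable M f" "(L2_norm M f)\<^sup>2 \<le> c\<^sup>2 * (L2_norm M g)\<^sup>2"
proof -
  have le: "AE x in M. (norm (f x))\<^sup>2 \<le> c\<^sup>2 * (norm (g x))\<^sup>2"
    using assms(3)
  proof eventually_elim
    case (elim x)
    then show ?case using power_mono[OF elim, of 2] by (simp add: power_mult_distrib)
  qed
  have int: "integrable M (\<lambda>x. c\<^sup>2 * (norm (g x))\<^sup>2)"
    using assms(1) by (simp add: square_integrable_def)
  have intf: "integrable M (\<lambda>x. (norm (f x))\<^sup>2)"
    by (rule Bochner_Integration.integrable_bound[OF int]) (use le assms(2) in auto)
  with assms(2) show "square_integrable M f" by (simp add: square_integrable_def)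
  show "(L2_norm M f)\<^sup>2 \<le> c\<^sup>2 * (L2_norm M g)\<^sup>2"
    unfolding L2_norm_power2 using integral_mono_AE[OF intf int le] by simp
qed

lemma L2_norm_bound:
  fixes f :: "'a \<Rightarrow> 'b::euclidean_space" and g :: "'a \<Rightarrow> 'c::euclidean_space"
  assumes "square_integrable M g" "f \<in> borel_measurable M"
    and "AE x in M. norm (f x) \<le> c * norm (g x)" "0 \<le> c"
  shows "L2_norm M f \<le> c * L2_norm M g"
proof (rule power2_le_imp_le)
  show "(L2_norm M f)\<^sup>2 \<le> (c * L2_norm M g)\<^sup>2"
    using square_integrable_bound(2)[OF assms(1-3)] by (simp only: power_mult_distrib)
qed (simp add: assms(4))

lemma square_integrable_const:
  "finite_measure M \<Longrightarrow> square_integrable M (\<lambda>x. c)"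
  by (simp add: square_integrable_def finite_measure.integrable_const)

lemma square_integrable_add:
  assumes "square_integrable M f" "square_integrable M g"
  shows "square_integrable M (\<lambda>x. f x + g x)"
proof -
  have "integrable M (\<lambda>x. (norm (f x + g x))\<^sup>2)"
  proof (rule Bochner_Integration.integrable_bound)
    show "integrable M (\<lambda>x. 2 * (norm (f x))\<^sup>2 + 2 * (norm (g x))\<^sup>2)"
      using assms by (auto simp: square_integrable_def)
    show "(\<lambda>x. (norm (f x + g x))\<^sup>2) \<in> borel_measurable M"
      using assms by (auto simp: square_integrable_def)
    show "AE x in M. norm ((norm (f x + g x))\<^sup>2) \<le> norm (2 * (norm (f x))\<^sup>2 + 2 * (norm (g x))\<^sup>2)"
      by (rule AE_I2) (simp add: norm_add_power2_le)
  qed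
  then show ?thesis using assms by (auto simp: square_integrable_def)
qed

lemma square_integrable_linear:
  fixes f :: "'a \<Rightarrow> 'b::euclidean_space" and L :: "'b \<Rightarrow> 'c::euclidean_space"
  assumes "bounded_linear L" "square_integrable M f"
  shows "square_integrable M (\<lambda>x. L (f x))"
proof (rule square_integrable_bound(1)[OF assms(2)])
  show "(\<lambda>x. L (f x)) \<in> borel_measurable M"
    by (rule borel_measurable_continuous_on[OF linear_continuous_on[OF assms(1)]
          square_integrable_measurable[OF assms(2)]])
  show "AE x in M. norm (L (f x)) \<le> onorm L * norm (f x)"
    by (simp add: onorm[OF assms(1)])
qed

lemma L2_norm_linear:
  fixes f :: "'a \<Rightarrow> 'b::euclidean_space" and L :: "'b \<Rightarrow> 'c::euclidean_space"
  assumes "bounded_linear L" "square_integrable M f"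
  shows "L2_norm M (\<lambda>x. L (f x)) \<le> onorm L * L2_norm M f"
proof (rule L2_norm_bound[OF assms(2)])
  show "(\<lambda>x. L (f x)) \<in> borel_measurable M"
    using square_integrable_linear[OF assms] by (rule square_integrable_measurable)
qed (simp_all add: onorm[OF assms(1)] onorm_pos_le[OF assms(1)])

lemma square_integrable_scaleR:
  "square_integrable M f \<Longrightarrow> square_integrable M (\<lambda>x. c *\<^sub>R f x)"
  by (rule square_integrable_linear[OF bounded_linear_scaleR_right])

lemma square_integrable_uminus:
  "square_integrable M f \<Longrightarrow> square_integrable M (\<lambda>x. - f x)"
  using square_integrable_scaleR[of M f "-1"] by simp

lemma square_integrable_diff:
  assumes "square_integrable M f" "square_integrable M g"
  shows "square_integrable M (\<lambda>x. f x - g x)"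
  using square_integrable_add[OF assms(1) square_integrable_uminus[OF assms(2)]] by simp

lemma square_integrable_cong_AE:
  assumes "square_integrable M f" "g \<in> borel_measurable M" "AE x in M. f x = g x"
  shows "square_integrable M g"
  by (rule square_integrable_bound(1)[OF assms(1,2), of 1]) (use assms(3) in auto)

lemma L2_norm_cong_AE:
  assumes "f \<in> borel_measurable M" "g \<in> borel_measurable M" "AE x in M. f x = g x"
  shows "L2_norm M f = L2_norm M g"
  unfolding L2_norm_def
  by (rule arg_cong[of _ _ sqrt], rule integral_cong_AE) (use assms in auto)

lemma L2_norm_cong: "(\<And>x. x \<in> space M \<Longrightarrow> f x = g x) \<Longrightarrow> L2_norm M f = L2_norm M g"
  unfolding L2_norm_def by (rule arg_cong[of _ _ sqrt], rule Bochner_Integration.integral_cong) auto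

lemma L2_norm_uminus: "L2_norm M (\<lambda>x. - f x) = L2_norm M f"
  by (simp add: L2_norm_def)

lemma L2_norm_minus_commute: "L2_norm M (\<lambda>x. f x - g x) = L2_norm M (\<lambda>x. g x - f x)"
  by (simp add: L2_norm_def norm_minus_commute)

lemma L2_norm_scaleR: "L2_norm M (\<lambda>x. c *\<^sub>R f x) = \<bar>c\<bar> * L2_norm M f"
  by (simp add: L2_norm_def power_mult_distrib real_sqrt_mult)

section \<open>Products, Cauchy-Schwarz and the geometry of the L2 norm\<close>

lemma integrable_norm_mult_L2:
  fixes f :: "'a \<Rightarrow> 'b::euclidean_space" and g :: "'a \<Rightarrow> 'c::euclidean_space"
  assumes "square_integrable M f" "square_integrable M g"
  shows "integrable M (\<lambda>x. norm (f x) * norm (g x))"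
proof (rule Bochner_Integration.integrable_bound[of _ "\<lambda>x. (norm (f x))\<^sup>2 + (norm (g x))\<^sup>2"])
  show "integrable M (\<lambda>x. (norm (f x))\<^sup>2 + (norm (g x))\<^sup>2)"
    using assms by (auto simp: square_integrable_def)
  show "(\<lambda>x. norm (f x) * norm (g x)) \<in> borel_measurable M"
    using assms by (auto simp: square_integrable_def)
  have "a * b \<le> a\<^sup>2 + b\<^sup>2" if "a \<ge> 0" "b \<ge> 0" for a b :: real
    using that sum_squares_bound[of a b] mult_nonneg_nonneg[OF that] by linarith
  then show "AE x in M. norm (norm (f x) * norm (g x)) \<le> norm ((norm (f x))\<^sup>2 + (norm (g x))\<^sup>2)"
    by simp
qed

lemma integrable_bilinear_L2:
  fixes f :: "'a \<Rightarrow> 'b::euclidean_space" and g :: "'a \<Rightarrow> 'c::euclidean_space"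
    and h :: "'b \<Rightarrow> 'c \<Rightarrow> 'd::euclidean_space"
  assumes "bounded_bilinear h" "square_integrable M f" "square_integrable M g"
  shows "integrable M (\<lambda>x. h (f x) (g x))"
proof -
  obtain K where K: "\<And>a b. norm (h a b) \<le> norm a * norm b * K"
    using bounded_bilinear.bounded[OF assms(1)] by blast
  show ?thesis
  proof (rule Bochner_Integration.integrable_bound)
    show "integrable M (\<lambda>x. norm (f x) * norm (g x) * K)"
      using integrable_norm_mult_L2[OF assms(2,3)] by simp
    have "continuous_on UNIV (\<lambda>p. h (fst p) (snd p))"
      by (intro bounded_bilinear.continuous_on[OF assms(1)] continuous_intros)
    then have "(\<lambda>x. h (fst (f x, g x)) (snd (f x, g x))) \<in> borel_measurable M"
      by (rule borel_measurable_continuous_on[of "\<lambda>p. h (fst p) (snd p)" "\<lambda>x. (f x, g x)"])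
        (use assms in \<open>auto simp: square_integrable_def\<close>)
    then show "(\<lambda>x. h (f x) (g x)) \<in> borel_measurable M" by simp
    show "AE x in M. norm (h (f x) (g x)) \<le> norm (norm (f x) * norm (g x) * K)"
      using K by (intro AE_I2) (smt (verit) real_norm_def)
  qed
qed

lemmas integrable_inner_L2 = integrable_bilinear_L2[OF bounded_bilinear_inner]

lemma L2_norm_add_power2:
  fixes f g :: "'a \<Rightarrow> 'b::euclidean_space"
  assumes "square_integrable M f" "square_integrable M g"
  shows "(L2_norm M (\<lambda>x. f x + g x))\<^sup>2 = (L2_norm M f)\<^sup>2 + 2 * (\<integral>x. f x \<bullet> g x \<partial>M) + (L2_norm M g)\<^sup>2"
proof -
  have "(norm (f x + g x))\<^sup>2 = (norm (f x))\<^sup>2 + 2 * (f x \<bullet> g x) + (norm (g x))\<^sup>2" for x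
    unfolding power2_norm_eq_inner by (simp add: inner_add inner_commute)
  moreover have "integrable M (\<lambda>x. (norm (f x))\<^sup>2)" "integrable M (\<lambda>x. (norm (g x))\<^sup>2)"
      "integrable M (\<lambda>x. f x \<bullet> g x)"
    using assms integrable_inner_L2[OF assms] by (auto simp: square_integrable_def)
  ultimately show ?thesis unfolding L2_norm_power2 by simp
qed

lemma L2_quadratic:
  fixes f g :: "'a \<Rightarrow> 'b::euclidean_space"
  assumes "square_integrable M f" "square_integrable M g"
  shows "(L2_norm M (\<lambda>x. f x + t *\<^sub>R g x))\<^sup>2
    = (L2_norm M g)\<^sup>2 * t\<^sup>2 + 2 * t * (\<integral>x. f x \<bullet> g x \<partial>M) + (L2_norm M f)\<^sup>2"
  using L2_norm_add_power2[OF assms(1) square_integrable_scaleR[OF assms(2), of t]]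
  by (simp add: L2_norm_scaleR power_mult_distrib)

lemma L2_Cauchy_Schwarz:
  fixes f g :: "'a \<Rightarrow> 'b::euclidean_space"
  assumes "square_integrable M f" "square_integrable M g"
  shows "\<bar>\<integral>x. f x \<bullet> g x \<partial>M\<bar> \<le> L2_norm M f * L2_norm M g"
proof -
  have "(\<integral>x. f x \<bullet> g x \<partial>M)\<^sup>2 \<le> (L2_norm M g)\<^sup>2 * (L2_norm M f)\<^sup>2"
    by (rule quadratic_nonneg_imp) (simp flip: L2_quadratic[OF assms])
  then have "\<bar>\<integral>x. f x \<bullet> g x \<partial>M\<bar>\<^sup>2 \<le> (L2_norm M f * L2_norm M g)\<^sup>2"
    by (simp add: power_mult_distrib mult.commute)
  then show ?thesis by (rule power2_le_imp_le) simp
qed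

lemma L2_norm_triangle:
  fixes f g :: "'a \<Rightarrow> 'b::euclidean_space"
  assumes "square_integrable M f" "square_integrable M g"
  shows "L2_norm M (\<lambda>x. f x + g x) \<le> L2_norm M f + L2_norm M g"
proof (rule power2_le_imp_le)
  show "(L2_norm M (\<lambda>x. f x + g x))\<^sup>2 \<le> (L2_norm M f + L2_norm M g)\<^sup>2"
    using L2_Cauchy_Schwarz[OF assms] by (simp add: L2_norm_add_power2[OF assms] power2_sum)
qed simp

lemma L2_norm_triangle_diff:
  fixes f g h :: "'a \<Rightarrow> 'b::euclidean_space"
  assumes "square_integrable M f" "square_integrable M g" "square_integrable M h"
  shows "L2_norm M (\<lambda>x. f x - h x) \<le> L2_norm M (\<lambda>x. f x - g x) + L2_norm M (\<lambda>x. g x - h x)"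
proof -
  have "f x - g x + (g x - h x) = f x - h x" for x by simp
  then show ?thesis
    using L2_norm_triangle[OF square_integrable_diff[OF assms(1,2)] square_integrable_diff[OF assms(2,3)]]
    by (simp only:)
qed

lemma L2_norm_triangle_sub:
  fixes f g :: "'a \<Rightarrow> 'b::euclidean_space"
  assumes "square_integrable M f" "square_integrable M g"
  shows "L2_norm M f \<le> L2_norm M g + L2_norm M (\<lambda>x. f x - g x)"
  using L2_norm_triangle[OF assms(2) square_integrable_diff[OF assms]] by simp

lemma L2_norm_tendsto:
  fixes f :: "nat \<Rightarrow> 'a \<Rightarrow> 'b::euclidean_space"
  assumes "\<And>n. square_integrable M (f n)" "square_integrable M g"
    and "(\<lambda>n. L2_norm M (\<lambda>x. f n x - g x)) \<longlonglongrightarrow> 0"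
  shows "(\<lambda>n. L2_norm M (f n)) \<longlonglongrightarrow> L2_norm M g"
proof -
  have "\<bar>L2_norm M (f n) - L2_norm M g\<bar> \<le> L2_norm M (\<lambda>x. f n x - g x)" for n
    using L2_norm_triangle_sub[OF assms(1)[of n] assms(2)]
      L2_norm_triangle_sub[OF assms(2) assms(1)[of n]] L2_norm_minus_commute[of M "f n" g]
    by linarith
  then have "(\<lambda>n. L2_norm M (f n) - L2_norm M g) \<longlonglongrightarrow> 0"
    by (intro Lim_null_comparison[OF _ assms(3)]) auto
  then show ?thesis by (simp add: LIM_zero_iff)
qed

text \<open>The source of strong convergence for minimising sequences: if two elements of a convex
  set nearly minimise the norm, their midpoint cannot do much better, so the subtracted term is
  large and the two elements are close.\<close>

lemma L2_parallelogram:
  fixes f g :: "'a \<Rightarrow> 'b::euclidean_space"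
  assumes "square_integrable M f" "square_integrable M g"
  shows "(L2_norm M (\<lambda>x. f x - g x))\<^sup>2
    = 2 * (L2_norm M f)\<^sup>2 + 2 * (L2_norm M g)\<^sup>2 - 4 * (L2_norm M (\<lambda>x. (1/2) *\<^sub>R (f x + g x)))\<^sup>2"
  using L2_norm_add_power2[OF assms] L2_quadratic[OF assms, of "-1"]
  by (simp add: L2_norm_scaleR power_mult_distrib power_divide add_divide_distrib
      del: scaleR_add_right)

text \<open>The weights 4^n are affordable: the weighted squares still have integrals at most 2^-n,
  so their sum is finite at almost every point. A finite sum K bounds each term, hence the norm of
  \<open>h n x\<close> by sqrt K times 2^-n, a geometric series.\<close>

lemma L2_summable_AE:
  fixes h :: "nat \<Rightarrow> 'a \<Rightarrow> 'b::euclidean_space"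
  assumes "\<And>n. square_integrable M (h n)" "\<And>n. (L2_norm M (h n))\<^sup>2 \<le> (1/8)^n"
  shows "AE x in M. summable (\<lambda>n. norm (h n x))"
proof -
  have [measurable]: "\<And>n. h n \<in> borel_measurable M" using assms(1) by (auto simp: square_integrable_def)
  have "(\<integral>\<^sup>+x. (\<Sum>n. ennreal (4^n * (norm (h n x))\<^sup>2)) \<partial>M) = (\<Sum>n. \<integral>\<^sup>+x. ennreal (4^n * (norm (h n x))\<^sup>2) \<partial>M)"
    by (rule nn_integral_suminf) simp
  also have "\<dots> \<le> (\<Sum>n. ennreal ((1/2)^n))"
  proof (intro suminf_le summableI)
    fix n
    have "(\<integral>\<^sup>+x. ennreal (4^n * (norm (h n x))\<^sup>2) \<partial>M) = ennreal (4^n) * (\<integral>\<^sup>+x. ennreal ((norm (h n x))\<^sup>2) \<partial>M)"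
      by (subst nn_integral_cmult[symmetric]) (auto simp: ennreal_mult)
    also have "\<dots> = ennreal (4^n * (L2_norm M (h n))\<^sup>2)"
      by (simp add: nn_integral_L2_norm[OF assms(1)] ennreal_mult)
    also have "\<dots> \<le> ennreal (4^n * (1/8)^n)"
      using assms(2)[of n] by (intro ennreal_leI mult_left_mono) auto
    also have "(4::real)^n * (1/8)^n = (1/2)^n" by (simp only: power_mult_distrib[symmetric]) simp
    finally show "(\<integral>\<^sup>+x. ennreal (4^n * (norm (h n x))\<^sup>2) \<partial>M) \<le> ennreal ((1/2)^n)" .
  qed
  also have "\<dots> = ennreal (\<Sum>n. (1/2)^n)"
    by (intro suminf_ennreal2) (auto simp: summable_geometric)
  also have "\<dots> < \<infinity>" by simp
  finally have "AE x in M. (\<Sum>n. ennreal (4^n * (norm (h n x))\<^sup>2)) \<noteq> \<infinity>"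
    by (intro nn_integral_PInf_AE) auto
  then show ?thesis
  proof eventually_elim
    case (elim x)
    have "\<exists>K\<ge>0. s = ennreal K" if "s \<noteq> \<infinity>" for s
      using that by (cases s rule: ennreal_cases) auto
    from this[OF elim] obtain K
      where K: "(\<Sum>n. ennreal (4^n * (norm (h n x))\<^sup>2)) = ennreal K" "K \<ge> 0" by blast
    have "norm (h n x) \<le> sqrt K * (1/2)^n" for n
    proof -
      let ?g = "\<lambda>n. ennreal (4^n * (norm (h n x))\<^sup>2)"
      have "sum ?g {n} \<le> suminf ?g" by (rule sum_le_suminf) (auto intro: summableI)
      then have "?g n \<le> ennreal K" unfolding K(1) by (simp only: sum.insert sum.empty finite.emptyI empty_iff not_False_eq_True add_0_right)
      then have "4^n * (norm (h n x))\<^sup>2 \<le> K" by (rule iffD1[OF ennreal_le_iff[OF K(2)]])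
      moreover have "((2::real)^n)\<^sup>2 = 2^(2*n)" by (rule power_even_eq[symmetric])
      moreover have "(2::real)^(2*n) = (2\<^sup>2)^n" by (rule power_mult)
      moreover have "(2::real)\<^sup>2 = 4" by simp
      ultimately have "(2^n * norm (h n x))\<^sup>2 \<le> K"
        by (simp only: power_mult_distrib)
      then have "2^n * norm (h n x) \<le> sqrt K" by (rule real_le_rsqrt)
      then have "norm (h n x) \<le> sqrt K / 2^n"
        by (subst pos_le_divide_eq) (auto simp: mult.commute)
      then show ?thesis by (simp only: power_one_over times_divide_eq_right mult_1_right)
    qed
    then have *: "norm (norm (h n x)) \<le> sqrt K * (1/2)^n" for n
      by (simp only: real_norm_def abs_norm_cancel)
    have "summable (\<lambda>n. sqrt K * (1/2)^n)" by (rule summable_mult[OF summable_geometric]) simp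
    from summable_comparison_test'[OF this *] show ?case .
  qed
qed

text \<open>Indices from which the squared distance stays below 8^-n make the pointwise distances
  summable almost everywhere, hence null sequences.\<close>

lemma L2_AE_subseq:
  fixes f :: "nat \<Rightarrow> 'a \<Rightarrow> 'b::euclidean_space"
  assumes "\<And>n. square_integrable M (f n)" "square_integrable M g"
    and "(\<lambda>n. L2_norm M (\<lambda>x. f n x - g x)) \<longlonglongrightarrow> 0"
  obtains r where "strict_mono r" "AE x in M. (\<lambda>n. f (r n) x) \<longlonglongrightarrow> g x"
proof -
  have lim: "(\<lambda>n. (L2_norm M (\<lambda>x. f n x - g x))\<^sup>2) \<longlonglongrightarrow> 0"
    using tendsto_power[OF assms(3), of 2] by simp
  have "\<exists>r. strict_mono r \<and> (\<forall>n. \<forall>k\<ge>r n. (L2_norm M (\<lambda>x. f k x - g x))\<^sup>2 \<le> (1/8)^n)"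
  proof (rule strict_mono_choice)
    fix n :: nat
    have "eventually (\<lambda>k. (L2_norm M (\<lambda>x. f k x - g x))\<^sup>2 < (1/8)^n) sequentially"
      using lim by (rule order_tendstoD) simp
    then show "\<exists>K. \<forall>k\<ge>K. (L2_norm M (\<lambda>x. f k x - g x))\<^sup>2 \<le> (1/8)^n"
      unfolding eventually_sequentially by (meson less_imp_le)
  qed
  then obtain r where r: "strict_mono r" "\<And>n k. k \<ge> r n \<Longrightarrow> (L2_norm M (\<lambda>x. f k x - g x))\<^sup>2 \<le> (1/8)^n"
    by blast
  have "AE x in M. summable (\<lambda>n. norm (f (r n) x - g x))"
    by (rule L2_summable_AE) (auto intro!: square_integrable_diff assms r(2))
  then have "AE x in M. (\<lambda>n. f (r n) x) \<longlonglongrightarrow> g x"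
  proof eventually_elim
    case (elim x)
    then show ?case using summable_LIMSEQ_zero tendsto_norm_zero_iff LIM_zero_iff by blast
  qed
  with r(1) show ?thesis by (rule that)
qed

text \<open>Riesz-Fischer: a rapidly converging subsequence has summable increments almost
  everywhere, which produces a pointwise limit; Fatou's lemma then upgrades this to norm convergence
  of the whole sequence.\<close>

lemma L2_complete:
  fixes f :: "nat \<Rightarrow> 'a \<Rightarrow> 'b::euclidean_space"
  assumes sq: "\<And>n. square_integrable M (f n)"
    and cauchy: "\<And>e. e > 0 \<Longrightarrow> \<exists>K. \<forall>m\<ge>K. \<forall>n\<ge>K. L2_norm M (\<lambda>x. f m x - f n x) < e"
  obtains g where "square_integrable M g" "(\<lambda>n. L2_norm M (\<lambda>x. f n x - g x)) \<longlonglongrightarrow> 0"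
proof -
  have [measurable]: "\<And>n. f n \<in> borel_measurable M" using sq by (auto simp: square_integrable_def)
  have "\<exists>r. strict_mono r \<and>
    (\<forall>n. \<forall>k\<ge>r n. \<forall>l\<ge>k. (L2_norm M (\<lambda>x. f l x - f k x))\<^sup>2 \<le> (1/8)^n)"
  proof (rule strict_mono_choice)
    fix n :: nat
    obtain K where "\<forall>m\<ge>K. \<forall>l\<ge>K. L2_norm M (\<lambda>x. f m x - f l x) < sqrt ((1/8)^n)"
      using cauchy[of "sqrt ((1/8)^n)"] by auto
    then have "L2_norm M (\<lambda>x. f l x - f k x) \<le> sqrt ((1/8)^n)" if "k \<ge> K" "l \<ge> k" for k l
      using that by (simp add: less_imp_le)
    from power_mono[OF this L2_norm_nonneg, of _ _ 2]
    have "\<forall>k\<ge>K. \<forall>l\<ge>k. (L2_norm M (\<lambda>x. f l x - f k x))\<^sup>2 \<le> (1/8)^n"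
      by simp
    then show "\<exists>K. \<forall>k\<ge>K. \<forall>l\<ge>k. (L2_norm M (\<lambda>x. f l x - f k x))\<^sup>2 \<le> (1/8)^n" by blast
  qed
  then obtain r where r: "strict_mono r"
    "\<And>n k l. r n \<le> k \<Longrightarrow> k \<le> l \<Longrightarrow> (L2_norm M (\<lambda>x. f l x - f k x))\<^sup>2 \<le> (1/8)^n"
    by blast
  have "AE x in M. summable (\<lambda>n. norm (f (r (Suc n)) x - f (r n) x))"
    by (rule L2_summable_AE)
      (auto intro!: square_integrable_diff sq r(2) strict_mono_leD[OF r(1)])
  then have conv: "AE x in M. convergent (\<lambda>n. f (r n) x)"
  proof eventually_elim
    case (elim x)
    from summable_norm_cancel[OF elim] have "convergent (\<lambda>n. \<Sum>i<n. f (r (Suc i)) x - f (r i) x)"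
      by (simp add: summable_iff_convergent)
    then have "convergent (\<lambda>n. f (r n) x - f (r 0) x)"
      using sum_lessThan_telescope[of "\<lambda>n. f (r n) x"] by simp
    from convergent_add[OF this convergent_const[of "f (r 0) x"]] show ?case by simp
  qed
  \<comment> \<open>Where the subsequence diverges the value of \<open>lim\<close> carries no
    information; this concerns a null set only, and \<open>g\<close> is measurable all the
    same.\<close>
  define g where "g x = lim (\<lambda>n. f (r n) x)" for x
  have gm [measurable]: "g \<in> borel_measurable M" unfolding g_def by measurable
  \<comment> \<open>Fatou along the subsequence bounds the distance to the limit for every large
    \<open>n\<close>. Square integrability of \<open>g\<close> itself is only available afterwards,
    from that of one such difference.\<close>
  have bound: "square_integrable M (\<lambda>x. f n x - g x) \<and> (L2_norm M (\<lambda>x. f n x - g x))\<^sup>2 \<le> e\<^sup>2"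
    if e: "e > 0" and K: "\<forall>m\<ge>K. \<forall>l\<ge>K. L2_norm M (\<lambda>x. f m x - f l x) < e" and n: "n \<ge> K" for e K n
  proof -
    have "(\<integral>\<^sup>+x. ennreal ((norm (f n x - g x))\<^sup>2) \<partial>M)
      = (\<integral>\<^sup>+x. liminf (\<lambda>k. ennreal ((norm (f n x - f (r k) x))\<^sup>2)) \<partial>M)"
    proof (rule nn_integral_cong_AE, use conv in eventually_elim)
      fix x assume "convergent (\<lambda>n. f (r n) x)"
      then have "(\<lambda>k. f (r k) x) \<longlonglongrightarrow> g x" unfolding g_def by (simp add: convergent_LIMSEQ_iff)
      then have "(\<lambda>k. ennreal ((norm (f n x - f (r k) x))\<^sup>2)) \<longlonglongrightarrow> ennreal ((norm (f n x - g x))\<^sup>2)"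
        by (intro tendsto_intros)
      then show "ennreal ((norm (f n x - g x))\<^sup>2) = liminf (\<lambda>k. ennreal ((norm (f n x - f (r k) x))\<^sup>2))"
        using lim_imp_Liminf[OF trivial_limit_sequentially] by metis
    qed
    also have "\<dots> \<le> liminf (\<lambda>k. \<integral>\<^sup>+x. ennreal ((norm (f n x - f (r k) x))\<^sup>2) \<partial>M)"
      by (rule nn_integral_liminf) measurable
    also have "\<dots> \<le> ennreal (e\<^sup>2)"
    proof (rule order_trans[OF Liminf_le_Limsup Limsup_bounded], simp, rule eventually_sequentiallyI)
      fix k assume "K \<le> k"
      then have "K \<le> r k" using seq_suble[OF r(1), of k] by linarith
      then have "L2_norm M (\<lambda>x. f n x - f (r k) x) \<le> e" using K n by (simp add: less_imp_le)
      then show "(\<integral>\<^sup>+x. ennreal ((norm (f n x - f (r k) x))\<^sup>2) \<partial>M) \<le> ennreal (e\<^sup>2)"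
        by (subst nn_integral_L2_norm) (auto intro!: square_integrable_diff sq ennreal_leI power_mono)
    qed
    finally show ?thesis using L2_nn_integral_bound[of "\<lambda>x. f n x - g x" M "e\<^sup>2"] by simp
  qed
  obtain K where "\<forall>m\<ge>K. \<forall>l\<ge>K. L2_norm M (\<lambda>x. f m x - f l x) < 1" using cauchy[of 1] by auto
  then have "square_integrable M (\<lambda>x. f K x - g x)" using bound[of 1 K K] by simp
  from square_integrable_diff[OF sq[of K] this] have "square_integrable M g" by simp
  moreover have "(\<lambda>n. L2_norm M (\<lambda>x. f n x - g x)) \<longlonglongrightarrow> 0"
  proof (rule LIMSEQ_I)
    fix e :: real assume "e > 0"
    then obtain K where K: "\<forall>m\<ge>K. \<forall>l\<ge>K. L2_norm M (\<lambda>x. f m x - f l x) < e/2" using cauchy[of "e/2"] by auto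
    have "L2_norm M (\<lambda>x. f n x - g x) < e" if "n \<ge> K" for n
    proof -
      have "L2_norm M (\<lambda>x. f n x - g x) \<le> e/2"
        using power2_le_imp_le[OF conjunct2[OF bound[OF half_gt_zero[OF \<open>e > 0\<close>] K that]]] \<open>e > 0\<close> by simp
      then show ?thesis using \<open>e > 0\<close> by simp
    qed
    then show "\<exists>K. \<forall>n\<ge>K. norm (L2_norm M (\<lambda>x. f n x - g x) - 0) < e" by auto
  qed
  ultimately show ?thesis by (rule that)
qed

section \<open>Functions of class \<open>C\<^sup>k\<close>\<close>

lemma Ck_SucI:
  assumes "\<And>x. (f has_derivative D x) (at x)" "\<And>v. Ck k (\<lambda>x. D x v)"
  shows "Ck (Suc k) f"
proof -
  have "frechet_derivative f (at x) = D x" for x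
    using frechet_derivative_at[OF assms(1)[of x]] by simp
  moreover have "f differentiable_on UNIV"
    unfolding differentiable_on_def differentiable_def using assms(1) by blast
  ultimately show ?thesis using assms(2) by simp
qed

lemma Ck_Suc_has_derivative:
  assumes "Ck (Suc k) f"
  shows "(f has_derivative frechet_derivative f (at x)) (at x)"
  using assms by (auto simp: differentiable_on_def frechet_derivative_works)

lemma Ck_Suc_deriv: "Ck (Suc k) f \<Longrightarrow> Ck k (\<lambda>x. frechet_derivative f (at x) v)"
  by simp

lemma Ck_SucD: "Ck (Suc k) f \<Longrightarrow> Ck k f"
proof (induction k arbitrary: f)
  case 0
  then show ?case using differentiable_imp_continuous_on by auto
next
  case (Suc k)
  show ?case
    by (rule Ck_SucI[OF Ck_Suc_has_derivative[OF Suc.prems] Suc.IH[OF Ck_Suc_deriv[OF Suc.prems]]])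
qed

lemma Ck_imp_continuous_on: "Ck k f \<Longrightarrow> continuous_on S f"
proof (induction k)
  case 0
  then show ?case by (auto intro: continuous_on_subset)
next
  case (Suc k)
  then show ?case using Ck_SucD by blast
qed

lemma Ck_const: "Ck k (\<lambda>x. c)"
proof (induction k arbitrary: c)
  case (Suc k)
  show ?case by (rule Ck_SucI[where D="\<lambda>_ _. 0"]) (auto intro: Suc.IH derivative_eq_intros)
qed simp

lemma Ck_add: "Ck k f \<Longrightarrow> Ck k g \<Longrightarrow> Ck k (\<lambda>x. f x + g x)"
proof (induction k arbitrary: f g)
  case 0
  then show ?case by (simp add: continuous_on_add)
next
  case (Suc k)
  show ?case
    by (rule Ck_SucI[OF has_derivative_add[OF Ck_Suc_has_derivative[OF Suc.prems(1)] Ck_Suc_has_derivative[OF Suc.prems(2)]]])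
      (rule Suc.IH[OF Ck_Suc_deriv[OF Suc.prems(1)] Ck_Suc_deriv[OF Suc.prems(2)]])
qed

lemma Ck_linear:
  assumes "bounded_linear L"
  shows "Ck k f \<Longrightarrow> Ck k (\<lambda>x. L (f x))"
proof (induction k arbitrary: f)
  case 0
  then show ?case by (simp add: bounded_linear.continuous_on[OF assms])
next
  case (Suc k)
  show ?case
    by (rule Ck_SucI[OF bounded_linear.has_derivative[OF assms Ck_Suc_has_derivative[OF Suc.prems]]])
      (rule Suc.IH[OF Ck_Suc_deriv[OF Suc.prems]])
qed

lemma Ck_bilinear:
  assumes "bounded_bilinear h"
  shows "Ck k f \<Longrightarrow> Ck k g \<Longrightarrow> Ck k (\<lambda>x. h (f x) (g x))"
proof (induction k arbitrary: f g)
  case 0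
  then show ?case by (simp add: bounded_bilinear.continuous_on[OF assms])
next
  case (Suc k)
  show ?case
    by (rule Ck_SucI[OF bounded_bilinear.FDERIV[OF assms Ck_Suc_has_derivative[OF Suc.prems(1)] Ck_Suc_has_derivative[OF Suc.prems(2)]]])
      (intro Ck_add Suc.IH Ck_Suc_deriv[OF Suc.prems(1)] Ck_Suc_deriv[OF Suc.prems(2)] Ck_SucD[OF Suc.prems(1)] Ck_SucD[OF Suc.prems(2)])
qed

lemmas Ck_scaleR = Ck_bilinear[OF bounded_bilinear_scaleR]
lemmas Ck_mult = Ck_bilinear[OF bounded_bilinear_mult]

lemma Ck_diff: "Ck k f \<Longrightarrow> Ck k g \<Longrightarrow> Ck k (\<lambda>x. f x - g x)"
  using Ck_add[OF _ Ck_linear[OF bounded_linear_minus[OF bounded_linear_ident]], of k f g] by simp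

lemma Ck_prod:
  fixes f :: "'i \<Rightarrow> 'a::euclidean_space \<Rightarrow> real"
  assumes "\<And>i. i \<in> I \<Longrightarrow> Ck k (f i)"
  shows "Ck k (\<lambda>x. \<Prod>i\<in>I. f i x)"
  using assms by (induction I rule: infinite_finite_induct) (auto intro!: Ck_const Ck_mult)

lemma Ck_compose_affine:
  "Ck k f \<Longrightarrow> Ck k (\<lambda>x. f (\<beta> + \<alpha> *\<^sub>R x))"
proof (induction k arbitrary: f)
  case 0
  then show ?case by (auto intro!: continuous_on_compose2[of UNIV f] continuous_intros)
next
  case (Suc k)
  have "((\<lambda>x. f (\<beta> + \<alpha> *\<^sub>R x)) has_derivative (\<lambda>v. frechet_derivative f (at (\<beta> + \<alpha> *\<^sub>R x)) (\<alpha> *\<^sub>R v))) (at x)" for x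
    by (rule has_derivative_compose[OF _ Ck_Suc_has_derivative[OF Suc.prems]])
      (auto intro!: derivative_eq_intros)
  then show ?case
    by (rule Ck_SucI) (rule Suc.IH[OF Ck_Suc_deriv[OF Suc.prems]])
qed

lemma Ck_1_compose:
  assumes "\<And>t::real. (g has_real_derivative g' t) (at t)" "continuous_on UNIV g'" "Ck (Suc 0) f"
  shows "Ck (Suc 0) (\<lambda>x. g (f x))"
    and "frechet_derivative (\<lambda>x. g (f x)) (at x) v = g' (f x) * frechet_derivative f (at x) v"
proof -
  have D: "((\<lambda>x. g (f x)) has_derivative (\<lambda>v. g' (f x) * frechet_derivative f (at x) v)) (at x)" for x
    by (rule has_derivative_compose[OF Ck_Suc_has_derivative[OF assms(3)] has_field_derivative_imp_has_derivative[OF assms(1)]])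
  have "continuous_on UNIV (\<lambda>x. frechet_derivative f (at x) v)" for v
    using Ck_Suc_deriv[OF assms(3)] by simp
  then show "Ck (Suc 0) (\<lambda>x. g (f x))"
    by (intro Ck_SucI[OF D])
      (auto intro!: continuous_intros continuous_on_compose2[OF assms(2)] Ck_imp_continuous_on[OF assms(3)])
  show "frechet_derivative (\<lambda>x. g (f x)) (at x) v = g' (f x) * frechet_derivative f (at x) v"
    using frechet_derivative_at[OF D] by metis
qed

section \<open>Bump functions\<close>

text \<open>The polynomial factor makes this family closed under differentiation.\<close>

definition flat :: "real poly \<Rightarrow> real \<Rightarrow> real" where
  "flat p t = (if t > 0 then poly p (1 / t) * exp (- (1 / t)) else 0)"

text \<open>The power \<open>x ^ k\<close> is carried along so that the induction over the
  coefficients closes: splitting off the lowest coefficient raises the exponent by one.\<close>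

lemma poly_mult_exp_tendsto_0:
  fixes p :: "real poly"
  shows "((\<lambda>x. x ^ k * poly p x / exp x) \<longlongrightarrow> 0) at_top"
proof (induction p arbitrary: k)
  case (pCons a p)
  have "((\<lambda>x::real. a * (x ^ k / exp x) + x ^ Suc k * poly p x / exp x) \<longlongrightarrow> a * 0 + 0) at_top"
    by (intro tendsto_intros tendsto_power_div_exp_0 pCons.IH)
  moreover have "(\<lambda>x::real. a * (x ^ k / exp x) + x ^ Suc k * poly p x / exp x)
    = (\<lambda>x. x ^ k * poly (pCons a p) x / exp x)"
    by (rule ext) (simp add: algebra_simps add_divide_distrib)
  ultimately show ?case by simp
qed simp

text \<open>\<open>[:0, 0, 1:]\<close> is the square of the variable. For s = 1/t one has ds/dt =
  -s^2, so p(s) exp(-s) has the derivative s^2 (p - p')(s) exp(-s). The only delicate point is t =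
  0, where exponential decay beats every polynomial.\<close>

lemma flat_has_derivative:
  "(flat p has_real_derivative flat ([:0, 0, 1:] * (p - pderiv p)) t) (at t)"
proof -
  let ?q = "[:0, 0, 1:] * (p - pderiv p)"
  consider "t > 0" | "t < 0" | "t = 0" by linarith
  then show ?thesis
  proof cases
    case 1
    have "((\<lambda>t. poly p (1 / t) * exp (- (1 / t))) has_real_derivative
        (poly (pderiv p) (1 / t) * (- (1 / t\<^sup>2))) * exp (- (1 / t)) + poly p (1 / t) * (exp (- (1 / t)) * (1 / t\<^sup>2))) (at t)"
      by (rule derivative_eq_intros DERIV_chain2[OF poly_DERIV] refl | use 1 in \<open>simp add: power2_eq_square\<close>)+
    moreover have "(poly (pderiv p) (1 / t) * (- (1 / t\<^sup>2))) * exp (- (1 / t)) + poly p (1 / t) * (exp (- (1 / t)) * (1 / t\<^sup>2)) = flat ?q t"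
      using 1 by (simp add: flat_def power2_eq_square field_simps)
    ultimately have "((\<lambda>t. poly p (1 / t) * exp (- (1 / t))) has_real_derivative flat ?q t) (at t)" by simp
    moreover have "eventually (\<lambda>x. poly p (1 / x) * exp (- (1 / x)) = flat p x) (nhds t)"
      using eventually_nhds_in_open[of "{0<..}" t] 1 by (auto elim!: eventually_mono simp: flat_def)
    ultimately show ?thesis using DERIV_cong_ev[OF refl _ refl] by fast
  next
    case 2
    have "eventually (\<lambda>x. 0 = flat p x) (nhds t)"
      using eventually_nhds_in_open[of "{..<0}" t] 2 by (auto elim!: eventually_mono simp: flat_def)
    then have "((\<lambda>x. 0) has_real_derivative 0) (at t) = (flat p has_real_derivative 0) (at t)"
      by (rule DERIV_cong_ev[OF refl _ refl])
    moreover have "flat ?q t = 0" using 2 by (simp add: flat_def)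
    ultimately show ?thesis by simp
  next
    case 3
    \<comment> \<open>With s = 1/h the difference quotient at 0 from the right is s p(s) exp(-s);
      the exponent 1 stands for the division by h.\<close>
    have "((\<lambda>s. s ^ 1 * poly p s / exp s) \<longlongrightarrow> 0) at_top" by (rule poly_mult_exp_tendsto_0)
    then have "((\<lambda>h::real. (inverse h) ^ 1 * poly p (inverse h) / exp (inverse h)) \<longlongrightarrow> 0) (at_right 0)"
      by (rule filterlim_compose[OF _ filterlim_inverse_at_top_right])
    then have "((\<lambda>h. flat p h / h) \<longlongrightarrow> 0) (at_right 0)"
      by (rule Lim_transform_eventually)
        (auto simp: eventually_at_right_less flat_def exp_minus field_simps eventually_at_filter)
    moreover have "((\<lambda>h. flat p h / h) \<longlongrightarrow> 0) (at_left 0)"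
      by (rule tendsto_eventually) (auto simp: flat_def eventually_at_filter)
    ultimately have "((\<lambda>h. flat p h / h) \<longlongrightarrow> 0) (at 0)"
      by (simp add: filterlim_split_at)
    then show ?thesis using 3 by (simp add: DERIV_def flat_def)
  qed
qed

lemma Ck_flat: "Ck k (\<lambda>x. flat p (a \<bullet> x + b))"
proof (induction k arbitrary: p)
  case 0
  have "continuous_on UNIV (flat p)"
    using flat_has_derivative by (meson DERIV_continuous_on DERIV_subset subset_UNIV)
  then show ?case by (auto intro!: continuous_on_compose2[of UNIV "flat p"] continuous_intros)
next
  case (Suc k)
  have "((\<lambda>x. flat p (a \<bullet> x + b)) has_derivative (\<lambda>v. flat ([:0, 0, 1:] * (p - pderiv p)) (a \<bullet> x + b) * (a \<bullet> v))) (at x)" for x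
    by (rule has_derivative_compose[OF _ has_field_derivative_imp_has_derivative[OF flat_has_derivative]])
      (auto intro!: derivative_eq_intros)
  then show ?case by (rule Ck_SucI) (intro Ck_mult Suc.IH Ck_const)
qed

lemma flat_1: "flat 1 t = (if t > 0 then exp (- (1 / t)) else 0)"
  by (simp add: flat_def)

lemma flat_1_bounds: "0 \<le> flat 1 t" "flat 1 t \<le> 1"
  by (auto simp: flat_1)

lemma flat_1_eq_0_iff: "flat 1 t = 0 \<longleftrightarrow> t \<le> 0"
  by (auto simp: flat_1)

lemma flat_1_tendsto: "(\<lambda>n. flat 1 (real n * t)) \<longlonglongrightarrow> (if t > 0 then 1 else 0)"
proof (cases "t > 0")
  case True
  have "(\<lambda>n. - (inverse (real n) * (1 / t))) \<longlonglongrightarrow> - (0 * (1 / t))"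
    by (intro tendsto_intros lim_inverse_n)
  then have "(\<lambda>n. exp (- (inverse (real n) * (1 / t)))) \<longlonglongrightarrow> exp (- (0 * (1 / t)))"
    by (rule tendsto_exp)
  then have "(\<lambda>n. exp (- (inverse (real n) * (1 / t)))) \<longlonglongrightarrow> 1" by simp
  then have "(\<lambda>n. flat 1 (real n * t)) \<longlonglongrightarrow> 1"
    by (rule Lim_transform_eventually)
      (use True in \<open>auto simp: eventually_sequentially flat_1 field_simps intro!: exI[of _ 1]\<close>)
  with True show ?thesis by simp
next
  case False
  then have "flat 1 (real n * t) = 0" for n by (simp add: flat_1_eq_0_iff mult_nonneg_nonpos)
  with False show ?thesis by simp
qed

text \<open>The parameter \<open>r\<close> governs only the steepness: for every r > 0 the function
  is positive exactly on the open box, and as r grows it tends to the indicator of the box. Large r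
  serves the fundamental lemma, r = 1 the mollifier.\<close>

definition box_bump :: "real \<Rightarrow> 'a::euclidean_space \<Rightarrow> 'a \<Rightarrow> 'a \<Rightarrow> real" where
  "box_bump r c d x = (\<Prod>i\<in>Basis. flat 1 (r * (x \<bullet> i - c \<bullet> i)) * flat 1 (r * (d \<bullet> i - x \<bullet> i)))"

lemma smooth_box_bump: "smooth (box_bump r c d)"
proof -
  have "Ck k (\<lambda>x. flat 1 (r * (x \<bullet> i - c \<bullet> i)))" "Ck k (\<lambda>x. flat 1 (r * (d \<bullet> i - x \<bullet> i)))" for k i
    using Ck_flat[of k 1 "r *\<^sub>R i" "- (r * (c \<bullet> i))"] Ck_flat[of k 1 "- r *\<^sub>R i" "r * (d \<bullet> i)"]
    by (simp_all add: algebra_simps inner_commute)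
  then show ?thesis unfolding smooth_def box_bump_def[abs_def] by (intro allI Ck_prod Ck_mult)
qed

lemma box_bump_bounds: "0 \<le> box_bump r c d x" "box_bump r c d x \<le> 1"
  unfolding box_bump_def
  by (auto intro!: prod_nonneg prod_le_1 mult_nonneg_nonneg mult_le_one flat_1_bounds)

lemma box_bump_eq_0_iff: "r > 0 \<Longrightarrow> box_bump r c d x = 0 \<longleftrightarrow> x \<notin> box c d"
  by (force simp: box_bump_def flat_1_eq_0_iff mult_le_0_iff box_def not_less)

lemma test_function_box_bump:
  assumes "r > 0" "cbox c d \<subseteq> U"
  shows "test_function U (box_bump r c d)"
proof -
  have "{x. box_bump r c d x \<noteq> 0} = box c d" using box_bump_eq_0_iff[OF assms(1)] by auto
  moreover have "closure (box c d) \<subseteq> cbox c d" by (intro closure_minimal box_subset_cbox closed_cbox)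
  ultimately show ?thesis
    using assms(2) bounded_box[of c d] unfolding test_function_def
    by (auto simp: smooth_box_bump compact_closure)
qed

lemma box_bump_tendsto: "(\<lambda>n. box_bump (real n) c d x) \<longlonglongrightarrow> indicator (box c d) x"
proof -
  let ?l = "\<lambda>t::real. if t > 0 then 1 else (0::real)"
  have "(\<lambda>n. box_bump (real n) c d x) \<longlonglongrightarrow> (\<Prod>i\<in>Basis. ?l (x \<bullet> i - c \<bullet> i) * ?l (d \<bullet> i - x \<bullet> i))"
    unfolding box_bump_def by (intro tendsto_prod tendsto_mult flat_1_tendsto)
  also have "(\<Prod>i\<in>Basis. ?l (x \<bullet> i - c \<bullet> i) * ?l (d \<bullet> i - x \<bullet> i)) = indicator (box c d) x"
  proof (cases "x \<in> box c d")
    case True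
    then show ?thesis by (auto simp: box_def intro!: prod.neutral)
  next
    case False
    then show ?thesis by (auto simp: box_def indicator_def intro!: prod_zero)
  qed
  finally show ?thesis .
qed

section \<open>The fundamental lemma of the calculus of variations\<close>

lemma continuous_measurable_lebesgue_on:
  assumes "continuous_on UNIV f"
  shows "f \<in> borel_measurable (lebesgue_on S)"
  using continuous_imp_measurable_on_sets_lebesgue[OF assms]
  by (auto simp: lebesgue_on_UNIV_eq intro: measurable_restrict_space1)

text \<open>Bumps of growing steepness are test functions bounded by 1 that tend to the indicator of
  the open box, and \<open>g\<close> is integrable on the closed box, so dominated convergence
  applies.\<close>

lemma fundamental_lemma_box:
  fixes g :: "'a::euclidean_space \<Rightarrow> 'b::euclidean_space"
  assumes "open U" "locally_integrable_on g U" "cbox c d \<subseteq> U"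
    and "\<And>\<phi>. test_function U \<phi> \<Longrightarrow> (\<integral>x. \<phi> x *\<^sub>R g x \<partial>lebesgue_on U) = 0"
  shows "(\<integral>x. indicator (box c d) x *\<^sub>R g x \<partial>lebesgue) = 0"
proof -
  have int: "integrable lebesgue (\<lambda>x. indicator (cbox c d) x *\<^sub>R g x)"
    using assms(2,3) by (auto simp: locally_integrable_on_def set_integrable_def)
  have U: "U \<inter> space lebesgue \<in> sets lebesgue" using assms(1) by auto
  \<comment> \<open>\<open>Suc n\<close> keeps the steepness positive, so each bump vanishes exactly
    outside the open box.\<close>
  let ?b = "\<lambda>n x. box_bump (real (Suc n)) c d x"
  have eq: "?b n x *\<^sub>R indicator (cbox c d) x *\<^sub>R g x = indicator U x *\<^sub>R ?b n x *\<^sub>R g x" for n x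
  proof (cases "x \<in> box c d")
    case True
    then have "x \<in> cbox c d" "x \<in> U" using box_subset_cbox[of c d] assms(3) by auto
    then show ?thesis by simp
  next
    case False
    then have "?b n x = 0" using box_bump_eq_0_iff[of "real (Suc n)" c d x] by simp
    then show ?thesis by simp
  qed
  have bm: "?b n \<in> borel_measurable lebesgue" for n
  proof -
    have "Ck 0 (?b n)" using smooth_box_bump[of "real (Suc n)" c d] unfolding smooth_def by blast
    then show ?thesis using continuous_measurable_lebesgue_on[of "?b n" UNIV] by (simp add: lebesgue_on_UNIV_eq)
  qed
  have "(\<lambda>n. \<integral>x. ?b n x *\<^sub>R indicator (cbox c d) x *\<^sub>R g x \<partial>lebesgue)
    \<longlonglongrightarrow> (\<integral>x. indicator (box c d) x *\<^sub>R indicator (cbox c d) x *\<^sub>R g x \<partial>lebesgue)"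
  proof (rule integral_dominated_convergence[OF _ _ integrable_norm[OF int]])
    show "(\<lambda>x. indicator (box c d) x *\<^sub>R indicator (cbox c d) x *\<^sub>R g x) \<in> borel_measurable lebesgue"
      using integrable_mult_indicator[OF _ int, of "box c d"] by (intro borel_measurable_integrable) simp
    show "(\<lambda>x. ?b n x *\<^sub>R indicator (cbox c d) x *\<^sub>R g x) \<in> borel_measurable lebesgue" for n
      by (rule borel_measurable_scaleR[OF bm borel_measurable_integrable[OF int]])
    show "AE x in lebesgue. (\<lambda>n. ?b n x *\<^sub>R indicator (cbox c d) x *\<^sub>R g x)
        \<longlonglongrightarrow> indicator (box c d) x *\<^sub>R indicator (cbox c d) x *\<^sub>R g x"
      by (intro AE_I2 tendsto_scaleR tendsto_const LIMSEQ_Suc[OF box_bump_tendsto])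
    show "AE x in lebesgue. norm (?b n x *\<^sub>R indicator (cbox c d) x *\<^sub>R g x) \<le> norm (indicator (cbox c d) x *\<^sub>R g x)" for n
      unfolding norm_scaleR[of "?b n _"]
      by (rule AE_I2, rule mult_left_le_one_le) (simp_all only: norm_ge_zero abs_ge_zero abs_of_nonneg box_bump_bounds)
  qed
  moreover have "(\<integral>x. ?b n x *\<^sub>R indicator (cbox c d) x *\<^sub>R g x \<partial>lebesgue) = 0" for n
    unfolding eq using assms(4)[OF test_function_box_bump[OF _ assms(3)], of "real (Suc n)"]
    by (simp add: integral_restrict_space[OF U])
  moreover have "indicator (box c d) x *\<^sub>R indicator (cbox c d) x *\<^sub>R g x = indicator (box c d) x *\<^sub>R g x" for x
    using box_subset_cbox[of c d] by (auto simp: indicator_def)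
  ultimately show ?thesis by (simp only: LIMSEQ_const_iff)
qed

text \<open>Once the integrals over all boxes vanish, Lebesgue's differentiation theorem forces the
  function to vanish almost everywhere on each closed box inside \<open>U\<close>; countably many
  such boxes exhaust \<open>U\<close>.\<close>

lemma fundamental_lemma:
  fixes g :: "'a::euclidean_space \<Rightarrow> 'b::euclidean_space"
  assumes U: "open U" and g: "locally_integrable_on g U"
    and z: "\<And>\<phi>. test_function U \<phi> \<Longrightarrow> (\<integral>x. \<phi> x *\<^sub>R g x \<partial>lebesgue_on U) = 0"
  shows "AE x in lebesgue_on U. g x = 0"
proof -
  have local: "AE x in lebesgue. x \<in> cbox a b \<longrightarrow> g x = 0" if ab: "cbox a b \<subseteq> U" for a b
  proof -
    \<comment> \<open>Cutting to the open box gives a globally integrable function. Its integral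
      over any other box is an integral of \<open>g\<close> over an intersection of two boxes, again
      a box inside \<open>U\<close>.\<close>
    define f where "f = (\<lambda>x. indicator (box a b) x *\<^sub>R g x)"
    have int: "integrable lebesgue (\<lambda>x. indicator (cbox a b) x *\<^sub>R g x)"
      using g ab by (auto simp: locally_integrable_on_def set_integrable_def)
    have "integrable lebesgue (\<lambda>x. indicator (box a b) x *\<^sub>R indicator (cbox a b) x *\<^sub>R g x)"
      using integrable_mult_indicator[OF _ int, of "box a b"] by simp
    also have "(\<lambda>x. indicator (box a b) x *\<^sub>R indicator (cbox a b) x *\<^sub>R g x) = f"
      using box_subset_cbox[of a b] by (auto simp: f_def indicator_def fun_eq_iff)
    finally have f: "integrable lebesgue f" .
    have fc: "set_integrable lebesgue (cbox c d) f" for c d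
      using integrable_mult_indicator[OF _ f, of "cbox c d"] by (simp add: set_integrable_def)
    have zero: "integral (cbox c d) f = 0" for c d
    proof -
      obtain p q where pq: "box c d \<inter> box a b = box p q" "cbox p q \<subseteq> cbox a b \<or> box p q = {}"
      proof
        let ?p = "\<Sum>i\<in>Basis. max (c \<bullet> i) (a \<bullet> i) *\<^sub>R i" and ?q = "\<Sum>i\<in>Basis. min (d \<bullet> i) (b \<bullet> i) *\<^sub>R i"
        show "box c d \<inter> box a b = box ?p ?q" by (rule box_Int_box)
        show "cbox ?p ?q \<subseteq> cbox a b \<or> box ?p ?q = {}" by (auto simp: mem_box)
      qed
      have "integral (cbox c d) f = (\<integral>x. indicator (cbox c d) x *\<^sub>R f x \<partial>lebesgue)"
        using set_lebesgue_integral_eq_integral(2)[OF fc[of c d]] by (simp add: set_lebesgue_integral_def)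
      also have "\<dots> = (\<integral>x. indicator (box c d) x *\<^sub>R f x \<partial>lebesgue)"
      proof (rule integral_cong_AE)
        have "negligible (cbox c d - box c d)" by (rule negligible_frontier_interval)
        then have "AE x in lebesgue. x \<notin> cbox c d - box c d"
          using AE_not_in unfolding negligible_iff_null_sets by blast
        then show "AE x in lebesgue. indicator (cbox c d) x *\<^sub>R f x = indicator (box c d) x *\<^sub>R f x"
          by eventually_elim (use box_subset_cbox[of c d] in \<open>auto simp: indicator_def\<close>)
      qed (use borel_measurable_integrable[OF f] in \<open>auto intro!: borel_measurable_scaleR borel_measurable_indicator\<close>)
      also have "\<dots> = (\<integral>x. indicator (box p q) x *\<^sub>R g x \<partial>lebesgue)"
        by (rule Bochner_Integration.integral_cong) (auto simp: f_def indicator_def simp flip: pq(1))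
      also have "\<dots> = 0"
        using pq(2) fundamental_lemma_box[OF U g _ z, of p q] ab by (cases "box p q = {}") auto
      finally show ?thesis .
    qed
    \<comment> \<open>Lebesgue differentiation with cubes that have \<open>x\<close> as a corner:
      outside a null set their averages converge to \<open>f x\<close>, and here all averages are
      0.\<close>
    obtain N where N: "negligible N"
      "\<And>x e. x \<notin> N \<Longrightarrow> 0 < e \<Longrightarrow> \<exists>t>0. \<forall>h. 0 < h \<and> h < t \<longrightarrow>
         norm (integral (cbox x (x + h *\<^sub>R One)) f /\<^sub>R h ^ DIM('a) - f x) < e"
      using integrable_ccontinuous_explicit[of f] set_lebesgue_integral_eq_integral(1)[OF fc] by metis
    have f0: "f x = 0" if "x \<notin> N" for x
    proof (rule ccontr)
      assume "f x \<noteq> 0"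
      with N(2)[OF that, of "norm (f x)"] obtain t where "t > 0"
        "\<And>h. 0 < h \<Longrightarrow> h < t \<Longrightarrow> norm (integral (cbox x (x + h *\<^sub>R One)) f /\<^sub>R h ^ DIM('a) - f x) < norm (f x)"
        by auto
      from this(2)[of "t/2"] \<open>t > 0\<close> show False by (simp add: zero)
    qed
    \<comment> \<open>The faces of the box join the null set because \<open>f\<close> was cut to the
      open box.\<close>
    have "negligible (N \<union> (cbox a b - box a b))"
      by (intro negligible_Un N(1) negligible_frontier_interval)
    then have "AE x in lebesgue. x \<notin> N \<union> (cbox a b - box a b)"
      using AE_not_in unfolding negligible_iff_null_sets by blast
    then show ?thesis
    proof eventually_elim
      case (elim x)
      then show ?case using f0[of x] by (auto simp: f_def)
    qed
  qed
  obtain D where D: "countable D" "\<And>X. X \<in> D \<Longrightarrow> X \<subseteq> U" "\<And>X. X \<in> D \<Longrightarrow> \<exists>a b. X = cbox a b" "\<Union>D = U"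
    using open_countable_Union_open_cbox[OF U] by (metis PowD subsetD)
  have "AE x in lebesgue. \<forall>X\<in>D. x \<in> X \<longrightarrow> g x = 0"
    using D local by (subst AE_ball_countable[OF D(1)]) metis
  then have "AE x in lebesgue. x \<in> U \<longrightarrow> g x = 0"
    by eventually_elim (use D(4) in blast)
  then show ?thesis using U by (subst AE_restrict_space_iff) auto
qed

section \<open>Gradients and integration by parts\<close>

definition grad :: "(real^'n \<Rightarrow> 'b::euclidean_space) \<Rightarrow> real^'n \<Rightarrow> 'b^'n" where
  "grad f x = (\<chi> i. frechet_derivative f (at x) (axis i 1))"

lemma grad_component: "grad f x $ i = frechet_derivative f (at x) (axis i 1)"
  by (simp add: grad_def)

lemma grad_eqI:
  assumes "(f has_derivative D) (at x)"
  shows "grad f x = (\<chi> i. D (axis i 1))"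
  unfolding grad_def using frechet_derivative_at[OF assms] by simp

lemma frechet_derivative_grad:
  assumes "Ck (Suc k) f"
  shows "frechet_derivative f (at x) v = (\<Sum>i\<in>UNIV. v $ i *\<^sub>R grad f x $ i)"
proof -
  have "linear (frechet_derivative f (at x))"
    using Ck_Suc_has_derivative[OF assms] has_derivative_linear by blast
  then have "frechet_derivative f (at x) (\<Sum>i\<in>UNIV. v $ i *\<^sub>R axis i 1)
      = (\<Sum>i\<in>UNIV. v $ i *\<^sub>R frechet_derivative f (at x) (axis i 1))"
    by (simp add: linear_sum linear_scale)
  moreover have "(\<Sum>i\<in>UNIV. v $ i *\<^sub>R axis i 1) = v"
    using basis_expansion[of v] by (simp add: scalar_mult_eq_scaleR)
  ultimately show ?thesis by (simp add: grad_component)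
qed

lemma Ck_grad_component: "Ck (Suc k) f \<Longrightarrow> Ck k (\<lambda>x. grad f x $ i)"
  unfolding grad_component by (rule Ck_Suc_deriv)

lemma continuous_on_grad:
  assumes "Ck (Suc k) f"
  shows "continuous_on S (grad f)"
proof -
  have "continuous_on S (\<lambda>x. \<chi> i. grad f x $ i)"
    by (intro continuous_on_vec_lambda Ck_imp_continuous_on[OF Ck_grad_component[OF assms]])
  then show ?thesis by simp
qed

lemma grad_const: "grad (\<lambda>x. c) x = 0"
  using grad_eqI[OF has_derivative_const[of c "at x"]] by (simp add: vec_eq_iff)

lemma grad_add:
  assumes "Ck (Suc 0) f" "Ck (Suc 0) g"
  shows "grad (\<lambda>x. f x + g x) x = grad f x + grad g x"
  using grad_eqI[OF has_derivative_add[OF Ck_Suc_has_derivative[OF assms(1)] Ck_Suc_has_derivative[OF assms(2)]]]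
  by (simp add: vec_eq_iff grad_component)

lemma grad_linear:
  assumes "bounded_linear L" "Ck (Suc 0) f"
  shows "grad (\<lambda>x. L (f x)) x = (\<chi> i. L (grad f x $ i))"
  using grad_eqI[OF bounded_linear.has_derivative[OF assms(1) Ck_Suc_has_derivative[OF assms(2)]]]
  by (simp add: vec_eq_iff grad_component)

lemma grad_diff:
  assumes "Ck (Suc 0) f" "Ck (Suc 0) g"
  shows "grad (\<lambda>x. f x - g x) x = grad f x - grad g x"
  using grad_eqI[OF has_derivative_diff[OF Ck_Suc_has_derivative[OF assms(1)] Ck_Suc_has_derivative[OF assms(2)]]]
  by (simp add: vec_eq_iff grad_component)

lemma grad_bilinear:
  assumes "bounded_bilinear h" "Ck (Suc 0) f" "Ck (Suc 0) g"
  shows "grad (\<lambda>x. h (f x) (g x)) x = (\<chi> i. h (f x) (grad g x $ i) + h (grad f x $ i) (g x))"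
  using grad_eqI[OF bounded_bilinear.FDERIV[OF assms(1) Ck_Suc_has_derivative[OF assms(2)] Ck_Suc_has_derivative[OF assms(3)]]]
  by (simp add: vec_eq_iff grad_component)

section \<open>Integration along segments and integration by parts\<close>

lemma has_integral_line:
  fixes f :: "'a::euclidean_space \<Rightarrow> 'b::euclidean_space"
  assumes "Ck (Suc 0) f"
  shows "((\<lambda>t. frechet_derivative f (at (x + t *\<^sub>R v)) v) has_integral (f (x + v) - f x)) {0..1}"
proof -
  have "((\<lambda>t. f (x + t *\<^sub>R v)) has_vector_derivative frechet_derivative f (at (x + t *\<^sub>R v)) v) (at t within {0..1})" for t
  proof -
    let ?D = "frechet_derivative f (at (x + t *\<^sub>R v))"
    have D: "(f has_derivative ?D) (at (x + t *\<^sub>R v))" by (rule Ck_Suc_has_derivative[OF assms])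
    have "((\<lambda>t. x + t *\<^sub>R v) has_derivative (\<lambda>s. s *\<^sub>R v)) (at t within {0..1})"
      by (auto intro!: derivative_eq_intros)
    from has_derivative_compose[OF this D]
    have "((\<lambda>t. f (x + t *\<^sub>R v)) has_derivative (\<lambda>s. ?D (s *\<^sub>R v))) (at t within {0..1})" .
    then show ?thesis
      unfolding has_vector_derivative_def using linear_scale[OF has_derivative_linear[OF D]] by simp
  qed
  then have "((\<lambda>t. frechet_derivative f (at (x + t *\<^sub>R v)) v) has_integral (f (x + 1 *\<^sub>R v) - f (x + 0 *\<^sub>R v))) {0..1}"
    by (intro fundamental_theorem_of_calculus[of 0 1 "\<lambda>t. f (x + t *\<^sub>R v)"]) auto
  then show ?thesis by simp
qed

text \<open>The difference quotient is taken along the fixed steps 1/(n+1), so that dominated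
  convergence can be applied to the resulting sequence of functions.\<close>

lemma has_derivative_directional_seq:
  assumes "(f has_derivative D) (at x)"
  shows "(\<lambda>n. real (Suc n) *\<^sub>R (f (x + (1 / real (Suc n)) *\<^sub>R v) - f x)) \<longlonglongrightarrow> D v"
proof (cases "v = 0")
  case True
  then show ?thesis using linear_0[OF has_derivative_linear[OF assms]] by simp
next
  case False
  define h where "h n = (1 / real (Suc n)) *\<^sub>R v" for n
  have "(\<lambda>n. 1 / real (Suc n)) \<longlonglongrightarrow> 0" by (rule LIMSEQ_Suc[OF lim_1_over_n])
  from tendsto_scaleR[OF this tendsto_const[of v]] have "h \<longlonglongrightarrow> 0" by (simp add: h_def[abs_def])
  moreover have "h n \<noteq> 0" for n using False by (simp add: h_def)
  ultimately have "filterlim h (at 0) sequentially" by (simp add: filterlim_at)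
  moreover have "((\<lambda>h. norm (f (x + h) - f x - D h) / norm h) \<longlongrightarrow> 0) (at 0)"
    using assms by (simp add: has_derivative_at)
  ultimately have "(\<lambda>n. norm (f (x + h n) - f x - D (h n)) / norm (h n)) \<longlonglongrightarrow> 0"
    by (rule filterlim_compose[rotated])
  then have "(\<lambda>n. norm (f (x + h n) - f x - D (h n)) / norm (h n) * norm v) \<longlonglongrightarrow> 0 * norm v"
    by (intro tendsto_mult tendsto_const)
  moreover have "norm (f (x + h n) - f x - D (h n)) / norm (h n) * norm v
      = norm (real (Suc n) *\<^sub>R (f (x + h n) - f x) - D v)" for n
  proof -
    have "D v = real (Suc n) *\<^sub>R D (h n)"
      unfolding h_def linear_scale[OF has_derivative_linear[OF assms]] by simp
    then have "norm (real (Suc n) *\<^sub>R (f (x + h n) - f x) - D v) = real (Suc n) * norm (f (x + h n) - f x - D (h n))"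
      by (metis abs_of_nat norm_scaleR scaleR_right_diff_distrib)
    moreover have "norm (h n) = norm v / real (Suc n)" by (simp add: h_def)
    ultimately show ?thesis using False by (simp del: of_nat_Suc)
  qed
  ultimately have "(\<lambda>n. norm (real (Suc n) *\<^sub>R (f (x + h n) - f x) - D v)) \<longlonglongrightarrow> 0" by simp
  then show ?thesis unfolding h_def tendsto_norm_zero_iff LIM_zero_iff .
qed

lemma integrable_continuous_bounded_support:
  fixes f :: "'a::euclidean_space \<Rightarrow> 'b::euclidean_space"
  assumes "continuous_on UNIV f" "\<And>x. R < norm x \<Longrightarrow> f x = 0"
  shows "integrable lborel f"
proof -
  have "integrable lborel (\<lambda>x. indicator (cball 0 R) x *\<^sub>R f x)"
    using borel_integrable_compact[of "cball 0 R" f] continuous_on_subset[OF assms(1)] by simp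
  also have "(\<lambda>x. indicator (cball 0 R) x *\<^sub>R f x) = f"
    using assms(2) by (auto simp: fun_eq_iff indicator_def not_le)
  finally show ?thesis .
qed

lemma frechet_derivative_eq_0:
  assumes "open S" "\<And>y. y \<in> S \<Longrightarrow> f y = 0" "x \<in> S"
  shows "frechet_derivative f (at x) v = 0"
proof -
  have "(f has_derivative (\<lambda>_. 0)) (at x)"
    by (rule has_derivative_transform_within_open[OF has_derivative_const[of 0] assms(1,3)])
      (simp add: assms(2))
  then show ?thesis using frechet_derivative_at by metis
qed

text \<open>By translation invariance every difference quotient has integral 0, and the quotients
  converge to the derivative while staying bounded with a common bounded support. This replaces
  Fubini and one-dimensional integration.\<close>

lemma integral_derivative_bounded_support:
  fixes f :: "'a::euclidean_space \<Rightarrow> 'b::euclidean_space"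
  assumes f: "Ck (Suc 0) f" and R: "\<And>x. R < norm x \<Longrightarrow> f x = 0"
  shows "(\<integral>x. frechet_derivative f (at x) v \<partial>lborel) = 0"
proof -
  let ?D = "\<lambda>x. frechet_derivative f (at x) v"
  have contD: "continuous_on UNIV ?D" using Ck_Suc_deriv[OF f] by simp
  have D0: "?D x = 0" if "R < norm x" for x
    by (rule frechet_derivative_eq_0[of "{x. R < norm x}"]) (use R that in \<open>auto intro: open_Collect_less continuous_intros\<close>)
  have cf: "continuous_on UNIV f" by (rule Ck_imp_continuous_on[OF f])
  have fint: "integrable lborel f" by (rule integrable_continuous_bounded_support[OF cf R])
  have "bounded (?D ` cball 0 R)"
    by (intro compact_imp_bounded compact_continuous_image continuous_on_subset[OF contD]) auto
  then obtain B where "B > 0" "\<And>x. x \<in> cball 0 R \<Longrightarrow> norm (?D x) \<le> B"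
    unfolding bounded_pos by auto
  then have B: "B > 0" "norm (?D x) \<le> B" for x
    using D0[of x] by (cases "R < norm x"; force simp: not_less)+
  let ?q = "\<lambda>n x. real (Suc n) *\<^sub>R (f (x + (1 / real (Suc n)) *\<^sub>R v) - f x)"
  \<comment> \<open>The quotient is an average of the directional derivative over a segment, hence
    inherits its bound independently of the step.\<close>
  have qB: "norm (?q n x) \<le> B" for n x
  proof -
    let ?h = "1 / real (Suc n)"
    have *: "((\<lambda>t. frechet_derivative f (at (x + t *\<^sub>R (?h *\<^sub>R v))) (?h *\<^sub>R v)) has_integral (f (x + ?h *\<^sub>R v) - f x)) {0..1}"
      by (rule has_integral_line[OF f])
    have "norm (frechet_derivative f (at y) (?h *\<^sub>R v)) \<le> ?h * B" for y
      unfolding linear_scale[OF has_derivative_linear[OF Ck_Suc_has_derivative[OF f]]]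
      using B(2)[of y] by (simp add: divide_right_mono)
    then have "norm (f (x + ?h *\<^sub>R v) - f x) \<le> ?h * B"
      using has_integral_bound_real[OF _ finite.emptyI *, of "?h * B"] B(1) by simp
    then have "real (Suc n) * norm (f (x + ?h *\<^sub>R v) - f x) \<le> B"
      by (simp add: pos_le_divide_eq mult.commute del: of_nat_Suc)
    then show ?thesis by (simp only: norm_scaleR abs_of_nat)
  qed
  \<comment> \<open>The steps have length at most the norm of \<open>v\<close>, so all quotients
    vanish outside this one ball.\<close>
  let ?S = "cball 0 (\<bar>R\<bar> + norm v)"
  have q0: "?q n x = 0" if "x \<notin> ?S" for n x
  proof -
    have "R + norm v < norm x" using that by simp
    moreover have "norm x \<le> norm (x + (1 / real (Suc n)) *\<^sub>R v) + norm ((1 / real (Suc n)) *\<^sub>R v)"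
      using norm_triangle_ineq4[of "x + (1 / real (Suc n)) *\<^sub>R v" "(1 / real (Suc n)) *\<^sub>R v"] by simp
    moreover have "norm ((1 / real (Suc n)) *\<^sub>R v) \<le> norm v"
      by (simp add: divide_le_eq mult_left_le mult_le_cancel_left1 algebra_simps)
    ultimately have "R < norm (x + (1 / real (Suc n)) *\<^sub>R v)" "R < norm x"
      using norm_ge_zero[of v] by linarith+
    then show ?thesis by (simp add: R)
  qed
  have shift: "integrable lborel (\<lambda>x. f (x + c))" "(\<integral>x. f (x + c) \<partial>lborel) = (\<integral>x. f x \<partial>lborel)" for c
  proof -
    have fm: "f \<in> borel_measurable borel" by (rule borel_measurable_continuous_onI[OF cf])
    have *: "lborel = distr lborel borel (\<lambda>x. x + c)"
      using lborel_distr_plus[of c, symmetric] by (simp only: add.commute[of _ c])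
    show "integrable lborel (\<lambda>x. f (x + c))"
      using fint by (subst (asm) *) (subst (asm) integrable_distr_eq, auto simp: fm)
    show "(\<integral>x. f (x + c) \<partial>lborel) = (\<integral>x. f x \<partial>lborel)"
      by (subst (2) *) (subst integral_distr, auto simp: fm)
  qed
  have q_int: "(\<integral>x. ?q n x \<partial>lborel) = 0" for n
    using shift fint by simp
  have "(\<lambda>n. \<integral>x. ?q n x \<partial>lborel) \<longlonglongrightarrow> (\<integral>x. ?D x \<partial>lborel)"
  proof (rule integral_dominated_convergence)
    show "integrable lborel (\<lambda>x. indicator ?S x *\<^sub>R B)"
      by (rule borel_integrable_compact) auto
    show "?D \<in> borel_measurable lborel" using borel_measurable_continuous_onI[OF contD] by simp
    have qc: "continuous_on UNIV (?q n)" for n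
      by (intro continuous_intros continuous_on_compose2[OF cf]) auto
    show "?q n \<in> borel_measurable lborel" for n using borel_measurable_continuous_onI[OF qc[of n]] by simp
    show "AE x in lborel. (\<lambda>n. ?q n x) \<longlonglongrightarrow> ?D x"
      by (intro AE_I2 has_derivative_directional_seq Ck_Suc_has_derivative[OF f])
    show "AE x in lborel. norm (?q n x) \<le> indicator ?S x *\<^sub>R B" for n
    proof (rule AE_I2)
      fix x show "norm (?q n x) \<le> indicator ?S x *\<^sub>R B"
      proof (cases "x \<in> ?S")
        case True
        then show ?thesis using qB[of n x] by (simp only: indicator_simps scaleR_one)
      next
        case False
        then show ?thesis unfolding q0[OF False] using B(1) by simp
      qed
    qed
  qed
  then show ?thesis unfolding q_int by (simp only: LIMSEQ_const_iff)
qed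

text \<open>Joins the two measures in use: the notions of the statement integrate over
  \<open>lebesgue_on U\<close>, while translations, dilations and Fubini are applied to
  \<open>lborel\<close>.\<close>

lemma integral_lebesgue_on_lborel:
  fixes f :: "'a::euclidean_space \<Rightarrow> 'b::euclidean_space"
  assumes "open U" "f \<in> borel_measurable borel" "\<And>x. x \<notin> U \<Longrightarrow> f x = 0"
  shows "integral\<^sup>L (lebesgue_on U) f = integral\<^sup>L lborel f"
proof -
  have "integral\<^sup>L (lebesgue_on U) f = (\<integral>x. indicator U x *\<^sub>R f x \<partial>lebesgue)"
    by (rule integral_restrict_space) (use assms(1) in auto)
  also have "(\<lambda>x. indicator U x *\<^sub>R f x) = f" using assms(3) by (auto simp: indicator_def fun_eq_iff)
  also have "integral\<^sup>L lebesgue f = integral\<^sup>L lborel f"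
    by (rule integral_completion) (use assms(2) in simp)
  finally show ?thesis .
qed

lemma test_function_Ck: "test_function U \<phi> \<Longrightarrow> Ck k \<phi>"
  by (simp add: test_function_def smooth_def)

lemma test_function_outside:
  assumes "test_function U \<phi>" "x \<notin> U"
  shows "\<phi> x = 0" "frechet_derivative \<phi> (at x) v = 0"
proof -
  have x: "x \<in> - closure {x. \<phi> x \<noteq> 0}" using assms by (auto simp: test_function_def)
  then show "\<phi> x = 0" using closure_subset[of "{x. \<phi> x \<noteq> 0}"] by auto
  show "frechet_derivative \<phi> (at x) v = 0"
    by (rule frechet_derivative_eq_0[OF _ _ x]) (use closure_subset[of "{x. \<phi> x \<noteq> 0}"] in auto)
qed

lemma test_function_bounded_support:
  assumes "test_function U \<phi>"
  obtains R where "\<And>x. R < norm x \<Longrightarrow> \<phi> x = 0"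
proof -
  have "bounded {x. \<phi> x \<noteq> 0}"
    using assms compact_imp_bounded bounded_subset closure_subset unfolding test_function_def by metis
  then obtain R where "\<And>x. \<phi> x \<noteq> 0 \<Longrightarrow> norm x \<le> R" by (auto simp: bounded_iff)
  then show ?thesis by (meson not_less that)
qed

lemma partial_deriv_eq_grad: "partial_deriv i \<phi> x = grad \<phi> x $ i"
  by (simp add: partial_deriv_def grad_component)

text \<open>The product of the test function with \<open>v\<close> has bounded support whatever
  \<open>v\<close> does near and beyond the boundary, so the integral of its derivative
  vanishes.\<close>

lemma integration_by_parts_C1:
  fixes v :: "real^'n \<Rightarrow> 'b::euclidean_space"
  assumes U: "open U" and \<phi>: "test_function U \<phi>" and v: "Ck (Suc 0) v"
  shows "(\<integral>x. partial_deriv i \<phi> x *\<^sub>R v x \<partial>lebesgue_on U) = - (\<integral>x. \<phi> x *\<^sub>R (grad v x $ i) \<partial>lebesgue_on U)"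
proof -
  obtain R where R: "\<And>x. R < norm x \<Longrightarrow> \<phi> x = 0" using test_function_bounded_support[OF \<phi>] by blast
  have c\<phi>: "Ck (Suc 0) \<phi>" by (rule test_function_Ck[OF \<phi>])
  let ?w = "\<lambda>x. \<phi> x *\<^sub>R v x"
  have w: "Ck (Suc 0) ?w" by (rule Ck_scaleR[OF c\<phi> v])
  have gw: "grad ?w x $ i = \<phi> x *\<^sub>R grad v x $ i + partial_deriv i \<phi> x *\<^sub>R v x" for x
    unfolding grad_bilinear[OF bounded_bilinear_scaleR c\<phi> v] by (simp add: partial_deriv_eq_grad)
  have R': "partial_deriv i \<phi> x = 0" if "R < norm x" for x
    unfolding partial_deriv_def
    by (rule frechet_derivative_eq_0[of "{x. R < norm x}"]) (use R that in \<open>auto intro: open_Collect_less continuous_intros\<close>)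
  have c1: "continuous_on UNIV (\<lambda>x. \<phi> x *\<^sub>R grad v x $ i)"
    by (intro continuous_on_scaleR Ck_imp_continuous_on[OF c\<phi>] Ck_imp_continuous_on[OF Ck_grad_component[OF v]])
  have c2: "continuous_on UNIV (\<lambda>x. partial_deriv i \<phi> x *\<^sub>R v x)"
    unfolding partial_deriv_eq_grad
    by (intro continuous_on_scaleR Ck_imp_continuous_on[OF v] Ck_imp_continuous_on[OF Ck_grad_component[OF c\<phi>]])
  have "0 = (\<integral>x. grad ?w x $ i \<partial>lborel)"
    unfolding grad_component by (rule integral_derivative_bounded_support[OF w, of R, symmetric]) (simp add: R)
  also have "\<dots> = (\<integral>x. \<phi> x *\<^sub>R grad v x $ i \<partial>lborel) + (\<integral>x. partial_deriv i \<phi> x *\<^sub>R v x \<partial>lborel)"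
    unfolding gw
    by (intro Bochner_Integration.integral_add integrable_continuous_bounded_support[OF c1, of R] integrable_continuous_bounded_support[OF c2, of R])
      (simp_all add: R R')
  finally have "(\<integral>x. partial_deriv i \<phi> x *\<^sub>R v x \<partial>lborel) = - (\<integral>x. \<phi> x *\<^sub>R grad v x $ i \<partial>lborel)"
    by (simp add: eq_neg_iff_add_eq_0 add.commute)
  moreover have "(\<integral>x. partial_deriv i \<phi> x *\<^sub>R v x \<partial>lebesgue_on U) = (\<integral>x. partial_deriv i \<phi> x *\<^sub>R v x \<partial>lborel)"
    by (rule integral_lebesgue_on_lborel[OF U borel_measurable_continuous_onI[OF c2]]) (simp add: partial_deriv_def test_function_outside[OF \<phi>])
  moreover have "(\<integral>x. \<phi> x *\<^sub>R grad v x $ i \<partial>lebesgue_on U) = (\<integral>x. \<phi> x *\<^sub>R grad v x $ i \<partial>lborel)"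
    by (rule integral_lebesgue_on_lborel[OF U borel_measurable_continuous_onI[OF c1]]) (simp add: test_function_outside[OF \<phi>])
  ultimately show ?thesis by simp
qed

section \<open>Limits of bilinear expressions in \<open>L\<^sup>2\<close>\<close>

lemma L2_norm_mult_le:
  fixes f :: "'a \<Rightarrow> 'b::euclidean_space" and g :: "'a \<Rightarrow> 'c::euclidean_space"
  assumes "square_integrable M f" "square_integrable M g"
  shows "(\<integral>x. norm (f x) * norm (g x) \<partial>M) \<le> L2_norm M f * L2_norm M g"
proof -
  have "square_integrable M (\<lambda>x. norm (f x))" "square_integrable M (\<lambda>x. norm (g x))"
    using assms by (auto simp: square_integrable_def)
  from L2_Cauchy_Schwarz[OF this] show ?thesis by (simp add: L2_norm_def)
qed

text \<open>The difference splits as h(f n - f0, g n) + h(f0, g n - g0). Each part is estimated by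
  Cauchy-Schwarz, with the norms of \<open>g n\<close> converging and hence bounded.\<close>

lemma L2_bilinear_tendsto:
  fixes f :: "nat \<Rightarrow> 'a \<Rightarrow> 'b::euclidean_space" and g :: "nat \<Rightarrow> 'a \<Rightarrow> 'c::euclidean_space"
    and h :: "'b \<Rightarrow> 'c \<Rightarrow> 'd::euclidean_space"
  assumes h: "bounded_bilinear h"
    and f: "\<And>n. square_integrable M (f n)" "square_integrable M f0"
    and g: "\<And>n. square_integrable M (g n)" "square_integrable M g0"
    and fl: "(\<lambda>n. L2_norm M (\<lambda>x. f n x - f0 x)) \<longlonglongrightarrow> 0"
    and gl: "(\<lambda>n. L2_norm M (\<lambda>x. g n x - g0 x)) \<longlonglongrightarrow> 0"
  shows "(\<lambda>n. \<integral>x. h (f n x) (g n x) \<partial>M) \<longlonglongrightarrow> (\<integral>x. h (f0 x) (g0 x) \<partial>M)"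
proof -
  obtain K where K: "K > 0" "\<And>a b. norm (h a b) \<le> norm a * norm b * K"
    using bounded_bilinear.pos_bounded[OF h] by blast
  have bd: "norm (\<integral>x. h (u x) (w x) \<partial>M) \<le> K * (L2_norm M u * L2_norm M w)"
    if u: "square_integrable M u" and w: "square_integrable M w" for u w
  proof -
    have "norm (\<integral>x. h (u x) (w x) \<partial>M) \<le> (\<integral>x. norm (u x) * norm (w x) * K \<partial>M)"
      by (rule order_trans[OF integral_norm_bound integral_mono[OF integrable_norm[OF integrable_bilinear_L2[OF h u w]]]])
        (use integrable_norm_mult_L2[OF u w] K(2) in auto)
    also have "\<dots> = K * (\<integral>x. norm (u x) * norm (w x) \<partial>M)" by simp
    also have "\<dots> \<le> K * (L2_norm M u * L2_norm M w)"
      using L2_norm_mult_le[OF u w] K(1) by simp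
    finally show ?thesis .
  qed
  have "norm ((\<integral>x. h (f n x) (g n x) \<partial>M) - (\<integral>x. h (f0 x) (g0 x) \<partial>M))
    \<le> K * (L2_norm M (\<lambda>x. f n x - f0 x) * L2_norm M (g n)) + K * (L2_norm M f0 * L2_norm M (\<lambda>x. g n x - g0 x))" for n
  proof -
    have "(\<integral>x. h (f n x) (g n x) \<partial>M) - (\<integral>x. h (f0 x) (g0 x) \<partial>M)
        = (\<integral>x. h (f n x - f0 x) (g n x) + h (f0 x) (g n x - g0 x) \<partial>M)"
      by (subst Bochner_Integration.integral_diff[symmetric])
        (auto intro!: integrable_bilinear_L2[OF h] f g
          simp: bounded_bilinear.diff_left[OF h] bounded_bilinear.diff_right[OF h])
    also have "\<dots> = (\<integral>x. h (f n x - f0 x) (g n x) \<partial>M) + (\<integral>x. h (f0 x) (g n x - g0 x) \<partial>M)"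
      by (intro Bochner_Integration.integral_add integrable_bilinear_L2[OF h] square_integrable_diff f g)
    finally show ?thesis
      using norm_triangle_mono[OF bd[OF square_integrable_diff[OF f(1)[of n] f(2)] g(1)[of n]]
          bd[OF f(2) square_integrable_diff[OF g(1)[of n] g(2)]]] by simp
  qed
  note bound = this
  have "(\<lambda>n. K * (L2_norm M (\<lambda>x. f n x - f0 x) * L2_norm M (g n)) + K * (L2_norm M f0 * L2_norm M (\<lambda>x. g n x - g0 x)))
     \<longlonglongrightarrow> K * (0 * L2_norm M g0) + K * (L2_norm M f0 * 0)"
    by (intro tendsto_intros fl gl L2_norm_tendsto g)
  then have lim: "(\<lambda>n. K * (L2_norm M (\<lambda>x. f n x - f0 x) * L2_norm M (g n)) + K * (L2_norm M f0 * L2_norm M (\<lambda>x. g n x - g0 x))) \<longlonglongrightarrow> 0"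
    by (simp only: mult_zero_left mult_zero_right add_0_left)
  have "(\<lambda>n. (\<integral>x. h (f n x) (g n x) \<partial>M) - (\<integral>x. h (f0 x) (g0 x) \<partial>M)) \<longlonglongrightarrow> 0"
    by (rule Lim_null_comparison[OF always_eventually[OF allI[OF bound]] lim])
  then show ?thesis by (simp add: LIM_zero_iff)
qed

lemma bounded_continuous_scaleR_L2:
  fixes f :: "'a::euclidean_space \<Rightarrow> 'b::euclidean_space"
  assumes "continuous_on UNIV (\<psi> :: 'a \<Rightarrow> real)" "\<forall>x\<in>U. \<bar>\<psi> x\<bar> \<le> B" "square_integrable (lebesgue_on U) f"
  shows "square_integrable (lebesgue_on U) (\<lambda>x. \<psi> x *\<^sub>R f x)"
    and "L2_norm (lebesgue_on U) (\<lambda>x. \<psi> x *\<^sub>R f x) \<le> \<bar>B\<bar> * L2_norm (lebesgue_on U) f"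
proof -
  have m: "(\<lambda>x. \<psi> x *\<^sub>R f x) \<in> borel_measurable (lebesgue_on U)"
    using continuous_measurable_lebesgue_on[OF assms(1)] square_integrable_measurable[OF assms(3)]
    by (rule borel_measurable_scaleR)
  have b: "AE x in lebesgue_on U. norm (\<psi> x *\<^sub>R f x) \<le> \<bar>B\<bar> * norm (f x)"
  proof (rule AE_I2)
    fix x assume "x \<in> space (lebesgue_on U)"
    then have "\<bar>\<psi> x\<bar> \<le> \<bar>B\<bar>" using bspec[OF assms(2), of x] by simp
    then show "norm (\<psi> x *\<^sub>R f x) \<le> \<bar>B\<bar> * norm (f x)" by (simp add: mult_right_mono)
  qed
  show "square_integrable (lebesgue_on U) (\<lambda>x. \<psi> x *\<^sub>R f x)"
    by (rule square_integrable_bound(1)[OF assms(3) m b])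
  show "L2_norm (lebesgue_on U) (\<lambda>x. \<psi> x *\<^sub>R f x) \<le> \<bar>B\<bar> * L2_norm (lebesgue_on U) f"
    by (rule L2_norm_bound[OF assms(3) m b]) simp
qed

text \<open>Completeness of Lebesgue measure. It makes an arbitrarily chosen weak gradient
  measurable as soon as it agrees almost everywhere with a known field.\<close>

lemma borel_measurable_lebesgue_on_AE:
  fixes f g :: "'a::euclidean_space \<Rightarrow> 'b::euclidean_space"
  assumes "open U" "f \<in> borel_measurable (lebesgue_on U)" "AE x in lebesgue_on U. f x = g x"
  shows "g \<in> borel_measurable (lebesgue_on U)"
proof -
  have "AE x in lebesgue. x \<in> U \<longrightarrow> f x = g x"
    using assms(1,3) by (subst (asm) AE_restrict_space_iff) auto
  then have "AE x in lebesgue. (if x \<in> U then f x else 0) = (if x \<in> U then g x else 0)"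
    by eventually_elim simp
  moreover have "(\<lambda>x. if x \<in> U then f x else 0) \<in> borel_measurable lebesgue"
    using assms(1,2) by (subst borel_measurable_if) auto
  ultimately have "(\<lambda>x. if x \<in> U then g x else 0) \<in> borel_measurable lebesgue"
    by (rule borel_measurable_AE[rotated])
  then show ?thesis by (rule borel_measurable_if_D)
qed

section \<open>Strong gradients\<close>

lemma finite_measure_lebesgue_on_bounded:
  assumes "open U" "bounded U"
  shows "finite_measure (lebesgue_on U)"
  by (rule finite_measure_lebesgue_on[OF lmeasurable_open[OF assms(2,1)]])

lemma continuous_bounded_on:
  fixes f :: "'a::euclidean_space \<Rightarrow> 'b::euclidean_space"
  assumes "bounded U" "continuous_on UNIV f"
  obtains B where "\<And>x. x \<in> U \<Longrightarrow> norm (f x) \<le> B"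
proof -
  have "bounded (f ` closure U)"
    using assms by (intro compact_imp_bounded compact_continuous_image) (auto intro: continuous_on_subset simp: compact_closure)
  then obtain B where "\<And>x. x \<in> closure U \<Longrightarrow> norm (f x) \<le> B" by (auto simp: bounded_iff)
  then show ?thesis using closure_subset[of U] that by blast
qed

lemma square_integrable_continuous:
  fixes f :: "'a::euclidean_space \<Rightarrow> 'b::euclidean_space"
  assumes "open U" "bounded U" "continuous_on UNIV f"
  shows "square_integrable (lebesgue_on U) f"
proof -
  obtain B where B: "\<And>x. x \<in> U \<Longrightarrow> norm (f x) \<le> B"
    using continuous_bounded_on[OF assms(2,3)] by blast
  show ?thesis
  proof (rule square_integrable_bound(1))
    show "square_integrable (lebesgue_on U) (\<lambda>x. 1::real)"
      by (rule square_integrable_const[OF finite_measure_lebesgue_on_bounded[OF assms(1,2)]])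
    show "AE x in lebesgue_on U. norm (f x) \<le> B * norm (1::real)" using B by (intro AE_I2) simp
  qed (rule continuous_measurable_lebesgue_on[OF assms(3)])
qed

lemma locally_integrable_on_integrable:
  fixes f :: "'a::euclidean_space \<Rightarrow> 'b::euclidean_space"
  assumes "open U" "integrable (lebesgue_on U) f"
  shows "locally_integrable_on f U"
proof -
  have "set_integrable lebesgue U f"
    using assms(2) unfolding set_integrable_def by (subst (asm) integrable_restrict_space) (use assms(1) in auto)
  then show ?thesis unfolding locally_integrable_on_def
    by (auto intro: set_integrable_subset simp: borel_compact sets_completionI_sets)
qed

lemma integrable_square_integrable:
  fixes f :: "'a \<Rightarrow> 'b::euclidean_space"
  assumes "finite_measure M" "square_integrable M f"
  shows "integrable M f"
  using integrable_bilinear_L2[OF bounded_bilinear_scaleR square_integrable_const[OF assms(1), of "1::real"] assms(2)]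
  by simp

text \<open>Approximation by functions that are \<open>C\<^sup>1\<close> on the whole space is part of the definition, which spares
  the density theorems for \<open>W\<^sup>1\<^sup>,\<^sup>2\<close>.\<close>

definition strong_gradient ::
    "(real^'n \<Rightarrow> 'b::euclidean_space) \<Rightarrow> (real^'n \<Rightarrow> 'b^'n) \<Rightarrow> (real^'n) set \<Rightarrow> bool" where
  "strong_gradient u G U \<longleftrightarrow>
     square_integrable (lebesgue_on U) u \<and> square_integrable (lebesgue_on U) G \<and>
     (\<exists>v. (\<forall>k::nat. Ck (Suc 0) (v k)) \<and>
        (\<lambda>k. L2_norm (lebesgue_on U) (\<lambda>x. v k x - u x)) \<longlonglongrightarrow> 0 \<and>
        (\<lambda>k. L2_norm (lebesgue_on U) (\<lambda>x. grad (v k) x - G x)) \<longlonglongrightarrow> 0)"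

lemma strong_gradient_square_integrable:
  assumes "strong_gradient u G U"
  shows "square_integrable (lebesgue_on U) u" "square_integrable (lebesgue_on U) G"
  using assms by (auto simp: strong_gradient_def)

lemma square_integrable_component:
  fixes F :: "'a \<Rightarrow> 'b::euclidean_space^'n"
  assumes "square_integrable M F"
  shows "square_integrable M (\<lambda>x. F x $ i)"
  by (rule square_integrable_linear[OF bounded_linear_vec_nth assms])

lemma L2_norm_component_le:
  fixes F :: "'a \<Rightarrow> 'b::euclidean_space^'n"
  assumes "square_integrable M F"
  shows "L2_norm M (\<lambda>x. F x $ i) \<le> L2_norm M F"
proof -
  have "L2_norm M (\<lambda>x. F x $ i) \<le> 1 * L2_norm M F"
    by (rule L2_norm_bound[OF assms square_integrable_measurable[OF square_integrable_component[OF assms]]])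
      (auto intro!: AE_I2 simp: Finite_Cartesian_Product.norm_nth_le)
  then show ?thesis by simp
qed

lemma L2_tendsto_component:
  fixes F :: "nat \<Rightarrow> 'a \<Rightarrow> 'b::euclidean_space^'n"
  assumes "(\<lambda>k. L2_norm M (\<lambda>x. F k x - F0 x)) \<longlonglongrightarrow> 0"
    "\<And>k. square_integrable M (F k)" "square_integrable M F0"
  shows "(\<lambda>k. L2_norm M (\<lambda>x. F k x $ i - F0 x $ i)) \<longlonglongrightarrow> 0"
proof (rule Lim_null_comparison[OF always_eventually assms(1)], rule allI)
  fix k
  show "norm (L2_norm M (\<lambda>x. F k x $ i - F0 x $ i)) \<le> L2_norm M (\<lambda>x. F k x - F0 x)"
    using L2_norm_component_le[OF square_integrable_diff[OF assms(2)[of k] assms(3)], of i] by simp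
qed

context
  fixes U :: "(real^'n) set"
  assumes U: "open U" "bounded U"
begin

lemma square_integrable_C1:
  assumes "Ck (Suc 0) v"
  shows "square_integrable (lebesgue_on U) v" "square_integrable (lebesgue_on U) (grad v)"
  using square_integrable_continuous[OF U Ck_imp_continuous_on[OF assms]]
    square_integrable_continuous[OF U continuous_on_grad[OF assms]] by auto

lemma strong_gradientE:
  assumes "strong_gradient u G U"
  obtains v where "\<And>k::nat. Ck (Suc 0) (v k)"
    "\<And>k. square_integrable (lebesgue_on U) (v k)" "\<And>k. square_integrable (lebesgue_on U) (grad (v k))"
    "(\<lambda>k. L2_norm (lebesgue_on U) (\<lambda>x. v k x - u x)) \<longlonglongrightarrow> 0"
    "(\<lambda>k. L2_norm (lebesgue_on U) (\<lambda>x. grad (v k) x - G x)) \<longlonglongrightarrow> 0"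
proof -
  from assms obtain v where v: "\<And>k::nat. Ck (Suc 0) (v k)"
    "(\<lambda>k. L2_norm (lebesgue_on U) (\<lambda>x. v k x - u x)) \<longlonglongrightarrow> 0"
    "(\<lambda>k. L2_norm (lebesgue_on U) (\<lambda>x. grad (v k) x - G x)) \<longlonglongrightarrow> 0"
    unfolding strong_gradient_def by blast
  show ?thesis
    by (rule that[OF v(1) square_integrable_C1(1)[OF v(1)] square_integrable_C1(2)[OF v(1)] v(2,3)])
qed

lemma strong_gradient_C1:
  assumes "Ck (Suc 0) v"
  shows "strong_gradient v (grad v) U"
  unfolding strong_gradient_def
proof (intro conjI exI[of _ "\<lambda>_. v"] allI)
  show "Ck (Suc 0) v" by (rule assms)
qed (rule square_integrable_C1[OF assms] | simp add: L2_norm_def)+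

lemma strong_gradient_linear:
  fixes u :: "real^'n \<Rightarrow> 'b::euclidean_space" and L :: "'b \<Rightarrow> 'c::euclidean_space"
  assumes L: "bounded_linear L" and u: "strong_gradient u G U"
  shows "strong_gradient (\<lambda>x. L (u x)) (\<lambda>x. \<chi> i. L (G x $ i)) U"
proof -
  note sq = strong_gradient_square_integrable[OF u]
  let ?L = "\<lambda>w::'b^'n. \<chi> i. L (w $ i)"
  have L': "bounded_linear ?L"
  proof (rule linear_conv_bounded_linear[THEN iffD1], rule linearI)
    show "?L (a + b) = ?L a + ?L b" for a b
      using L by (simp add: vec_eq_iff linear_add bounded_linear.linear)
    show "?L (c *\<^sub>R a) = c *\<^sub>R ?L a" for c a
      using L by (simp add: vec_eq_iff linear_scale bounded_linear.linear)
  qed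
  obtain v where v: "\<And>k. Ck (Suc 0) (v k)"
    "\<And>k. square_integrable (lebesgue_on U) (v k)" "\<And>k. square_integrable (lebesgue_on U) (grad (v k))"
    "(\<lambda>k. L2_norm (lebesgue_on U) (\<lambda>x. v k x - u x)) \<longlonglongrightarrow> 0"
    "(\<lambda>k. L2_norm (lebesgue_on U) (\<lambda>x. grad (v k) x - G x)) \<longlonglongrightarrow> 0"
    using strong_gradientE[OF u] by blast
  have "L2_norm (lebesgue_on U) (\<lambda>x. L (v k x) - L (u x)) \<le> onorm L * L2_norm (lebesgue_on U) (\<lambda>x. v k x - u x)" for k
    using L2_norm_linear[OF L square_integrable_diff[OF v(2)[of k] sq(1)]]
    by (simp add: linear_diff[OF bounded_linear.linear[OF L]])
  then have 1: "(\<lambda>k. L2_norm (lebesgue_on U) (\<lambda>x. L (v k x) - L (u x))) \<longlonglongrightarrow> 0"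
    by (intro Lim_null_comparison[OF _ tendsto_mult_right_zero[OF v(4), of "onorm L"]]) auto
  have "L2_norm (lebesgue_on U) (\<lambda>x. ?L (grad (v k) x) - ?L (G x)) \<le> onorm ?L * L2_norm (lebesgue_on U) (\<lambda>x. grad (v k) x - G x)" for k
    using L2_norm_linear[OF L' square_integrable_diff[OF v(3)[of k] sq(2)]]
    by (simp only: linear_diff[OF bounded_linear.linear[OF L']])
  then have 2: "(\<lambda>k. L2_norm (lebesgue_on U) (\<lambda>x. ?L (grad (v k) x) - ?L (G x))) \<longlonglongrightarrow> 0"
    by (intro Lim_null_comparison[OF _ tendsto_mult_right_zero[OF v(5), of "onorm ?L"]]) auto
  show ?thesis
    unfolding strong_gradient_def
  proof (intro conjI exI[of _ "\<lambda>k x. L (v k x)"] allI)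
    show "square_integrable (lebesgue_on U) (\<lambda>x. L (u x))" by (rule square_integrable_linear[OF L sq(1)])
    show "square_integrable (lebesgue_on U) (\<lambda>x. ?L (G x))" by (rule square_integrable_linear[OF L' sq(2)])
    show "Ck (Suc 0) (\<lambda>x. L (v k x))" for k by (rule Ck_linear[OF L v(1)])
    show "(\<lambda>k. L2_norm (lebesgue_on U) (\<lambda>x. grad (\<lambda>x. L (v k x)) x - ?L (G x))) \<longlonglongrightarrow> 0"
      using 2 by (simp only: grad_linear[OF L v(1)])
  qed (rule 1)
qed

lemma strong_gradient_add:
  assumes u: "strong_gradient u G U" and w: "strong_gradient w H U"
  shows "strong_gradient (\<lambda>x. u x + w x) (\<lambda>x. G x + H x) U"
proof -
  note sq = strong_gradient_square_integrable[OF u] strong_gradient_square_integrable[OF w]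
  obtain v where v: "\<And>k. Ck (Suc 0) (v k)"
    "\<And>k. square_integrable (lebesgue_on U) (v k)" "\<And>k. square_integrable (lebesgue_on U) (grad (v k))"
    "(\<lambda>k. L2_norm (lebesgue_on U) (\<lambda>x. v k x - u x)) \<longlonglongrightarrow> 0"
    "(\<lambda>k. L2_norm (lebesgue_on U) (\<lambda>x. grad (v k) x - G x)) \<longlonglongrightarrow> 0"
    using strong_gradientE[OF u] by blast
  obtain z where z: "\<And>k. Ck (Suc 0) (z k)"
    "\<And>k. square_integrable (lebesgue_on U) (z k)" "\<And>k. square_integrable (lebesgue_on U) (grad (z k))"
    "(\<lambda>k. L2_norm (lebesgue_on U) (\<lambda>x. z k x - w x)) \<longlonglongrightarrow> 0"
    "(\<lambda>k. L2_norm (lebesgue_on U) (\<lambda>x. grad (z k) x - H x)) \<longlonglongrightarrow> 0"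
    using strong_gradientE[OF w] by blast
  have eq: "a + b - (c + d) = (a - c) + (b - d)" for a b c d :: "'c::real_vector" by simp
  have 1: "(\<lambda>k. L2_norm (lebesgue_on U) (\<lambda>x. v k x + z k x - (u x + w x))) \<longlonglongrightarrow> 0"
    unfolding eq
    by (rule Lim_null_comparison[OF always_eventually tendsto_add_zero[OF v(4) z(4)]])
      (simp add: L2_norm_triangle square_integrable_diff v z sq)
  have 2: "(\<lambda>k. L2_norm (lebesgue_on U) (\<lambda>x. grad (v k) x + grad (z k) x - (G x + H x))) \<longlonglongrightarrow> 0"
    unfolding eq
    by (rule Lim_null_comparison[OF always_eventually tendsto_add_zero[OF v(5) z(5)]])
      (simp add: L2_norm_triangle square_integrable_diff v z sq)
  show ?thesis
    unfolding strong_gradient_def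
  proof (intro conjI exI[of _ "\<lambda>k x. v k x + z k x"] allI)
    show "square_integrable (lebesgue_on U) (\<lambda>x. u x + w x)" by (rule square_integrable_add[OF sq(1,3)])
    show "square_integrable (lebesgue_on U) (\<lambda>x. G x + H x)" by (rule square_integrable_add[OF sq(2,4)])
    show "Ck (Suc 0) (\<lambda>x. v k x + z k x)" for k by (rule Ck_add[OF v(1) z(1)])
    show "(\<lambda>k. L2_norm (lebesgue_on U) (\<lambda>x. grad (\<lambda>x. v k x + z k x) x - (G x + H x))) \<longlonglongrightarrow> 0"
      using 2 by (simp only: grad_add[OF v(1) z(1)])
  qed (rule 1)
qed

lemma strong_gradient_scaleR:
  assumes "strong_gradient u G U"
  shows "strong_gradient (\<lambda>x. c *\<^sub>R u x) (\<lambda>x. c *\<^sub>R G x) U"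
proof -
  have "(\<chi> i. c *\<^sub>R G x $ i) = c *\<^sub>R G x" for x by (simp add: vec_eq_iff)
  then show ?thesis
    using strong_gradient_linear[OF bounded_linear_scaleR_right assms, of c] by simp
qed

lemma strong_gradient_diff:
  assumes "strong_gradient u G U" "strong_gradient w H U"
  shows "strong_gradient (\<lambda>x. u x - w x) (\<lambda>x. G x - H x) U"
  using strong_gradient_add[OF assms(1) strong_gradient_scaleR[OF assms(2), of "-1"]] by simp

lemma strong_gradient_mult:
  fixes u :: "real^'n \<Rightarrow> 'b::euclidean_space"
  assumes g: "Ck (Suc 0) (g :: real^'n \<Rightarrow> real)" and u: "strong_gradient u G U"
  shows "strong_gradient (\<lambda>x. g x *\<^sub>R u x) (\<lambda>x. \<chi> i. g x *\<^sub>R G x $ i + grad g x $ i *\<^sub>R u x) U"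
proof -
  note sq = strong_gradient_square_integrable[OF u]
  obtain v where v: "\<And>k. Ck (Suc 0) (v k)"
    "\<And>k. square_integrable (lebesgue_on U) (v k)" "\<And>k. square_integrable (lebesgue_on U) (grad (v k))"
    "(\<lambda>k. L2_norm (lebesgue_on U) (\<lambda>x. v k x - u x)) \<longlonglongrightarrow> 0"
    "(\<lambda>k. L2_norm (lebesgue_on U) (\<lambda>x. grad (v k) x - G x)) \<longlonglongrightarrow> 0"
    using strong_gradientE[OF u] by blast
  have cg: "continuous_on UNIV g" by (rule Ck_imp_continuous_on[OF g])
  have cgg: "continuous_on UNIV (grad g)" by (rule continuous_on_grad[OF g])
  obtain B where B: "\<And>x. x \<in> U \<Longrightarrow> norm (g x) \<le> B" using continuous_bounded_on[OF U(2) cg] by blast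
  obtain B' where B': "\<And>x. x \<in> U \<Longrightarrow> norm (grad g x) \<le> B'" using continuous_bounded_on[OF U(2) cgg] by blast
  \<comment> \<open>The tensor product of the gradient of \<open>g\<close> with \<open>w\<close>.
    Separating it from the term with \<open>g\<close> reduces everything to two bounded
    multiplications.\<close>
  let ?T = "\<lambda>x (w :: 'b). (\<chi> i. grad g x $ i *\<^sub>R w) :: 'b^'n"
  have Tn: "norm (?T x w) \<le> norm (grad g x) * norm w" for x w
  proof -
    have "norm (?T x w) = L2_set (\<lambda>i. norm (grad g x $ i) * norm w) UNIV" by (simp add: norm_vec_def)
    also have "\<dots> = norm (grad g x) * norm w" by (simp add: norm_vec_def L2_set_left_distrib)
    finally show ?thesis by simp
  qed
  have Tdiff: "?T x a - ?T x b = ?T x (a - b)" for x a b by (simp add: vec_eq_iff scaleR_diff_right)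
  have T: "square_integrable (lebesgue_on U) (\<lambda>x. ?T x (w x))"
    "L2_norm (lebesgue_on U) (\<lambda>x. ?T x (w x)) \<le> \<bar>B'\<bar> * L2_norm (lebesgue_on U) w"
    if w: "square_integrable (lebesgue_on U) w" for w
  proof -
    have cT: "continuous_on UNIV (\<lambda>p. (\<chi> i. fst p $ i *\<^sub>R snd p) :: 'b^'n)"
      by (intro continuous_intros)
    have "(\<lambda>x. (grad g x, w x)) \<in> borel_measurable (lebesgue_on U)"
      by (rule borel_measurable_Pair[OF continuous_measurable_lebesgue_on[OF cgg] square_integrable_measurable[OF w]])
    from borel_measurable_continuous_on[OF cT this]
    have m: "(\<lambda>x. ?T x (w x)) \<in> borel_measurable (lebesgue_on U)" by simp
    have b: "AE x in lebesgue_on U. norm (?T x (w x)) \<le> \<bar>B'\<bar> * norm (w x)"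
    proof (rule AE_I2)
      fix x assume "x \<in> space (lebesgue_on U)"
      then have "norm (grad g x) \<le> \<bar>B'\<bar>" using B'[of x] by simp
      then show "norm (?T x (w x)) \<le> \<bar>B'\<bar> * norm (w x)"
        using Tn[of x "w x"] mult_right_mono[OF _ norm_ge_zero] order_trans by blast
    qed
    show "square_integrable (lebesgue_on U) (\<lambda>x. ?T x (w x))" by (rule square_integrable_bound(1)[OF w m b])
    show "L2_norm (lebesgue_on U) (\<lambda>x. ?T x (w x)) \<le> \<bar>B'\<bar> * L2_norm (lebesgue_on U) w"
      by (rule L2_norm_bound[OF w m b]) simp
  qed
  have B_abs: "\<forall>x\<in>U. \<bar>g x\<bar> \<le> B" using B by simp
  note gb = bounded_continuous_scaleR_L2[OF cg B_abs]
  have split: "(\<chi> i. g x *\<^sub>R W $ i + grad g x $ i *\<^sub>R w) = g x *\<^sub>R W + ?T x w" for x w and W :: "'b^'n"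
    by (simp add: vec_eq_iff)
  have 1: "(\<lambda>k. L2_norm (lebesgue_on U) (\<lambda>x. g x *\<^sub>R v k x - g x *\<^sub>R u x)) \<longlonglongrightarrow> 0"
    unfolding scaleR_diff_right[symmetric]
    by (rule Lim_null_comparison[OF always_eventually tendsto_mult_right_zero[OF v(4), of "\<bar>B\<bar>"]])
      (simp add: gb square_integrable_diff v sq)
  have 2: "(\<lambda>k. L2_norm (lebesgue_on U) (\<lambda>x. (g x *\<^sub>R grad (v k) x + ?T x (v k x)) - (g x *\<^sub>R G x + ?T x (u x)))) \<longlonglongrightarrow> 0"
  proof (rule Lim_null_comparison[OF always_eventually])
    show "(\<lambda>k. \<bar>B\<bar> * L2_norm (lebesgue_on U) (\<lambda>x. grad (v k) x - G x) + \<bar>B'\<bar> * L2_norm (lebesgue_on U) (\<lambda>x. v k x - u x)) \<longlonglongrightarrow> 0"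
      by (intro tendsto_add_zero tendsto_mult_right_zero v)
    show "\<forall>k. norm (L2_norm (lebesgue_on U) (\<lambda>x. (g x *\<^sub>R grad (v k) x + ?T x (v k x)) - (g x *\<^sub>R G x + ?T x (u x))))
        \<le> \<bar>B\<bar> * L2_norm (lebesgue_on U) (\<lambda>x. grad (v k) x - G x) + \<bar>B'\<bar> * L2_norm (lebesgue_on U) (\<lambda>x. v k x - u x)"
    proof
      fix k
      let ?a = "\<lambda>x. grad (v k) x - G x" and ?b = "\<lambda>x. v k x - u x"
      have a: "square_integrable (lebesgue_on U) ?a" and b: "square_integrable (lebesgue_on U) ?b"
        by (intro square_integrable_diff v sq)+
      have "(g x *\<^sub>R grad (v k) x + ?T x (v k x)) - (g x *\<^sub>R G x + ?T x (u x)) = g x *\<^sub>R ?a x + ?T x (?b x)" for x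
        by (simp add: vec_eq_iff algebra_simps)
      then show "norm (L2_norm (lebesgue_on U) (\<lambda>x. (g x *\<^sub>R grad (v k) x + ?T x (v k x)) - (g x *\<^sub>R G x + ?T x (u x))))
        \<le> \<bar>B\<bar> * L2_norm (lebesgue_on U) ?a + \<bar>B'\<bar> * L2_norm (lebesgue_on U) ?b"
        using L2_norm_triangle[OF gb(1)[OF a] T(1)[OF b]] gb(2)[OF a] T(2)[OF b] by simp
    qed
  qed
  show ?thesis
    unfolding strong_gradient_def
  proof (intro conjI exI[of _ "\<lambda>k x. g x *\<^sub>R v k x"] allI)
    show "square_integrable (lebesgue_on U) (\<lambda>x. g x *\<^sub>R u x)" by (rule gb(1)[OF sq(1)])
    show "square_integrable (lebesgue_on U) (\<lambda>x. \<chi> i. g x *\<^sub>R G x $ i + grad g x $ i *\<^sub>R u x)"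
      unfolding split by (intro square_integrable_add gb(1) T(1) sq)
    show "Ck (Suc 0) (\<lambda>x. g x *\<^sub>R v k x)" for k by (rule Ck_scaleR[OF g v(1)])
    show "(\<lambda>k. L2_norm (lebesgue_on U) (\<lambda>x. grad (\<lambda>x. g x *\<^sub>R v k x) x - (\<chi> i. g x *\<^sub>R G x $ i + grad g x $ i *\<^sub>R u x))) \<longlonglongrightarrow> 0"
      using 2 by (simp only: grad_bilinear[OF bounded_bilinear_scaleR g v(1)] split)
  qed (rule 1)
qed

lemma strong_gradient_approx:
  assumes "strong_gradient u G U" "e > 0"
  shows "\<exists>v. Ck (Suc 0) v \<and> L2_norm (lebesgue_on U) (\<lambda>x. v x - u x) < e
     \<and> L2_norm (lebesgue_on U) (\<lambda>x. grad v x - G x) < e"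
proof -
  obtain v where v: "\<And>k. Ck (Suc 0) (v k)"
    "\<And>k. square_integrable (lebesgue_on U) (v k)" "\<And>k. square_integrable (lebesgue_on U) (grad (v k))"
    "(\<lambda>k. L2_norm (lebesgue_on U) (\<lambda>x. v k x - u x)) \<longlonglongrightarrow> 0"
    "(\<lambda>k. L2_norm (lebesgue_on U) (\<lambda>x. grad (v k) x - G x)) \<longlonglongrightarrow> 0"
    using strong_gradientE[OF assms(1)] by blast
  from eventually_conj[OF order_tendstoD(2)[OF v(4) assms(2)] order_tendstoD(2)[OF v(5) assms(2)]]
  obtain k where "L2_norm (lebesgue_on U) (\<lambda>x. v k x - u x) < e"
    "L2_norm (lebesgue_on U) (\<lambda>x. grad (v k) x - G x) < e"
    by (auto simp: eventually_sequentially)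
  with v(1) show ?thesis by blast
qed

text \<open>A diagonal argument: the n-th field is replaced by one C1 function at distance less than
  1/(n+1) in both norms.\<close>

lemma strong_gradient_closed:
  assumes u: "\<And>n. strong_gradient (u n) (G n) U"
    and sq: "square_integrable (lebesgue_on U) u0" "square_integrable (lebesgue_on U) G0"
    and ul: "(\<lambda>n. L2_norm (lebesgue_on U) (\<lambda>x. u n x - u0 x)) \<longlonglongrightarrow> 0"
    and Gl: "(\<lambda>n. L2_norm (lebesgue_on U) (\<lambda>x. G n x - G0 x)) \<longlonglongrightarrow> 0"
  shows "strong_gradient u0 G0 U"
proof -
  note sqn = strong_gradient_square_integrable[OF u]
  have "\<exists>v. Ck (Suc 0) v \<and> L2_norm (lebesgue_on U) (\<lambda>x. v x - u n x) < 1 / real (Suc n)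
     \<and> L2_norm (lebesgue_on U) (\<lambda>x. grad v x - G n x) < 1 / real (Suc n)" for n
    by (rule strong_gradient_approx[OF u]) simp
  then have "\<exists>v. \<forall>n. Ck (Suc 0) (v n) \<and> L2_norm (lebesgue_on U) (\<lambda>x. v n x - u n x) < 1 / real (Suc n)
     \<and> L2_norm (lebesgue_on U) (\<lambda>x. grad (v n) x - G n x) < 1 / real (Suc n)"
    by (intro choice allI)
  then obtain v where v: "\<And>n. Ck (Suc 0) (v n)"
    "\<And>n. L2_norm (lebesgue_on U) (\<lambda>x. v n x - u n x) < 1 / real (Suc n)"
    "\<And>n. L2_norm (lebesgue_on U) (\<lambda>x. grad (v n) x - G n x) < 1 / real (Suc n)"
    by blast
  have l: "(\<lambda>n. 1 / real (Suc n)) \<longlonglongrightarrow> 0" by (rule LIMSEQ_Suc[OF lim_1_over_n])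
  have b1: "L2_norm (lebesgue_on U) (\<lambda>x. v n x - u0 x) \<le> 1 / real (Suc n) + L2_norm (lebesgue_on U) (\<lambda>x. u n x - u0 x)" for n
    using L2_norm_triangle_diff[OF square_integrable_C1(1)[OF v(1)[of n]] sqn(1)[of n] sq(1)] v(2)[of n] by simp
  have b2: "L2_norm (lebesgue_on U) (\<lambda>x. grad (v n) x - G0 x) \<le> 1 / real (Suc n) + L2_norm (lebesgue_on U) (\<lambda>x. G n x - G0 x)" for n
    using L2_norm_triangle_diff[OF square_integrable_C1(2)[OF v(1)[of n]] sqn(2)[of n] sq(2)] v(3)[of n] by simp
  have 1: "(\<lambda>n. L2_norm (lebesgue_on U) (\<lambda>x. v n x - u0 x)) \<longlonglongrightarrow> 0"
    by (rule Lim_null_comparison[OF always_eventually tendsto_add_zero[OF l ul]]) (use b1 in simp)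
  have 2: "(\<lambda>n. L2_norm (lebesgue_on U) (\<lambda>x. grad (v n) x - G0 x)) \<longlonglongrightarrow> 0"
    by (rule Lim_null_comparison[OF always_eventually tendsto_add_zero[OF l Gl]]) (use b2 in simp)
  show ?thesis unfolding strong_gradient_def using sq v(1) 1 2 by blast
qed

text \<open>The conclusion is a weak gradient only, since a product of two square integrable fields
  is merely integrable. Integration by parts holds for the C1 approximants, and every integral in it
  is a bilinear expression in L2-convergent sequences.\<close>

lemma strong_gradient_bilinear:
  fixes u :: "real^'n \<Rightarrow> 'b::euclidean_space" and w :: "real^'n \<Rightarrow> 'c::euclidean_space"
    and h :: "'b \<Rightarrow> 'c \<Rightarrow> 'd::euclidean_space"
  assumes h: "bounded_bilinear h" and u: "strong_gradient u G U" and w: "strong_gradient w H U"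
  shows "has_weak_gradient (\<lambda>x. h (u x) (w x)) (\<lambda>x. \<chi> i. h (u x) (H x $ i) + h (G x $ i) (w x)) U"
proof -
  let ?M = "lebesgue_on U"
  note sq = strong_gradient_square_integrable[OF u] strong_gradient_square_integrable[OF w]
  note comp = square_integrable_component and compl = L2_tendsto_component
  have int: "integrable ?M (\<lambda>x. h (u x) (w x))" by (rule integrable_bilinear_L2[OF h sq(1,3)])
  have inti: "integrable ?M (\<lambda>x. h (u x) (H x $ i) + h (G x $ i) (w x))" for i
    by (intro Bochner_Integration.integrable_add integrable_bilinear_L2[OF h] sq comp)
  have intG: "integrable ?M (\<lambda>x. \<chi> i. h (u x) (H x $ i) + h (G x $ i) (w x))"
  proof -
    have eq: "(\<chi> i. F i) = (\<Sum>i\<in>UNIV. axis i (F i))" for F :: "'n \<Rightarrow> 'd"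
      by (simp add: vec_eq_iff axis_def if_distrib cong: if_cong)
    have bl: "bounded_linear (axis i :: 'd \<Rightarrow> 'd^'n)" for i
      by (rule linear_conv_bounded_linear[THEN iffD1], rule linearI) (auto simp: vec_eq_iff axis_def)
    show ?thesis
      unfolding eq by (rule Bochner_Integration.integrable_sum) (rule integrable_bounded_linear[OF bl inti])
  qed
  obtain v where v: "\<And>k. Ck (Suc 0) (v k)"
    "\<And>k. square_integrable ?M (v k)" "\<And>k. square_integrable ?M (grad (v k))"
    "(\<lambda>k. L2_norm ?M (\<lambda>x. v k x - u x)) \<longlonglongrightarrow> 0"
    "(\<lambda>k. L2_norm ?M (\<lambda>x. grad (v k) x - G x)) \<longlonglongrightarrow> 0"
    using strong_gradientE[OF u] by blast
  obtain z where z: "\<And>k. Ck (Suc 0) (z k)"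
    "\<And>k. square_integrable ?M (z k)" "\<And>k. square_integrable ?M (grad (z k))"
    "(\<lambda>k. L2_norm ?M (\<lambda>x. z k x - w x)) \<longlonglongrightarrow> 0"
    "(\<lambda>k. L2_norm ?M (\<lambda>x. grad (z k) x - H x)) \<longlonglongrightarrow> 0"
    using strong_gradientE[OF w] by blast
  have parts: "(\<integral>x. partial_deriv i \<phi> x *\<^sub>R h (u x) (w x) \<partial>?M)
      = - (\<integral>x. \<phi> x *\<^sub>R (h (u x) (H x $ i) + h (G x $ i) (w x)) \<partial>?M)" if \<phi>: "test_function U \<phi>" for \<phi> i
  proof -
    have c: "continuous_on UNIV \<phi>" "continuous_on UNIV (partial_deriv i \<phi>)"
      using Ck_imp_continuous_on[OF test_function_Ck[OF \<phi>, of 0]]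
        Ck_imp_continuous_on[OF Ck_grad_component[OF test_function_Ck[OF \<phi>, of "Suc 0"]]]
      by (auto simp: partial_deriv_eq_grad[abs_def])
    have mul: "square_integrable ?M (\<lambda>x. \<psi> x *\<^sub>R f x)" if "continuous_on UNIV \<psi>" "square_integrable ?M f"
      for \<psi> :: "real^'n \<Rightarrow> real" and f :: "real^'n \<Rightarrow> 'b"
      using continuous_bounded_on[OF U(2) that(1)] bounded_continuous_scaleR_L2(1)[OF that(1) _ that(2)]
      by (metis real_norm_def)
    have mull: "(\<lambda>k. L2_norm ?M (\<lambda>x. \<psi> x *\<^sub>R f k x - \<psi> x *\<^sub>R f0 x)) \<longlonglongrightarrow> 0"
      if \<psi>: "continuous_on UNIV \<psi>" and f: "\<And>k. square_integrable ?M (f k)" "square_integrable ?M f0"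
        "(\<lambda>k. L2_norm ?M (\<lambda>x. f k x - f0 x)) \<longlonglongrightarrow> 0"
      for \<psi> :: "real^'n \<Rightarrow> real" and f :: "nat \<Rightarrow> real^'n \<Rightarrow> 'b" and f0
    proof -
      obtain B where B: "\<And>x. x \<in> U \<Longrightarrow> norm (\<psi> x) \<le> B" using continuous_bounded_on[OF U(2) \<psi>] by blast
      show ?thesis
        unfolding scaleR_diff_right[symmetric]
        by (rule Lim_null_comparison[OF always_eventually tendsto_mult_right_zero[OF f(3), of "\<bar>B\<bar>"]])
          (use bounded_continuous_scaleR_L2(2)[OF \<psi> _ square_integrable_diff[OF f(1,2)], of B] B in auto)
    qed
    \<comment> \<open>The bounded factor coming from the test function is absorbed into the first
      argument, so that the limits are again of the form \<open>L2_bilinear_tendsto\<close>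
      handles.\<close>
    have hs: "r *\<^sub>R h a b = h (r *\<^sub>R a) b" for r a b by (simp add: bounded_bilinear.scaleR_left[OF h])
    have "(\<lambda>k. \<integral>x. h (partial_deriv i \<phi> x *\<^sub>R v k x) (z k x) \<partial>?M) \<longlonglongrightarrow> (\<integral>x. h (partial_deriv i \<phi> x *\<^sub>R u x) (w x) \<partial>?M)"
      by (rule L2_bilinear_tendsto[OF h]) (intro mul mull c v z sq)+
    moreover have "(\<lambda>k. - ((\<integral>x. h (\<phi> x *\<^sub>R v k x) (grad (z k) x $ i) \<partial>?M) + (\<integral>x. h (\<phi> x *\<^sub>R grad (v k) x $ i) (z k x) \<partial>?M)))
        \<longlonglongrightarrow> - ((\<integral>x. h (\<phi> x *\<^sub>R u x) (H x $ i) \<partial>?M) + (\<integral>x. h (\<phi> x *\<^sub>R G x $ i) (w x) \<partial>?M))"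
      by (intro tendsto_minus tendsto_add L2_bilinear_tendsto[OF h] mul mull c v z sq comp compl)
    moreover have "(\<integral>x. h (partial_deriv i \<phi> x *\<^sub>R v k x) (z k x) \<partial>?M)
      = - ((\<integral>x. h (\<phi> x *\<^sub>R v k x) (grad (z k) x $ i) \<partial>?M) + (\<integral>x. h (\<phi> x *\<^sub>R grad (v k) x $ i) (z k x) \<partial>?M))" for k
    proof -
      have "(\<integral>x. partial_deriv i \<phi> x *\<^sub>R h (v k x) (z k x) \<partial>?M) = - (\<integral>x. \<phi> x *\<^sub>R (grad (\<lambda>x. h (v k x) (z k x)) x $ i) \<partial>?M)"
        by (rule integration_by_parts_C1[OF U(1) \<phi> Ck_bilinear[OF h v(1) z(1)]])
      also have "(\<lambda>x. \<phi> x *\<^sub>R (grad (\<lambda>x. h (v k x) (z k x)) x $ i))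
          = (\<lambda>x. h (\<phi> x *\<^sub>R v k x) (grad (z k) x $ i) + h (\<phi> x *\<^sub>R grad (v k) x $ i) (z k x))"
        unfolding grad_bilinear[OF h v(1) z(1)] by (simp add: scaleR_add_right hs)
      also have "(\<integral>x. h (\<phi> x *\<^sub>R v k x) (grad (z k) x $ i) + h (\<phi> x *\<^sub>R grad (v k) x $ i) (z k x) \<partial>?M)
         = (\<integral>x. h (\<phi> x *\<^sub>R v k x) (grad (z k) x $ i) \<partial>?M) + (\<integral>x. h (\<phi> x *\<^sub>R grad (v k) x $ i) (z k x) \<partial>?M)"
        by (intro Bochner_Integration.integral_add integrable_bilinear_L2[OF h] mul comp c v z)
      finally show ?thesis by (simp only: hs)
    qed
    ultimately have "(\<integral>x. h (partial_deriv i \<phi> x *\<^sub>R u x) (w x) \<partial>?M)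
       = - ((\<integral>x. h (\<phi> x *\<^sub>R u x) (H x $ i) \<partial>?M) + (\<integral>x. h (\<phi> x *\<^sub>R G x $ i) (w x) \<partial>?M))"
      using LIMSEQ_unique by simp
    also have "(\<integral>x. h (\<phi> x *\<^sub>R u x) (H x $ i) \<partial>?M) + (\<integral>x. h (\<phi> x *\<^sub>R G x $ i) (w x) \<partial>?M)
        = (\<integral>x. h (\<phi> x *\<^sub>R u x) (H x $ i) + h (\<phi> x *\<^sub>R G x $ i) (w x) \<partial>?M)"
      by (intro Bochner_Integration.integral_add[symmetric] integrable_bilinear_L2[OF h] mul comp c sq)
    finally show ?thesis by (simp only: hs scaleR_add_right)
  qed
  show ?thesis
    unfolding has_weak_gradient_def
    using locally_integrable_on_integrable[OF U(1) int] locally_integrable_on_integrable[OF U(1) intG] parts by simp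
qed

text \<open>The bilinear product rule with the constant 1 as first factor, whose gradient
  vanishes.\<close>

lemma strong_gradient_weak:
  fixes u :: "real^'n \<Rightarrow> 'b::euclidean_space"
  assumes "strong_gradient u G U"
  shows "has_weak_gradient u G U"
proof -
  have "Ck (Suc 0) (\<lambda>x::real^'n. 1::real)" by (rule Ck_const)
  from strong_gradient_bilinear[OF bounded_bilinear_scaleR strong_gradient_C1[OF this] assms]
  show ?thesis by (simp add: grad_const)
qed

end

section \<open>Uniqueness of weak gradients and the passage to the notions of the statement\<close>

lemma weak_gradient_unique:
  fixes u :: "real^'n \<Rightarrow> 'b::euclidean_space"
  assumes U: "open U" and G: "has_weak_gradient u G U" and H: "has_weak_gradient u H U"
  shows "AE x in lebesgue_on U. G x = H x"
proof -
  have comp: "locally_integrable_on (\<lambda>x. F x $ i) U" if "locally_integrable_on F U"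
    for F :: "real^'n \<Rightarrow> 'b^'n" and i
    unfolding locally_integrable_on_def set_integrable_def
  proof (intro allI impI)
    fix K assume "compact K \<and> K \<subseteq> U"
    then have "integrable lebesgue (\<lambda>x. indicator K x *\<^sub>R F x)"
      using that by (simp add: locally_integrable_on_def set_integrable_def)
    from integrable_bounded_linear[OF bounded_linear_vec_nth this, of i]
    show "integrable lebesgue (\<lambda>x. indicator K x *\<^sub>R F x $ i)" by simp
  qed
  have li: "locally_integrable_on (\<lambda>x. G x $ i) U" "locally_integrable_on (\<lambda>x. H x $ i) U" for i
    using G H unfolding has_weak_gradient_def by (blast intro: comp)+
  \<comment> \<open>Both fields give the same integral against every test function, so each
    component of the difference falls under the fundamental lemma.\<close>
  have "AE x in lebesgue_on U. G x $ i - H x $ i = 0" for i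
  proof (rule fundamental_lemma[OF U])
    show "locally_integrable_on (\<lambda>x. G x $ i - H x $ i) U"
      using li unfolding locally_integrable_on_def by (auto intro: set_integral_diff)
    fix \<phi> :: "real^'n \<Rightarrow> real" assume \<phi>: "test_function U \<phi>"
    have int: "integrable (lebesgue_on U) (\<lambda>x. \<phi> x *\<^sub>R f x)" if "locally_integrable_on f U" for f :: "real^'n \<Rightarrow> 'b"
    proof -
      \<comment> \<open>Integrability is known on compact subsets only. Cutting to the closed
        support of the test function changes nothing and makes the product integrable over all of
        \<open>U\<close>.\<close>
      let ?K = "closure {x. \<phi> x \<noteq> 0}"
      have K: "compact ?K" "?K \<subseteq> U" using \<phi> by (auto simp: test_function_def)
      have i: "integrable lebesgue (\<lambda>x. indicator ?K x *\<^sub>R f x)"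
        using that K by (simp add: locally_integrable_on_def set_integrable_def)
      have c: "continuous_on UNIV \<phi>" using Ck_imp_continuous_on[OF test_function_Ck[OF \<phi>, of 0]] .
      obtain B where B: "\<And>x. x \<in> ?K \<Longrightarrow> norm (\<phi> x) \<le> B"
        using continuous_bounded_on[OF compact_imp_bounded[OF K(1)] c] by blast
      have "integrable lebesgue (\<lambda>x. \<phi> x *\<^sub>R indicator ?K x *\<^sub>R f x)"
      proof (rule Bochner_Integration.integrable_bound)
        show "integrable lebesgue (\<lambda>x. B * norm (indicator ?K x *\<^sub>R f x))"
          using integrable_norm[OF i] by (rule integrable_mult_right)
        show "(\<lambda>x. \<phi> x *\<^sub>R indicator ?K x *\<^sub>R f x) \<in> borel_measurable lebesgue"
          using continuous_measurable_lebesgue_on[OF c, of UNIV] borel_measurable_integrable[OF i]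
          unfolding lebesgue_on_UNIV_eq by (rule borel_measurable_scaleR)
        show "AE x in lebesgue. norm (\<phi> x *\<^sub>R indicator ?K x *\<^sub>R f x) \<le> norm (B * norm (indicator ?K x *\<^sub>R f x))"
        proof (rule AE_I2)
          fix x show "norm (\<phi> x *\<^sub>R indicator ?K x *\<^sub>R f x) \<le> norm (B * norm (indicator ?K x *\<^sub>R f x))"
          proof (cases "x \<in> ?K")
            case True
            have "\<bar>\<phi> x\<bar> \<le> \<bar>B\<bar>" using B[OF True] by simp
            with True show ?thesis by (simp add: abs_mult mult_right_mono)
          qed simp
        qed
      qed
      also have "(\<lambda>x. \<phi> x *\<^sub>R indicator ?K x *\<^sub>R f x) = (\<lambda>x. indicator U x *\<^sub>R \<phi> x *\<^sub>R f x)"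
      proof
        fix x show "\<phi> x *\<^sub>R indicator ?K x *\<^sub>R f x = indicator U x *\<^sub>R \<phi> x *\<^sub>R f x"
        proof (cases "\<phi> x = 0")
          case False
          then have "x \<in> ?K" using closure_subset[of "{x. \<phi> x \<noteq> 0}"] by auto
          with K(2) show ?thesis by auto
        qed simp
      qed
      finally show ?thesis by (subst integrable_restrict_space) (use U in auto)
    qed
    have "(\<integral>x. \<phi> x *\<^sub>R (G x $ i - H x $ i) \<partial>lebesgue_on U)
        = (\<integral>x. \<phi> x *\<^sub>R G x $ i \<partial>lebesgue_on U) - (\<integral>x. \<phi> x *\<^sub>R H x $ i \<partial>lebesgue_on U)"
      unfolding scaleR_diff_right by (intro Bochner_Integration.integral_diff int li)
    also have "\<dots> = 0"
    proof -
      have "(\<integral>x. partial_deriv i \<phi> x *\<^sub>R u x \<partial>lebesgue_on U) = - (\<integral>x. \<phi> x *\<^sub>R G x $ i \<partial>lebesgue_on U)"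
        "(\<integral>x. partial_deriv i \<phi> x *\<^sub>R u x \<partial>lebesgue_on U) = - (\<integral>x. \<phi> x *\<^sub>R H x $ i \<partial>lebesgue_on U)"
        using G H \<phi> unfolding has_weak_gradient_def by blast+
      then show ?thesis by simp
    qed
    finally show "(\<integral>x. \<phi> x *\<^sub>R (G x $ i - H x $ i) \<partial>lebesgue_on U) = 0" .
  qed
  then have "AE x in lebesgue_on U. \<forall>i\<in>UNIV. G x $ i - H x $ i = 0"
    by (intro AE_finite_allI) auto
  then show ?thesis by eventually_elim (simp add: vec_eq_iff)
qed

text \<open>\<open>weak_grad\<close> is an arbitrary choice; uniqueness identifies it almost
  everywhere with the given field, so norms of the chosen gradient can be computed from
  \<open>G\<close>.\<close>

lemma strong_gradient_W12:
  fixes u :: "real^'n \<Rightarrow> 'b::euclidean_space"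
  assumes "open U" "bounded U" "strong_gradient u G U"
  shows "u \<in> W12 U" "AE x in lebesgue_on U. weak_grad U u x = G x"
    "has_weak_gradient u (weak_grad U u) U"
    "L2_norm (lebesgue_on U) (weak_grad U u) = L2_norm (lebesgue_on U) G"
proof -
  note w = strong_gradient_weak[OF assms]
  note sq = strong_gradient_square_integrable[OF assms(3)]
  show "u \<in> W12 U" using w sq by (auto simp: W12_def)
  show 1: "has_weak_gradient u (weak_grad U u) U" unfolding weak_grad_def by (rule someI[of "\<lambda>G. has_weak_gradient u G U", OF w])
  show 2: "AE x in lebesgue_on U. weak_grad U u x = G x" by (rule weak_gradient_unique[OF assms(1) 1 w])
  then have "AE x in lebesgue_on U. G x = weak_grad U u x" by eventually_elim simp
  then have "weak_grad U u \<in> borel_measurable (lebesgue_on U)"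
    by (rule borel_measurable_lebesgue_on_AE[OF assms(1) square_integrable_measurable[OF sq(2)]])
  then show "L2_norm (lebesgue_on U) (weak_grad U u) = L2_norm (lebesgue_on U) G"
    by (rule L2_norm_cong_AE[OF _ square_integrable_measurable[OF sq(2)] 2])
qed

section \<open>Averages over affine images\<close>

lemma nn_integral_lborel_affine:
  fixes g :: "'a::euclidean_space \<Rightarrow> ennreal"
  assumes "c \<noteq> 0" "g \<in> borel_measurable borel"
  shows "(\<integral>\<^sup>+x. g x \<partial>lborel) = ennreal (\<bar>c\<bar> ^ DIM('a)) * (\<integral>\<^sup>+x. g (t + c *\<^sub>R x) \<partial>lborel)"
proof -
  have [measurable]: "g \<in> borel_measurable borel" by (rule assms)
  have "(\<integral>\<^sup>+x. g x \<partial>lborel) = (\<integral>\<^sup>+x. g x \<partial>density (distr lborel borel (\<lambda>x. t + c *\<^sub>R x)) (\<lambda>_. ennreal (\<bar>c\<bar> ^ DIM('a))))"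
    using lborel_affine[OF assms(1), of t] by simp
  also have "\<dots> = (\<integral>\<^sup>+x. ennreal (\<bar>c\<bar> ^ DIM('a)) * g x \<partial>distr lborel borel (\<lambda>x. t + c *\<^sub>R x))"
    by (rule nn_integral_density) auto
  also have "\<dots> = (\<integral>\<^sup>+x. ennreal (\<bar>c\<bar> ^ DIM('a)) * g (t + c *\<^sub>R x) \<partial>lborel)"
    by (rule nn_integral_distr) auto
  also have "\<dots> = ennreal (\<bar>c\<bar> ^ DIM('a)) * (\<integral>\<^sup>+x. g (t + c *\<^sub>R x) \<partial>lborel)"
    by (rule nn_integral_cmult) auto
  finally show ?thesis .
qed

lemma integral_lborel_affine:
  fixes f :: "'a::euclidean_space \<Rightarrow> 'b::euclidean_space"
  assumes "c \<noteq> 0" "f \<in> borel_measurable borel"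
  shows "(\<integral>x. f x \<partial>lborel) = \<bar>c\<bar> ^ DIM('a) *\<^sub>R (\<integral>x. f (t + c *\<^sub>R x) \<partial>lborel)"
proof -
  have [measurable]: "f \<in> borel_measurable borel" by (rule assms)
  have "(\<integral>x. f x \<partial>lborel) = (\<integral>x. f x \<partial>density (distr lborel borel (\<lambda>x. t + c *\<^sub>R x)) (\<lambda>_. ennreal (\<bar>c\<bar> ^ DIM('a))))"
    using lborel_affine[OF assms(1), of t] by simp
  also have "\<dots> = (\<integral>x. \<bar>c\<bar> ^ DIM('a) *\<^sub>R f x \<partial>distr lborel borel (\<lambda>x. t + c *\<^sub>R x))"
    by (rule integral_density) auto
  also have "\<dots> = (\<integral>x. \<bar>c\<bar> ^ DIM('a) *\<^sub>R f (t + c *\<^sub>R x) \<partial>lborel)"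
    by (rule integral_distr) auto
  finally show ?thesis by simp
qed

text \<open>Tonelli exchanges the two integrals, and for fixed y the substitution of the affine map
  costs the power of 1/\<alpha>(y), at most that of 1/a. The sets \<open>A\<close> and
  \<open>B\<close> record where the images of points lie. Poincare's inequality, the mollification
  error and the contraction property are all instances.\<close>

lemma nn_integral_affine_average_le:
  fixes g :: "'a::euclidean_space \<Rightarrow> ennreal" and w :: "'y::euclidean_space \<Rightarrow> ennreal"
  assumes [measurable]: "g \<in> borel_measurable borel" "w \<in> borel_measurable borel"
    "\<alpha> \<in> borel_measurable borel" "\<beta> \<in> borel_measurable borel" "A \<in> sets borel" "B \<in> sets borel"
    and a: "a > 0" "\<And>y. w y \<noteq> 0 \<Longrightarrow> \<alpha> y \<ge> a"
    and AB: "\<And>x y. w y \<noteq> 0 \<Longrightarrow> x \<in> A \<Longrightarrow> \<beta> y + \<alpha> y *\<^sub>R x \<in> B"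
  shows "(\<integral>\<^sup>+x. indicator A x * (\<integral>\<^sup>+y. w y * g (\<beta> y + \<alpha> y *\<^sub>R x) \<partial>lborel) \<partial>lborel)
    \<le> ennreal ((1 / a) ^ DIM('a)) * (\<integral>\<^sup>+y. w y \<partial>lborel) * (\<integral>\<^sup>+x. indicator B x * g x \<partial>lborel)"
proof -
  let ?I = "\<integral>\<^sup>+x. indicator B x * g x \<partial>lborel"
  have "(\<integral>\<^sup>+x. indicator A x * (\<integral>\<^sup>+y. w y * g (\<beta> y + \<alpha> y *\<^sub>R x) \<partial>lborel) \<partial>lborel)
      = (\<integral>\<^sup>+x. (\<integral>\<^sup>+y. indicator A x * (w y * g (\<beta> y + \<alpha> y *\<^sub>R x)) \<partial>lborel) \<partial>lborel)"
    by (intro nn_integral_cong nn_integral_cmult[symmetric]) measurable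
  also have "\<dots> = (\<integral>\<^sup>+y. (\<integral>\<^sup>+x. indicator A x * (w y * g (\<beta> y + \<alpha> y *\<^sub>R x)) \<partial>lborel) \<partial>lborel)"
    by (rule lborel_pair.Fubini'[symmetric]) measurable
  also have "\<dots> \<le> (\<integral>\<^sup>+y. w y * (ennreal ((1 / a) ^ DIM('a)) * ?I) \<partial>lborel)"
  proof (rule nn_integral_mono)
    fix y
    show "(\<integral>\<^sup>+x. indicator A x * (w y * g (\<beta> y + \<alpha> y *\<^sub>R x)) \<partial>lborel) \<le> w y * (ennreal ((1 / a) ^ DIM('a)) * ?I)"
    proof (cases "w y = 0")
      case False
      have al: "\<alpha> y \<ge> a" "\<alpha> y > 0" using a False by force+
      have "(\<integral>\<^sup>+x. indicator A x * (w y * g (\<beta> y + \<alpha> y *\<^sub>R x)) \<partial>lborel)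
          \<le> (\<integral>\<^sup>+x. w y * (indicator B (\<beta> y + \<alpha> y *\<^sub>R x) * g (\<beta> y + \<alpha> y *\<^sub>R x)) \<partial>lborel)"
        by (rule nn_integral_mono) (use AB[OF False] in \<open>auto simp: indicator_def\<close>)
      also have "\<dots> = w y * (\<integral>\<^sup>+x. indicator B (\<beta> y + \<alpha> y *\<^sub>R x) * g (\<beta> y + \<alpha> y *\<^sub>R x) \<partial>lborel)"
        by (rule nn_integral_cmult) measurable
      also have "(\<integral>\<^sup>+x. indicator B (\<beta> y + \<alpha> y *\<^sub>R x) * g (\<beta> y + \<alpha> y *\<^sub>R x) \<partial>lborel)
          = ennreal ((1 / \<alpha> y) ^ DIM('a)) * ?I"
      proof -
        have "ennreal ((1 / \<alpha> y) ^ DIM('a)) * ?I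
          = ennreal ((1 / \<alpha> y) ^ DIM('a)) * (ennreal (\<bar>\<alpha> y\<bar> ^ DIM('a)) * (\<integral>\<^sup>+x. indicator B (\<beta> y + \<alpha> y *\<^sub>R x) * g (\<beta> y + \<alpha> y *\<^sub>R x) \<partial>lborel))"
          using nn_integral_lborel_affine[of "\<alpha> y" "\<lambda>x. indicator B x * g x" "\<beta> y"] al by simp
        also have "\<dots> = ennreal ((1 / \<alpha> y) ^ DIM('a) * \<bar>\<alpha> y\<bar> ^ DIM('a)) * (\<integral>\<^sup>+x. indicator B (\<beta> y + \<alpha> y *\<^sub>R x) * g (\<beta> y + \<alpha> y *\<^sub>R x) \<partial>lborel)"
          using al by (simp add: ennreal_mult mult.assoc)
        also have "(1 / \<alpha> y) ^ DIM('a) * \<bar>\<alpha> y\<bar> ^ DIM('a) = 1"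
          using al by (simp only: power_mult_distrib[symmetric]) simp
        finally show ?thesis by simp
      qed
      also have "w y * (ennreal ((1 / \<alpha> y) ^ DIM('a)) * ?I) \<le> w y * (ennreal ((1 / a) ^ DIM('a)) * ?I)"
        using al a(1) by (intro mult_left_mono mult_right_mono ennreal_leI power_mono divide_left_mono) auto
      finally show ?thesis .
    qed simp
  qed
  also have "\<dots> = (\<integral>\<^sup>+y. w y \<partial>lborel) * (ennreal ((1 / a) ^ DIM('a)) * ?I)"
    by (rule nn_integral_multc) measurable
  finally show ?thesis by (simp add: mult_ac)
qed

text \<open>Jensen's inequality for the square and a weight of mass at most 1: Cauchy-Schwarz
  applied to sqrt(w) and sqrt(w) f. If the right side is infinite there is nothing to show.\<close>

lemma norm_weighted_integral_power2_le:
  fixes f :: "'a \<Rightarrow> 'b::euclidean_space" and w :: "'a \<Rightarrow> real"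
  assumes [measurable]: "f \<in> borel_measurable M" "w \<in> borel_measurable M"
    and w: "\<And>x. 0 \<le> w x" "integrable M w" "(\<integral>x. w x \<partial>M) \<le> 1"
  shows "ennreal ((norm (\<integral>x. w x *\<^sub>R f x \<partial>M))\<^sup>2) \<le> (\<integral>\<^sup>+x. ennreal (w x) * ennreal ((norm (f x))\<^sup>2) \<partial>M)"
proof (cases "(\<integral>\<^sup>+x. ennreal (w x) * ennreal ((norm (f x))\<^sup>2) \<partial>M) = \<infinity>")
  case False
  let ?a = "\<lambda>x. sqrt (w x)" and ?b = "\<lambda>x. sqrt (w x) *\<^sub>R f x"
  have b2: "ennreal ((norm (?b x))\<^sup>2) = ennreal (w x) * ennreal ((norm (f x))\<^sup>2)" for x
    using w(1)[of x] by (simp add: power_mult_distrib ennreal_mult)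
  have "(\<integral>\<^sup>+x. ennreal ((norm (?b x))\<^sup>2) \<partial>M) < \<infinity>" unfolding b2 using False by (simp add: less_top)
  then have b: "square_integrable M ?b"
    unfolding square_integrable_def integrable_iff_bounded by simp
  have a: "square_integrable M ?a" using w by (simp add: square_integrable_def)
  have "norm (\<integral>x. w x *\<^sub>R f x \<partial>M) \<le> (\<integral>x. norm (w x *\<^sub>R f x) \<partial>M)" by (rule integral_norm_bound)
  also have "\<dots> = (\<integral>x. norm (?a x) * norm (?b x) \<partial>M)"
  proof (rule Bochner_Integration.integral_cong[OF refl])
    fix x
    have "sqrt (w x) * (sqrt (w x) * norm (f x)) = w x * norm (f x)"
      using w(1)[of x] by (simp add: mult.assoc[symmetric])
    then show "norm (w x *\<^sub>R f x) = norm (?a x) * norm (?b x)" using w(1)[of x] by simp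
  qed
  also have "\<dots> \<le> L2_norm M ?a * L2_norm M ?b" by (rule L2_norm_mult_le[OF a b])
  also have "\<dots> \<le> 1 * L2_norm M ?b"
    using w by (intro mult_right_mono) (simp_all add: L2_norm_def)
  finally have "norm (\<integral>x. w x *\<^sub>R f x \<partial>M) \<le> L2_norm M ?b" by simp
  then have "ennreal ((norm (\<integral>x. w x *\<^sub>R f x \<partial>M))\<^sup>2) \<le> ennreal ((L2_norm M ?b)\<^sup>2)"
    by (intro ennreal_leI power_mono) auto
  then show ?thesis unfolding nn_integral_L2_norm[OF b, symmetric] b2 .
qed simp

text \<open>The fundamental theorem of calculus along the segment, followed by Jensen's inequality
  on the unit interval.\<close>

lemma C1_increment_power2_le:
  fixes f :: "'a::euclidean_space \<Rightarrow> 'b::euclidean_space"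
  assumes f: "Ck (Suc 0) f"
  shows "ennreal ((norm (f (x + v) - f x))\<^sup>2)
    \<le> (\<integral>\<^sup>+t. indicator {0..1} t * ennreal ((norm (frechet_derivative f (at (x + t *\<^sub>R v)) v))\<^sup>2) \<partial>lborel)"
proof -
  let ?D = "\<lambda>t. frechet_derivative f (at (x + t *\<^sub>R v)) v"
  have "continuous_on UNIV (\<lambda>y. frechet_derivative f (at y) v)" using Ck_Suc_deriv[OF f] by simp
  then have c: "continuous_on UNIV ?D"
    by (rule continuous_on_compose2) (auto intro!: continuous_intros)
  have "set_integrable lborel {0..1} ?D"
    unfolding set_integrable_def by (rule borel_integrable_compact) (auto intro: continuous_on_subset[OF c])
  from set_borel_integral_eq_integral(2)[OF this]
  have "f (x + v) - f x = (\<integral>t. indicator {0..1} t *\<^sub>R ?D t \<partial>lborel)"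
    using integral_unique[OF has_integral_line[OF f, of x v]] by (simp add: set_lebesgue_integral_def)
  moreover have "ennreal ((norm (\<integral>t. indicator {0..1} t *\<^sub>R ?D t \<partial>lborel))\<^sup>2)
      \<le> (\<integral>\<^sup>+t. ennreal (indicator {0..1} t) * ennreal ((norm (?D t))\<^sup>2) \<partial>lborel)"
    by (rule norm_weighted_integral_power2_le) (use borel_measurable_continuous_onI[OF c] in auto)
  ultimately show ?thesis by (simp add: ennreal_indicator)
qed

lemma norm_frechet_derivative_le_grad:
  assumes "Ck (Suc k) f"
  shows "norm (frechet_derivative f (at x) v) \<le> norm v * norm (grad f x)"
proof -
  have "norm (frechet_derivative f (at x) v) \<le> (\<Sum>i\<in>UNIV. \<bar>v $ i\<bar> * norm (grad f x $ i))"
    unfolding frechet_derivative_grad[OF assms] by (rule order_trans[OF norm_sum]) simp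
  also have "\<dots> \<le> L2_set (\<lambda>i. v $ i) UNIV * L2_set (\<lambda>i. norm (grad f x $ i)) UNIV"
    using L2_set_mult_ineq[of "\<lambda>i. v $ i" "\<lambda>i. norm (grad f x $ i)" UNIV] by simp
  finally show ?thesis by (simp add: norm_vec_def L2_set_def)
qed

lemma nn_integral_lebesgue_on_lborel:
  fixes f :: "'a::euclidean_space \<Rightarrow> 'b::euclidean_space"
  assumes "open U" "f \<in> borel_measurable borel"
  shows "(\<integral>\<^sup>+x. ennreal ((norm (f x))\<^sup>2) \<partial>lebesgue_on U)
    = (\<integral>\<^sup>+x. indicator U x * ennreal ((norm (f x))\<^sup>2) \<partial>lborel)"
proof -
  have [measurable]: "f \<in> borel_measurable borel" "U \<in> sets borel" using assms by auto
  have "(\<integral>\<^sup>+x. ennreal ((norm (f x))\<^sup>2) \<partial>lebesgue_on U) = (\<integral>\<^sup>+x. ennreal ((norm (f x))\<^sup>2) * indicator U x \<partial>lebesgue)"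
    by (rule nn_integral_restrict_space) (use assms(1) in auto)
  also have "\<dots> = (\<integral>\<^sup>+x. ennreal ((norm (f x))\<^sup>2) * indicator U x \<partial>lborel)"
    by (rule nn_integral_completion) measurable
  finally show ?thesis by (simp add: mult.commute)
qed

section \<open>The Poincare inequality\<close>

text \<open>Moving a point of the disc by 2 in a fixed direction takes it to the zero set of
  \<open>u\<close>, so \<open>u\<close> is controlled by its increment along that segment. The
  constant 2 is the length of the segment, the diameter of the disc.\<close>

lemma Poincare_inequality_disc:
  fixes u :: "real^2 \<Rightarrow> 'b::euclidean_space"
  assumes u: "Ck (Suc 0) u" and z: "\<And>x. 1 \<le> norm x \<Longrightarrow> u x = 0"
  shows "L2_norm (lebesgue_on disc) u \<le> 2 * L2_norm (lebesgue_on disc) (grad u)"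
proof -
  let ?e = "2 *\<^sub>R axis 1 1 :: real^2"
  have cg: "continuous_on UNIV (grad u)" by (rule continuous_on_grad[OF u])
  have cu: "continuous_on UNIV u" by (rule Ck_imp_continuous_on[OF u])
  have [measurable]: "grad u \<in> borel_measurable borel" "u \<in> borel_measurable borel"
    using borel_measurable_continuous_onI[OF cg] borel_measurable_continuous_onI[OF cu] by auto
  note sq = square_integrable_C1[OF open_ball bounded_ball u, of 0 1]
  \<comment> \<open>The exterior is open only for norm greater than 1; on the unit circle itself the
    gradient vanishes by continuity, approaching along the ray through \<open>x\<close>.\<close>
  have g0: "grad u x = 0" if "x \<notin> disc" for x
  proof -
    have out: "grad u y = 0" if "1 < norm y" for y
      unfolding vec_eq_iff grad_component
      by (auto intro!: frechet_derivative_eq_0[of "{x. 1 < norm x}"] z open_Collect_less continuous_intros that)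
    have "x \<in> closure {y. 1 < norm y}"
    proof -
      have "(\<lambda>n. (1 + 1 / real (Suc n)) *\<^sub>R x) \<longlonglongrightarrow> (1 + 0) *\<^sub>R x"
        by (intro tendsto_intros LIMSEQ_Suc[OF lim_1_over_n])
      moreover have "(1 + 1 / real (Suc n)) *\<^sub>R x \<in> {y. 1 < norm y}" for n
      proof -
        have n1: "1 \<le> norm x" using that by simp
        have e: "0 < 1 / real (Suc n)" by simp
        have "(1 / real (Suc n)) * 1 \<le> (1 / real (Suc n)) * norm x" using n1 e by (intro mult_left_mono) simp_all
        with n1 e have "1 < norm x + (1 / real (Suc n)) * norm x" by linarith
        moreover have "norm ((1 + 1 / real (Suc n)) *\<^sub>R x) = (1 + 1 / real (Suc n)) * norm x"
          using e by (simp only: norm_scaleR abs_of_pos add_pos_pos zero_less_one)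
        ultimately show ?thesis by (simp only: distrib_right mult_1_left mem_Collect_eq)
      qed
      ultimately show ?thesis unfolding closure_sequential by (intro exI[of _ "\<lambda>n. (1 + 1 / real (Suc n)) *\<^sub>R x"]) simp
    qed
    then show ?thesis
      using continuous_constant_on_closure[of "{y. 1 < norm y}" "grad u" 0] out continuous_on_subset[OF cg] by auto
  qed
  have bound: "indicator disc x * ennreal ((norm (u x))\<^sup>2)
      \<le> indicator disc x * (\<integral>\<^sup>+t. indicator {0..1} t * ennreal ((2 * norm (grad u (t *\<^sub>R ?e + 1 *\<^sub>R x)))\<^sup>2) \<partial>lborel)" for x
  proof (cases "x \<in> disc")
    case True
    have "norm ?e \<le> norm (x + ?e) + norm x" using norm_triangle_ineq4[of "x + ?e" x] by simp
    then have "1 \<le> norm (x + ?e)" using True by simp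
    then have "u (x + ?e) = 0" by (rule z)
    then have "ennreal ((norm (u x))\<^sup>2) \<le> (\<integral>\<^sup>+t. indicator {0..1} t * ennreal ((norm (frechet_derivative u (at (x + t *\<^sub>R ?e)) ?e))\<^sup>2) \<partial>lborel)"
      using C1_increment_power2_le[OF u, of x ?e] by simp
    also have "\<dots> \<le> (\<integral>\<^sup>+t. indicator {0..1} t * ennreal ((2 * norm (grad u (t *\<^sub>R ?e + 1 *\<^sub>R x)))\<^sup>2) \<partial>lborel)"
    proof (intro nn_integral_mono mult_left_mono ennreal_leI power_mono)
      fix t :: real
      show "norm (frechet_derivative u (at (x + t *\<^sub>R ?e)) ?e) \<le> 2 * norm (grad u (t *\<^sub>R ?e + 1 *\<^sub>R x))"
        using norm_frechet_derivative_le_grad[OF u, of "x + t *\<^sub>R ?e" ?e] by (simp add: add.commute)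
    qed auto
    finally show ?thesis by (simp add: mult_left_mono)
  qed simp
  have "(\<integral>\<^sup>+x. ennreal ((norm (u x))\<^sup>2) \<partial>lebesgue_on disc) = (\<integral>\<^sup>+x. indicator disc x * ennreal ((norm (u x))\<^sup>2) \<partial>lborel)"
    by (rule nn_integral_lebesgue_on_lborel) auto
  also have "\<dots> \<le> (\<integral>\<^sup>+x. indicator disc x * (\<integral>\<^sup>+t. indicator {0..1} t * ennreal ((2 * norm (grad u (t *\<^sub>R ?e + 1 *\<^sub>R x)))\<^sup>2) \<partial>lborel) \<partial>lborel)"
    by (rule nn_integral_mono) (rule bound)
  \<comment> \<open>Pure translations, hence ratio 1. The segments leave the disc, so the target set
    is the whole plane; the vanishing of the gradient outside brings the integral back.\<close>
  also have "\<dots> \<le> ennreal ((1 / 1) ^ DIM(real^2)) * (\<integral>\<^sup>+t. indicator {0..1::real} t \<partial>lborel) * (\<integral>\<^sup>+x. indicator UNIV x * ennreal ((2 * norm (grad u x))\<^sup>2) \<partial>lborel)"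
    by (rule nn_integral_affine_average_le[where g="\<lambda>x. ennreal ((2 * norm (grad u x))\<^sup>2)"]) auto
  also have "\<dots> = (\<integral>\<^sup>+x. ennreal ((2 * norm (grad u x))\<^sup>2) \<partial>lborel)" by simp
  also have "\<dots> = (\<integral>\<^sup>+x. indicator disc x * ennreal ((norm (2 *\<^sub>R grad u x))\<^sup>2) \<partial>lborel)"
    by (rule nn_integral_cong) (use g0 in \<open>auto simp: indicator_def\<close>)
  also have "\<dots> = (\<integral>\<^sup>+x. ennreal ((norm (2 *\<^sub>R grad u x))\<^sup>2) \<partial>lebesgue_on disc)"
    by (rule nn_integral_lebesgue_on_lborel[symmetric]) auto
  also have "\<dots> = ennreal ((2 * L2_norm (lebesgue_on disc) (grad u))\<^sup>2)"
    using nn_integral_L2_norm[OF square_integrable_scaleR[OF sq(2), of 2]] by (simp add: L2_norm_scaleR)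
  finally have "(L2_norm (lebesgue_on disc) u)\<^sup>2 \<le> (2 * L2_norm (lebesgue_on disc) (grad u))\<^sup>2"
    unfolding nn_integral_L2_norm[OF sq(1)] by (simp add: ennreal_le_iff)
  then show ?thesis by (rule power2_le_imp_le) simp
qed

section \<open>Mollification\<close>

text \<open>A normalised bump on the square of side 1 around the origin. Its half-diagonal is less
  than 1, so the support lies in the unit disc, and the square shape keeps it a product of
  one-variable functions, which \<open>moll_kernel_antiderivative\<close> exploits.\<close>

definition moll :: "real^2 \<Rightarrow> real" where
  "moll x = box_bump 1 (- (1/2) *\<^sub>R One) ((1/2) *\<^sub>R One) x
     / (\<integral>x. box_bump 1 (- (1/2) *\<^sub>R One :: real^2) ((1/2) *\<^sub>R One) x \<partial>lborel)"

lemma moll_facts: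
  "smooth moll" "0 \<le> moll x" "1 \<le> norm x \<Longrightarrow> moll x = 0" "integrable lborel moll" "(\<integral>x. moll x \<partial>lborel) = 1"
proof -
  let ?b = "box_bump 1 (- (1/2) *\<^sub>R One :: real^2) ((1/2) *\<^sub>R One)"
  let ?I = "\<integral>x. ?b x \<partial>lborel"
  have sm: "smooth ?b" by (rule smooth_box_bump)
  then have c: "continuous_on UNIV ?b" using Ck_imp_continuous_on[of 0 ?b] by (auto simp: smooth_def)
  have z: "?b x = 0" if "1 \<le> norm x" for x
  proof (rule ccontr)
    assume "?b x \<noteq> 0"
    then have x: "x \<in> box (- (1/2) *\<^sub>R One) ((1/2) *\<^sub>R One)" using box_bump_eq_0_iff[of 1] by auto
    have half: "\<bar>x $ i\<bar> < 1/2" for i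
    proof -
      have ax: "axis i (1::real) \<in> Basis" by (simp add: axis_in_Basis_iff)
      show ?thesis using x ax by (auto simp: mem_box inner_axis abs_less_iff dest!: bspec[OF _ ax])
    qed
    have quarter: "(x $ i)\<^sup>2 < 1/4" for i
    proof -
      have "\<bar>2 * x $ i\<bar> < 1" using half[of i] unfolding abs_mult by simp
      then have "(2 * x $ i)\<^sup>2 < 1" by (simp only: abs_square_less_1)
      then show ?thesis unfolding power_mult_distrib by simp
    qed
    have "(norm x)\<^sup>2 = (x $ 1)\<^sup>2 + (x $ 2)\<^sup>2"
      unfolding power2_norm_eq_inner inner_vec_def sum_2 by (simp add: power2_eq_square)
    with quarter[of 1] quarter[of 2] have "(norm x)\<^sup>2 < 1" by linarith
    then have "norm x < 1" unfolding abs_square_less_1 by simp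
    with that show False by simp
  qed
  have int: "integrable lborel ?b"
    by (rule integrable_continuous_bounded_support[OF c, of 1]) (use z in auto)
  have "?I \<noteq> 0"
  proof
    assume "?I = 0"
    then have "AE x in lborel. ?b x = 0"
      using integral_nonneg_eq_0_iff_AE[OF int] by (simp add: box_bump_bounds)
    then have "AE x in lborel. x \<notin> box (- (1/2) *\<^sub>R One :: real^2) ((1/2) *\<^sub>R One)"
      by eventually_elim (simp add: box_bump_eq_0_iff)
    then have "emeasure lborel (box (- (1/2) *\<^sub>R One :: real^2) ((1/2) *\<^sub>R One)) = 0"
      by (subst (asm) AE_iff_null_sets[symmetric]) auto
    then show False by (simp add: emeasure_lborel_box_eq)
  qed
  moreover have "?I \<ge> 0" by (simp add: box_bump_bounds)
  ultimately have I: "?I > 0" by linarith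
  have eq: "moll = (\<lambda>x. (1 / ?I) *\<^sub>R ?b x)" by (rule ext) (simp add: moll_def)
  show "smooth moll"
    using sm Ck_linear[OF bounded_linear_scaleR_right] unfolding eq smooth_def by blast
  show "0 \<le> moll x" using I by (simp add: moll_def box_bump_bounds)
  show "moll x = 0" if "1 \<le> norm x" using z[OF that] by (simp add: moll_def)
  show "integrable lborel moll" unfolding eq by (rule integrable_scaleR_right[OF int])
  show "(\<integral>x. moll x \<partial>lborel) = 1" unfolding eq using I by simp
qed

lemma moll_continuous: "continuous_on UNIV moll"
  using moll_facts(1) Ck_imp_continuous_on[of 0 moll] by (auto simp: smooth_def)

lemma moll_measurable [measurable]: "moll \<in> borel_measurable borel"
  by (rule borel_measurable_continuous_onI[OF moll_continuous])

lemma nn_integral_moll: "(\<integral>\<^sup>+x. ennreal (moll x) \<partial>lborel) = 1"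
  using nn_integral_eq_integral[OF moll_facts(4)] moll_facts(2,5) by simp

text \<open>The two faces of the mollification. As an average of values of f near x/s it is suited
  to norm estimates; as an integral against a kernel evaluated at x - s z it depends smoothly on x.
  The factor is the Jacobian of z = (x - \<delta> y)/s in the plane.\<close>

lemma moll_average_substitution:
  fixes f :: "real^2 \<Rightarrow> 'b::euclidean_space"
  assumes "s > 0" "\<delta> > 0" "f \<in> borel_measurable borel"
  shows "(\<integral>y. moll y *\<^sub>R f ((1 / s) *\<^sub>R (x - \<delta> *\<^sub>R y)) \<partial>lborel)
    = (\<integral>z. ((s / \<delta>)\<^sup>2 * moll ((1 / \<delta>) *\<^sub>R (x - s *\<^sub>R z))) *\<^sub>R f z \<partial>lborel)"
proof -
  have [measurable]: "f \<in> borel_measurable borel" by (rule assms)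
  let ?h = "\<lambda>y. moll y *\<^sub>R f ((1 / s) *\<^sub>R (x - \<delta> *\<^sub>R y))"
  have "(\<integral>y. ?h y \<partial>lborel) = \<bar>- (s / \<delta>)\<bar> ^ DIM(real^2) *\<^sub>R (\<integral>z. ?h ((1 / \<delta>) *\<^sub>R x + (- (s / \<delta>)) *\<^sub>R z) \<partial>lborel)"
    by (rule integral_lborel_affine) (use assms(1,2) in auto)
  also have "(\<lambda>z. ?h ((1 / \<delta>) *\<^sub>R x + (- (s / \<delta>)) *\<^sub>R z)) = (\<lambda>z. moll ((1 / \<delta>) *\<^sub>R (x - s *\<^sub>R z)) *\<^sub>R f z)"
  proof
    fix z
    have 1: "(1 / \<delta>) *\<^sub>R x + (- (s / \<delta>)) *\<^sub>R z = (1 / \<delta>) *\<^sub>R (x - s *\<^sub>R z)"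
      by (simp add: scaleR_diff_right)
    have 2: "(1 / s) *\<^sub>R (x - \<delta> *\<^sub>R ((1 / \<delta>) *\<^sub>R (x - s *\<^sub>R z))) = z" using assms(1,2) by simp
    show "?h ((1 / \<delta>) *\<^sub>R x + (- (s / \<delta>)) *\<^sub>R z) = moll ((1 / \<delta>) *\<^sub>R (x - s *\<^sub>R z)) *\<^sub>R f z"
      unfolding 1 2 ..
  qed
  also have "\<bar>- (s / \<delta>)\<bar> ^ DIM(real^2) = (s / \<delta>)\<^sup>2" by (simp add: power_divide)
  finally show ?thesis by (simp flip: scaleR_scaleR integral_scaleR_right)
qed

text \<open>Differentiation under the integral by dominated convergence along an arbitrary null
  sequence of increments. Boundedness of \<open>U\<close> confines the arguments of the kernel to a
  ball; this also covers the antiderivative of the mollifier kernel, whose support is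
  unbounded.\<close>

lemma integral_kernel_has_derivative:
  fixes \<psi> :: "real^'n \<Rightarrow> real" and F :: "real^'n \<Rightarrow> 'b::euclidean_space"
  assumes \<psi>: "Ck (Suc 0) \<psi>" and F: "integrable (lebesgue_on U) F" and U: "bounded U"
  shows "((\<lambda>x. \<integral>z. \<psi> (x - s *\<^sub>R z) *\<^sub>R F z \<partial>lebesgue_on U) has_derivative
    (\<lambda>h. \<integral>z. frechet_derivative \<psi> (at (x - s *\<^sub>R z)) h *\<^sub>R F z \<partial>lebesgue_on U)) (at x)"
proof -
  let ?M = "lebesgue_on U"
  let ?D = "\<lambda>x h. frechet_derivative \<psi> (at x) h"
  obtain R where R: "R > 0" "\<And>z. z \<in> U \<Longrightarrow> norm z \<le> R" using U by (auto simp: bounded_pos)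
  have int: "integrable ?M (\<lambda>z. g (x - s *\<^sub>R z) *\<^sub>R F z)" if g: "continuous_on UNIV g" for g :: "real^'n \<Rightarrow> real" and x
  proof -
    have c: "continuous_on UNIV (\<lambda>z. g (x - s *\<^sub>R z))"
      by (rule continuous_on_compose2[OF g]) (auto intro!: continuous_intros)
    obtain B where B: "\<And>z. z \<in> U \<Longrightarrow> norm (g (x - s *\<^sub>R z)) \<le> B" using continuous_bounded_on[OF U c] by blast
    show ?thesis
    proof (rule Bochner_Integration.integrable_bound)
      show "integrable ?M (\<lambda>z. \<bar>B\<bar> * norm (F z))" using integrable_norm[OF F] by (rule integrable_mult_right)
      show "(\<lambda>z. g (x - s *\<^sub>R z) *\<^sub>R F z) \<in> borel_measurable ?M"
        by (rule borel_measurable_scaleR[OF continuous_measurable_lebesgue_on[OF c] borel_measurable_integrable[OF F]])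
      show "AE z in ?M. norm (g (x - s *\<^sub>R z) *\<^sub>R F z) \<le> norm (\<bar>B\<bar> * norm (F z))"
      proof (rule AE_I2)
        fix z assume "z \<in> space ?M"
        then have "\<bar>g (x - s *\<^sub>R z)\<bar> \<le> \<bar>B\<bar>" using B[of z] by simp
        then show "norm (g (x - s *\<^sub>R z) *\<^sub>R F z) \<le> norm (\<bar>B\<bar> * norm (F z))" by (simp add: mult_right_mono)
      qed
    qed
  qed
  have c\<psi>: "continuous_on UNIV \<psi>" by (rule Ck_imp_continuous_on[OF \<psi>])
  have cD: "continuous_on UNIV (\<lambda>x. ?D x h)" for h using Ck_Suc_deriv[OF \<psi>] by simp
  have linD: "linear (?D x)" for x by (rule has_derivative_linear[OF Ck_Suc_has_derivative[OF \<psi>]])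
  show ?thesis
    unfolding has_derivative_at
  proof (intro conjI)
    show "bounded_linear (\<lambda>h. \<integral>z. ?D (x - s *\<^sub>R z) h *\<^sub>R F z \<partial>?M)"
    proof (rule linear_conv_bounded_linear[THEN iffD1], rule linearI)
      fix a b c
      show "(\<integral>z. ?D (x - s *\<^sub>R z) (a + b) *\<^sub>R F z \<partial>?M) = (\<integral>z. ?D (x - s *\<^sub>R z) a *\<^sub>R F z \<partial>?M) + (\<integral>z. ?D (x - s *\<^sub>R z) b *\<^sub>R F z \<partial>?M)"
        unfolding linear_add[OF linD] scaleR_add_left by (rule Bochner_Integration.integral_add[OF int[OF cD] int[OF cD]])
      show "(\<integral>z. ?D (x - s *\<^sub>R z) (c *\<^sub>R a) *\<^sub>R F z \<partial>?M) = c *\<^sub>R (\<integral>z. ?D (x - s *\<^sub>R z) a *\<^sub>R F z \<partial>?M)"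
        unfolding linear_scale[OF linD] by (simp flip: scaleR_scaleR)
    qed
    let ?E = "\<lambda>h z. \<psi> (x + h - s *\<^sub>R z) - \<psi> (x - s *\<^sub>R z) - ?D (x - s *\<^sub>R z) h"
    let ?r = "\<lambda>h. norm ((\<integral>z. \<psi> (x + h - s *\<^sub>R z) *\<^sub>R F z \<partial>?M) - (\<integral>z. \<psi> (x - s *\<^sub>R z) *\<^sub>R F z \<partial>?M)
        - (\<integral>z. ?D (x - s *\<^sub>R z) h *\<^sub>R F z \<partial>?M)) / norm h"
    show "(?r \<longlongrightarrow> 0) (at 0)"
      unfolding tendsto_at_iff_sequentially o_def
    proof (intro allI impI)
      fix X :: "nat \<Rightarrow> real^'n" assume X: "\<forall>i. X i \<in> UNIV - {0}" "X \<longlonglongrightarrow> 0"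
      obtain Q where Q: "Q > 0" "\<And>n. norm (X n) \<le> Q"
        using convergent_imp_Bseq[OF convergentI[OF X(2)]] by (auto simp: Bseq_def)
      have cgr: "continuous_on UNIV (grad \<psi>)" by (rule continuous_on_grad[OF \<psi>])
      \<comment> \<open>The radius accommodates all points of the segments from x - s z to x + h - s
        z, for z in \<open>U\<close> and h in the bounded sequence.\<close>
      obtain B where B: "\<And>y. y \<in> cball 0 (norm x + Q + \<bar>s\<bar> * R) \<Longrightarrow> norm (grad \<psi> y) \<le> B"
        using continuous_bounded_on[OF bounded_cball cgr] by blast
      have B0: "B \<ge> 0"
        using B[of 0] Q(1) R(1) norm_ge_zero[of "grad \<psi> 0"]
        by (smt (verit) mem_cball_0 mult_nonneg_nonneg norm_ge_zero norm_zero abs_ge_zero)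
      have inR: "x + t *\<^sub>R X n - s *\<^sub>R z \<in> cball 0 (norm x + Q + \<bar>s\<bar> * R)" if "z \<in> U" "t \<in> {0..1}" for t n z
      proof -
        have "norm (x + t *\<^sub>R X n - s *\<^sub>R z) \<le> norm x + norm (t *\<^sub>R X n) + norm (s *\<^sub>R z)"
          by (meson norm_triangle_ineq4 norm_triangle_ineq add_mono order_refl order_trans)
        moreover have "norm (t *\<^sub>R X n) \<le> Q"
          using that(2) Q(2)[of n] mult_mono[of "\<bar>t\<bar>" 1 "norm (X n)" Q] by simp
        moreover have "norm (s *\<^sub>R z) \<le> \<bar>s\<bar> * R" using R(2)[OF that(1)] by (simp add: mult_left_mono)
        ultimately show ?thesis by simp
      qed
      \<comment> \<open>One B bounds the increment of the kernel by the mean value inequality, the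
        other its linear part.\<close>
      have Eb: "\<bar>?E (X n) z\<bar> / norm (X n) \<le> 2 * B" if z: "z \<in> U" for n z
      proof -
        have Db: "norm (?D (x + t *\<^sub>R X n - s *\<^sub>R z) (X n)) \<le> norm (X n) * B" if "t \<in> {0..1}" for t
          using order_trans[OF norm_frechet_derivative_le_grad[OF \<psi>] mult_left_mono[OF B[OF inR[OF z that]]]] by simp
        have line: "((\<lambda>t. ?D (x - s *\<^sub>R z + t *\<^sub>R X n) (X n)) has_integral (\<psi> (x - s *\<^sub>R z + X n) - \<psi> (x - s *\<^sub>R z))) {0..1}"
          by (rule has_integral_line[OF \<psi>])
        have "norm (?D (x - s *\<^sub>R z + t *\<^sub>R X n) (X n)) \<le> norm (X n) * B" if "t \<in> {0..1} - {}" for t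
          using Db[of t] that by (simp add: algebra_simps)
        from has_integral_bound_real[OF mult_nonneg_nonneg[OF norm_ge_zero B0] finite.emptyI line this]
        have "norm (\<psi> (x - s *\<^sub>R z + X n) - \<psi> (x - s *\<^sub>R z)) \<le> norm (X n) * B" by simp
        moreover have "x - s *\<^sub>R z + X n = x + X n - s *\<^sub>R z" by simp
        moreover have "norm (?D (x - s *\<^sub>R z) (X n)) \<le> norm (X n) * B" using Db[of 0] by simp
        moreover have "2 * B * norm (X n) = norm (X n) * B + norm (X n) * B" by simp
        ultimately have "\<bar>?E (X n) z\<bar> \<le> 2 * B * norm (X n)"
          using abs_triangle_ineq4[of "\<psi> (x + X n - s *\<^sub>R z) - \<psi> (x - s *\<^sub>R z)" "?D (x - s *\<^sub>R z) (X n)"]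
          unfolding real_norm_def by (simp only:)
        moreover have "norm (X n) > 0" using X(1) by auto
        ultimately show ?thesis by (simp add: pos_divide_le_eq)
      qed
      have lim: "(\<lambda>n. \<integral>z. (\<bar>?E (X n) z\<bar> / norm (X n)) * norm (F z) \<partial>?M) \<longlonglongrightarrow> (\<integral>z. 0 \<partial>?M)"
      proof (rule integral_dominated_convergence)
        show "integrable ?M (\<lambda>z. 2 * B * norm (F z))" using integrable_norm[OF F] by (rule integrable_mult_right)
        have cE: "continuous_on UNIV (\<lambda>z. \<bar>?E (X n) z\<bar> / norm (X n))" for n
        proof -
          have "continuous_on UNIV (?E (X n))"
            by (intro continuous_on_diff continuous_on_compose2[OF c\<psi>] continuous_on_compose2[OF cD]) (auto intro!: continuous_intros)
          then show ?thesis using X(1) by (intro continuous_on_divide continuous_on_rabs) auto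
        qed
        show "(\<lambda>z. (\<bar>?E (X n) z\<bar> / norm (X n)) * norm (F z)) \<in> borel_measurable ?M" for n
          by (rule borel_measurable_times[OF continuous_measurable_lebesgue_on[OF cE] borel_measurable_integrable[OF integrable_norm[OF F]]])
        show "AE z in ?M. (\<lambda>n. (\<bar>?E (X n) z\<bar> / norm (X n)) * norm (F z)) \<longlonglongrightarrow> 0"
        proof (rule AE_I2, rule tendsto_mult_left_zero)
          fix z
          have "((\<lambda>h. norm (\<psi> (x - s *\<^sub>R z + h) - \<psi> (x - s *\<^sub>R z) - ?D (x - s *\<^sub>R z) h) / norm h) \<longlongrightarrow> 0) (at 0)"
            using Ck_Suc_has_derivative[OF \<psi>, of "x - s *\<^sub>R z"] by (simp add: has_derivative_at)
          then have "((\<lambda>h. \<bar>?E h z\<bar> / norm h) \<longlongrightarrow> 0) (at 0)" by (simp add: algebra_simps)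
          then show "(\<lambda>n. \<bar>?E (X n) z\<bar> / norm (X n)) \<longlonglongrightarrow> 0"
            using X unfolding tendsto_at_iff_sequentially o_def by blast
        qed
        show "AE z in ?M. norm ((\<bar>?E (X n) z\<bar> / norm (X n)) * norm (F z)) \<le> 2 * B * norm (F z)" for n
        proof (rule AE_I2)
          fix z assume "z \<in> space ?M"
          then have "\<bar>?E (X n) z\<bar> / norm (X n) \<le> 2 * B" using Eb[of z n] by simp
          then show "norm ((\<bar>?E (X n) z\<bar> / norm (X n)) * norm (F z)) \<le> 2 * B * norm (F z)"
            unfolding real_norm_def abs_mult by (intro mult_mono) (simp_all add: B0)
        qed
      qed simp
      have le: "norm (?r (X n)) \<le> (\<integral>z. (\<bar>?E (X n) z\<bar> / norm (X n)) * norm (F z) \<partial>?M)" for n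
      proof -
        have "(\<integral>z. \<psi> (x + X n - s *\<^sub>R z) *\<^sub>R F z \<partial>?M) - (\<integral>z. \<psi> (x - s *\<^sub>R z) *\<^sub>R F z \<partial>?M) - (\<integral>z. ?D (x - s *\<^sub>R z) (X n) *\<^sub>R F z \<partial>?M)
          = (\<integral>z. ?E (X n) z *\<^sub>R F z \<partial>?M)"
          unfolding scaleR_diff_left
          by (simp only: Bochner_Integration.integral_diff int[OF c\<psi>] int[OF cD] Bochner_Integration.integrable_diff)
        moreover have "norm (\<integral>z. ?E (X n) z *\<^sub>R F z \<partial>?M) \<le> (\<integral>z. \<bar>?E (X n) z\<bar> * norm (F z) \<partial>?M)"
          using integral_norm_bound[of ?M "\<lambda>z. ?E (X n) z *\<^sub>R F z"] by simp
        ultimately have "?r (X n) \<le> (\<integral>z. \<bar>?E (X n) z\<bar> * norm (F z) \<partial>?M) / norm (X n)"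
          by (simp add: divide_right_mono)
        also have "\<dots> = (\<integral>z. (\<bar>?E (X n) z\<bar> / norm (X n)) * norm (F z) \<partial>?M)"
          by (simp flip: integral_divide_zero)
        finally show ?thesis by simp
      qed
      show "(\<lambda>n. ?r (X n)) \<longlonglongrightarrow> 0"
        by (rule Lim_null_comparison[OF always_eventually[OF allI[OF le]]]) (use lim in simp)
    qed
  qed
qed

lemma smooth_deriv: "smooth \<psi> \<Longrightarrow> smooth (\<lambda>x. frechet_derivative \<psi> (at x) v)"
  unfolding smooth_def using Ck_Suc_deriv by blast

text \<open>The derivative is the same kind of integral with the kernel differentiated, so the
  induction runs over all smooth kernels at once.\<close>

lemma smooth_integral_kernel:
  fixes \<psi> :: "real^'n \<Rightarrow> real" and F :: "real^'n \<Rightarrow> 'b::euclidean_space"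
  assumes F: "integrable (lebesgue_on U) F" and U: "bounded U"
  shows "smooth \<psi> \<Longrightarrow> smooth (\<lambda>x. \<integral>z. \<psi> (x - s *\<^sub>R z) *\<^sub>R F z \<partial>lebesgue_on U)"
proof -
  have "Ck k (\<lambda>x. \<integral>z. \<psi> (x - s *\<^sub>R z) *\<^sub>R F z \<partial>lebesgue_on U)" if "smooth \<psi>" for k \<psi>
    using that
  proof (induction k arbitrary: \<psi>)
    case 0
    have "Ck (Suc 0) \<psi>" using 0 by (auto simp: smooth_def)
    from has_derivative_continuous_on[OF has_derivative_at_withinI[OF integral_kernel_has_derivative[OF this F U, of s]]]
    show ?case by (simp only: Ck.simps)
  next
    case (Suc k)
    have "Ck (Suc 0) \<psi>" using Suc.prems by (auto simp: smooth_def)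
    from integral_kernel_has_derivative[OF this F U, of s]
    show ?case by (rule Ck_SucI) (rule Suc.IH[OF smooth_deriv[OF Suc.prems]])
  qed
  then show "smooth \<psi> \<Longrightarrow> smooth (\<lambda>x. \<integral>z. \<psi> (x - s *\<^sub>R z) *\<^sub>R F z \<partial>lebesgue_on U)"
    unfolding smooth_def[of "\<lambda>x. \<integral>z. \<psi> (x - s *\<^sub>R z) *\<^sub>R F z \<partial>lebesgue_on U"] by blast
qed

text \<open>The prefactor is the Jacobian from \<open>moll_average_substitution\<close>; with
  argument x - s z the kernel turns integration in z into averaging with
  \<open>moll\<close>.\<close>

definition moll_kernel :: "real \<Rightarrow> real \<Rightarrow> real^2 \<Rightarrow> real" where
  "moll_kernel s \<delta> x = (s / \<delta>)\<^sup>2 * moll ((1 / \<delta>) *\<^sub>R x)"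

text \<open>The average of \<open>F\<close> near \<open>x / s\<close>. For \<open>s \<ge> 1 + \<delta>\<close> and \<open>x\<close> in the disc only values of \<open>F\<close> inside the disc
  enter, so no extension is needed; for \<open>s + \<delta> < 1\<close> the result is supported inside the disc.\<close>

definition mollify :: "real \<Rightarrow> real \<Rightarrow> (real^2 \<Rightarrow> 'b::euclidean_space) \<Rightarrow> real^2 \<Rightarrow> 'b" where
  "mollify s \<delta> F x = (\<integral>z. moll_kernel s \<delta> (x - s *\<^sub>R z) *\<^sub>R F z \<partial>lebesgue_on disc)"

lemma smooth_moll_kernel: "smooth (moll_kernel s \<delta>)"
proof -
  have "Ck k moll" for k using moll_facts(1) by (simp add: smooth_def)
  then have "Ck k (\<lambda>x. moll (0 + (1 / \<delta>) *\<^sub>R x))" for k by (rule Ck_compose_affine)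
  then have "Ck k (\<lambda>x. (s / \<delta>)\<^sup>2 *\<^sub>R moll (0 + (1 / \<delta>) *\<^sub>R x))" for k
    by (rule Ck_linear[OF bounded_linear_scaleR_right])
  then show ?thesis by (simp add: smooth_def moll_kernel_def[abs_def])
qed

lemma moll_kernel_eq_0: "\<delta> > 0 \<Longrightarrow> \<delta> \<le> norm x \<Longrightarrow> moll_kernel s \<delta> x = 0"
  by (simp add: moll_kernel_def moll_facts(3))

lemma smooth_mollify:
  assumes "integrable (lebesgue_on disc) F"
  shows "smooth (mollify s \<delta> F)"
  unfolding mollify_def[abs_def] by (rule smooth_integral_kernel[OF assms bounded_ball smooth_moll_kernel])

lemma continuous_smooth: "smooth f \<Longrightarrow> continuous_on UNIV f"
  unfolding smooth_def using Ck_imp_continuous_on by blast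

lemmas disc_open_bounded = open_ball[of "0::real^2" 1] bounded_ball[of "0::real^2" 1]
lemmas disc_finite_measure = finite_measure_lebesgue_on_bounded[OF disc_open_bounded]
lemmas disc_integrable = integrable_square_integrable[OF disc_finite_measure]

lemma integrable_moll_translate:
  fixes f :: "real^2 \<Rightarrow> 'b::euclidean_space"
  assumes "continuous_on UNIV f"
  shows "integrable lborel (\<lambda>y. moll y *\<^sub>R f (a + b *\<^sub>R y))"
proof (rule integrable_continuous_bounded_support[where R=1])
  show "continuous_on UNIV (\<lambda>y. moll y *\<^sub>R f (a + b *\<^sub>R y))"
    by (intro continuous_on_scaleR moll_continuous continuous_on_compose2[OF assms]) (auto intro!: continuous_intros)
qed (simp add: moll_facts(3))

text \<open>For z outside the disc, x - s z has norm at least s - 1 = 2 \<delta>, where the kernel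
  vanishes. So integrating over the disc alone gives the full average.\<close>

lemma mollify_outer:
  fixes v :: "real^2 \<Rightarrow> 'b::euclidean_space"
  assumes v: "continuous_on UNIV v" and d: "\<delta> > 0" and s: "s = 1 + 2 * \<delta>" and x: "norm x < 1"
  shows "mollify s \<delta> v x = (\<integral>y. moll y *\<^sub>R v ((1 / s) *\<^sub>R (x - \<delta> *\<^sub>R y)) \<partial>lborel)"
proof -
  have s0: "s > 0" using s d by simp
  have "mollify s \<delta> v x = (\<integral>z. moll_kernel s \<delta> (x - s *\<^sub>R z) *\<^sub>R v z \<partial>lborel)"
    unfolding mollify_def
  proof (rule integral_lebesgue_on_lborel[OF open_ball])
    have "continuous_on UNIV (\<lambda>z. moll_kernel s \<delta> (x - s *\<^sub>R z))"
      by (rule continuous_on_compose2[OF continuous_smooth[OF smooth_moll_kernel]]) (auto intro!: continuous_intros)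
    then show "(\<lambda>z. moll_kernel s \<delta> (x - s *\<^sub>R z) *\<^sub>R v z) \<in> borel_measurable borel"
      by (intro borel_measurable_continuous_onI continuous_on_scaleR v)
    fix z :: "real^2" assume "z \<notin> disc"
    then have "s * 1 \<le> s * norm z" using s0 by (intro mult_left_mono) auto
    moreover have "norm (s *\<^sub>R z) \<le> norm (x - s *\<^sub>R z) + norm x"
      using norm_triangle_ineq4[of x "x - s *\<^sub>R z"] by simp
    moreover have "norm (s *\<^sub>R z) = s * norm z" using s0 by simp
    ultimately have "\<delta> \<le> norm (x - s *\<^sub>R z)" using x s d by linarith
    then show "moll_kernel s \<delta> (x - s *\<^sub>R z) *\<^sub>R v z = 0" using moll_kernel_eq_0[OF d] by simp
  qed
  also have "\<dots> = (\<integral>y. moll y *\<^sub>R v ((1 / s) *\<^sub>R (x - \<delta> *\<^sub>R y)) \<partial>lborel)"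
    unfolding moll_kernel_def
    by (rule moll_average_substitution[OF s0 d borel_measurable_continuous_onI[OF v], symmetric])
  finally show ?thesis .
qed

section \<open>Rellich compactness\<close>

text \<open>The error is an average of increments of v over segments of length at most 3 \<delta>
  that stay in the disc by convexity. The affine maps involved shrink by at most the factor 1/s,
  which costs s \<le> 3 in the norm; together this gives 9 \<delta>.\<close>

lemma mollify_approx:
  fixes v :: "real^2 \<Rightarrow> 'b::euclidean_space"
  assumes v: "Ck (Suc 0) v" and d: "\<delta> > 0" "\<delta> \<le> 1"
  shows "L2_norm (lebesgue_on disc) (\<lambda>x. mollify (1 + 2 * \<delta>) \<delta> v x - v x) \<le> 9 * \<delta> * L2_norm (lebesgue_on disc) (grad v)"
proof -
  define s where "s = 1 + 2 * \<delta>"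
  have s0: "s > 0" "1 < s" "s \<le> 3" using d by (auto simp: s_def)
  let ?M = "lebesgue_on disc"
  have cv: "continuous_on UNIV v" by (rule Ck_imp_continuous_on[OF v])
  have cg: "continuous_on UNIV (grad v)" by (rule continuous_on_grad[OF v])
  have [measurable]: "v \<in> borel_measurable borel" "grad v \<in> borel_measurable borel"
    by (rule borel_measurable_continuous_onI[OF cv] borel_measurable_continuous_onI[OF cg])+
  note sq = square_integrable_C1[OF disc_open_bounded v]
  have cm: "continuous_on UNIV (mollify s \<delta> v)"
    by (rule continuous_smooth[OF smooth_mollify[OF disc_integrable[OF sq(1)]]])
  have cdiff: "continuous_on UNIV (\<lambda>x. mollify s \<delta> v x - v x)" by (intro continuous_intros cm cv)
  let ?p = "\<lambda>x y. (1 / s) *\<^sub>R (x - \<delta> *\<^sub>R y)"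
  \<comment> \<open>The point at time t on the segment from x to the sample point is an affine
    function of x with ratio and offset depending on (y, t), so one average over the pairs (y, t)
    covers mollification and line integral together.\<close>
  let ?\<alpha> = "\<lambda>(y :: real^2, t). 1 - t + t / s" and ?\<beta> = "\<lambda>(y :: real^2, t). (- (t * \<delta> / s)) *\<^sub>R y"
  let ?w = "\<lambda>(y, t). ennreal (moll y) * indicator {0..1::real} t"
  let ?g = "\<lambda>p. ennreal ((norm ((3 * \<delta>) *\<^sub>R grad v p))\<^sup>2)"
  have pdisc: "?p x y \<in> disc" if "x \<in> disc" "moll y \<noteq> 0" for x y
  proof -
    have y: "norm y < 1" using moll_facts(3)[of y] that(2) by force
    have "norm (x - \<delta> *\<^sub>R y) \<le> norm x + norm (\<delta> *\<^sub>R y)" by (rule norm_triangle_ineq4)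
    also have "norm (\<delta> *\<^sub>R y) \<le> \<delta>" using d y by (simp add: mult_left_le)
    finally have "norm (x - \<delta> *\<^sub>R y) < s" using that(1) d by (simp add: s_def)
    then show ?thesis using s0 by (simp add: divide_simps)
  qed
  have point: "?\<beta> (y, t) + ?\<alpha> (y, t) *\<^sub>R x = x + t *\<^sub>R (?p x y - x)" for x y t
    by (simp add: algebra_simps scaleR_diff_right)
  \<comment> \<open>The dilation by 1/s displaces x by at most 2 \<delta>, the shift by y adds at
    most \<delta>.\<close>
  have hbound: "norm (?p x y - x) \<le> 3 * \<delta>" if "x \<in> disc" "moll y \<noteq> 0" for x y
  proof -
    have y: "norm y < 1" using moll_facts(3)[of y] that(2) by force
    have "?p x y - x = - (((2 * \<delta>) / s) *\<^sub>R x + (\<delta> / s) *\<^sub>R y)"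
    proof -
      have "1 / s - 1 = - (2 * \<delta> / s)" using s0 by (simp add: field_simps s_def)
      then have "(1 / s) *\<^sub>R x - x = (- (2 * \<delta> / s)) *\<^sub>R x" by (metis scaleR_left_diff_distrib scaleR_one)
      then show ?thesis by (simp add: scaleR_diff_right algebra_simps)
    qed
    also have "norm \<dots> \<le> norm (((2 * \<delta>) / s) *\<^sub>R x) + norm ((\<delta> / s) *\<^sub>R y)"
      unfolding norm_minus_cancel by (rule norm_triangle_ineq)
    also have "norm (((2 * \<delta>) / s) *\<^sub>R x) \<le> 2 * \<delta> * 1"
    proof -
      have "(2 * \<delta>) / s \<le> 2 * \<delta>" using s0 d by (simp add: divide_le_eq mult_le_cancel_left1)
      then have "(2 * \<delta>) / s * norm x \<le> 2 * \<delta> * 1" using that(1) d s0 by (intro mult_mono) auto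
      then show ?thesis using d s0 by simp
    qed
    also have "norm ((\<delta> / s) *\<^sub>R y) \<le> \<delta> * 1"
    proof -
      have "\<delta> / s \<le> \<delta>" using s0 d by (simp add: divide_le_eq mult_le_cancel_left1)
      then have "\<delta> / s * norm y \<le> \<delta> * 1" using y d s0 by (intro mult_mono) auto
      then show ?thesis using d s0 by simp
    qed
    finally show ?thesis by simp
  qed
  have bound: "indicator disc x * ennreal ((norm (mollify s \<delta> v x - v x))\<^sup>2)
      \<le> indicator disc x * (\<integral>\<^sup>+q. ?w q * ?g (?\<beta> q + ?\<alpha> q *\<^sub>R x) \<partial>lborel)" for x
  proof (cases "x \<in> disc")
    case True
    have peq: "?p x y = (1 / s) *\<^sub>R x + (- (\<delta> / s)) *\<^sub>R y" for y by (simp add: scaleR_diff_right)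
    have "mollify s \<delta> v x = (\<integral>y. moll y *\<^sub>R v (?p x y) \<partial>lborel)"
      by (rule mollify_outer[OF cv d(1) s_def]) (use True in simp)
    moreover have "v x = (\<integral>y. moll y *\<^sub>R v x \<partial>lborel)" using moll_facts(4,5) by simp
    ultimately have "mollify s \<delta> v x - v x = (\<integral>y. moll y *\<^sub>R v (?p x y) - moll y *\<^sub>R v x \<partial>lborel)"
      using integrable_moll_translate[OF cv, of "(1 / s) *\<^sub>R x" "- (\<delta> / s)"] integrable_scaleR_left[OF moll_facts(4), of "v x"]
      by (simp only: peq Bochner_Integration.integral_diff)
    also have "\<dots> = (\<integral>y. moll y *\<^sub>R (v (?p x y) - v x) \<partial>lborel)" by (simp only: scaleR_diff_right)
    finally have "ennreal ((norm (mollify s \<delta> v x - v x))\<^sup>2) \<le> (\<integral>\<^sup>+y. ennreal (moll y) * ennreal ((norm (v (?p x y) - v x))\<^sup>2) \<partial>lborel)"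
      using norm_weighted_integral_power2_le[of "\<lambda>y. v (?p x y) - v x" lborel moll] moll_facts(2,4,5) by simp
    also have "\<dots> \<le> (\<integral>\<^sup>+y. (\<integral>\<^sup>+t. ?w (y, t) * ?g (?\<beta> (y, t) + ?\<alpha> (y, t) *\<^sub>R x) \<partial>lborel) \<partial>lborel)"
    proof (rule nn_integral_mono)
      fix y
      show "ennreal (moll y) * ennreal ((norm (v (?p x y) - v x))\<^sup>2)
        \<le> (\<integral>\<^sup>+t. ?w (y, t) * ?g (?\<beta> (y, t) + ?\<alpha> (y, t) *\<^sub>R x) \<partial>lborel)"
      proof (cases "moll y = 0")
        case False
        let ?h = "?p x y - x"
        have "ennreal ((norm (v (?p x y) - v x))\<^sup>2)
          \<le> (\<integral>\<^sup>+t. indicator {0..1} t * ennreal ((norm (frechet_derivative v (at (x + t *\<^sub>R ?h)) ?h))\<^sup>2) \<partial>lborel)"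
          using C1_increment_power2_le[OF v, of x ?h] by simp
        also have "\<dots> \<le> (\<integral>\<^sup>+t. indicator {0..1} t * ?g (?\<beta> (y, t) + ?\<alpha> (y, t) *\<^sub>R x) \<partial>lborel)"
        proof (intro nn_integral_mono mult_left_mono ennreal_leI power_mono)
          fix t :: real
          have "norm (frechet_derivative v (at (x + t *\<^sub>R ?h)) ?h) \<le> norm ?h * norm (grad v (x + t *\<^sub>R ?h))"
            by (rule norm_frechet_derivative_le_grad[OF v])
          also have "\<dots> \<le> (3 * \<delta>) * norm (grad v (x + t *\<^sub>R ?h))"
            by (rule mult_right_mono[OF hbound[OF True False]]) simp
          finally show "norm (frechet_derivative v (at (x + t *\<^sub>R ?h)) ?h) \<le> norm ((3 * \<delta>) *\<^sub>R grad v (?\<beta> (y, t) + ?\<alpha> (y, t) *\<^sub>R x))"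
            unfolding point using d(1) by simp
        qed auto
        finally have "ennreal (moll y) * ennreal ((norm (v (?p x y) - v x))\<^sup>2)
          \<le> ennreal (moll y) * (\<integral>\<^sup>+t. indicator {0..1} t * ?g (?\<beta> (y, t) + ?\<alpha> (y, t) *\<^sub>R x) \<partial>lborel)"
          by (rule mult_left_mono) simp
        also have "\<dots> = (\<integral>\<^sup>+t. ?w (y, t) * ?g (?\<beta> (y, t) + ?\<alpha> (y, t) *\<^sub>R x) \<partial>lborel)"
          by (subst nn_integral_cmult[symmetric]) (auto simp: mult.assoc)
        finally show ?thesis .
      qed simp
    qed
    also have "\<dots> = (\<integral>\<^sup>+q. ?w q * ?g (?\<beta> q + ?\<alpha> q *\<^sub>R x) \<partial>(lborel \<Otimes>\<^sub>M lborel))"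
      by (rule lborel.nn_integral_fst) measurable
    finally show ?thesis by (simp add: lborel_prod mult_left_mono)
  qed simp
  have "(\<integral>\<^sup>+x. ennreal ((norm (mollify s \<delta> v x - v x))\<^sup>2) \<partial>?M) = (\<integral>\<^sup>+x. indicator disc x * ennreal ((norm (mollify s \<delta> v x - v x))\<^sup>2) \<partial>lborel)"
    by (rule nn_integral_lebesgue_on_lborel[OF open_ball borel_measurable_continuous_onI[OF cdiff]])
  also have "\<dots> \<le> (\<integral>\<^sup>+x. indicator disc x * (\<integral>\<^sup>+q. ?w q * ?g (?\<beta> q + ?\<alpha> q *\<^sub>R x) \<partial>lborel) \<partial>lborel)"
    by (rule nn_integral_mono) (rule bound)
  \<comment> \<open>The ratio 1 - t + t/s decreases from 1 to 1/s on the unit interval, so 1/s is a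
    lower bound.\<close>
  also have "\<dots> \<le> ennreal ((1 / (1 / s)) ^ DIM(real^2)) * (\<integral>\<^sup>+q. ?w q \<partial>lborel) * (\<integral>\<^sup>+x. indicator disc x * ?g x \<partial>lborel)"
  proof (rule nn_integral_affine_average_le)
    fix q assume q: "?w q \<noteq> 0"
    obtain y t where yt: "q = (y, t)" by (cases q)
    have my: "moll y \<noteq> 0" and t: "0 \<le> t" "t \<le> 1" using q by (auto simp: yt indicator_def split: if_splits)
    have "t * (1 - 1 / s) \<le> 1 * (1 - 1 / s)" using t s0 by (intro mult_right_mono) auto
    then show "1 / s \<le> ?\<alpha> q" by (simp add: yt algebra_simps)
    fix x :: "real^2" assume x: "x \<in> disc"
    have "(1 - t) *\<^sub>R x + t *\<^sub>R ?p x y \<in> disc"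
      by (rule convexD[OF convex_ball x pdisc[OF x my]]) (use t in auto)
    also have "(1 - t) *\<^sub>R x + t *\<^sub>R ?p x y = ?\<beta> q + ?\<alpha> q *\<^sub>R x"
      unfolding yt point by (simp add: algebra_simps)
    finally show "?\<beta> q + ?\<alpha> q *\<^sub>R x \<in> disc" .
  qed (use s0 in \<open>auto simp: borel_prod[symmetric]\<close>)
  also have "(\<integral>\<^sup>+q. ?w q \<partial>lborel) = 1"
  proof -
    have "(\<integral>\<^sup>+q. ?w q \<partial>(lborel \<Otimes>\<^sub>M lborel)) = (\<integral>\<^sup>+y. (\<integral>\<^sup>+t. ?w (y, t) \<partial>lborel) \<partial>lborel)"
      by (rule lborel.nn_integral_fst[symmetric]) measurable
    also have "\<dots> = (\<integral>\<^sup>+y. ennreal (moll y) \<partial>lborel)"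
      by (rule nn_integral_cong) (simp add: nn_integral_cmult)
    finally show ?thesis by (simp add: lborel_prod nn_integral_moll)
  qed
  also have "(\<integral>\<^sup>+x. indicator disc x * ?g x \<partial>lborel) = (\<integral>\<^sup>+x. ?g x \<partial>?M)"
    by (rule nn_integral_lebesgue_on_lborel[symmetric]) auto
  also have "\<dots> = ennreal ((3 * \<delta> * L2_norm ?M (grad v))\<^sup>2)"
    using nn_integral_L2_norm[OF square_integrable_scaleR[OF sq(2)], of "3 * \<delta>"] d(1) by (simp add: L2_norm_scaleR)
  also have "ennreal ((1 / (1 / s)) ^ DIM(real^2)) * 1 * ennreal ((3 * \<delta> * L2_norm ?M (grad v))\<^sup>2)
      = ennreal ((s * (3 * \<delta> * L2_norm ?M (grad v)))\<^sup>2)"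
    by (simp add: ennreal_mult[symmetric] power_mult_distrib)
  finally have "(L2_norm ?M (\<lambda>x. mollify s \<delta> v x - v x))\<^sup>2 \<le> (s * (3 * \<delta> * L2_norm ?M (grad v)))\<^sup>2"
    using nn_integral_L2_norm[OF square_integrable_continuous[OF disc_open_bounded cdiff]] by (simp add: ennreal_le_iff)
  then have "L2_norm ?M (\<lambda>x. mollify s \<delta> v x - v x) \<le> s * (3 * \<delta> * L2_norm ?M (grad v))"
    by (rule power2_le_imp_le) (use d(1) s0(1) in simp)
  also have "\<dots> \<le> 3 * (3 * \<delta> * L2_norm ?M (grad v))"
    using s0 d by (intro mult_right_mono) auto
  finally show ?thesis unfolding s_def by simp
qed

lemma C1_bounded_support_Lipschitz:
  fixes \<psi> :: "real^'n \<Rightarrow> real"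
  assumes \<psi>: "Ck (Suc 0) \<psi>" and z: "\<And>x. R \<le> norm x \<Longrightarrow> \<psi> x = 0"
  obtains L where "L > 0" "\<And>x. \<bar>\<psi> x\<bar> \<le> L" "\<And>x y. \<bar>\<psi> x - \<psi> y\<bar> \<le> L * norm (x - y)"
proof -
  have c: "continuous_on UNIV \<psi>" by (rule Ck_imp_continuous_on[OF \<psi>])
  have cg: "continuous_on UNIV (grad \<psi>)" by (rule continuous_on_grad[OF \<psi>])
  obtain B1 where B1: "\<And>x. x \<in> cball 0 R \<Longrightarrow> norm (\<psi> x) \<le> B1" using continuous_bounded_on[OF bounded_cball c] by blast
  obtain B2 where B2: "\<And>x. x \<in> cball 0 R \<Longrightarrow> norm (grad \<psi> x) \<le> B2" using continuous_bounded_on[OF bounded_cball cg] by blast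
  let ?L = "\<bar>B1\<bar> + \<bar>B2\<bar> + 1"
  have g: "norm (grad \<psi> x) \<le> ?L" for x
  proof (cases "x \<in> cball 0 R")
    case True
    then show ?thesis using B2[OF True] by simp
  next
    case False
    then have "grad \<psi> x = 0"
      unfolding vec_eq_iff grad_component
      by (auto intro!: frechet_derivative_eq_0[of "{x. R < norm x}"] z open_Collect_less continuous_intros)
    then show ?thesis by simp
  qed
  have "\<bar>\<psi> x\<bar> \<le> ?L" for x
  proof (cases "x \<in> cball 0 R")
    case True
    then show ?thesis using B1[OF True] by simp
  next
    case False
    then show ?thesis using z[of x] by simp
  qed
  moreover have "\<bar>\<psi> x - \<psi> y\<bar> \<le> ?L * norm (x - y)" for x y
  proof -
    have line: "((\<lambda>t. frechet_derivative \<psi> (at (y + t *\<^sub>R (x - y))) (x - y)) has_integral (\<psi> (y + (x - y)) - \<psi> y)) {0..1}"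
      by (rule has_integral_line[OF \<psi>])
    have "norm (frechet_derivative \<psi> (at q) (x - y)) \<le> ?L * norm (x - y)" for q
      using order_trans[OF norm_frechet_derivative_le_grad[OF \<psi>] mult_left_mono[OF g norm_ge_zero]]
      by (simp add: mult.commute)
    from has_integral_bound_real[OF _ finite.emptyI line this]
    show ?thesis by simp
  qed
  ultimately show ?thesis using that[of ?L] by simp
qed

lemma integral_norm_disc_le:
  assumes "square_integrable (lebesgue_on disc) f"
  shows "(\<integral>x. norm (f x) \<partial>lebesgue_on disc) \<le> L2_norm (lebesgue_on disc) (\<lambda>x. 1::real) * L2_norm (lebesgue_on disc) f"
  using L2_norm_mult_le[OF square_integrable_const[OF disc_finite_measure, of "1::real"] assms] by simp

text \<open>At a fixed scale the constant is the same for all F: this is the equicontinuity behind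
  Rellich's theorem. It comes from the Lipschitz bound of the kernel and the embedding of L2 into L1
  on the disc.\<close>

lemma mollify_equi_Lipschitz:
  assumes d: "\<delta> > 0"
  obtains C where "C > 0"
    "\<And>(F :: real^2 \<Rightarrow> 'b::euclidean_space) x. square_integrable (lebesgue_on disc) F \<Longrightarrow>
      norm (mollify s \<delta> F x) \<le> C * L2_norm (lebesgue_on disc) F"
    "\<And>(F :: real^2 \<Rightarrow> 'b::euclidean_space) x y. square_integrable (lebesgue_on disc) F \<Longrightarrow>
      norm (mollify s \<delta> F x - mollify s \<delta> F y) \<le> C * L2_norm (lebesgue_on disc) F * norm (x - y)"
proof -
  let ?M = "lebesgue_on disc"
  have k: "Ck (Suc 0) (moll_kernel s \<delta>)" using smooth_moll_kernel by (simp only: smooth_def)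
  obtain L where L: "L > 0" "\<And>x. \<bar>moll_kernel s \<delta> x\<bar> \<le> L"
    "\<And>x y. \<bar>moll_kernel s \<delta> x - moll_kernel s \<delta> y\<bar> \<le> L * norm (x - y)"
    using C1_bounded_support_Lipschitz[OF k moll_kernel_eq_0[OF d]] by blast
  let ?V = "L2_norm ?M (\<lambda>x. 1::real)"
  \<comment> \<open>\<open>?V\<close> is the norm of the constant 1, the price of passing from L1 to
    L2; the added 1 makes positivity immediate.\<close>
  let ?C = "L * (?V + 1)"
  have C: "?C > 0" using L(1) L2_norm_nonneg[of ?M "\<lambda>x. 1::real"] by (intro mult_pos_pos add_nonneg_pos) simp_all
  have int: "integrable ?M (\<lambda>z. moll_kernel s \<delta> (x - s *\<^sub>R z) *\<^sub>R F z)"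
    if F: "square_integrable ?M F" for F :: "real^2 \<Rightarrow> 'b" and x
  proof -
    have "continuous_on UNIV (\<lambda>z. moll_kernel s \<delta> (x - s *\<^sub>R z))"
      by (rule continuous_on_compose2[OF continuous_smooth[OF smooth_moll_kernel]]) (auto intro!: continuous_intros)
    then show ?thesis
      by (rule integrable_bilinear_L2[OF bounded_bilinear_scaleR square_integrable_continuous[OF disc_open_bounded] F])
  qed
  \<comment> \<open>Used with c = 1 for the sup bound and with c the distance of two points for the
    Lipschitz bound.\<close>
  have key: "norm (\<integral>z. \<kappa> z *\<^sub>R F z \<partial>?M) \<le> c * ?C * L2_norm ?M F"
    if F: "square_integrable ?M F" and i: "integrable ?M (\<lambda>z. \<kappa> z *\<^sub>R F z)" and b: "\<And>z. \<bar>\<kappa> z\<bar> \<le> c * L" and c: "0 \<le> c"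
    for F :: "real^2 \<Rightarrow> 'b" and \<kappa> and c :: real
  proof -
    have "norm (\<integral>z. \<kappa> z *\<^sub>R F z \<partial>?M) \<le> (\<integral>z. norm (\<kappa> z *\<^sub>R F z) \<partial>?M)" by (rule integral_norm_bound)
    also have "\<dots> \<le> (\<integral>z. c * L * norm (F z) \<partial>?M)"
      by (rule integral_mono[OF integrable_norm[OF i]])
        (use disc_integrable[OF F] b in \<open>auto intro!: mult_right_mono\<close>)
    also have "\<dots> = c * L * (\<integral>z. norm (F z) \<partial>?M)" by simp
    also have "\<dots> \<le> c * L * (?V * L2_norm ?M F)"
      using integral_norm_disc_le[OF F] c L(1) by (intro mult_left_mono) auto
    also have "\<dots> \<le> c * L * ((?V + 1) * L2_norm ?M F)"
      using c L(1) by (intro mult_left_mono mult_right_mono) auto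
    finally show ?thesis by (simp add: mult_ac)
  qed
  show ?thesis
  proof (rule that[OF C])
    fix F :: "real^2 \<Rightarrow> 'b" and x y assume F: "square_integrable ?M F"
    show "norm (mollify s \<delta> F x) \<le> ?C * L2_norm ?M F"
      unfolding mollify_def using key[OF F int[OF F], of _ 1] L(2) by simp
    have "mollify s \<delta> F x - mollify s \<delta> F y
      = (\<integral>z. (moll_kernel s \<delta> (x - s *\<^sub>R z) - moll_kernel s \<delta> (y - s *\<^sub>R z)) *\<^sub>R F z \<partial>?M)"
      unfolding mollify_def scaleR_diff_left by (rule Bochner_Integration.integral_diff[OF int[OF F] int[OF F], symmetric])
    moreover have "norm \<dots> \<le> norm (x - y) * ?C * L2_norm ?M F"
    proof (rule key[OF F])
      show "integrable ?M (\<lambda>z. (moll_kernel s \<delta> (x - s *\<^sub>R z) - moll_kernel s \<delta> (y - s *\<^sub>R z)) *\<^sub>R F z)"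
        unfolding scaleR_diff_left by (rule Bochner_Integration.integrable_diff[OF int[OF F] int[OF F]])
      show "\<bar>moll_kernel s \<delta> (x - s *\<^sub>R z) - moll_kernel s \<delta> (y - s *\<^sub>R z)\<bar> \<le> norm (x - y) * L" for z
        using L(3)[of "x - s *\<^sub>R z" "y - s *\<^sub>R z"] by (simp add: mult.commute)
    qed simp
    ultimately show "norm (mollify s \<delta> F x - mollify s \<delta> F y) \<le> ?C * L2_norm ?M F * norm (x - y)"
      by (simp add: mult_ac)
  qed
qed

section \<open>Dominated convergence in L2 and the compactness theorem\<close>

lemma L2_dominated_tendsto:
  fixes f :: "nat \<Rightarrow> 'a \<Rightarrow> 'b::euclidean_space" and h :: "'a \<Rightarrow> real"
  assumes m: "\<And>n. f n \<in> borel_measurable M" "g \<in> borel_measurable M"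
    and h: "square_integrable M h"
    and b: "\<And>n. AE x in M. norm (f n x - g x) \<le> h x"
    and l: "AE x in M. (\<lambda>n. f n x) \<longlonglongrightarrow> g x"
  shows "(\<lambda>n. L2_norm M (\<lambda>x. f n x - g x)) \<longlonglongrightarrow> 0"
proof -
  have "(\<lambda>n. \<integral>x. (norm (f n x - g x))\<^sup>2 \<partial>M) \<longlonglongrightarrow> (\<integral>x. 0 \<partial>M)"
  proof (rule integral_dominated_convergence)
    show "integrable M (\<lambda>x. (norm (h x))\<^sup>2)" by (rule square_integrable_integrable[OF h])
    show "(\<lambda>x. (norm (f n x - g x))\<^sup>2) \<in> borel_measurable M" for n using m by measurable
    show "AE x in M. (\<lambda>n. (norm (f n x - g x))\<^sup>2) \<longlonglongrightarrow> 0"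
      using l
    proof eventually_elim
      case (elim x)
      from tendsto_power[OF tendsto_norm[OF LIM_zero[OF elim]], of 2] show ?case by simp
    qed
    show "AE x in M. norm ((norm (f n x - g x))\<^sup>2) \<le> (norm (h x))\<^sup>2" for n
      using b[of n]
    proof eventually_elim
      case (elim x)
      then have "norm (f n x - g x) \<le> norm (h x)" by simp
      from power_mono[OF this norm_ge_zero, of 2] show ?case by simp
    qed
  qed simp
  from tendsto_real_sqrt[OF this]
  show "(\<lambda>n. L2_norm M (\<lambda>x. f n x - g x)) \<longlonglongrightarrow> 0" by (simp add: L2_norm_def)
qed

lemma bounded_convergent_L2_disc:
  fixes f :: "nat \<Rightarrow> real^2 \<Rightarrow> 'b::euclidean_space"
  assumes m: "\<And>n. f n \<in> borel_measurable (lebesgue_on disc)"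
    and b: "\<And>n x. x \<in> disc \<Longrightarrow> norm (f n x) \<le> C"
    and l: "\<And>x. x \<in> disc \<Longrightarrow> (\<lambda>n. f n x) \<longlonglongrightarrow> g x"
  shows "square_integrable (lebesgue_on disc) g"
    "(\<lambda>n. L2_norm (lebesgue_on disc) (\<lambda>x. f n x - g x)) \<longlonglongrightarrow> 0"
proof -
  let ?M = "lebesgue_on disc"
  have gm: "g \<in> borel_measurable ?M" by (rule borel_measurable_LIMSEQ_metric[of f]) (simp_all add: l m)
  have gb: "norm (g x) \<le> C" if "x \<in> disc" for x
    by (rule LIMSEQ_le_const2[OF tendsto_norm[OF l[OF that]]]) (use b[OF that] in auto)
  show "square_integrable ?M g"
    by (rule square_integrable_bound(1)[OF square_integrable_const[OF disc_finite_measure, of "1::real"] gm, of C])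
      (use gb in \<open>auto intro!: AE_I2\<close>)
  show "(\<lambda>n. L2_norm ?M (\<lambda>x. f n x - g x)) \<longlonglongrightarrow> 0"
  proof (rule L2_dominated_tendsto[OF m gm square_integrable_const[OF disc_finite_measure, of "2 * C"]])
    show "AE x in ?M. norm (f n x - g x) \<le> 2 * C" for n
    proof (rule AE_I2)
      fix x assume "x \<in> space ?M"
      then have "norm (f n x) \<le> C" "norm (g x) \<le> C" using b gb by auto
      then show "norm (f n x - g x) \<le> 2 * C" using norm_triangle_ineq4[of "f n x" "g x"] by simp
    qed
    show "AE x in ?M. (\<lambda>n. f n x) \<longlonglongrightarrow> g x" using l by (intro AE_I2) simp
  qed
qed

text \<open>At each scale the mollified sequence is bounded and equi-Lipschitz, so a diagonal
  subsequence converges pointwise, hence in L2, at all scales simultaneously. The mollification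
  error is small uniformly in the sequence by the gradient bound, so the original subsequence is
  Cauchy.\<close>

lemma Rellich_C1:
  fixes v :: "nat \<Rightarrow> real^2 \<Rightarrow> 'b::euclidean_space"
  assumes v: "\<And>k. Ck (Suc 0) (v k)"
    and B: "\<And>k. L2_norm (lebesgue_on disc) (v k) \<le> B" "\<And>k. L2_norm (lebesgue_on disc) (grad (v k)) \<le> B"
  obtains r :: "nat \<Rightarrow> nat" where "strict_mono r"
    "\<And>e. e > 0 \<Longrightarrow> \<exists>K. \<forall>m\<ge>K. \<forall>n\<ge>K. L2_norm (lebesgue_on disc) (\<lambda>x. v (r m) x - v (r n) x) < e"
proof -
  let ?M = "lebesgue_on disc"
  note sq = square_integrable_C1[OF disc_open_bounded v]
  have B0: "0 \<le> B" using B(1)[of 0] L2_norm_nonneg order_trans by blast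
  define \<delta> where "\<delta> j = 1 / real (Suc j)" for j
  have d: "\<delta> j > 0" "\<delta> j \<le> 1" for j by (auto simp: \<delta>_def)
  define T where "T j k = mollify (1 + 2 * \<delta> j) (\<delta> j) (v k)" for j k
  have "\<exists>C>0. \<forall>k x y. norm (T j k x) \<le> C \<and> norm (T j k x - T j k y) \<le> C * norm (x - y)" for j
  proof -
    obtain C where C: "C > 0"
      "\<And>(F :: real^2 \<Rightarrow> 'b) x. square_integrable ?M F \<Longrightarrow> norm (mollify (1 + 2 * \<delta> j) (\<delta> j) F x) \<le> C * L2_norm ?M F"
      "\<And>(F :: real^2 \<Rightarrow> 'b) x y. square_integrable ?M F \<Longrightarrow>
        norm (mollify (1 + 2 * \<delta> j) (\<delta> j) F x - mollify (1 + 2 * \<delta> j) (\<delta> j) F y) \<le> C * L2_norm ?M F * norm (x - y)"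
      using mollify_equi_Lipschitz[OF d(1)[of j]] by blast
    have le: "C * L2_norm ?M (v k) \<le> C * (B + 1)" for k
      using B(1)[of k] C(1) by (intro mult_left_mono) auto
    have "norm (T j k x) \<le> C * (B + 1)" "norm (T j k x - T j k y) \<le> C * (B + 1) * norm (x - y)" for k x y
      unfolding T_def using order_trans[OF C(2)[OF sq(1)] le]
        order_trans[OF C(3)[OF sq(1)] mult_right_mono[OF le norm_ge_zero]] by blast+
    moreover have "C * (B + 1) > 0" using C(1) B0 by simp
    ultimately show ?thesis by blast
  qed
  then obtain C where C: "\<And>j. C j > 0" "\<And>j k x. norm (T j k x) \<le> C j"
    "\<And>j k x y. norm (T j k x - T j k y) \<le> C j * norm (x - y)" by metis
  obtain D :: "(real^2) set" where D: "countable D" "\<And>X. open X \<Longrightarrow> X \<noteq> {} \<Longrightarrow> \<exists>q\<in>D. q \<in> X"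
    using countable_dense_exists by metis
  have cD: "countable (D \<times> (UNIV :: nat set))" using D(1) by simp
  \<comment> \<open>Dividing by the constant of the scale bounds everything by 1, so a single
    diagonal extraction over the countable set of pairs (point, scale) suffices.\<close>
  define f where "f n p = (1 / C (snd p)) *\<^sub>R T (snd p) n (fst p)" for n and p :: "(real^2) \<times> nat"
  have nb: "norm (f n p) \<le> 1" for n p
    using C(1,2) by (simp add: f_def divide_le_eq_1 less_imp_le)
  obtain r where r: "strict_mono r" "\<And>p. p \<in> D \<times> UNIV \<Longrightarrow> \<exists>l. (\<lambda>n. f (r n) p) \<longlonglongrightarrow> l"
    by (rule function_convergent_subsequence[of "D \<times> UNIV" f 1, OF cD nb]) blast
  have convD: "convergent (\<lambda>n. T j (r n) q)" if q: "q \<in> D" for j q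
  proof -
    obtain l where "(\<lambda>n. (1 / C j) *\<^sub>R T j (r n) q) \<longlonglongrightarrow> l" using r(2)[of "(q, j)"] q by (auto simp: f_def)
    from tendsto_scaleR[OF tendsto_const[of "C j"] this] have "(\<lambda>n. T j (r n) q) \<longlonglongrightarrow> C j *\<^sub>R l"
      using C(1)[of j] by simp
    then show ?thesis by (rule convergentI)
  qed
  \<comment> \<open>The uniform Lipschitz bound carries convergence from the dense set to every
    point.\<close>
  have conv: "convergent (\<lambda>n. T j (r n) x)" for j x
  proof -
    have "Cauchy (\<lambda>n. T j (r n) x)"
    proof (rule metric_CauchyI)
      fix e :: real assume e: "e > 0"
      have e3: "e / (3 * C j) > 0" using e C(1)[of j] by simp
      obtain q where q: "q \<in> D" "dist x q < e / (3 * C j)" using D(2)[of "ball x (e / (3 * C j))"] e3 by auto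
      have near: "dist (T j k x) (T j k q) < e / 3" for k
      proof -
        have "norm (T j k x - T j k q) \<le> C j * norm (x - q)" by (rule C(3))
        also have "\<dots> < C j * (e / (3 * C j))" using q(2) C(1)[of j] by (intro mult_strict_left_mono) (auto simp: dist_norm)
        also have "\<dots> = e / 3" using C(1)[of j] by simp
        finally show ?thesis by (simp add: dist_norm)
      qed
      obtain K where K: "\<And>m n. K \<le> m \<Longrightarrow> K \<le> n \<Longrightarrow> dist (T j (r m) q) (T j (r n) q) < e / 3"
        using metric_CauchyD[OF convergent_Cauchy[OF convD[OF q(1), of j]], of "e / 3"] e by auto
      have "dist (T j (r m) x) (T j (r n) x) < e" if "K \<le> m" "K \<le> n" for m n
        using near[of "r m"] near[of "r n"] K[OF that] dist_triangle[of "T j (r m) x" "T j (r n) x" "T j (r m) q"]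
          dist_triangle[of "T j (r m) q" "T j (r n) x" "T j (r n) q"] dist_commute[of "T j (r n) q" "T j (r n) x"]
        by linarith
      then show "\<exists>K. \<forall>m\<ge>K. \<forall>n\<ge>K. dist (T j (r m) x) (T j (r n) x) < e" by blast
    qed
    then show ?thesis by (rule Cauchy_convergent)
  qed
  define w where "w j x = lim (\<lambda>n. T j (r n) x)" for j x
  have w: "(\<lambda>n. T j (r n) x) \<longlonglongrightarrow> w j x" for j x
    unfolding w_def using conv by (simp add: convergent_LIMSEQ_iff)
  have Tc: "continuous_on UNIV (T j k)" for j k
    unfolding T_def by (rule continuous_smooth[OF smooth_mollify[OF disc_integrable[OF sq(1)]]])
  have Tsq: "square_integrable ?M (T j k)" for j k by (rule square_integrable_continuous[OF disc_open_bounded Tc])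
  note Tw = bounded_convergent_L2_disc[OF continuous_measurable_lebesgue_on[OF Tc] C(2) w]
  have cauchy: "\<exists>K. \<forall>m\<ge>K. \<forall>n\<ge>K. L2_norm ?M (\<lambda>x. v (r m) x - v (r n) x) < e" if e: "e > 0" for e
  proof -
    \<comment> \<open>The scale is fixed first, uniformly in the sequence. Two of the four quarters
      of e are mollification errors, the other two the distances to the limit at this scale.\<close>
    obtain j where j: "9 * \<delta> j * B < e / 4"
    proof -
      have "(\<lambda>j. 9 * \<delta> j * B) \<longlonglongrightarrow> 9 * 0 * B"
        unfolding \<delta>_def by (intro tendsto_intros LIMSEQ_Suc[OF lim_1_over_n])
      then have "eventually (\<lambda>j. 9 * \<delta> j * B < e / 4) sequentially"
        by (rule order_tendstoD) (use e in simp)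
      then show ?thesis using that by (auto simp: eventually_sequentially)
    qed
    have vT: "L2_norm ?M (\<lambda>x. T j k x - v k x) < e / 4" for k
    proof -
      have "L2_norm ?M (\<lambda>x. T j k x - v k x) \<le> 9 * \<delta> j * L2_norm ?M (grad (v k))"
        unfolding T_def by (rule mollify_approx[OF v d])
      also have "\<dots> \<le> 9 * \<delta> j * B" using B(2) d(1)[of j] by (intro mult_left_mono) auto
      finally show ?thesis using j by simp
    qed
    have "eventually (\<lambda>n. L2_norm ?M (\<lambda>x. T j (r n) x - w j x) < e / 4) sequentially"
      using Tw(2)[of j] by (rule order_tendstoD) (use e in simp)
    then obtain K where K: "\<And>n. n \<ge> K \<Longrightarrow> L2_norm ?M (\<lambda>x. T j (r n) x - w j x) < e / 4"
      by (auto simp: eventually_sequentially)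
    have "L2_norm ?M (\<lambda>x. v (r m) x - v (r n) x) < e" if "m \<ge> K" "n \<ge> K" for m n
    proof -
      note wsq = Tw(1)[of j]
      have "L2_norm ?M (\<lambda>x. v (r m) x - v (r n) x)
          \<le> L2_norm ?M (\<lambda>x. v (r m) x - T j (r m) x) + L2_norm ?M (\<lambda>x. T j (r m) x - v (r n) x)"
        by (rule L2_norm_triangle_diff[OF sq(1) Tsq sq(1)])
      moreover have "L2_norm ?M (\<lambda>x. T j (r m) x - v (r n) x)
          \<le> L2_norm ?M (\<lambda>x. T j (r m) x - w j x) + L2_norm ?M (\<lambda>x. w j x - v (r n) x)"
        by (rule L2_norm_triangle_diff[OF Tsq wsq sq(1)])
      moreover have "L2_norm ?M (\<lambda>x. w j x - v (r n) x)
          \<le> L2_norm ?M (\<lambda>x. w j x - T j (r n) x) + L2_norm ?M (\<lambda>x. T j (r n) x - v (r n) x)"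
        by (rule L2_norm_triangle_diff[OF wsq Tsq sq(1)])
      ultimately show ?thesis
        using vT[of "r m"] vT[of "r n"] K[OF that(1)] K[OF that(2)]
          L2_norm_minus_commute[of ?M "v (r m)" "T j (r m)"] L2_norm_minus_commute[of ?M "w j" "T j (r n)"]
        by linarith
    qed
    then show ?thesis by blast
  qed
  show ?thesis by (rule that[OF r(1) cauchy])
qed

text \<open>Each field is replaced by a C1 function within 1/(k+1), which raises the bounds by 1 and
  disappears in the limit along the subsequence.\<close>

lemma Rellich:
  fixes u :: "nat \<Rightarrow> real^2 \<Rightarrow> 'b::euclidean_space"
  assumes u: "\<And>k. strong_gradient (u k) (G k) disc"
    and B: "\<And>k. L2_norm (lebesgue_on disc) (u k) \<le> B" "\<And>k. L2_norm (lebesgue_on disc) (G k) \<le> B"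
  obtains r :: "nat \<Rightarrow> nat" and u0 where "strict_mono r" "square_integrable (lebesgue_on disc) u0"
    "(\<lambda>n. L2_norm (lebesgue_on disc) (\<lambda>x. u (r n) x - u0 x)) \<longlonglongrightarrow> 0"
proof -
  let ?M = "lebesgue_on disc"
  note sq = strong_gradient_square_integrable[OF u]
  have "\<exists>v. Ck (Suc 0) v \<and> L2_norm ?M (\<lambda>x. v x - u k x) < 1 / real (Suc k)
     \<and> L2_norm ?M (\<lambda>x. grad v x - G k x) < 1 / real (Suc k)" for k
    by (rule strong_gradient_approx[OF disc_open_bounded u]) simp
  then have "\<exists>v. \<forall>k. Ck (Suc 0) (v k) \<and> L2_norm ?M (\<lambda>x. v k x - u k x) < 1 / real (Suc k)
     \<and> L2_norm ?M (\<lambda>x. grad (v k) x - G k x) < 1 / real (Suc k)"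
    by (intro choice allI)
  then obtain v where v: "\<And>k. Ck (Suc 0) (v k)"
    "\<And>k. L2_norm ?M (\<lambda>x. v k x - u k x) < 1 / real (Suc k)"
    "\<And>k. L2_norm ?M (\<lambda>x. grad (v k) x - G k x) < 1 / real (Suc k)" by blast
  note vsq = square_integrable_C1[OF disc_open_bounded v(1)]
  have le1: "1 / real (Suc k) \<le> 1" for k by simp
  have b1: "L2_norm ?M (v k) \<le> B + 1" for k
    using L2_norm_triangle_sub[OF vsq(1)[of k] sq(1)[of k]] B(1)[of k] v(2)[of k] le1[of k] by linarith
  have b2: "L2_norm ?M (grad (v k)) \<le> B + 1" for k
    using L2_norm_triangle_sub[OF vsq(2)[of k] sq(2)[of k]] B(2)[of k] v(3)[of k] le1[of k] by linarith
  obtain r :: "nat \<Rightarrow> nat" where r: "strict_mono r"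
    "\<And>e. e > 0 \<Longrightarrow> \<exists>K. \<forall>m\<ge>K. \<forall>n\<ge>K. L2_norm ?M (\<lambda>x. v (r m) x - v (r n) x) < e"
    by (rule Rellich_C1[of v "B + 1", OF v(1) b1 b2]) blast
  obtain u0 where u0: "square_integrable ?M u0" "(\<lambda>n. L2_norm ?M (\<lambda>x. v (r n) x - u0 x)) \<longlonglongrightarrow> 0"
    by (rule L2_complete[of ?M "\<lambda>n. v (r n)", OF vsq(1) r(2)]) blast
  have "L2_norm ?M (\<lambda>x. u (r n) x - u0 x) \<le> 1 / real (Suc n) + L2_norm ?M (\<lambda>x. v (r n) x - u0 x)" for n
  proof -
    have "1 / real (Suc (r n)) \<le> 1 / real (Suc n)"
      using seq_suble[OF r(1), of n] by (intro divide_left_mono) auto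
    then show ?thesis
      using L2_norm_triangle_diff[OF sq(1)[of "r n"] vsq(1)[of "r n"] u0(1)] v(2)[of "r n"]
        L2_norm_minus_commute[of ?M "v (r n)" "u (r n)"] by linarith
  qed
  then have "(\<lambda>n. L2_norm ?M (\<lambda>x. u (r n) x - u0 x)) \<longlonglongrightarrow> 0"
    by (intro Lim_null_comparison[OF always_eventually tendsto_add_zero[OF LIMSEQ_Suc[OF lim_1_over_n] u0(2)]]) simp
  with r(1) u0(1) show ?thesis by (rule that)
qed

section \<open>Convergence of mollifications\<close>

text \<open>A Lebesgue measurable function is an almost everywhere limit of continuous ones. This
  yields a Borel version vanishing off \<open>U\<close>, on which Tonelli and substitutions can be
  used, and at the same time the continuous approximants for the density theorem.\<close>

lemma borel_representative:
  fixes F :: "'a::euclidean_space \<Rightarrow> 'b::euclidean_space"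
  assumes U: "open U" and F: "F \<in> borel_measurable (lebesgue_on U)"
  obtains g F' N where "\<And>n::nat. continuous_on UNIV (g n)" "negligible N" "F' \<in> borel_measurable borel"
    "\<And>x. x \<notin> U \<Longrightarrow> F' x = 0" "\<And>x. x \<in> U \<Longrightarrow> x \<notin> N \<Longrightarrow> (\<lambda>n. g n x) \<longlonglongrightarrow> F x \<and> F' x = F x"
proof -
  have "F measurable_on U" using F U by (subst measurable_on_iff_borel_measurable) auto
  then obtain N g where g: "negligible N" "\<And>n::nat. continuous_on UNIV (g n)"
    "\<And>x. x \<notin> N \<Longrightarrow> (\<lambda>n. g n x) \<longlonglongrightarrow> (if x \<in> U then F x else 0)"
    unfolding measurable_on_def by blast
  let ?F' = "\<lambda>x. indicator U x *\<^sub>R lim (\<lambda>n. g n x)"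
  show ?thesis
  proof (rule that[of g N ?F'])
    have "(\<lambda>x. lim (\<lambda>n. g n x)) \<in> borel_measurable borel"
      by (rule borel_measurable_lim_metric) (rule borel_measurable_continuous_onI[OF g(2)])
    then show "?F' \<in> borel_measurable borel" using U by (intro borel_measurable_scaleR borel_measurable_indicator) auto
    show "(\<lambda>n. g n x) \<longlonglongrightarrow> F x \<and> ?F' x = F x" if "x \<in> U" "x \<notin> N" for x
      using g(3)[OF that(2)] limI[OF g(3)[OF that(2)]] that(1) by simp
  qed (simp_all add: g)
qed

lemma AE_lebesgue_on_negligible:
  assumes "open U" "negligible N" "\<And>x. x \<in> U \<Longrightarrow> x \<notin> N \<Longrightarrow> P x"
  shows "AE x in lebesgue_on U. P x"
proof -
  have "AE x in lebesgue. x \<notin> N"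
    using assms(2) AE_not_in unfolding negligible_iff_null_sets by blast
  then have "AE x in lebesgue. x \<in> U \<longrightarrow> P x" by eventually_elim (use assms(3) in blast)
  then show ?thesis using assms(1) by (subst AE_restrict_space_iff) auto
qed

text \<open>First the values are retracted to a large ball, then continuous pointwise approximants
  are retracted to the same ball; both steps are dominated convergence.\<close>

lemma continuous_dense_L2:
  fixes F :: "'a::euclidean_space \<Rightarrow> 'b::euclidean_space"
  assumes U: "open U" "bounded U" and F: "square_integrable (lebesgue_on U) F" and e: "e > 0"
  obtains c where "continuous_on UNIV c" "L2_norm (lebesgue_on U) (\<lambda>x. F x - c x) < e"
proof -
  let ?M = "lebesgue_on U"
  have Fm: "F \<in> borel_measurable ?M" by (rule square_integrable_measurable[OF F])
  \<comment> \<open>The radial retraction onto the ball of radius n + 1: continuous, bounded, and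
    eventually the identity at each point.\<close>
  define K where "K n y = (real (Suc n) / max (real (Suc n)) (norm y)) *\<^sub>R y" for n and y :: 'b
  have pos: "max (real (Suc n)) (norm y) > 0" for n and y :: 'b by (rule less_le_trans[of _ "real (Suc n)"]) simp_all
  have Kc: "continuous_on UNIV (K n)" for n
    unfolding K_def using pos by (intro continuous_intros) (auto simp: less_imp_neq[symmetric])
  have Kb: "norm (K n y) \<le> real (Suc n)" for n y
  proof -
    have "norm (K n y) = real (Suc n) / max (real (Suc n)) (norm y) * norm y"
      using pos[of n y] by (simp add: K_def abs_of_pos del: of_nat_Suc)
    also have "\<dots> = real (Suc n) * (norm y / max (real (Suc n)) (norm y))" by simp
    also have "\<dots> \<le> real (Suc n) * 1"
      using pos[of n y] by (intro mult_left_mono) (simp_all add: pos_divide_le_eq)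
    finally show ?thesis by simp
  qed
  have Kn: "norm (K n y - y) \<le> norm y" for n y
  proof -
    let ?a = "real (Suc n) / max (real (Suc n)) (norm y)"
    have a: "0 \<le> ?a" "?a \<le> 1" using pos[of n y] by (simp_all add: pos_divide_le_eq)
    have "K n y - y = (?a - 1) *\<^sub>R y" by (simp add: K_def scaleR_left_diff_distrib)
    then have "norm (K n y - y) = (1 - ?a) * norm y" using a by simp
    also have "\<dots> \<le> 1 * norm y" using a by (intro mult_right_mono) simp_all
    finally show ?thesis by simp
  qed
  have Kl: "(\<lambda>n. K n y) \<longlonglongrightarrow> y" for y
  proof (rule tendsto_eventually)
    obtain n0 where n0: "norm y \<le> real n0" using real_arch_simple by blast
    have "K n y = y" if "n \<ge> n0" for n
    proof -
      have "norm y \<le> real (Suc n)" using n0 that by simp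
      then show ?thesis by (simp add: K_def max_absorb1 del: of_nat_Suc)
    qed
    then show "eventually (\<lambda>n. K n y = y) sequentially" by (auto simp: eventually_sequentially)
  qed
  have Km: "(\<lambda>x. K n (F x)) \<in> borel_measurable ?M" for n by (rule borel_measurable_continuous_on[OF Kc Fm])
  have "(\<lambda>n. L2_norm ?M (\<lambda>x. K n (F x) - F x)) \<longlonglongrightarrow> 0"
  proof (rule L2_dominated_tendsto[OF Km Fm])
    show "square_integrable ?M (\<lambda>x. norm (F x))" using F by (auto simp: square_integrable_def)
  qed (simp_all add: Kn Kl)
  then have "eventually (\<lambda>n. L2_norm ?M (\<lambda>x. K n (F x) - F x) < e / 2) sequentially"
    by (rule order_tendstoD) (use e in simp)
  then obtain n where n: "L2_norm ?M (\<lambda>x. K n (F x) - F x) < e / 2" by (auto simp: eventually_sequentially)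
  have Ksq: "square_integrable ?M (\<lambda>x. K n (F x))"
    by (rule square_integrable_bound(1)[where c="real (Suc n)", OF square_integrable_const[OF finite_measure_lebesgue_on_bounded[OF U], of "1::real"] Km])
      (use Kb[of n] in \<open>auto intro!: AE_I2 simp del: of_nat_Suc\<close>)
  obtain g F' N where g: "\<And>k::nat. continuous_on UNIV (g k)" "negligible N"
    "\<And>x. x \<in> U \<Longrightarrow> x \<notin> N \<Longrightarrow> (\<lambda>k. g k x) \<longlonglongrightarrow> F x \<and> F' x = F x"
    by (rule borel_representative[OF U(1) Fm]) blast
  \<comment> \<open>The approximants carry no bound of their own; composing them with the retraction
    supplies a constant majorant, square integrable because \<open>U\<close> is bounded.\<close>
  have gc: "continuous_on UNIV (\<lambda>x. K n (g k x))" for k by (rule continuous_on_compose2[OF Kc g(1)]) simp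
  have "(\<lambda>k. L2_norm ?M (\<lambda>x. K n (g k x) - K n (F x))) \<longlonglongrightarrow> 0"
  proof (rule L2_dominated_tendsto[OF continuous_measurable_lebesgue_on[OF gc] Km])
    show "square_integrable ?M (\<lambda>x. real (Suc n) + real (Suc n))"
      by (rule square_integrable_const[OF finite_measure_lebesgue_on_bounded[OF U]])
    show "AE x in ?M. norm (K n (g k x) - K n (F x)) \<le> real (Suc n) + real (Suc n)" for k
      by (rule AE_I2) (rule order_trans[OF norm_triangle_ineq4 add_mono[OF Kb Kb]])
    show "AE x in ?M. (\<lambda>k. K n (g k x)) \<longlonglongrightarrow> K n (F x)"
    proof (rule AE_lebesgue_on_negligible[OF U(1) g(2)])
      fix x assume "x \<in> U" "x \<notin> N"
      then have "(\<lambda>k. g k x) \<longlonglongrightarrow> F x" using g(3) by blast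
      then show "(\<lambda>k. K n (g k x)) \<longlonglongrightarrow> K n (F x)"
        by (rule continuous_on_tendsto_compose[OF Kc]) auto
    qed
  qed
  then have "eventually (\<lambda>k. L2_norm ?M (\<lambda>x. K n (g k x) - K n (F x)) < e / 2) sequentially"
    by (rule order_tendstoD) (use e in simp)
  then obtain k where k: "L2_norm ?M (\<lambda>x. K n (g k x) - K n (F x)) < e / 2" by (auto simp: eventually_sequentially)
  have "L2_norm ?M (\<lambda>x. F x - K n (g k x)) \<le> L2_norm ?M (\<lambda>x. F x - K n (F x)) + L2_norm ?M (\<lambda>x. K n (F x) - K n (g k x))"
    by (rule L2_norm_triangle_diff[OF F Ksq square_integrable_continuous[OF U gc]])
  then have "L2_norm ?M (\<lambda>x. F x - K n (g k x)) < e"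
    using n k L2_norm_minus_commute[of ?M F "\<lambda>x. K n (F x)"] L2_norm_minus_commute[of ?M "\<lambda>x. K n (F x)" "\<lambda>x. K n (g k x)"]
    by linarith
  with gc show ?thesis by (rule that)
qed

section \<open>Inner mollification: linearity, contraction and convergence\<close>

lemma moll_kernel_shift_continuous: "continuous_on UNIV (\<lambda>z. moll_kernel s \<delta> (x - s *\<^sub>R z))"
  by (rule continuous_on_compose2[OF continuous_smooth[OF smooth_moll_kernel]]) (auto intro!: continuous_intros)

lemma mollify_integrable:
  assumes "square_integrable (lebesgue_on disc) F"
  shows "integrable (lebesgue_on disc) (\<lambda>z. moll_kernel s \<delta> (x - s *\<^sub>R z) *\<^sub>R F z)"
  by (rule integrable_bilinear_L2[OF bounded_bilinear_scaleR
        square_integrable_continuous[OF disc_open_bounded moll_kernel_shift_continuous] assms])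

lemma mollify_diff:
  assumes "square_integrable (lebesgue_on disc) F" "square_integrable (lebesgue_on disc) H"
  shows "mollify s \<delta> (\<lambda>z. F z - H z) x = mollify s \<delta> F x - mollify s \<delta> H x"
  unfolding mollify_def scaleR_diff_right
  by (rule Bochner_Integration.integral_diff[OF mollify_integrable[OF assms(1)] mollify_integrable[OF assms(2)]])

lemma mollify_cong_AE:
  assumes "F \<in> borel_measurable (lebesgue_on disc)" "H \<in> borel_measurable (lebesgue_on disc)"
    "AE x in lebesgue_on disc. F x = H x"
  shows "mollify s \<delta> F x = mollify s \<delta> H x"
  unfolding mollify_def
proof (rule integral_cong_AE)
  note km = continuous_measurable_lebesgue_on[OF moll_kernel_shift_continuous]
  show "(\<lambda>z. moll_kernel s \<delta> (x - s *\<^sub>R z) *\<^sub>R F z) \<in> borel_measurable (lebesgue_on disc)"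
    by (rule borel_measurable_scaleR[OF km assms(1)])
  show "(\<lambda>z. moll_kernel s \<delta> (x - s *\<^sub>R z) *\<^sub>R H z) \<in> borel_measurable (lebesgue_on disc)"
    by (rule borel_measurable_scaleR[OF km assms(2)])
  show "AE z in lebesgue_on disc. moll_kernel s \<delta> (x - s *\<^sub>R z) *\<^sub>R F z = moll_kernel s \<delta> (x - s *\<^sub>R z) *\<^sub>R H z"
    using assms(3) by eventually_elim simp
qed

lemma mollify_eq_average:
  fixes F :: "real^2 \<Rightarrow> 'b::euclidean_space"
  assumes "F \<in> borel_measurable borel" "\<And>x. x \<notin> disc \<Longrightarrow> F x = 0" "\<delta> > 0" "s > 0"
  shows "mollify s \<delta> F x = (\<integral>y. moll y *\<^sub>R F ((1 / s) *\<^sub>R (x - \<delta> *\<^sub>R y)) \<partial>lborel)"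
proof -
  have "mollify s \<delta> F x = (\<integral>z. moll_kernel s \<delta> (x - s *\<^sub>R z) *\<^sub>R F z \<partial>lborel)"
    unfolding mollify_def
  proof (rule integral_lebesgue_on_lborel[OF open_ball])
    show "(\<lambda>z. moll_kernel s \<delta> (x - s *\<^sub>R z) *\<^sub>R F z) \<in> borel_measurable borel"
      by (rule borel_measurable_scaleR[OF borel_measurable_continuous_onI[OF moll_kernel_shift_continuous] assms(1)])
  qed (simp add: assms(2))
  also have "\<dots> = (\<integral>y. moll y *\<^sub>R F ((1 / s) *\<^sub>R (x - \<delta> *\<^sub>R y)) \<partial>lborel)"
    unfolding moll_kernel_def by (rule moll_average_substitution[OF assms(4,3,1), symmetric])
  finally show ?thesis .
qed

lemma continuous_mollify:
  "square_integrable (lebesgue_on disc) F \<Longrightarrow> continuous_on UNIV (mollify s \<delta> F)"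
  by (rule continuous_smooth[OF smooth_mollify[OF disc_integrable]])

text \<open>Jensen's inequality bounds the square by an average of squares at affine images with
  ratio 1/s, whose Jacobian factor s^2 is at most 1.\<close>

lemma mollify_contraction:
  fixes F :: "real^2 \<Rightarrow> 'b::euclidean_space"
  assumes F: "square_integrable (lebesgue_on disc) F" and d: "\<delta> > 0" and s: "0 < s" "s \<le> 1"
  shows "L2_norm (lebesgue_on disc) (mollify s \<delta> F) \<le> L2_norm (lebesgue_on disc) F"
proof -
  let ?M = "lebesgue_on disc"
  note Fm = square_integrable_measurable[OF F]
  \<comment> \<open>Tonelli is applied to Borel functions on the plane, so F is exchanged for a
    Borel version extended by zero.\<close>
  obtain g F' N where F': "negligible N" "F' \<in> borel_measurable borel" "\<And>x. x \<notin> disc \<Longrightarrow> F' x = 0"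
    "\<And>x. x \<in> disc \<Longrightarrow> x \<notin> N \<Longrightarrow> (\<lambda>n::nat. g n x) \<longlonglongrightarrow> F x \<and> F' x = F x"
    by (rule borel_representative[OF open_ball Fm]) blast
  have [measurable]: "F' \<in> borel_measurable borel" by (rule F'(2))
  have ae: "AE x in ?M. F x = F' x"
    by (rule AE_lebesgue_on_negligible[OF open_ball F'(1)]) (use F'(4) in metis)
  have F'm: "F' \<in> borel_measurable ?M"
    by (rule borel_measurable_lebesgue_on_AE[OF open_ball Fm ae])
  have F'sq: "square_integrable ?M F'" by (rule square_integrable_cong_AE[OF F F'm ae])
  let ?p = "\<lambda>x y. (- (\<delta> / s)) *\<^sub>R y + (1 / s) *\<^sub>R x"
  have eq: "mollify s \<delta> F x = (\<integral>y. moll y *\<^sub>R F' (?p x y) \<partial>lborel)" for x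
  proof -
    have "(1 / s) *\<^sub>R (x - \<delta> *\<^sub>R y) = ?p x y" for y by (simp add: scaleR_diff_right)
    then show ?thesis
      using mollify_cong_AE[OF Fm F'm ae] mollify_eq_average[OF F'(2,3) d s(1)] by simp
  qed
  have "(\<integral>\<^sup>+x. ennreal ((norm (mollify s \<delta> F x))\<^sup>2) \<partial>?M) = (\<integral>\<^sup>+x. indicator disc x * ennreal ((norm (mollify s \<delta> F x))\<^sup>2) \<partial>lborel)"
    by (rule nn_integral_lebesgue_on_lborel[OF open_ball borel_measurable_continuous_onI[OF continuous_mollify[OF F]]])
  also have "\<dots> \<le> (\<integral>\<^sup>+x. indicator disc x * (\<integral>\<^sup>+y. ennreal (moll y) * ennreal ((norm (F' (?p x y)))\<^sup>2) \<partial>lborel) \<partial>lborel)"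
    unfolding eq
    by (intro nn_integral_mono mult_left_mono norm_weighted_integral_power2_le) (auto simp: moll_facts)
  also have "\<dots> \<le> ennreal ((1 / (1 / s)) ^ DIM(real^2)) * (\<integral>\<^sup>+y. ennreal (moll y) \<partial>lborel) * (\<integral>\<^sup>+x. indicator UNIV x * ennreal ((norm (F' x))\<^sup>2) \<partial>lborel)"
    by (rule nn_integral_affine_average_le[where g="\<lambda>x. ennreal ((norm (F' x))\<^sup>2)" and \<alpha>="\<lambda>_. 1 / s" and \<beta>="\<lambda>y. (- (\<delta> / s)) *\<^sub>R y"])
      (use s in auto)
  also have "\<dots> \<le> 1 * 1 * (\<integral>\<^sup>+x. indicator UNIV x * ennreal ((norm (F' x))\<^sup>2) \<partial>lborel)"
    unfolding nn_integral_moll using s by (intro mult_mono) (auto simp: power_le_one)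
  also have "\<dots> = (\<integral>\<^sup>+x. indicator disc x * ennreal ((norm (F' x))\<^sup>2) \<partial>lborel)"
    unfolding mult_1_left by (rule nn_integral_cong) (use F'(3) in \<open>auto simp: indicator_def\<close>)
  also have "\<dots> = (\<integral>\<^sup>+x. ennreal ((norm (F' x))\<^sup>2) \<partial>?M)"
    by (rule nn_integral_lebesgue_on_lborel[OF open_ball F'(2), symmetric])
  also have "\<dots> = ennreal ((L2_norm ?M F)\<^sup>2)"
    unfolding nn_integral_L2_norm[OF F'sq] L2_norm_cong_AE[OF Fm F'm ae] ..
  finally have "(L2_norm ?M (mollify s \<delta> F))\<^sup>2 \<le> (L2_norm ?M F)\<^sup>2"
    using nn_integral_L2_norm[OF square_integrable_continuous[OF disc_open_bounded continuous_mollify[OF F]]]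
    by (simp add: ennreal_le_iff)
  then show ?thesis by (rule power2_le_imp_le) simp
qed

text \<open>With \<delta> = 1/(k+3) and s = 1 - 2 \<delta> one has s + \<delta> = 1 - \<delta> < 1,
  so the result vanishes near and outside the unit circle. The shift by 3 keeps s positive, already
  1/3 for k = 0.\<close>

definition mol :: "nat \<Rightarrow> (real^2 \<Rightarrow> 'b::euclidean_space) \<Rightarrow> real^2 \<Rightarrow> 'b" where
  "mol k = mollify (1 - 2 / real (k + 3)) (1 / real (k + 3))"

lemma mol_params:
  "0 < 1 / real (k + 3)" "0 < 1 - 2 / real (k + 3)" "1 - 2 / real (k + 3) \<le> 1"
  by (simp_all add: field_simps)

text \<open>At a fixed point of the open disc the samples eventually stay inside the disc and close
  to the point, so the cut-off at the circle is not seen there; the uniform bound then gives L2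
  convergence.\<close>

lemma mol_continuous_tendsto:
  fixes c :: "real^2 \<Rightarrow> 'b::euclidean_space"
  assumes c: "continuous_on UNIV c"
  shows "(\<lambda>k. L2_norm (lebesgue_on disc) (\<lambda>x. mol k c x - c x)) \<longlonglongrightarrow> 0"
proof -
  let ?M = "lebesgue_on disc"
  obtain C where C: "\<And>x. x \<in> disc \<Longrightarrow> norm (c x) \<le> C" using continuous_bounded_on[OF bounded_ball c] by blast
  have C0: "0 \<le> C" using order_trans[OF norm_ge_zero C[of 0]] by simp
  note csq = square_integrable_continuous[OF disc_open_bounded c]
  let ?c = "\<lambda>x. indicator disc x *\<^sub>R c x"
  have cm: "?c \<in> borel_measurable borel"
    by (intro borel_measurable_scaleR borel_measurable_continuous_onI[OF c] borel_measurable_indicator) simp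
  let ?s = "\<lambda>k. 1 - 2 / real (k + 3)" and ?d = "\<lambda>k. 1 / real (k + 3)"
  let ?p = "\<lambda>k x y. (1 / ?s k) *\<^sub>R (x - ?d k *\<^sub>R y)"
  have cc: "mollify s \<delta> c x = mollify s \<delta> ?c x" for s \<delta> x
    unfolding mollify_def by (rule Bochner_Integration.integral_cong) auto
  have eq: "mol k c x = (\<integral>y. moll y *\<^sub>R ?c (?p k x y) \<partial>lborel)" for k x
    unfolding mol_def cc by (rule mollify_eq_average[OF cm _ mol_params(1,2)]) simp
  have cb: "norm (?c q) \<le> C" for q using C[of q] C0 by (simp add: indicator_def)
  have bound: "norm (mol k c x) \<le> C" for k x
  proof -
    have "ennreal ((norm (mol k c x))\<^sup>2) \<le> (\<integral>\<^sup>+y. ennreal (moll y) * ennreal ((norm (?c (?p k x y)))\<^sup>2) \<partial>lborel)"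
      unfolding eq
    proof (rule norm_weighted_integral_power2_le)
      show "(\<lambda>y. ?c (?p k x y)) \<in> borel_measurable lborel"
        by (rule measurable_compose[OF _ cm]) simp
    qed (auto simp: moll_facts)
    also have "\<dots> \<le> (\<integral>\<^sup>+y. ennreal (moll y) * ennreal (C\<^sup>2) \<partial>lborel)"
    proof (intro nn_integral_mono mult_left_mono ennreal_leI power_mono)
      fix y show "norm (?c (?p k x y)) \<le> C" by (rule cb)
    qed auto
    also have "\<dots> = ennreal (C\<^sup>2)" by (subst nn_integral_multc) (auto simp: nn_integral_moll)
    finally have "(norm (mol k c x))\<^sup>2 \<le> C\<^sup>2" by (simp add: ennreal_le_iff)
    then show ?thesis using C0 by (rule power2_le_imp_le)
  qed
  have lim: "(\<lambda>k. mol k c x) \<longlonglongrightarrow> c x" if x: "x \<in> disc" for x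
  proof (rule LIMSEQ_I)
    fix e :: real assume e: "e > 0"
    have "isCont c x" using c by (simp add: continuous_on_eq_continuous_at)
    then obtain r where r: "r > 0" "\<And>p. dist p x < r \<Longrightarrow> dist (c p) (c x) < e / 2"
      using e unfolding continuous_at_eps_delta by (metis half_gt_zero)
    have l: "?d \<longlonglongrightarrow> 0" by (rule LIMSEQ_ignore_initial_segment[OF lim_1_over_n])
    \<comment> \<open>This bounds the displacement of the samples: 2d from the contraction, d from
      the shift, divided by s. Being below r invokes continuity, being below 1 - |x| keeps the
      samples in the disc.\<close>
    have "(\<lambda>k. (1 / (1 - 2 * ?d k)) * (3 * ?d k)) \<longlonglongrightarrow> (1 / (1 - 2 * 0)) * (3 * 0)"
      by (intro tendsto_intros l) simp
    then have "eventually (\<lambda>k. (1 / (1 - 2 * ?d k)) * (3 * ?d k) < min r (1 - norm x)) sequentially"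
      by (rule order_tendstoD) (use r(1) x in simp)
    then obtain K where K: "\<And>k. k \<ge> K \<Longrightarrow> (1 / (1 - 2 * ?d k)) * (3 * ?d k) < min r (1 - norm x)"
      by (auto simp: eventually_sequentially)
    have "norm (mol k c x - c x) < e" if k: "k \<ge> K" for k
    proof -
      obtain s d where sd: "s = ?s k" "d = ?d k" by blast
      have s0: "s > 0" and d0: "d > 0" and s1: "s = 1 - 2 * d" using mol_params unfolding sd by auto
      have pk: "?p k x y = (1 / s) *\<^sub>R (x - d *\<^sub>R y)" for y unfolding sd ..
      have Kk: "(1 / s) * (3 * d) < min r (1 - norm x)" using K[OF k] unfolding s1 sd(2) .
      have near: "norm (?p k x y - x) < min r (1 - norm x)" if "moll y \<noteq> 0" for y
      proof -
        have y: "norm y \<le> 1" using moll_facts(3)[of y] that by force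
        have "?p k x y - x = (1 / s) *\<^sub>R ((2 * d) *\<^sub>R x - d *\<^sub>R y)"
        proof -
          have "x = (1 / s) *\<^sub>R (s *\<^sub>R x)" using s0 by simp
          then have "?p k x y - x = (1 / s) *\<^sub>R ((x - d *\<^sub>R y) - s *\<^sub>R x)" unfolding pk by (metis scaleR_diff_right)
          also have "(x - d *\<^sub>R y) - s *\<^sub>R x = (2 * d) *\<^sub>R x - d *\<^sub>R y"
            unfolding s1 by (simp add: scaleR_left_diff_distrib)
          finally show ?thesis .
        qed
        then have "norm (?p k x y - x) = (1 / s) * norm ((2 * d) *\<^sub>R x - d *\<^sub>R y)"
          using s0 by simp
        also have "\<dots> \<le> (1 / s) * (3 * d)"
        proof (rule mult_left_mono)
          have "norm ((2 * d) *\<^sub>R x - d *\<^sub>R y) \<le> norm ((2 * d) *\<^sub>R x) + norm (d *\<^sub>R y)" by (rule norm_triangle_ineq4)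
          also have "\<dots> = 2 * d * norm x + d * norm y" using d0 by simp
          also have "\<dots> \<le> 2 * d * 1 + d * 1"
            using d0 x y by (intro add_mono mult_left_mono) auto
          finally show "norm ((2 * d) *\<^sub>R x - d *\<^sub>R y) \<le> 3 * d" by simp
        qed (use s0 in simp)
        also note Kk
        finally show ?thesis .
      qed
      have pd: "?p k x y \<in> disc" if "moll y \<noteq> 0" for y
        using near[OF that] norm_triangle_sub[of "?p k x y" x] unfolding pk by simp
      have peq: "?p k x y = (1 / s) *\<^sub>R x + (- (d / s)) *\<^sub>R y" for y unfolding pk by (simp add: scaleR_diff_right)
      have "mol k c x = (\<integral>y. moll y *\<^sub>R c (?p k x y) \<partial>lborel)"
        unfolding eq
      proof (rule Bochner_Integration.integral_cong[OF refl])
        fix y show "moll y *\<^sub>R ?c (?p k x y) = moll y *\<^sub>R c (?p k x y)"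
          using pd[of y] unfolding pk by (cases "moll y = 0") simp_all
      qed
      moreover have "c x = (\<integral>y. moll y *\<^sub>R c x \<partial>lborel)" using moll_facts(4,5) by simp
      ultimately have "mol k c x - c x = (\<integral>y. moll y *\<^sub>R c (?p k x y) - moll y *\<^sub>R c x \<partial>lborel)"
        using integrable_moll_translate[OF c, of "(1 / s) *\<^sub>R x" "- (d / s)"] integrable_scaleR_left[OF moll_facts(4), of "c x"]
        by (simp only: peq Bochner_Integration.integral_diff)
      also have "\<dots> = (\<integral>y. moll y *\<^sub>R (c (?p k x y) - c x) \<partial>lborel)" by (simp only: scaleR_diff_right)
      finally have diff: "mol k c x - c x = (\<integral>y. moll y *\<^sub>R (c (?p k x y) - c x) \<partial>lborel)" .
      have "continuous_on UNIV (\<lambda>y. c (?p k x y) - c x)"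
        unfolding pk by (intro continuous_on_diff continuous_on_compose2[OF c]) (auto intro!: continuous_intros)
      then have m: "(\<lambda>y. c (?p k x y) - c x) \<in> borel_measurable lborel"
        using borel_measurable_continuous_onI by (simp only: measurable_lborel2)
      have "ennreal ((norm (mol k c x - c x))\<^sup>2) \<le> (\<integral>\<^sup>+y. ennreal (moll y) * ennreal ((norm (c (?p k x y) - c x))\<^sup>2) \<partial>lborel)"
        unfolding diff by (rule norm_weighted_integral_power2_le[OF m]) (auto simp: moll_facts)
      also have "\<dots> \<le> (\<integral>\<^sup>+y. ennreal (moll y) * ennreal ((e / 2)\<^sup>2) \<partial>lborel)"
      proof (rule nn_integral_mono)
        fix y show "ennreal (moll y) * ennreal ((norm (c (?p k x y) - c x))\<^sup>2) \<le> ennreal (moll y) * ennreal ((e / 2)\<^sup>2)"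
        proof (cases "moll y = 0")
          case False
          have "dist (c (?p k x y)) (c x) < e / 2" by (rule r(2)) (use near[OF False] in \<open>simp only: dist_norm min_less_iff_conj\<close>)
          then have "norm (c (?p k x y) - c x) \<le> e / 2" by (simp only: dist_norm less_imp_le)
          from power_mono[OF this norm_ge_zero, of 2] show ?thesis by (intro mult_left_mono ennreal_leI) simp_all
        qed simp
      qed
      also have "\<dots> = ennreal ((e / 2)\<^sup>2)" by (subst nn_integral_multc) (auto simp: nn_integral_moll)
      finally have "(norm (mol k c x - c x))\<^sup>2 \<le> (e / 2)\<^sup>2" by (subst (asm) ennreal_le_iff) simp_all
      then have "norm (mol k c x - c x) \<le> e / 2" by (rule power2_le_imp_le) (use e in simp)
      then show ?thesis using e by simp
    qed
    then show "\<exists>K. \<forall>k\<ge>K. norm (mol k c x - c x) < e" by blast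
  qed
  have mm: "mol k c \<in> borel_measurable ?M" for k
    unfolding mol_def by (rule continuous_measurable_lebesgue_on[OF continuous_mollify[OF csq]])
  show ?thesis by (rule bounded_convergent_L2_disc(2)[OF mm bound lim])
qed

text \<open>Convergence on the dense set of continuous functions, extended by the contraction
  property, which is uniform in k.\<close>

lemma mol_tendsto:
  fixes F :: "real^2 \<Rightarrow> 'b::euclidean_space"
  assumes F: "square_integrable (lebesgue_on disc) F"
  shows "(\<lambda>k. L2_norm (lebesgue_on disc) (\<lambda>x. mol k F x - F x)) \<longlonglongrightarrow> 0"
proof (rule LIMSEQ_I)
  let ?M = "lebesgue_on disc"
  fix e :: real assume e: "e > 0"
  obtain c where c: "continuous_on UNIV c" "L2_norm ?M (\<lambda>x. F x - c x) < e / 3"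
    using continuous_dense_L2[OF disc_open_bounded F, of "e / 3"] e by auto
  note csq = square_integrable_continuous[OF disc_open_bounded c(1)]
  note dsq = square_integrable_diff[OF F csq]
  have msq: "square_integrable ?M (mol k H)" if "square_integrable ?M H" for k and H :: "real^2 \<Rightarrow> 'b"
    unfolding mol_def by (rule square_integrable_continuous[OF disc_open_bounded continuous_mollify[OF that]])
  have "eventually (\<lambda>k. L2_norm ?M (\<lambda>x. mol k c x - c x) < e / 3) sequentially"
    using mol_continuous_tendsto[OF c(1)] by (rule order_tendstoD) (use e in simp)
  then obtain K where K: "\<And>k. k \<ge> K \<Longrightarrow> L2_norm ?M (\<lambda>x. mol k c x - c x) < e / 3" by (auto simp: eventually_sequentially)
  have "L2_norm ?M (\<lambda>x. mol k F x - F x) < e" if "k \<ge> K" for k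
  proof -
    have "L2_norm ?M (\<lambda>x. mol k F x - mol k c x) = L2_norm ?M (mol k (\<lambda>x. F x - c x))"
      unfolding mol_def mollify_diff[OF F csq] ..
    also have "\<dots> \<le> L2_norm ?M (\<lambda>x. F x - c x)"
      unfolding mol_def by (rule mollify_contraction[OF dsq mol_params])
    finally have "L2_norm ?M (\<lambda>x. mol k F x - mol k c x) < e / 3" using c(2) by simp
    moreover have "L2_norm ?M (\<lambda>x. mol k F x - F x) \<le> L2_norm ?M (\<lambda>x. mol k F x - mol k c x) + L2_norm ?M (\<lambda>x. mol k c x - F x)"
      by (rule L2_norm_triangle_diff[OF msq[OF F] msq[OF csq] F])
    moreover have "L2_norm ?M (\<lambda>x. mol k c x - F x) \<le> L2_norm ?M (\<lambda>x. mol k c x - c x) + L2_norm ?M (\<lambda>x. c x - F x)"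
      by (rule L2_norm_triangle_diff[OF msq[OF csq] csq F])
    ultimately show ?thesis using K[OF that] c(2) L2_norm_minus_commute[of ?M F c] by linarith
  qed
  then show "\<exists>K. \<forall>k\<ge>K. norm (L2_norm ?M (\<lambda>x. mol k F x - F x) - 0) < e" by auto
qed

section \<open>Potentials of divergence-free fields with vanishing normal component\<close>

lemma flat_continuous: "continuous_on UNIV (flat p)"
  using flat_has_derivative by (meson DERIV_continuous_on DERIV_subset subset_UNIV)

lemma Basis_real2: "(Basis :: (real^2) set) = {axis 1 1, axis 2 1}"
  by (auto simp: Basis_vec_def UNIV_2)

lemma grad_coordinate_function:
  fixes g g' :: "real \<Rightarrow> real"
  assumes g: "\<And>t. (g has_real_derivative g' t) (at t)" "continuous_on UNIV g'"
  shows "Ck (Suc 0) (\<lambda>x::real^2. g (r * x $ j))"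
    "grad (\<lambda>x::real^2. g (r * x $ j)) x $ i = (if i = j then r * g' (r * x $ j) else 0)"
proof -
  let ?f = "\<lambda>x::real^2. r * x $ j"
  have D: "(?f has_derivative (\<lambda>v. r * v $ j)) (at x)" for x
    by (rule has_derivative_mult_right[OF bounded_linear_imp_has_derivative[OF bounded_linear_vec_nth]])
  have f: "Ck (Suc 0) ?f" by (rule Ck_SucI[OF D Ck_const])
  show "Ck (Suc 0) (\<lambda>x::real^2. g (r * x $ j))" by (rule Ck_1_compose(1)[OF g f])
  have "frechet_derivative ?f (at x) = (\<lambda>v. r * v $ j)" using frechet_derivative_at[OF D] by simp
  then show "grad (\<lambda>x::real^2. g (r * x $ j)) x $ i = (if i = j then r * g' (r * x $ j) else 0)"
    unfolding grad_component Ck_1_compose(2)[OF g f] by (simp add: axis_def)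
qed

text \<open>The bump on the square is a product b(x1) b(x2), so integrating in the first variable
  only replaces one factor by an antiderivative B.\<close>

lemma moll_kernel_antiderivative:
  assumes "\<delta> > 0"
  obtains \<Lambda> where "Ck (Suc 0) \<Lambda>" "\<And>x. grad \<Lambda> x $ 1 = moll_kernel s \<delta> x"
proof -
  define q where "q = [:0, 0, 1:] * (1 - pderiv (1 :: real poly))"
  have fq: "(flat 1 has_real_derivative flat q t) (at t)" for t
    unfolding q_def by (rule flat_has_derivative)
  define b where "b t = flat 1 (t + 1/2) * flat 1 (1/2 - t)" for t
  define b' where "b' t = flat 1 (t + 1/2) * (- flat q (1/2 - t)) + flat q (t + 1/2) * flat 1 (1/2 - t)" for t
  have fd1: "((\<lambda>t. flat 1 (t + 1/2)) has_real_derivative flat q (t + 1/2) * 1) (at t)" for t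
    by (rule DERIV_chain2[OF fq]) (auto intro!: derivative_eq_intros)
  have fd2: "((\<lambda>t. flat 1 (1/2 - t)) has_real_derivative flat q (1/2 - t) * (- 1)) (at t)" for t
    by (rule DERIV_chain2[OF fq]) (auto intro!: derivative_eq_intros)
  have bD: "(b has_real_derivative b' t) (at t)" for t
    using DERIV_mult'[OF fd1[of t] fd2[of t]] unfolding b_def[abs_def] b'_def by simp
  have b'c: "continuous_on UNIV b'"
    unfolding b'_def[abs_def] by (intro continuous_intros continuous_on_compose2[OF flat_continuous]) auto
  have bc: "continuous_on UNIV b"
    using bD by (meson DERIV_continuous_on DERIV_subset subset_UNIV)
  have "isCont b t" for t using bc by (simp add: continuous_on_eq_continuous_at)
  then obtain B where B: "\<And>t. (B has_vector_derivative b t) (at t)"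
    using einterval_antiderivative[of "-\<infinity>" "\<infinity>" b] by auto
  have BD: "(B has_real_derivative b t) (at t)" for t
    using B[of t] by (simp add: has_real_derivative_iff_has_vector_derivative)
  have bump: "box_bump 1 (- (1/2) *\<^sub>R One) ((1/2) *\<^sub>R One) x = b (x $ 1) * b (x $ 2)" for x :: "real^2"
  proof -
    have ne: "axis 1 (1::real) \<noteq> (axis 2 1 :: real^2)" by (simp add: axis_eq_axis)
    have One: "(One :: real^2) \<bullet> u = 1" if "u \<in> Basis" for u
      using that by (simp add: inner_sum_left inner_Basis if_distrib cong: if_cong)
    have c: "(- (1/2) *\<^sub>R One :: real^2) \<bullet> u = - 1/2" "((1/2) *\<^sub>R One :: real^2) \<bullet> u = 1/2" if "u \<in> Basis" for u
      using One[OF that] by simp_all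
    have "box_bump 1 (- (1/2) *\<^sub>R One) ((1/2) *\<^sub>R One) x = (\<Prod>u\<in>Basis. b (x \<bullet> u))"
      unfolding box_bump_def b_def by (rule prod.cong[OF refl]) (simp only: c mult_1_left, simp)
    also have "\<dots> = b (x $ 1) * b (x $ 2)"
      unfolding Basis_real2 using ne by (simp add: inner_axis)
    finally show ?thesis .
  qed
  let ?I = "\<integral>x. box_bump 1 (- (1/2) *\<^sub>R One :: real^2) ((1/2) *\<^sub>R One) x \<partial>lborel"
  \<comment> \<open>The extra \<delta> cancels the factor 1/\<delta> from differentiating
    B(x1/\<delta>).\<close>
  let ?c = "(s / \<delta>)\<^sup>2 / ?I * \<delta>" and ?r = "1 / \<delta>"
  define \<Lambda> where "\<Lambda> x = ?c *\<^sub>R (B (?r * x $ 1) * b (?r * x $ 2))" for x :: "real^2"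
  note g1 = grad_coordinate_function[OF BD bc, of ?r 1] and g2 = grad_coordinate_function[OF bD b'c, of ?r 2]
  have C: "Ck (Suc 0) (\<lambda>x::real^2. B (?r * x $ 1) * b (?r * x $ 2))" by (rule Ck_mult[OF g1(1) g2(1)])
  have L1: "Ck (Suc 0) \<Lambda>" unfolding \<Lambda>_def[abs_def] by (rule Ck_linear[OF bounded_linear_scaleR_right C])
  have "grad \<Lambda> x $ 1 = ?c *\<^sub>R (b (?r * x $ 2) * (?r * b (?r * x $ 1)))" for x
    unfolding \<Lambda>_def[abs_def] grad_linear[OF bounded_linear_scaleR_right C]
    by (simp only: vec_lambda_beta grad_bilinear[OF bounded_bilinear_mult g1(1) g2(1)] g1(2) g2(2)) (simp add: mult_ac)
  also have "?c *\<^sub>R (b (?r * x $ 2) * (?r * b (?r * x $ 1))) = moll_kernel s \<delta> x" for x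
    unfolding moll_kernel_def moll_def bump using assms by (simp add: mult_ac)
  finally show ?thesis using that[OF L1] by blast
qed

text \<open>The potential is the convolution of \<open>F\<^sub>2\<close> with an antiderivative \<open>\<Lambda>\<close> of the kernel in the first variable;
  testing the hypothesis on \<open>F\<close> with \<open>\<Lambda>\<close> itself gives its second derivative. It is constant outside the disc,
  where the mollification vanishes, because that region is connected.\<close>

lemma potential_of_mollification:
  fixes F :: "real^2 \<Rightarrow> 'b::euclidean_space^2"
  assumes F: "square_integrable (lebesgue_on disc) F"
    and div: "\<And>f. Ck (Suc 0) f \<Longrightarrow> (\<integral>x. grad f x $ 1 *\<^sub>R F x $ 1 + grad f x $ 2 *\<^sub>R F x $ 2 \<partial>lebesgue_on disc) = 0"
    and d: "\<delta> > 0" "s > 0" "s + \<delta> < 1"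
  shows "\<exists>\<xi>. smooth \<xi> \<and> (\<forall>x. 1 \<le> norm x \<longrightarrow> \<xi> x = 0) \<and>
    (\<forall>x. grad \<xi> x $ 1 = mollify s \<delta> (\<lambda>z. F z $ 2) x) \<and> (\<forall>x. grad \<xi> x $ 2 = - mollify s \<delta> (\<lambda>z. F z $ 1) x) \<and>
    (\<forall>L :: 'b \<Rightarrow> 'b. bounded_linear L \<longrightarrow> (AE x in lebesgue_on disc. L (F x $ 2) = 0) \<longrightarrow> (\<forall>x. L (\<xi> x) = 0))"
proof -
  let ?M = "lebesgue_on disc"
  let ?m = "\<lambda>i. mollify s \<delta> (\<lambda>z. F z $ i)"
  note Fi = square_integrable_component[OF F]
  obtain \<Lambda> where \<Lambda>: "Ck (Suc 0) \<Lambda>" "\<And>x. grad \<Lambda> x $ 1 = moll_kernel s \<delta> x"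
    using moll_kernel_antiderivative[OF d(1)] by blast
  have int: "integrable ?M (\<lambda>z. g (x - s *\<^sub>R z) *\<^sub>R F z $ i)" if "continuous_on UNIV g" for g :: "real^2 \<Rightarrow> real" and i x
  proof -
    have "continuous_on UNIV (\<lambda>z. g (x - s *\<^sub>R z))"
      by (rule continuous_on_compose2[OF that]) (auto intro!: continuous_intros)
    then show ?thesis
      by (rule integrable_bilinear_L2[OF bounded_bilinear_scaleR square_integrable_continuous[OF disc_open_bounded] Fi])
  qed
  have cg: "continuous_on UNIV (\<lambda>y. grad \<Lambda> y $ i)" for i by (rule Ck_imp_continuous_on[OF Ck_grad_component[OF \<Lambda>(1)]])
  define \<xi>0 where "\<xi>0 x = (\<integral>z. \<Lambda> (x - s *\<^sub>R z) *\<^sub>R F z $ 2 \<partial>?M)" for x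
  have i1: "(\<integral>z. grad \<Lambda> (x - s *\<^sub>R z) $ 1 *\<^sub>R F z $ i \<partial>?M) = ?m i x" for x i
    by (simp add: mollify_def \<Lambda>(2))
  have i2: "(\<integral>z. grad \<Lambda> (x - s *\<^sub>R z) $ 2 *\<^sub>R F z $ 2 \<partial>?M) = - ?m 1 x" for x
  proof -
    \<comment> \<open>This test function is under no constraint on the unit circle. Here the
      hypothesis encodes more than zero divergence inside the disc: it includes the vanishing normal
      component.\<close>
    let ?f = "\<lambda>z. \<Lambda> (x + (- s) *\<^sub>R z)"
    have f: "Ck (Suc 0) ?f" by (rule Ck_compose_affine[OF \<Lambda>(1)])
    have "grad ?f z $ i = - s * grad \<Lambda> (x - s *\<^sub>R z) $ i" for z i
    proof -
      have "(\<Lambda> has_derivative frechet_derivative \<Lambda> (at (x + (- s) *\<^sub>R z))) (at (x + (- s) *\<^sub>R z))"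
        by (rule Ck_Suc_has_derivative[OF \<Lambda>(1)])
      moreover have "((\<lambda>z. x + (- s) *\<^sub>R z) has_derivative (\<lambda>h. (- s) *\<^sub>R h)) (at z)"
        by (auto intro!: derivative_eq_intros)
      ultimately have "(?f has_derivative (\<lambda>h. frechet_derivative \<Lambda> (at (x + (- s) *\<^sub>R z)) ((- s) *\<^sub>R h))) (at z)"
        by (rule has_derivative_compose[rotated])
      from grad_eqI[OF this] show ?thesis
        using linear_scale[OF has_derivative_linear[OF Ck_Suc_has_derivative[OF \<Lambda>(1)]], of "x + (- s) *\<^sub>R z" "- s" "axis i 1"]
        by (simp add: grad_component)
    qed
    from div[OF f, unfolded this]
    have "0 = (\<integral>z. (- s) *\<^sub>R (grad \<Lambda> (x - s *\<^sub>R z) $ 1 *\<^sub>R F z $ 1 + grad \<Lambda> (x - s *\<^sub>R z) $ 2 *\<^sub>R F z $ 2) \<partial>?M)"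
      by (simp add: scaleR_add_right)
    also have "\<dots> = (- s) *\<^sub>R (\<integral>z. grad \<Lambda> (x - s *\<^sub>R z) $ 1 *\<^sub>R F z $ 1 + grad \<Lambda> (x - s *\<^sub>R z) $ 2 *\<^sub>R F z $ 2 \<partial>?M)"
      by (rule integral_scaleR_right)
    also have "(\<integral>z. grad \<Lambda> (x - s *\<^sub>R z) $ 1 *\<^sub>R F z $ 1 + grad \<Lambda> (x - s *\<^sub>R z) $ 2 *\<^sub>R F z $ 2 \<partial>?M)
        = (\<integral>z. grad \<Lambda> (x - s *\<^sub>R z) $ 1 *\<^sub>R F z $ 1 \<partial>?M) + (\<integral>z. grad \<Lambda> (x - s *\<^sub>R z) $ 2 *\<^sub>R F z $ 2 \<partial>?M)"
      by (rule Bochner_Integration.integral_add[OF int[OF cg] int[OF cg]])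
    finally show ?thesis using d(2) unfolding i1 by (simp add: eq_neg_iff_add_eq_0 add.commute)
  qed
  have D0: "(\<xi>0 has_derivative (\<lambda>v. v $ 1 *\<^sub>R ?m 2 x - v $ 2 *\<^sub>R ?m 1 x)) (at x)" for x
  proof -
    have D: "(\<xi>0 has_derivative (\<lambda>h. \<integral>z. frechet_derivative \<Lambda> (at (x - s *\<^sub>R z)) h *\<^sub>R F z $ 2 \<partial>?M)) (at x)"
      unfolding \<xi>0_def by (rule integral_kernel_has_derivative[OF \<Lambda>(1) disc_integrable[OF Fi] bounded_ball])
    have "(\<integral>z. frechet_derivative \<Lambda> (at (x - s *\<^sub>R z)) h *\<^sub>R F z $ 2 \<partial>?M) = h $ 1 *\<^sub>R ?m 2 x - h $ 2 *\<^sub>R ?m 1 x" for h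
    proof -
      have "(\<integral>z. frechet_derivative \<Lambda> (at (x - s *\<^sub>R z)) h *\<^sub>R F z $ 2 \<partial>?M)
        = (\<integral>z. h $ 1 *\<^sub>R (grad \<Lambda> (x - s *\<^sub>R z) $ 1 *\<^sub>R F z $ 2) + h $ 2 *\<^sub>R (grad \<Lambda> (x - s *\<^sub>R z) $ 2 *\<^sub>R F z $ 2) \<partial>?M)"
        unfolding frechet_derivative_grad[OF \<Lambda>(1)] by (simp add: sum_2 scaleR_add_left)
      also have "\<dots> = (\<integral>z. h $ 1 *\<^sub>R (grad \<Lambda> (x - s *\<^sub>R z) $ 1 *\<^sub>R F z $ 2) \<partial>?M) + (\<integral>z. h $ 2 *\<^sub>R (grad \<Lambda> (x - s *\<^sub>R z) $ 2 *\<^sub>R F z $ 2) \<partial>?M)"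
        by (intro Bochner_Integration.integral_add integrable_scaleR_right int[OF cg])
      also have "\<dots> = h $ 1 *\<^sub>R ?m 2 x + h $ 2 *\<^sub>R (- ?m 1 x)"
        unfolding integral_scaleR_right i1 i2 ..
      finally show ?thesis by simp
    qed
    with D show ?thesis by simp
  qed
  \<comment> \<open>Normalised at a point outside the disc, so that the constant value of the
    potential out there is 0.\<close>
  define \<xi> where "\<xi> x = \<xi>0 x - \<xi>0 (2 *\<^sub>R axis 1 1)" for x
  have D: "(\<xi> has_derivative (\<lambda>v. v $ 1 *\<^sub>R ?m 2 x - v $ 2 *\<^sub>R ?m 1 x)) (at x)" for x
    unfolding \<xi>_def[abs_def] using has_derivative_diff[OF D0 has_derivative_const] by simp
  have sm: "smooth (?m i)" for i by (rule smooth_mollify[OF disc_integrable[OF Fi]])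
  have "Ck (Suc k) \<xi>" for k
  proof (rule Ck_SucI[OF D])
    have "Ck k (?m i)" for i using sm[of i] by (simp add: smooth_def)
    then show "Ck k (\<lambda>x. v $ 1 *\<^sub>R ?m 2 x - v $ 2 *\<^sub>R ?m 1 x)" for v :: "real^2"
      by (intro Ck_diff Ck_linear[OF bounded_linear_scaleR_right])
  qed
  then have smooth: "smooth \<xi>" unfolding smooth_def using Ck_SucD by blast
  have g: "grad \<xi> x $ 1 = ?m 2 x" "grad \<xi> x $ 2 = - ?m 1 x" for x
    unfolding grad_eqI[OF D] by (simp_all add: axis_def)
  \<comment> \<open>For x in this region and z in the disc, x - s z has norm at least \<delta>, so
    the gradient vanishes. As s + \<delta> < 1 the region contains the unit circle.\<close>
  let ?S = "- cball (0::real^2) (s + \<delta>)"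
  have m0: "?m i x = 0" if "x \<in> ?S" for i x
    unfolding mollify_def
  proof (rule integral_eq_zero_AE, rule AE_I2)
    fix z assume "z \<in> space ?M"
    then have "s * norm z \<le> s * 1" using d(2) by (intro mult_left_mono) auto
    moreover have "norm x \<le> norm (x - s *\<^sub>R z) + norm (s *\<^sub>R z)" by (metis diff_add_cancel norm_triangle_ineq)
    moreover have "norm (s *\<^sub>R z) = s * norm z" using d(2) by simp
    moreover have "s + \<delta> < norm x" using that by simp
    ultimately have "\<delta> \<le> norm (x - s *\<^sub>R z)" by linarith
    then show "moll_kernel s \<delta> (x - s *\<^sub>R z) *\<^sub>R F z $ i = 0" using moll_kernel_eq_0[OF d(1)] by simp
  qed
  have zero: "\<xi> x = 0" if "1 \<le> norm x" for x
  proof -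
    have o: "open ?S" by (simp add: open_Compl)
    have c: "connected ?S" by (rule connected_complement_bounded_convex) auto
    have dz: "(\<xi> has_derivative (\<lambda>_. 0)) (at y)" if "y \<in> ?S" for y
      using D[of y] m0[OF that] by simp
    have xS: "x \<in> ?S" "2 *\<^sub>R axis 1 1 \<in> ?S" using that d by auto
    have "\<xi> x = \<xi> (2 *\<^sub>R axis 1 1)"
      by (rule has_derivative_zero_unique_connected[where f=\<xi>, OF o c dz xS])
    then show ?thesis by (simp add: \<xi>_def)
  qed
  \<comment> \<open>Linear constraints pass through the integral because the kernel is scalar. With
    L sending A to A plus its transpose this will make the potential skew.\<close>
  have L: "L (\<xi> x) = 0" if L: "bounded_linear L" and ae: "AE x in ?M. L (F x $ 2) = 0" for L :: "'b \<Rightarrow> 'b" and x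
  proof -
    have "L (\<xi>0 y) = 0" for y
    proof -
      have "L (\<xi>0 y) = (\<integral>z. L (\<Lambda> (y - s *\<^sub>R z) *\<^sub>R F z $ 2) \<partial>?M)"
        unfolding \<xi>0_def by (rule integral_bounded_linear[OF L int[OF Ck_imp_continuous_on[OF \<Lambda>(1)]], symmetric])
      also have "\<dots> = 0"
        by (rule integral_eq_zero_AE) (use ae in \<open>eventually_elim, simp add: linear_scale[OF bounded_linear.linear[OF L]]\<close>)
      finally show ?thesis .
    qed
    then show ?thesis by (simp add: \<xi>_def linear_diff[OF bounded_linear.linear[OF L]])
  qed
  show ?thesis using smooth zero g L by blast
qed

text \<open>Inverse of the rotation in the perpendicular gradient: if the perpendicular gradient of
  \<xi> is w, then the gradient of \<xi> is \<open>rot w\<close>.\<close>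

definition rot :: "'b::euclidean_space^2 \<Rightarrow> 'b^2" where
  "rot w = vector [w $ 2, - (w $ 1)]"

lemma rot_component [simp]: "rot w $ 1 = w $ 2" "rot w $ 2 = - (w $ 1)"
  by (simp_all add: rot_def)

lemma bounded_linear_rot: "bounded_linear rot"
  by (rule linear_conv_bounded_linear[THEN iffD1], rule linearI) (simp_all add: vec_eq_iff forall_2)

lemma norm_rot: "norm (rot w) = norm w"
  by (simp add: norm_vec_def L2_set_def sum_2 add.commute)

text \<open>The potentials of the mollified fields have convergent gradients and vanish outside the
  disc, so Poincare's inequality makes them Cauchy. They are handed out with the limit, since smooth
  functions vanishing on the circle are exactly the witnesses for the zero trace.\<close>

lemma weak_Poincare_lemma:
  fixes F :: "real^2 \<Rightarrow> 'b::euclidean_space^2"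
  assumes F: "square_integrable (lebesgue_on disc) F"
    and div: "\<And>f. Ck (Suc 0) f \<Longrightarrow> (\<integral>x. grad f x $ 1 *\<^sub>R F x $ 1 + grad f x $ 2 *\<^sub>R F x $ 2 \<partial>lebesgue_on disc) = 0"
  obtains \<xi> v where "strong_gradient \<xi> (\<lambda>x. rot (F x)) disc"
    "\<And>k::nat. smooth (v k)" "\<And>k x. 1 \<le> norm x \<Longrightarrow> v k x = 0"
    "(\<lambda>k. L2_norm (lebesgue_on disc) (\<lambda>x. v k x - \<xi> x)) \<longlonglongrightarrow> 0"
    "(\<lambda>k. L2_norm (lebesgue_on disc) (\<lambda>x. grad (v k) x - rot (F x))) \<longlonglongrightarrow> 0"
    "L2_norm (lebesgue_on disc) \<xi> \<le> 2 * L2_norm (lebesgue_on disc) F"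
    "\<And>L :: 'b \<Rightarrow> 'b. bounded_linear L \<Longrightarrow> AE x in lebesgue_on disc. L (F x $ 2) = 0 \<Longrightarrow>
      AE x in lebesgue_on disc. L (\<xi> x) = 0"
proof -
  let ?M = "lebesgue_on disc"
  let ?G = "\<lambda>x. rot (F x)"
  have G: "square_integrable ?M ?G" by (rule square_integrable_linear[OF bounded_linear_rot F])
  have NG: "L2_norm ?M ?G = L2_norm ?M F" by (simp add: L2_norm_def norm_rot)
  note Fi = square_integrable_component[OF F]
  let ?P = "\<lambda>k \<xi>. smooth \<xi> \<and> (\<forall>x. 1 \<le> norm x \<longrightarrow> \<xi> x = 0) \<and>
    (\<forall>x. grad \<xi> x $ 1 = mol k (\<lambda>z. F z $ 2) x) \<and> (\<forall>x. grad \<xi> x $ 2 = - mol k (\<lambda>z. F z $ 1) x) \<and>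
    (\<forall>L :: 'b \<Rightarrow> 'b. bounded_linear L \<longrightarrow> (AE x in ?M. L (F x $ 2) = 0) \<longrightarrow> (\<forall>x. L (\<xi> x) = 0))"
  have "\<exists>\<xi>. ?P k \<xi>" for k
  proof -
    have "1 - 2 / real (k + 3) + 1 / real (k + 3) < 1" by (simp add: field_simps)
    from potential_of_mollification[OF F div mol_params(1,2) this] show ?thesis unfolding mol_def by blast
  qed
  then have "\<exists>v. \<forall>k. ?P k (v k)" by (intro choice allI)
  then obtain v where vP: "\<forall>k. ?P k (v k)" by (rule exE)
  have v: "smooth (v k)" "1 \<le> norm x \<Longrightarrow> v k x = 0"
    "grad (v k) x $ 1 = mol k (\<lambda>z. F z $ 2) x" "grad (v k) x $ 2 = - mol k (\<lambda>z. F z $ 1) x" for k x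
    using spec[OF vP, of k] by simp_all
  have vL: "L (v k x) = 0" if "bounded_linear L" "AE x in ?M. L (F x $ 2) = 0" for k x and L :: "'b \<Rightarrow> 'b"
    using spec[OF vP, of k] that by blast
  have v1: "Ck (Suc 0) (v k)" for k using v(1)[of k] unfolding smooth_def by blast
  note vsq = square_integrable_C1[OF disc_open_bounded v1]
  have gl: "(\<lambda>k. L2_norm ?M (\<lambda>x. grad (v k) x - ?G x)) \<longlonglongrightarrow> 0"
  proof (rule Lim_null_comparison[OF always_eventually tendsto_add_zero[OF mol_tendsto[OF Fi[of 2]] mol_tendsto[OF Fi[of 1]]]], rule allI)
    fix k
    let ?a = "\<lambda>i x. mol k (\<lambda>z. F z $ i) x - F x $ i"
    have asq: "square_integrable ?M (?a i)" for i
      unfolding mol_def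
      by (rule square_integrable_diff[OF square_integrable_continuous[OF disc_open_bounded continuous_mollify[OF Fi]] Fi])
    have nsq: "square_integrable ?M (\<lambda>x. norm (?a i x))" for i
      using asq[of i] by (auto simp: square_integrable_def)
    have "L2_norm ?M (\<lambda>x. grad (v k) x - ?G x) \<le> 1 * L2_norm ?M (\<lambda>x. norm (?a 2 x) + norm (?a 1 x))"
    proof (rule L2_norm_bound[OF square_integrable_add[OF nsq nsq] square_integrable_measurable[OF square_integrable_diff[OF vsq(2) G]]])
      have "norm w \<le> norm (w $ 1) + norm (w $ 2)" for w :: "'b^2"
        using L2_set_le_sum[of UNIV "\<lambda>i. norm (w $ i)"] by (simp add: norm_vec_def sum_2)
      from this[of "grad (v k) x - ?G x" for x]
      show "AE x in ?M. norm (grad (v k) x - ?G x) \<le> 1 * norm (norm (?a 2 x) + norm (?a 1 x))"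
        by (intro AE_I2) (simp add: v(3,4) norm_minus_commute add.commute)
    qed simp
    also have "\<dots> \<le> L2_norm ?M (\<lambda>x. norm (?a 2 x)) + L2_norm ?M (\<lambda>x. norm (?a 1 x))"
      using L2_norm_triangle[OF nsq nsq, of 2 1] by simp
    also have "\<dots> = L2_norm ?M (?a 2) + L2_norm ?M (?a 1)" by (simp add: L2_norm_def)
    finally show "norm (L2_norm ?M (\<lambda>x. grad (v k) x - ?G x)) \<le> L2_norm ?M (?a 2) + L2_norm ?M (?a 1)" by simp
  qed
  \<comment> \<open>Differences of potentials vanish outside the disc as well, so the inequality
    applies to them; their gradients are compared through the common limit.\<close>
  have P: "L2_norm ?M (\<lambda>x. v k x - v l x) \<le> 2 * (L2_norm ?M (\<lambda>x. grad (v k) x - ?G x) + L2_norm ?M (\<lambda>x. grad (v l) x - ?G x))" for k l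
  proof -
    have "L2_norm ?M (\<lambda>x. v k x - v l x) \<le> 2 * L2_norm ?M (grad (\<lambda>x. v k x - v l x))"
      by (rule Poincare_inequality_disc[OF Ck_diff[OF v1 v1]]) (simp add: v(2))
    also have "L2_norm ?M (grad (\<lambda>x. v k x - v l x)) = L2_norm ?M (\<lambda>x. grad (v k) x - grad (v l) x)"
      by (rule L2_norm_cong) (simp add: grad_diff[OF v1 v1])
    also have "\<dots> \<le> L2_norm ?M (\<lambda>x. grad (v k) x - ?G x) + L2_norm ?M (\<lambda>x. ?G x - grad (v l) x)"
      by (rule L2_norm_triangle_diff[OF vsq(2) G vsq(2)])
    finally show ?thesis using L2_norm_minus_commute[of ?M ?G "grad (v l)"] by simp
  qed
  have cauchy: "\<exists>K. \<forall>m\<ge>K. \<forall>n\<ge>K. L2_norm ?M (\<lambda>x. v m x - v n x) < e" if e: "e > 0" for e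
  proof -
    have "eventually (\<lambda>k. L2_norm ?M (\<lambda>x. grad (v k) x - ?G x) < e / 4) sequentially"
      using gl by (rule order_tendstoD) (use e in simp)
    then obtain K where K: "\<And>k. k \<ge> K \<Longrightarrow> L2_norm ?M (\<lambda>x. grad (v k) x - ?G x) < e / 4"
      by (auto simp: eventually_sequentially)
    have "L2_norm ?M (\<lambda>x. v m x - v n x) < e" if "m \<ge> K" "n \<ge> K" for m n
    proof -
      note P[of m n]
      also have "2 * (L2_norm ?M (\<lambda>x. grad (v m) x - ?G x) + L2_norm ?M (\<lambda>x. grad (v n) x - ?G x)) < 2 * (e / 4 + e / 4)"
        by (intro mult_strict_left_mono add_strict_mono K that) simp
      finally show ?thesis by simp
    qed
    then show ?thesis by blast
  qed
  obtain \<xi> where \<xi>: "square_integrable ?M \<xi>" "(\<lambda>k. L2_norm ?M (\<lambda>x. v k x - \<xi> x)) \<longlonglongrightarrow> 0"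
    by (rule L2_complete[of ?M v, OF vsq(1) cauchy]) blast
  have sg: "strong_gradient \<xi> ?G disc"
    unfolding strong_gradient_def using \<xi> G v1 gl by blast
  have bound: "L2_norm ?M \<xi> \<le> 2 * L2_norm ?M F"
  proof (rule LIMSEQ_le)
    show "(\<lambda>k. L2_norm ?M (v k)) \<longlonglongrightarrow> L2_norm ?M \<xi>" by (rule L2_norm_tendsto[OF vsq(1) \<xi>])
    show "(\<lambda>k. 2 * L2_norm ?M (grad (v k))) \<longlonglongrightarrow> 2 * L2_norm ?M F"
      unfolding NG[symmetric] by (intro tendsto_mult tendsto_const L2_norm_tendsto vsq G gl)
    show "\<exists>N. \<forall>n\<ge>N. L2_norm ?M (v n) \<le> 2 * L2_norm ?M (grad (v n))"
      using Poincare_inequality_disc[OF v1 v(2)] by blast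
  qed
  have L: "AE x in ?M. L (\<xi> x) = 0" if L: "bounded_linear L" "AE x in ?M. L (F x $ 2) = 0" for L :: "'b \<Rightarrow> 'b"
  proof -
    \<comment> \<open>The constraint holds pointwise for the approximants; an almost everywhere
      convergent subsequence transfers it to the limit.\<close>
    obtain r where r: "strict_mono r" "AE x in ?M. (\<lambda>n. v (r n) x) \<longlonglongrightarrow> \<xi> x"
      by (rule L2_AE_subseq[OF vsq(1) \<xi>])
    from r(2) show ?thesis
    proof eventually_elim
      case (elim x)
      have "(\<lambda>n. L (v (r n) x)) \<longlonglongrightarrow> L (\<xi> x)" by (rule bounded_linear.tendsto[OF L(1) elim])
      then show ?case unfolding vL[OF L] by (simp only: LIMSEQ_const_iff)
    qed
  qed
  show ?thesis by (rule that[OF sg v(1,2) \<xi>(2) gl bound L])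
qed

text \<open>The boundary norms are identically 0, since the circle lies in the zero set of every
  approximant. The Sobolev norm of the difference is computed from the strong gradient of the
  difference.\<close>

lemma has_trace_zeroI:
  fixes \<xi> :: "real^2 \<Rightarrow> 'b::euclidean_space"
  assumes sg: "strong_gradient \<xi> G disc"
    and v: "\<And>k::nat. smooth (v k)" "\<And>k x. 1 \<le> norm x \<Longrightarrow> v k x = 0"
    and vl: "(\<lambda>k. L2_norm (lebesgue_on disc) (\<lambda>x. v k x - \<xi> x)) \<longlonglongrightarrow> 0"
    and gl: "(\<lambda>k. L2_norm (lebesgue_on disc) (\<lambda>x. grad (v k) x - G x)) \<longlonglongrightarrow> 0"
  shows "has_trace \<xi> (\<lambda>_. 0)"
  unfolding has_trace_def
proof (intro conjI exI[of _ v] allI v(1))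
  let ?M = "lebesgue_on disc"
  show "\<xi> \<in> W12 disc" by (rule strong_gradient_W12(1)[OF disc_open_bounded sg])
  show "square_integrable circle_measure (\<lambda>_. 0::'b)" by (simp add: square_integrable_def)
  have v1: "Ck (Suc 0) (v k)" for k using v(1)[of k] unfolding smooth_def by blast
  have "W12_norm disc (\<lambda>x. v k x - \<xi> x)
      = sqrt ((L2_norm ?M (\<lambda>x. v k x - \<xi> x))\<^sup>2 + (L2_norm ?M (\<lambda>x. grad (v k) x - G x))\<^sup>2)" for k
    unfolding W12_norm_def
    using strong_gradient_W12(4)[OF disc_open_bounded strong_gradient_diff[OF disc_open_bounded strong_gradient_C1[OF disc_open_bounded v1] sg]]
    by simp
  moreover have "(\<lambda>k. sqrt ((L2_norm ?M (\<lambda>x. v k x - \<xi> x))\<^sup>2 + (L2_norm ?M (\<lambda>x. grad (v k) x - G x))\<^sup>2)) \<longlonglongrightarrow> sqrt (0\<^sup>2 + 0\<^sup>2)"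
    by (intro tendsto_intros vl gl)
  ultimately show "(\<lambda>k. W12_norm disc (\<lambda>x. v k x - \<xi> x)) \<longlonglongrightarrow> 0" by simp
  have "L2_norm circle_measure (\<lambda>x. v k x - 0) = 0" for k
  proof -
    have c: "continuous_on UNIV (v k)" by (rule continuous_smooth[OF v(1)])
    have "continuous_on UNIV (\<lambda>t::real. vector [cos t, sin t] :: real^2)"
    proof -
      have "(\<lambda>t::real. vector [cos t, sin t] :: real^2) = (\<lambda>t. \<chi> i. if i = 1 then cos t else sin t)"
        by (simp add: fun_eq_iff vec_eq_iff forall_2)
      moreover have "continuous_on UNIV (\<lambda>t::real. if i = 1 then cos t else sin t)" for i :: 2
        using continuous_on_cos[OF continuous_on_id, of "UNIV :: real set"] continuous_on_sin[OF continuous_on_id, of "UNIV :: real set"]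
        by (cases "i = 1") simp_all
      ultimately show ?thesis by (simp only:) (intro continuous_on_vec_lambda)
    qed
    then have m: "(\<lambda>t. vector [cos t, sin t] :: real^2) \<in> restrict_space lborel {0..<2 * pi} \<rightarrow>\<^sub>M borel"
      using borel_measurable_continuous_onI by (intro measurable_restrict_space1) simp
    have "norm (vector [cos t, sin t] :: real^2) = 1" for t
      by (simp add: norm_vec_def L2_set_def sum_2)
    then have z: "v k (vector [cos t, sin t]) = 0" for t using v(2) by simp
    have "(\<integral>x. (norm (v k x - 0))\<^sup>2 \<partial>circle_measure) = (\<integral>t. (norm (v k (vector [cos t, sin t]) - 0))\<^sup>2 \<partial>restrict_space lborel {0..<2 * pi})"
      unfolding circle_measure_def
      by (rule integral_distr[OF m]) (intro borel_measurable_continuous_onI continuous_intros c)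
    then show ?thesis by (simp add: L2_norm_def z)
  qed
  then show "(\<lambda>k. L2_norm circle_measure (\<lambda>x. v k x - 0)) \<longlonglongrightarrow> 0" by (simp only: tendsto_const)
qed

section \<open>Matrix preliminaries\<close>

lemma bounded_bilinear_matrix_mult:
  "bounded_bilinear ((**) :: real^'n^'m \<Rightarrow> real^'p^'n \<Rightarrow> real^'p^'m)"
  unfolding bilinear_conv_bounded_bilinear[symmetric] bilinear_def
  by (auto intro!: linearI simp: vec_eq_iff matrix_matrix_mult_def sum.distrib sum_distrib_left algebra_simps)

lemmas matrix_mult_tendsto = bounded_bilinear.tendsto[OF bounded_bilinear_matrix_mult]

lemma bounded_linear_transpose: "bounded_linear (transpose :: real^'n^'m \<Rightarrow> real^'m^'n)"
  by (rule linear_conv_bounded_linear[THEN iffD1], rule linearI) (simp_all add: vec_eq_iff transpose_def)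

lemma transpose_add: "transpose (A + B :: real^'n^'m) = transpose A + transpose B"
  by (simp add: vec_eq_iff transpose_def)

lemma transpose_scaleR: "transpose (c *\<^sub>R A :: real^'n^'m) = c *\<^sub>R transpose A"
  by (simp add: vec_eq_iff transpose_def)

lemma inner_matrix: "(A :: real^'n^'m) \<bullet> B = (\<Sum>i\<in>UNIV. \<Sum>j\<in>UNIV. A $ i $ j * B $ i $ j)"
  by (simp add: inner_vec_def)

lemma inner_transpose: "transpose (A :: real^'n^'m) \<bullet> transpose B = A \<bullet> B"
  unfolding inner_matrix transpose_def by (simp add: sum.swap[of _ "UNIV :: 'n set"])

lemma norm_transpose: "norm (transpose (A :: real^'n^'m)) = norm A"
  by (simp add: norm_eq_sqrt_inner inner_transpose)

lemma inner_matrix_mult_left: "(A :: real^'p^'m) \<bullet> (P ** B) = (transpose P ** A) \<bullet> (B :: real^'p^'n)"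
proof -
  have "A \<bullet> (P ** B) = (\<Sum>i\<in>UNIV. \<Sum>j\<in>UNIV. \<Sum>k\<in>UNIV. A $ i $ j * (P $ i $ k * B $ k $ j))"
    unfolding inner_matrix matrix_matrix_mult_def by (simp add: sum_distrib_left)
  also have "\<dots> = (\<Sum>i\<in>UNIV. \<Sum>k\<in>UNIV. \<Sum>j\<in>UNIV. A $ i $ j * (P $ i $ k * B $ k $ j))"
    by (rule sum.cong[OF refl]) (rule sum.swap)
  also have "\<dots> = (\<Sum>k\<in>UNIV. \<Sum>i\<in>UNIV. \<Sum>j\<in>UNIV. A $ i $ j * (P $ i $ k * B $ k $ j))"
    by (rule sum.swap)
  also have "\<dots> = (\<Sum>k\<in>UNIV. \<Sum>j\<in>UNIV. \<Sum>i\<in>UNIV. A $ i $ j * (P $ i $ k * B $ k $ j))"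
    by (rule sum.cong[OF refl]) (rule sum.swap)
  also have "\<dots> = (transpose P ** A) \<bullet> B"
    unfolding inner_matrix matrix_matrix_mult_def transpose_def by (simp add: sum_distrib_left mult_ac)
  finally show ?thesis .
qed

lemma norm_orthogonal_mult_left:
  assumes "transpose Q ** Q = mat 1"
  shows "norm ((Q :: real^'m^'m) ** A) = norm (A :: real^'p^'m)"
  by (simp add: norm_eq_sqrt_inner inner_matrix_mult_left matrix_mul_assoc assms matrix_mul_lid)

lemma norm_orthogonal_mult_right:
  assumes "Q ** transpose Q = mat 1"
  shows "norm (A ** (Q :: real^'m^'m)) = norm (A :: real^'m^'p)"
proof -
  have "norm (A ** Q) = norm (transpose Q ** transpose A)"
    unfolding matrix_transpose_mul[symmetric] norm_transpose ..
  also have "\<dots> = norm A" by (simp add: norm_orthogonal_mult_left transpose_transpose assms norm_transpose)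
  finally show ?thesis .
qed

lemma SO_grpD:
  assumes "Q \<in> SO_grp"
  shows "transpose Q ** Q = mat 1" "Q ** transpose Q = mat 1" "det Q = 1"
  using assms by (auto simp: SO_grp_def rotation_matrix_def orthogonal_matrix_def)

lemma SO_grpI:
  assumes "transpose Q ** Q = mat 1" "det Q = 1"
  shows "Q \<in> SO_grp"
  using assms by (simp add: SO_grp_def rotation_matrix_def orthogonal_matrix)

lemma mat_1_SO: "mat 1 \<in> SO_grp"
  by (rule SO_grpI) (simp_all add: transpose_mat matrix_mul_lid)

lemma SO_grp_mult: "A \<in> SO_grp \<Longrightarrow> B \<in> SO_grp \<Longrightarrow> A ** B \<in> SO_grp"
  unfolding SO_grp_def rotation_matrix_def by (simp add: orthogonal_matrix_mul det_mul)

text \<open>All rotations lie on one sphere of the matrix space; its radius is the bound in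
  \<open>relaxed_transform\<close>.\<close>

lemma norm_SO_grp:
  fixes Q :: "real^'m^'m"
  assumes "Q \<in> SO_grp"
  shows "norm Q = norm (mat 1 :: real^'m^'m)"
  using norm_orthogonal_mult_left[OF SO_grpD(1)[OF assms], of "mat 1"] by (simp add: matrix_mul_rid)

lemma matrix_inv_SO_grp:
  assumes "(Q :: real^'m^'m) \<in> SO_grp"
  shows "matrix_inv Q = transpose Q"
proof -
  have "invertible Q" unfolding invertible_def using SO_grpD(1,2)[OF assms] by blast
  then have "matrix_inv Q ** Q = mat 1"
    unfolding invertible_def matrix_inv_def by (rule someI2_ex) simp
  then have "matrix_inv Q ** (Q ** transpose Q) = transpose Q" by (simp add: matrix_mul_assoc matrix_mul_lid)
  then show ?thesis by (simp add: SO_grpD(2)[OF assms] matrix_mul_rid)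
qed

text \<open>The group is cut out by polynomial equations in the entries.\<close>

lemma SO_grp_closed:
  fixes Q :: "nat \<Rightarrow> real^'m^'m"
  assumes Q: "\<And>n. Q n \<in> SO_grp" and l: "Q \<longlonglongrightarrow> Q0"
  shows "Q0 \<in> SO_grp"
proof (rule SO_grpI)
  have "(\<lambda>n. transpose (Q n) ** Q n) \<longlonglongrightarrow> transpose Q0 ** Q0"
    by (intro matrix_mult_tendsto bounded_linear.tendsto[OF bounded_linear_transpose] l)
  then show "transpose Q0 ** Q0 = mat 1" unfolding SO_grpD(1)[OF Q] by (simp add: LIMSEQ_const_iff)
  have "(\<lambda>n. det (Q n)) \<longlonglongrightarrow> det Q0"
    unfolding det_def by (intro tendsto_intros l)
  then show "det Q0 = 1" unfolding SO_grpD(3)[OF Q] by (simp add: LIMSEQ_const_iff)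
qed

definition form_mult_right :: "real^'m^'m^2 \<Rightarrow> real^'m^'m \<Rightarrow> real^'m^'m^2" where
  "form_mult_right W Q = (\<chi> i. W $ i ** Q)"

definition form_mult_left :: "real^'m^'m \<Rightarrow> real^'m^'m^2 \<Rightarrow> real^'m^'m^2" where
  "form_mult_left Q W = (\<chi> i. Q ** W $ i)"

lemma bounded_bilinear_form_mult_right: "bounded_bilinear form_mult_right"
  unfolding bilinear_conv_bounded_bilinear[symmetric] bilinear_def form_mult_right_def
  by (auto intro!: linearI simp: vec_eq_iff bounded_bilinear.add_left[OF bounded_bilinear_matrix_mult]
      bounded_bilinear.add_right[OF bounded_bilinear_matrix_mult]
      bounded_bilinear.scaleR_left[OF bounded_bilinear_matrix_mult]
      bounded_bilinear.scaleR_right[OF bounded_bilinear_matrix_mult])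

lemma bounded_bilinear_form_mult_left: "bounded_bilinear form_mult_left"
  unfolding bilinear_conv_bounded_bilinear[symmetric] bilinear_def form_mult_left_def
  by (auto intro!: linearI simp: vec_eq_iff bounded_bilinear.add_left[OF bounded_bilinear_matrix_mult]
      bounded_bilinear.add_right[OF bounded_bilinear_matrix_mult]
      bounded_bilinear.scaleR_left[OF bounded_bilinear_matrix_mult]
      bounded_bilinear.scaleR_right[OF bounded_bilinear_matrix_mult])

lemma norm_form_mult_right: "Q \<in> SO_grp \<Longrightarrow> norm (form_mult_right W Q) = norm W"
  unfolding form_mult_right_def norm_vec_def[of "\<chi> i. W $ i ** Q"] norm_vec_def[of W]
  by (simp add: norm_orthogonal_mult_right SO_grpD)

lemma norm_form_mult_left: "Q ** transpose Q = mat 1 \<Longrightarrow> norm (form_mult_left (transpose Q) W) = norm W"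
  unfolding form_mult_left_def norm_vec_def[of "\<chi> i. transpose Q ** W $ i"] norm_vec_def[of W]
  by (simp add: norm_orthogonal_mult_left transpose_transpose)

lemma borel_measurable_bilinear_compose:
  fixes f :: "'a \<Rightarrow> 'b::euclidean_space" and g :: "'a \<Rightarrow> 'c::euclidean_space"
    and h :: "'b \<Rightarrow> 'c \<Rightarrow> 'd::euclidean_space"
  assumes h: "bounded_bilinear h" and f: "f \<in> borel_measurable M" and g: "g \<in> borel_measurable M"
  shows "(\<lambda>x. h (f x) (g x)) \<in> borel_measurable M"
proof -
  have "continuous_on UNIV (\<lambda>p. h (fst p) (snd p))"
    by (intro bounded_bilinear.continuous_on[OF h] continuous_intros)
  from borel_measurable_continuous_on[OF this borel_measurable_Pair[OF f g]] show ?thesis by simp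
qed

section \<open>Minimising the energy over gauge transformations\<close>

text \<open>The transformed connection multiplied by P from the left. For rotations this does not
  change the norm, and without the inverse the expression is linear in the pair (P, G), which
  convexity arguments require.\<close>

definition gauge_form ::
    "(real^2 \<Rightarrow> real^'m^'m^2) \<Rightarrow> (real^2 \<Rightarrow> real^'m^'m) \<Rightarrow> (real^2 \<Rightarrow> real^'m^'m^2) \<Rightarrow> real^2 \<Rightarrow> real^'m^'m^2" where
  "gauge_form \<Omega> P G x = G x + form_mult_right (\<Omega> x) (P x)"

abbreviation energy ::
    "(real^2 \<Rightarrow> real^'m^'m^2) \<Rightarrow> (real^2 \<Rightarrow> real^'m^'m) \<Rightarrow> (real^2 \<Rightarrow> real^'m^'m^2) \<Rightarrow> real" where
  "energy \<Omega> P G \<equiv> L2_norm (lebesgue_on disc) (gauge_form \<Omega> P G)"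

definition gauge_transform :: "(real^2 \<Rightarrow> real^'m^'m) \<Rightarrow> (real^2 \<Rightarrow> real^'m^'m^2) \<Rightarrow> bool" where
  "gauge_transform P G \<longleftrightarrow> strong_gradient P G disc \<and> (AE x in lebesgue_on disc. P x \<in> SO_grp)"

text \<open>The convex class in which the minimisation takes place: being a rotation is relaxed to
  the norm bound that rotations satisfy.\<close>

definition relaxed_transform :: "(real^2 \<Rightarrow> real^'m^'m) \<Rightarrow> (real^2 \<Rightarrow> real^'m^'m^2) \<Rightarrow> bool" where
  "relaxed_transform P G \<longleftrightarrow> strong_gradient P G disc \<and>
     (AE x in lebesgue_on disc. norm (P x) \<le> norm (mat 1 :: real^'m^'m))"

lemma gauge_transform_relaxed: "gauge_transform P G \<Longrightarrow> relaxed_transform P G"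
  unfolding gauge_transform_def relaxed_transform_def by (auto elim!: eventually_mono simp: norm_SO_grp)

lemma gauge_transform_const: "gauge_transform (\<lambda>x. mat 1) (grad (\<lambda>x. mat 1))"
  unfolding gauge_transform_def using strong_gradient_C1[OF disc_open_bounded Ck_const] by (auto simp: mat_1_SO)

context
  fixes \<Omega> :: "real^2 \<Rightarrow> real^'m^'m^2"
  assumes \<Omega>: "square_integrable (lebesgue_on disc) \<Omega>"
begin

text \<open>As \<Omega> is only in L2, it is the pointwise bound on Q that keeps the product in
  L2.\<close>

lemma form_mult_right_square_integrable:
  assumes "Q \<in> borel_measurable (lebesgue_on disc)" "AE x in lebesgue_on disc. norm (Q x) \<le> c"
  shows "square_integrable (lebesgue_on disc) (\<lambda>x. form_mult_right (\<Omega> x) (Q x))"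
proof -
  obtain K where K: "K > 0" "\<And>W Q :: real^'m^'m. norm (form_mult_right W Q) \<le> norm W * norm Q * K"
    using bounded_bilinear.pos_bounded[OF bounded_bilinear_form_mult_right] by blast
  show ?thesis
  proof (rule square_integrable_bound(1)[OF \<Omega>])
    show "(\<lambda>x. form_mult_right (\<Omega> x) (Q x)) \<in> borel_measurable (lebesgue_on disc)"
      by (rule borel_measurable_bilinear_compose[OF bounded_bilinear_form_mult_right square_integrable_measurable[OF \<Omega>] assms(1)])
    show "AE x in lebesgue_on disc. norm (form_mult_right (\<Omega> x) (Q x)) \<le> (c * K) * norm (\<Omega> x)"
      using assms(2)
    proof eventually_elim
      case (elim x)
      have "norm (\<Omega> x) * norm (Q x) * K \<le> norm (\<Omega> x) * c * K"
        using elim K(1) by (intro mult_right_mono mult_left_mono) auto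
      then show ?case using K(2)[of "\<Omega> x" "Q x"] by (simp add: mult_ac)
    qed
  qed
qed

lemma gauge_form_square_integrable:
  assumes "relaxed_transform P G"
  shows "square_integrable (lebesgue_on disc) (\<lambda>x. form_mult_right (\<Omega> x) (P x))"
    "square_integrable (lebesgue_on disc) (gauge_form \<Omega> P G)"
proof -
  note sg = assms[unfolded relaxed_transform_def]
  note sq = strong_gradient_square_integrable[OF conjunct1[OF sg]]
  show 1: "square_integrable (lebesgue_on disc) (\<lambda>x. form_mult_right (\<Omega> x) (P x))"
    by (rule form_mult_right_square_integrable[OF square_integrable_measurable[OF sq(1)] conjunct2[OF sg]])
  show "square_integrable (lebesgue_on disc) (gauge_form \<Omega> P G)"
    unfolding gauge_form_def by (rule square_integrable_add[OF sq(2) 1])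
qed

lemma L2_norm_form_mult_gauge:
  assumes "gauge_transform P G"
  shows "L2_norm (lebesgue_on disc) (\<lambda>x. form_mult_right (\<Omega> x) (P x)) = L2_norm (lebesgue_on disc) \<Omega>"
proof -
  let ?M = "lebesgue_on disc"
  note f = gauge_form_square_integrable(1)[OF gauge_transform_relaxed[OF assms]]
  have ae: "AE x in ?M. norm (form_mult_right (\<Omega> x) (P x)) = norm (\<Omega> x)"
    using assms unfolding gauge_transform_def by (auto elim!: eventually_mono simp: norm_form_mult_right)
  have "L2_norm ?M (\<lambda>x. norm (form_mult_right (\<Omega> x) (P x))) = L2_norm ?M (\<lambda>x. norm (\<Omega> x))"
    by (rule L2_norm_cong_AE[OF _ _ ae])
      (rule measurable_compose[OF square_integrable_measurable[OF f] borel_measurable_norm]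
        measurable_compose[OF square_integrable_measurable[OF \<Omega>] borel_measurable_norm])+
  then show ?thesis by (simp add: L2_norm_def)
qed

text \<open>By linearity the energy of the midpoint is the norm of the midpoint of the two gauge
  forms, the quantity in the parallelogram identity.\<close>

lemma gauge_form_convex:
  assumes "relaxed_transform P G" "relaxed_transform Q H"
  shows "relaxed_transform (\<lambda>x. (1/2) *\<^sub>R (P x + Q x)) (\<lambda>x. (1/2) *\<^sub>R (G x + H x))"
    "gauge_form \<Omega> (\<lambda>x. (1/2) *\<^sub>R (P x + Q x)) (\<lambda>x. (1/2) *\<^sub>R (G x + H x)) x = (1/2) *\<^sub>R (gauge_form \<Omega> P G x + gauge_form \<Omega> Q H x)"
proof -
  let ?c = "norm (mat 1 :: real^'m^'m)"
  have "AE x in lebesgue_on disc. norm (P x) \<le> ?c" "AE x in lebesgue_on disc. norm (Q x) \<le> ?c"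
    using assms by (auto simp: relaxed_transform_def)
  then have "AE x in lebesgue_on disc. norm ((1/2) *\<^sub>R (P x + Q x)) \<le> ?c"
  proof eventually_elim
    case (elim x)
    then show ?case using norm_triangle_ineq[of "P x" "Q x"] by simp
  qed
  then show "relaxed_transform (\<lambda>x. (1/2) *\<^sub>R (P x + Q x)) (\<lambda>x. (1/2) *\<^sub>R (G x + H x))"
    using assms strong_gradient_scaleR[OF disc_open_bounded strong_gradient_add[OF disc_open_bounded]]
    unfolding relaxed_transform_def by blast
  show "gauge_form \<Omega> (\<lambda>x. (1/2) *\<^sub>R (P x + Q x)) (\<lambda>x. (1/2) *\<^sub>R (G x + H x)) x = (1/2) *\<^sub>R (gauge_form \<Omega> P G x + gauge_form \<Omega> Q H x)"
    unfolding gauge_form_def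
    by (simp add: bounded_bilinear.add_right[OF bounded_bilinear_form_mult_right]
        bounded_bilinear.scaleR_right[OF bounded_bilinear_form_mult_right] algebra_simps)
qed

text \<open>Rotations are bounded, and G is the gauge form minus \<Omega>P with \<Omega>P as large
  as \<Omega>; so bounded energy suffices for Rellich. An almost everywhere convergent subsequence
  keeps the limit in the closed group.\<close>

lemma gauge_limit:
  assumes g: "\<And>n. gauge_transform (P n) (G n)" and e: "\<And>n. energy \<Omega> (P n) (G n) \<le> B"
  obtains r :: "nat \<Rightarrow> nat" and P0 where "strict_mono r" "square_integrable (lebesgue_on disc) P0"
    "(\<lambda>n. L2_norm (lebesgue_on disc) (\<lambda>x. P (r n) x - P0 x)) \<longlonglongrightarrow> 0"
    "AE x in lebesgue_on disc. P0 x \<in> SO_grp"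
proof -
  let ?M = "lebesgue_on disc" and ?c = "norm (mat 1 :: real^'m^'m)"
  have sg: "strong_gradient (P n) (G n) disc" and so: "AE x in ?M. P n x \<in> SO_grp" for n
    using g[of n] by (auto simp: gauge_transform_def)
  note sq = strong_gradient_square_integrable[OF sg]
  define C where "C = max (?c * L2_norm ?M (\<lambda>x. 1::real)) (B + L2_norm ?M \<Omega>)"
  have 1: "L2_norm ?M (P n) \<le> C" for n
  proof -
    have "L2_norm ?M (P n) \<le> ?c * L2_norm ?M (\<lambda>x. 1::real)"
      by (rule L2_norm_bound[OF square_integrable_const[OF disc_finite_measure] square_integrable_measurable[OF sq(1)]])
        (use so[of n] in \<open>auto elim!: eventually_mono simp: norm_SO_grp\<close>)
    then show ?thesis by (simp add: C_def)
  qed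
  have 2: "L2_norm ?M (G n) \<le> C" for n
  proof -
    note gs = gauge_form_square_integrable[OF gauge_transform_relaxed[OF g[of n]]]
    have "L2_norm ?M (G n) \<le> energy \<Omega> (P n) (G n) + L2_norm ?M (\<lambda>x. G n x - gauge_form \<Omega> (P n) (G n) x)"
      by (rule L2_norm_triangle_sub[OF sq(2) gs(2)])
    also have "(\<lambda>x. G n x - gauge_form \<Omega> (P n) (G n) x) = (\<lambda>x. - form_mult_right (\<Omega> x) (P n x))"
      by (simp add: gauge_form_def)
    finally show ?thesis using e[of n] by (simp add: L2_norm_uminus L2_norm_form_mult_gauge[OF g] C_def)
  qed
  obtain r :: "nat \<Rightarrow> nat" and P0 where r: "strict_mono r" "square_integrable ?M P0"
    "(\<lambda>n. L2_norm ?M (\<lambda>x. P (r n) x - P0 x)) \<longlonglongrightarrow> 0"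
    by (rule Rellich[of P G C, OF sg 1 2]) blast
  obtain q :: "nat \<Rightarrow> nat" where q: "strict_mono q" "AE x in ?M. (\<lambda>n. P (r (q n)) x) \<longlonglongrightarrow> P0 x"
    by (rule L2_AE_subseq[of ?M "\<lambda>n. P (r n)" P0, OF sq(1) r(2,3)]) blast
  have "AE x in ?M. \<forall>n. P n x \<in> SO_grp" using so by (simp add: AE_all_countable)
  with q(2) have "AE x in ?M. P0 x \<in> SO_grp"
  proof eventually_elim
    case (elim x)
    show ?case by (rule SO_grp_closed[OF _ elim(1)]) (use elim(2) in simp)
  qed
  with r show ?thesis by (rule that)
qed

text \<open>L2 convergence of the gauges alone does not control their product with an L2 form. The
  common pointwise bound supplies a multiple of |\<Omega>| as majorant, which is why the relaxed
  class retains it.\<close>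

lemma form_mult_tendsto:
  assumes Q: "\<And>n. relaxed_transform (Q n) (H n)"
    and P: "square_integrable (lebesgue_on disc) P0" "AE x in lebesgue_on disc. P0 x \<in> SO_grp"
    and l: "(\<lambda>n. L2_norm (lebesgue_on disc) (\<lambda>x. Q n x - P0 x)) \<longlonglongrightarrow> 0"
  obtains r :: "nat \<Rightarrow> nat" where "strict_mono r"
    "(\<lambda>n. L2_norm (lebesgue_on disc) (\<lambda>x. form_mult_right (\<Omega> x) (Q (r n) x) - form_mult_right (\<Omega> x) (P0 x))) \<longlonglongrightarrow> 0"
proof -
  let ?M = "lebesgue_on disc" and ?c = "norm (mat 1 :: real^'m^'m)"
  have sg: "strong_gradient (Q n) (H n) disc" and nb: "AE x in ?M. norm (Q n x) \<le> ?c" for n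
    using Q[of n] by (auto simp: relaxed_transform_def)
  note sq = strong_gradient_square_integrable[OF sg]
  obtain r :: "nat \<Rightarrow> nat" where r: "strict_mono r" "AE x in ?M. (\<lambda>n. Q (r n) x) \<longlonglongrightarrow> P0 x"
    by (rule L2_AE_subseq[of ?M Q P0, OF sq(1) P(1) l]) blast
  obtain K where K: "K > 0" "\<And>W Q :: real^'m^'m. norm (form_mult_right W Q) \<le> norm W * norm Q * K"
    using bounded_bilinear.pos_bounded[OF bounded_bilinear_form_mult_right] by blast
  have pb: "AE x in ?M. norm (P0 x) \<le> ?c"
    using P(2) by eventually_elim (simp add: norm_SO_grp)
  note f1 = form_mult_right_square_integrable[OF square_integrable_measurable[OF sq(1)] nb]
    and f2 = form_mult_right_square_integrable[OF square_integrable_measurable[OF P(1)] pb]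
  have "(\<lambda>n. L2_norm ?M (\<lambda>x. form_mult_right (\<Omega> x) (Q (r n) x) - form_mult_right (\<Omega> x) (P0 x))) \<longlonglongrightarrow> 0"
  proof (rule L2_dominated_tendsto)
    show "(\<lambda>x. form_mult_right (\<Omega> x) (Q (r n) x)) \<in> borel_measurable ?M" for n
      by (rule square_integrable_measurable[OF f1])
    show "(\<lambda>x. form_mult_right (\<Omega> x) (P0 x)) \<in> borel_measurable ?M" by (rule square_integrable_measurable[OF f2])
    show "square_integrable ?M (\<lambda>x. (2 * ?c * K) *\<^sub>R norm (\<Omega> x))"
      by (rule square_integrable_scaleR) (use \<Omega> in \<open>auto simp: square_integrable_def\<close>)
    show "AE x in ?M. norm (form_mult_right (\<Omega> x) (Q (r n) x) - form_mult_right (\<Omega> x) (P0 x)) \<le> (2 * ?c * K) *\<^sub>R norm (\<Omega> x)" for n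
      using nb[of "r n"] pb
    proof eventually_elim
      case (elim x)
      have "norm (Q (r n) x - P0 x) \<le> 2 * ?c" using norm_triangle_ineq4[of "Q (r n) x" "P0 x"] elim by simp
      then have "norm (\<Omega> x) * norm (Q (r n) x - P0 x) * K \<le> norm (\<Omega> x) * (2 * ?c) * K"
        using K(1) by (intro mult_right_mono mult_left_mono) auto
      then show ?case
        using K(2)[of "\<Omega> x" "Q (r n) x - P0 x"]
        by (simp add: bounded_bilinear.diff_right[OF bounded_bilinear_form_mult_right] mult_ac)
    qed
    show "AE x in ?M. (\<lambda>n. form_mult_right (\<Omega> x) (Q (r n) x)) \<longlonglongrightarrow> form_mult_right (\<Omega> x) (P0 x)"
      using r(2) by eventually_elim (intro bounded_bilinear.tendsto[OF bounded_bilinear_form_mult_right] tendsto_const)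
  qed
  with r(1) show ?thesis by (rule that)
qed

text \<open>A weak limit of a minimising sequence is replaced by a strong one: near-minimisers in the
  shrinking convex sets of relaxed gauges that are \<open>L\<^sup>2\<close>-close to the limit have Cauchy
  gauge forms by the parallelogram identity.\<close>

lemma energy_minimiser:
  obtains P G where "gauge_transform P G" "\<And>P' G'. gauge_transform P' G' \<Longrightarrow> energy \<Omega> P G \<le> energy \<Omega> P' G'"
proof -
  let ?M = "lebesgue_on disc"
  let ?Es = "{energy \<Omega> P G | P G. gauge_transform P G}"
  define \<alpha> where "\<alpha> = Inf ?Es"
  have ne: "?Es \<noteq> {}" using gauge_transform_const by blast
  have bb: "bdd_below ?Es" by (rule bdd_belowI[of _ 0]) auto
  have \<alpha>_le: "\<alpha> \<le> energy \<Omega> P G" if "gauge_transform P G" for P G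
    unfolding \<alpha>_def by (rule cInf_lower[OF _ bb]) (use that in blast)
  have "\<exists>PG. gauge_transform (fst PG) (snd PG) \<and> energy \<Omega> (fst PG) (snd PG) < \<alpha> + 1 / real (Suc n)" for n
  proof -
    have "Inf ?Es < \<alpha> + 1 / real (Suc n)" unfolding \<alpha>_def by simp
    from cInf_lessD[OF ne this] show ?thesis by force
  qed
  then have "\<exists>PG. \<forall>n. gauge_transform (fst (PG n)) (snd (PG n)) \<and> energy \<Omega> (fst (PG n)) (snd (PG n)) < \<alpha> + 1 / real (Suc n)"
    by (intro choice allI)
  then obtain PG where PG: "\<And>n. gauge_transform (fst (PG n)) (snd (PG n))"
    "\<And>n. energy \<Omega> (fst (PG n)) (snd (PG n)) < \<alpha> + 1 / real (Suc n)" by blast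
  have le1: "1 / real (Suc n) \<le> 1" for n by simp
  have eb: "energy \<Omega> (fst (PG n)) (snd (PG n)) \<le> \<alpha> + 1" for n using PG(2)[of n] le1[of n] by linarith
  obtain r :: "nat \<Rightarrow> nat" and P0 where r: "strict_mono r" and P0: "square_integrable ?M P0"
    and rl: "(\<lambda>n. L2_norm ?M (\<lambda>x. fst (PG (r n)) x - P0 x)) \<longlonglongrightarrow> 0"
    and SO: "AE x in ?M. P0 x \<in> SO_grp"
    by (rule gauge_limit[of "\<lambda>n. fst (PG n)" "\<lambda>n. snd (PG n)" "\<alpha> + 1", OF PG(1) eb]) blast
  \<comment> \<open>Decreasing convex sets around the limit P0, each containing a tail of the
    minimising sequence of true gauges.\<close>
  define C where "C n = {(Q, H). relaxed_transform Q H \<and> L2_norm ?M (\<lambda>x. Q x - P0 x) \<le> 1 / real (Suc n)}" for n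
  define a where "a n = Inf ((\<lambda>(Q, H). energy \<Omega> Q H) ` C n)" for n
  have near: "\<exists>K. \<forall>k\<ge>K. PG (r k) \<in> C n" for n
  proof -
    have "eventually (\<lambda>k. L2_norm ?M (\<lambda>x. fst (PG (r k)) x - P0 x) < 1 / real (Suc n)) sequentially"
      using rl by (rule order_tendstoD) simp
    then obtain K where "\<And>k. k \<ge> K \<Longrightarrow> L2_norm ?M (\<lambda>x. fst (PG (r k)) x - P0 x) < 1 / real (Suc n)"
      by (auto simp: eventually_sequentially)
    then have "PG (r k) \<in> C n" if "k \<ge> K" for k
      using gauge_transform_relaxed[OF PG(1)[of "r k"]] that by (simp add: C_def case_prod_beta less_imp_le)
    then show ?thesis by blast
  qed
  have Cne: "(\<lambda>(Q, H). energy \<Omega> Q H) ` C n \<noteq> {}" for n using near[of n] by blast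
  have Cbb: "bdd_below ((\<lambda>(Q, H). energy \<Omega> Q H) ` C n)" for n by (rule bdd_belowI[of _ 0]) auto
  have a_le: "a n \<le> energy \<Omega> Q H" if "(Q, H) \<in> C n" for n Q H
    unfolding a_def by (rule cInf_lower[OF _ Cbb]) (use that in force)
  have a0: "0 \<le> a n" for n unfolding a_def by (rule cInf_greatest[OF Cne]) auto
  \<comment> \<open>The tail inside \<open>C n\<close> has energies tending to \<alpha>, so relaxing
    the constraint can only lower the infimum.\<close>
  have a_\<alpha>: "a n \<le> \<alpha>" for n
  proof (rule field_le_epsilon)
    fix e :: real assume e: "e > 0"
    obtain K where K: "\<And>k. k \<ge> K \<Longrightarrow> PG (r k) \<in> C n" using near[of n] by blast
    obtain j where j: "1 / real (Suc j) < e" using nat_approx_posE[OF e] by auto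
    let ?k = "max K j"
    have "a n \<le> energy \<Omega> (fst (PG (r ?k))) (snd (PG (r ?k)))" by (rule a_le) (use K[of ?k] in simp)
    also have "\<dots> \<le> \<alpha> + 1 / real (Suc (r ?k))" using PG(2)[of "r ?k"] by simp
    also have "1 / real (Suc (r ?k)) \<le> 1 / real (Suc j)"
      using seq_suble[OF r, of ?k] by (intro divide_left_mono) auto
    finally show "a n \<le> \<alpha> + e" using j by simp
  qed
  have Cmono: "C n \<subseteq> C m" if "m \<le> n" for m n
  proof -
    have "1 / real (Suc n) \<le> 1 / real (Suc m)" using that by (intro divide_left_mono) auto
    then show ?thesis unfolding C_def by force
  qed
  have "incseq a"
    unfolding a_def by (intro monoI cInf_superset_mono Cne Cbb image_mono Cmono)
  then obtain a' where a': "a \<longlonglongrightarrow> a'" using incseq_convergent[of a \<alpha>] a_\<alpha> by blast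
  have a'\<alpha>: "a' \<le> \<alpha>" by (rule LIMSEQ_le_const2[OF a']) (use a_\<alpha> in blast)
  have "\<exists>QH. QH \<in> C n \<and> energy \<Omega> (fst QH) (snd QH) < a n + 1 / real (Suc n)" for n
  proof -
    have "Inf ((\<lambda>(Q, H). energy \<Omega> Q H) ` C n) < a n + 1 / real (Suc n)" unfolding a_def by simp
    from cInf_lessD[OF Cne this] show ?thesis by force
  qed
  then have "\<exists>QH. \<forall>n. QH n \<in> C n \<and> energy \<Omega> (fst (QH n)) (snd (QH n)) < a n + 1 / real (Suc n)"
    by (intro choice allI)
  then obtain QH where QH: "\<And>n. QH n \<in> C n"
    "\<And>n. energy \<Omega> (fst (QH n)) (snd (QH n)) < a n + 1 / real (Suc n)" by blast
  define Q where "Q n = fst (QH n)" for n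
  define H where "H n = snd (QH n)" for n
  define X where "X n = gauge_form \<Omega> (Q n) (H n)" for n
  have QC: "(Q n, H n) \<in> C n" for n using QH(1)[of n] by (simp add: Q_def H_def)
  have Qr: "relaxed_transform (Q n) (H n)" and Qn: "L2_norm ?M (\<lambda>x. Q n x - P0 x) \<le> 1 / real (Suc n)" for n
    using QC[of n] by (auto simp: C_def)
  have Qsg: "strong_gradient (Q n) (H n) disc" for n using Qr[of n] by (simp add: relaxed_transform_def)
  note Qsq = strong_gradient_square_integrable[OF Qsg]
  have Xsq: "square_integrable ?M (X n)" for n unfolding X_def by (rule gauge_form_square_integrable(2)[OF Qr])
  define b where "b n = a n + 1 / real (Suc n)" for n
  have b0: "0 \<le> b n" for n using a0[of n] by (simp add: b_def)
  have Xb: "L2_norm ?M (X n) \<le> b n" for n using QH(2)[of n] by (simp add: X_def Q_def H_def b_def)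
  have bl: "b \<longlonglongrightarrow> a'"
    unfolding b_def using tendsto_add[OF a' LIMSEQ_Suc[OF lim_1_over_n]] by simp
  \<comment> \<open>The sets are nested and convex, so the midpoint of the m-th and n-th choice lies
    in the larger set and its energy is at least \<open>a m\<close>.\<close>
  have Xdiff: "(L2_norm ?M (\<lambda>x. X m x - X n x))\<^sup>2 \<le> 2 * (b m)\<^sup>2 + 2 * (b n)\<^sup>2 - 4 * (a m)\<^sup>2" if mn: "m \<le> n" for m n
  proof -
    have nC: "(Q n, H n) \<in> C m" using QC[of n] Cmono[OF mn] by blast
    let ?Q = "\<lambda>x. (1/2) *\<^sub>R (Q m x + Q n x)" and ?H = "\<lambda>x. (1/2) *\<^sub>R (H m x + H n x)"
    have "L2_norm ?M (\<lambda>x. ?Q x - P0 x) \<le> 1 / real (Suc m)"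
    proof -
      have "?Q x - P0 x = (1/2) *\<^sub>R ((Q m x - P0 x) + (Q n x - P0 x))" for x
      proof -
        have "(Q m x - P0 x) + (Q n x - P0 x) = (Q m x + Q n x) - (P0 x + P0 x)" by simp
        then show ?thesis by (simp only: scaleR_diff_right scaleR_half_double)
      qed
      then have "L2_norm ?M (\<lambda>x. ?Q x - P0 x) = (1/2) * L2_norm ?M (\<lambda>x. (Q m x - P0 x) + (Q n x - P0 x))"
        by (simp add: L2_norm_scaleR del: scaleR_add_right)
      also have "L2_norm ?M (\<lambda>x. (Q m x - P0 x) + (Q n x - P0 x)) \<le> 1 / real (Suc m) + 1 / real (Suc m)"
        using L2_norm_triangle[OF square_integrable_diff[OF Qsq(1)[of m] P0] square_integrable_diff[OF Qsq(1)[of n] P0]]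
          Qn[of m] nC by (simp add: C_def)
      finally show ?thesis by simp
    qed
    then have "(?Q, ?H) \<in> C m" using gauge_form_convex(1)[OF Qr[of m] Qr[of n]] by (simp add: C_def)
    then have "a m \<le> energy \<Omega> ?Q ?H" by (rule a_le)
    also have "energy \<Omega> ?Q ?H = L2_norm ?M (\<lambda>x. (1/2) *\<^sub>R (X m x + X n x))"
      unfolding X_def by (rule L2_norm_cong) (rule gauge_form_convex(2)[OF Qr Qr])
    finally have "(a m)\<^sup>2 \<le> (L2_norm ?M (\<lambda>x. (1/2) *\<^sub>R (X m x + X n x)))\<^sup>2" by (rule power_mono[OF _ a0])
    moreover have "(L2_norm ?M (X m))\<^sup>2 \<le> (b m)\<^sup>2" "(L2_norm ?M (X n))\<^sup>2 \<le> (b n)\<^sup>2"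
      by (rule power_mono[OF Xb L2_norm_nonneg])+
    ultimately show ?thesis unfolding L2_parallelogram[OF Xsq Xsq] by linarith
  qed
  have cauchy: "\<exists>K. \<forall>m\<ge>K. \<forall>n\<ge>K. L2_norm ?M (\<lambda>x. X m x - X n x) < e" if e: "e > 0" for e
  proof -
    \<comment> \<open>The parallelogram bound has coefficients 2, 2 and -4; the terms with the limit
      cancel, and errors of e^2/8 add up to exactly e^2.\<close>
    have e8: "e\<^sup>2 / 8 > 0" using e by simp
    have "eventually (\<lambda>n. (b n)\<^sup>2 < a'\<^sup>2 + e\<^sup>2 / 8) sequentially"
      using tendsto_power[OF bl, of 2] by (rule order_tendstoD) (use e8 in simp)
    moreover have "eventually (\<lambda>n. (a n)\<^sup>2 > a'\<^sup>2 - e\<^sup>2 / 8) sequentially"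
      using tendsto_power[OF a', of 2] by (rule order_tendstoD) (use e8 in simp)
    ultimately have "eventually (\<lambda>n. (b n)\<^sup>2 < a'\<^sup>2 + e\<^sup>2 / 8 \<and> (a n)\<^sup>2 > a'\<^sup>2 - e\<^sup>2 / 8) sequentially"
      by (rule eventually_conj)
    then obtain K where K: "\<And>n. n \<ge> K \<Longrightarrow> (b n)\<^sup>2 < a'\<^sup>2 + e\<^sup>2 / 8" "\<And>n. n \<ge> K \<Longrightarrow> (a n)\<^sup>2 > a'\<^sup>2 - e\<^sup>2 / 8"
      by (auto simp: eventually_sequentially)
    have lt: "L2_norm ?M (\<lambda>x. X m x - X n x) < e" if "m \<ge> K" "n \<ge> K" "m \<le> n" for m n
    proof -
      have "(L2_norm ?M (\<lambda>x. X m x - X n x))\<^sup>2 < e\<^sup>2"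
        using Xdiff[OF that(3)] K(1)[OF that(1)] K(1)[OF that(2)] K(2)[OF that(1)] by linarith
      then show ?thesis by (rule power2_less_imp_less) (use e in simp)
    qed
    have "L2_norm ?M (\<lambda>x. X m x - X n x) < e" if "m \<ge> K" "n \<ge> K" for m n
      using lt[OF that] lt[OF that(2,1)] L2_norm_minus_commute[of ?M "X m" "X n"] by (cases "m \<le> n") auto
    then show ?thesis by blast
  qed
  obtain Y where Y: "square_integrable ?M Y" "(\<lambda>n. L2_norm ?M (\<lambda>x. X n x - Y x)) \<longlonglongrightarrow> 0"
    by (rule L2_complete[of ?M X, OF Xsq cauchy]) blast
  have Ql: "(\<lambda>n. L2_norm ?M (\<lambda>x. Q n x - P0 x)) \<longlonglongrightarrow> 0"
    by (rule Lim_null_comparison[OF always_eventually LIMSEQ_Suc[OF lim_1_over_n]]) (use Qn in simp)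
  obtain q :: "nat \<Rightarrow> nat" where q: "strict_mono q"
    "(\<lambda>n. L2_norm ?M (\<lambda>x. form_mult_right (\<Omega> x) (Q (q n) x) - form_mult_right (\<Omega> x) (P0 x))) \<longlonglongrightarrow> 0"
    by (rule form_mult_tendsto[of Q H P0, OF Qr P0 SO Ql]) blast
  have pb: "AE x in ?M. norm (P0 x) \<le> norm (mat 1 :: real^'m^'m)"
    using SO by eventually_elim (simp add: norm_SO_grp)
  note f1 = gauge_form_square_integrable(1)[OF Qr]
    and f2 = form_mult_right_square_integrable[OF square_integrable_measurable[OF P0] pb]
  \<comment> \<open>The only candidate for the gradient: what remains of the limiting gauge form
    after removing \<Omega> P0.\<close>
  define G where "G x = Y x - form_mult_right (\<Omega> x) (P0 x)" for x
  have Gsq: "square_integrable ?M G" unfolding G_def by (rule square_integrable_diff[OF Y(1) f2])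
  have Yq: "(\<lambda>n. L2_norm ?M (\<lambda>x. X (q n) x - Y x)) \<longlonglongrightarrow> 0"
    using LIMSEQ_subseq_LIMSEQ[OF Y(2) q(1)] by (simp add: o_def)
  have Hl: "(\<lambda>n. L2_norm ?M (\<lambda>x. H (q n) x - G x)) \<longlonglongrightarrow> 0"
  proof (rule Lim_null_comparison[OF always_eventually tendsto_add_zero[OF Yq q(2)]], rule allI)
    fix n
    let ?f = "\<lambda>x. form_mult_right (\<Omega> x) (Q (q n) x) - form_mult_right (\<Omega> x) (P0 x)"
    have eq: "(\<lambda>x. H (q n) x - G x) = (\<lambda>x. (X (q n) x - Y x) + - ?f x)"
      by (simp add: fun_eq_iff X_def gauge_form_def G_def)
    have "L2_norm ?M (\<lambda>x. H (q n) x - G x) \<le> L2_norm ?M (\<lambda>x. X (q n) x - Y x) + L2_norm ?M (\<lambda>x. - ?f x)"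
      unfolding eq by (rule L2_norm_triangle[OF square_integrable_diff[OF Xsq Y(1)] square_integrable_uminus[OF square_integrable_diff[OF f1 f2]]])
    then show "norm (L2_norm ?M (\<lambda>x. H (q n) x - G x)) \<le> L2_norm ?M (\<lambda>x. X (q n) x - Y x) + L2_norm ?M ?f"
      unfolding L2_norm_uminus by simp
  qed
  have Qq: "(\<lambda>n. L2_norm ?M (\<lambda>x. Q (q n) x - P0 x)) \<longlonglongrightarrow> 0"
    using LIMSEQ_subseq_LIMSEQ[OF Ql q(1)] by (simp add: o_def)
  have "strong_gradient P0 G disc"
    by (rule strong_gradient_closed[OF disc_open_bounded Qsg P0 Gsq Qq Hl])
  \<comment> \<open>The relaxed choices need not be rotations, but they converge to P0, which is one
    almost everywhere by its construction as a limit of true gauges.\<close>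
  with SO have gauge: "gauge_transform P0 G" by (simp add: gauge_transform_def)
  have "gauge_form \<Omega> P0 G = Y" by (rule ext) (simp add: gauge_form_def G_def)
  then have "energy \<Omega> P0 G \<le> a'"
    using LIMSEQ_le[OF L2_norm_tendsto[OF Xsq Y] bl] Xb by auto
  then show ?thesis using that[OF gauge] a'\<alpha> \<alpha>_le by (meson order_trans)
qed

end

section \<open>The Euler-Lagrange equation\<close>

lemmas matrix_bilinear =
  bounded_bilinear.add_left[OF bounded_bilinear_matrix_mult] bounded_bilinear.add_right[OF bounded_bilinear_matrix_mult]
  bounded_bilinear.scaleR_left[OF bounded_bilinear_matrix_mult] bounded_bilinear.scaleR_right[OF bounded_bilinear_matrix_mult]
  bounded_bilinear.minus_left[OF bounded_bilinear_matrix_mult] bounded_bilinear.minus_right[OF bounded_bilinear_matrix_mult]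

text \<open>For a skew matrix with \<open>A\<^sup>3 = - A\<close>, Rodrigues' formula gives the one-parameter group
  generated by \<open>A\<close> without the matrix exponential.\<close>

definition rodrigues :: "real^'m^'m \<Rightarrow> real \<Rightarrow> real^'m^'m" where
  "rodrigues A \<theta> = mat 1 + (1 - cos \<theta>) *\<^sub>R (A ** A) + sin \<theta> *\<^sub>R A"

context
  fixes A :: "real^'m^'m"
  assumes skew: "transpose A = - A" and cube: "A ** (A ** A) = - A"
begin

text \<open>The cubic relation reduces every product to a combination of 1, A and A^2; the
  coefficients then are the addition theorems of sine and cosine.\<close>

lemma rodrigues_add: "rodrigues A \<theta> ** rodrigues A \<phi> = rodrigues A (\<theta> + \<phi>)"
proof -
  have c1: "(A ** A) ** A = - A" using cube by (simp add: matrix_mul_assoc)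
  have c2: "(A ** A) ** (A ** A) = - (A ** A)"
    using cube by (metis matrix_mul_assoc bounded_bilinear.minus_right[OF bounded_bilinear_matrix_mult])
  have "(mat 1 + u *\<^sub>R (A ** A) + s *\<^sub>R A) ** (mat 1 + u' *\<^sub>R (A ** A) + s' *\<^sub>R A)
      = mat 1 + (u + u' - u * u' + s * s') *\<^sub>R (A ** A) + (s + s' - u * s' - s * u') *\<^sub>R A" for u s u' s'
    by (simp add: matrix_bilinear matrix_mul_lid matrix_mul_rid c1 c2 cube algebra_simps)
  moreover have "(1 - cos \<theta>) + (1 - cos \<phi>) - (1 - cos \<theta>) * (1 - cos \<phi>) + sin \<theta> * sin \<phi> = 1 - cos (\<theta> + \<phi>)"
    "sin \<theta> + sin \<phi> - (1 - cos \<theta>) * sin \<phi> - sin \<theta> * (1 - cos \<phi>) = sin (\<theta> + \<phi>)"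
    by (simp_all add: cos_add sin_add algebra_simps)
  ultimately show ?thesis by (simp only: rodrigues_def)
qed

text \<open>Orthogonality leaves the sign of the determinant open. It is settled by halving the
  angle: the matrix is a square, so its determinant is the square of a number whose square is
  1.\<close>

lemma rodrigues_SO: "rodrigues A \<theta> \<in> SO_grp"
proof -
  have "transpose (rodrigues A \<theta>) = rodrigues A (- \<theta>)" for \<theta>
    by (simp add: rodrigues_def transpose_add transpose_scaleR transpose_mat matrix_transpose_mul skew matrix_bilinear)
  then have o: "transpose (rodrigues A \<theta>) ** rodrigues A \<theta> = mat 1" for \<theta>
    by (simp only: rodrigues_add) (simp add: rodrigues_def)
  have "det (transpose (rodrigues A \<theta>) ** rodrigues A \<theta>) = 1" for \<theta> unfolding o by simp
  then have "det (rodrigues A \<theta>) * det (rodrigues A \<theta>) = 1" for \<theta> by (simp add: det_mul det_transpose)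
  then have "det (rodrigues A (\<theta> / 2) ** rodrigues A (\<theta> / 2)) = 1" by (simp add: det_mul)
  then have "det (rodrigues A \<theta>) = 1" unfolding rodrigues_add by simp
  with o show ?thesis by (rule SO_grpI)
qed

text \<open>The right side is the derivative of \<open>rodrigues A\<close> in the angle, which is
  how the formula enters the gradient of the rotated gauge.\<close>

lemma generator_rodrigues: "A ** rodrigues A \<theta> = cos \<theta> *\<^sub>R A + sin \<theta> *\<^sub>R (A ** A)"
  unfolding rodrigues_def by (simp only: matrix_bilinear matrix_mul_rid cube) (simp add: algebra_simps)

text \<open>Rodrigues' formula leaves only scalar C1 coefficients times fixed matrices, so the
  product rule with C1 functions suffices. The rotation is factored out on the right because the
  energy does not see it there.\<close>

lemma strong_gradient_rotated:
  assumes P: "strong_gradient P G disc" and f: "Ck (Suc 0) (f :: real^2 \<Rightarrow> real)"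
  shows "strong_gradient (\<lambda>x. P x ** rodrigues A (t * f x))
    (\<lambda>x. \<chi> i. (G x $ i + (t * grad f x $ i) *\<^sub>R (P x ** A)) ** rodrigues A (t * f x)) disc"
proof -
  let ?g = "\<lambda>y. 1 - cos (t * y)" and ?h = "\<lambda>y. sin (t * y)"
  have gD: "(?g has_real_derivative t * sin (t * y)) (at y)" and hD: "(?h has_real_derivative t * cos (t * y)) (at y)" for y
    by (auto intro!: derivative_eq_intros)
  have gc: "continuous_on UNIV (\<lambda>y. t * sin (t * y))" and hc: "continuous_on UNIV (\<lambda>y. t * cos (t * y))"
    by (auto intro!: continuous_intros)
  note g1 = Ck_1_compose(1)[OF gD gc f] and h1 = Ck_1_compose(1)[OF hD hc f]
  have gg: "grad (\<lambda>x. ?g (f x)) x $ i = t * sin (t * f x) * grad f x $ i"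
    and gh: "grad (\<lambda>x. ?h (f x)) x $ i = t * cos (t * f x) * grad f x $ i" for x i
    unfolding grad_component Ck_1_compose(2)[OF gD gc f] Ck_1_compose(2)[OF hD hc f] by simp_all
  have lin: "bounded_linear (\<lambda>Q. Q ** B)" for B :: "real^'m^'m"
    by (rule bounded_bilinear.bounded_linear_left[OF bounded_bilinear_matrix_mult])
  note s1 = strong_gradient_mult[OF disc_open_bounded g1 strong_gradient_linear[OF disc_open_bounded lin P, of "A ** A"]]
    and s2 = strong_gradient_mult[OF disc_open_bounded h1 strong_gradient_linear[OF disc_open_bounded lin P, of A]]
  note s = strong_gradient_add[OF disc_open_bounded strong_gradient_add[OF disc_open_bounded P s1] s2]
  have e1: "P x + ?g (f x) *\<^sub>R (P x ** (A ** A)) + ?h (f x) *\<^sub>R (P x ** A) = P x ** rodrigues A (t * f x)" for x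
    unfolding rodrigues_def by (simp add: matrix_bilinear matrix_mul_rid)
  have e2: "G x + (\<chi> i. ?g (f x) *\<^sub>R (\<chi> i. G x $ i ** (A ** A)) $ i + grad (\<lambda>x. ?g (f x)) x $ i *\<^sub>R (P x ** (A ** A)))
      + (\<chi> i. ?h (f x) *\<^sub>R (\<chi> i. G x $ i ** A) $ i + grad (\<lambda>x. ?h (f x)) x $ i *\<^sub>R (P x ** A))
    = (\<chi> i. (G x $ i + (t * grad f x $ i) *\<^sub>R (P x ** A)) ** rodrigues A (t * f x))" for x
  proof -
    have "(P x ** A) ** rodrigues A (t * f x) = cos (t * f x) *\<^sub>R (P x ** A) + sin (t * f x) *\<^sub>R (P x ** (A ** A))"
      unfolding matrix_mul_assoc[symmetric] generator_rodrigues by (simp add: matrix_bilinear)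
    moreover have "G x $ i ** rodrigues A (t * f x) = G x $ i + ?g (f x) *\<^sub>R (G x $ i ** (A ** A)) + ?h (f x) *\<^sub>R (G x $ i ** A)" for i
      unfolding rodrigues_def by (simp add: matrix_bilinear matrix_mul_rid)
    ultimately have "(G x $ i + (t * grad f x $ i) *\<^sub>R (P x ** A)) ** rodrigues A (t * f x)
        = (G x $ i + ?g (f x) *\<^sub>R (G x $ i ** (A ** A)) + ?h (f x) *\<^sub>R (G x $ i ** A))
          + (t * grad f x $ i) *\<^sub>R (cos (t * f x) *\<^sub>R (P x ** A) + sin (t * f x) *\<^sub>R (P x ** (A ** A)))" for i
      by (simp only: matrix_bilinear)
    note c = this
    show ?thesis
      by (rule vec_eq_iff[THEN iffD2], rule allI) (simp only: vector_add_component vec_lambda_beta gg gh c, simp add: algebra_simps)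
  qed
  from s show ?thesis unfolding e1 e2 .
qed

end

lemma continuous_bilinear_L2:
  fixes c :: "'a::euclidean_space \<Rightarrow> 'b::euclidean_space" and w :: "'a \<Rightarrow> 'c::euclidean_space"
    and h :: "'b \<Rightarrow> 'c \<Rightarrow> 'd::euclidean_space"
  assumes U: "bounded U" and h: "bounded_bilinear h" and c: "continuous_on UNIV c"
    and w: "square_integrable (lebesgue_on U) w"
  shows "square_integrable (lebesgue_on U) (\<lambda>x. h (c x) (w x))"
proof -
  obtain K where K: "K > 0" "\<And>a b. norm (h a b) \<le> norm a * norm b * K"
    using bounded_bilinear.pos_bounded[OF h] by blast
  obtain B where B: "\<And>x. x \<in> U \<Longrightarrow> norm (c x) \<le> B" using continuous_bounded_on[OF U c] by blast
  show ?thesis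
  proof (rule square_integrable_bound(1)[OF w])
    show "(\<lambda>x. h (c x) (w x)) \<in> borel_measurable (lebesgue_on U)"
      by (rule borel_measurable_bilinear_compose[OF h continuous_measurable_lebesgue_on[OF c] square_integrable_measurable[OF w]])
    show "AE x in lebesgue_on U. norm (h (c x) (w x)) \<le> (B * K) * norm (w x)"
    proof (rule AE_I2)
      fix x assume "x \<in> space (lebesgue_on U)"
      then have "norm (c x) * norm (w x) * K \<le> B * norm (w x) * K"
        using B[of x] K(1) by (intro mult_right_mono) auto
      then show "norm (h (c x) (w x)) \<le> (B * K) * norm (w x)" using K(2)[of "c x" "w x"] by (simp add: mult_ac)
    qed
  qed
qed

lemma bounded_bilinear_tensor: "bounded_bilinear (\<lambda>(v :: real^2) (W :: 'b::euclidean_space). (\<chi> i. v $ i *\<^sub>R W) :: 'b^2)"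
  unfolding bilinear_conv_bounded_bilinear[symmetric] bilinear_def
  by (auto intro!: linearI simp: vec_eq_iff scaleR_add_left scaleR_add_right)

text \<open>The variation is an exact right multiplication by rotations, so the energy along it is
  bounded by an exact quadratic polynomial in t, without remainder. No boundary condition on f is
  imposed, which yields the natural boundary condition.\<close>

lemma energy_first_variation:
  fixes \<Omega> :: "real^2 \<Rightarrow> real^'m^'m^2"
  assumes \<Omega>: "square_integrable (lebesgue_on disc) \<Omega>"
    and A: "transpose A = - A" "A ** (A ** A) = - A"
    and g: "gauge_transform P G" and min: "\<And>P' G'. gauge_transform P' G' \<Longrightarrow> energy \<Omega> P G \<le> energy \<Omega> P' G'"
    and f: "Ck (Suc 0) (f :: real^2 \<Rightarrow> real)"
  shows "(\<integral>x. gauge_form \<Omega> P G x \<bullet> (\<chi> i. grad f x $ i *\<^sub>R (P x ** A)) \<partial>lebesgue_on disc) = 0"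
proof -
  let ?M = "lebesgue_on disc"
  let ?X = "gauge_form \<Omega> P G" and ?Z = "\<lambda>x. (\<chi> i. grad f x $ i *\<^sub>R (P x ** A)) :: real^'m^'m^2"
  have sg: "strong_gradient P G disc" and so: "AE x in ?M. P x \<in> SO_grp" using g by (auto simp: gauge_transform_def)
  have X: "square_integrable ?M ?X" by (rule gauge_form_square_integrable(2)[OF \<Omega> gauge_transform_relaxed[OF g]])
  have PA: "square_integrable ?M (\<lambda>x. P x ** A)"
    by (rule square_integrable_linear[OF bounded_bilinear.bounded_linear_left[OF bounded_bilinear_matrix_mult] strong_gradient_square_integrable(1)[OF sg]])
  have Z: "square_integrable ?M ?Z"
    by (rule continuous_bilinear_L2[OF bounded_ball bounded_bilinear_tensor continuous_on_grad[OF f] PA])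
  \<comment> \<open>The constant term is the minimal energy and has been subtracted, hence the final
    0; the discriminant inequality then leaves no room for a linear term.\<close>
  have "0 \<le> (L2_norm ?M ?Z)\<^sup>2 * t\<^sup>2 + 2 * t * (\<integral>x. ?X x \<bullet> ?Z x \<partial>?M) + 0" for t
  proof -
    let ?R = "\<lambda>x. rodrigues A (t * f x)"
    let ?P = "\<lambda>x. P x ** ?R x" and ?G = "\<lambda>x. \<chi> i. (G x $ i + (t * grad f x $ i) *\<^sub>R (P x ** A)) ** ?R x"
    have "AE x in ?M. ?P x \<in> SO_grp" using so by eventually_elim (intro SO_grp_mult rodrigues_SO[OF A])
    then have "gauge_transform ?P ?G" using strong_gradient_rotated[OF A sg f] by (simp add: gauge_transform_def)
    from min[OF this] have "energy \<Omega> P G \<le> energy \<Omega> ?P ?G" .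
    also have "energy \<Omega> ?P ?G = L2_norm ?M (\<lambda>x. ?X x + t *\<^sub>R ?Z x)"
    proof -
      \<comment> \<open>The rotation comes out as a common right factor of derivative and connection
        term, and the norm drops it.\<close>
      have "gauge_form \<Omega> ?P ?G x = form_mult_right (?X x + t *\<^sub>R ?Z x) (?R x)" for x
        unfolding gauge_form_def form_mult_right_def
        by (rule vec_eq_iff[THEN iffD2], rule allI) (simp add: matrix_bilinear matrix_mul_assoc algebra_simps)
      then have "norm (gauge_form \<Omega> ?P ?G x) = norm (?X x + t *\<^sub>R ?Z x)" for x
        by (simp only: norm_form_mult_right[OF rodrigues_SO[OF A]])
      then show ?thesis by (simp only: L2_norm_def)
    qed
    finally have "(energy \<Omega> P G)\<^sup>2 \<le> (L2_norm ?M (\<lambda>x. ?X x + t *\<^sub>R ?Z x))\<^sup>2"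
      by (rule power_mono) simp
    then show ?thesis unfolding L2_quadratic[OF X Z] by simp
  qed
  from quadratic_nonneg_imp[OF this] show ?thesis by simp
qed

text \<open>The infinitesimal rotation in the plane of two coordinates. These matrices satisfy the
  cubic relation of Rodrigues' formula and span the skew matrices.\<close>

definition plane_generator :: "'m::finite \<Rightarrow> 'm \<Rightarrow> real^'m^'m" where
  "plane_generator a b = (\<chi> i j. (if i = a \<and> j = b then 1 else 0) - (if i = b \<and> j = a then 1 else 0))"

lemma plane_generator:
  assumes "a \<noteq> b"
  shows "transpose (plane_generator a b) = - plane_generator a b"
    "plane_generator a b ** (plane_generator a b ** plane_generator a b) = - plane_generator a b"
    "V \<bullet> plane_generator a b = V $ a $ b - V $ b $ a"
proof -
  let ?A = "plane_generator a b"
  have entry: "?A $ i $ j = (if i = a \<and> j = b then 1 else 0) - (if i = b \<and> j = a then 1 else 0)" for i j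
    by (simp only: plane_generator_def vec_lambda_beta)
  have "transpose ?A $ i $ j = (- ?A) $ i $ j" for i j
    unfolding transpose_def vec_lambda_beta vector_uminus_component entry by argo
  then show "transpose ?A = - ?A" by (simp only: vec_eq_iff) blast
  have delta: "(\<Sum>j\<in>UNIV. ?A $ i $ j * y j) = (if i = a then y b else 0) - (if i = b then y a else 0)" for y i
  proof -
    have "?A $ i $ j * y j = (if j = b then if i = a then y b else 0 else 0) - (if j = a then if i = b then y a else 0 else 0)" for j
      unfolding entry left_diff_distrib
      by (rule arg_cong2[of _ _ _ _ minus]) (cases "i = a"; cases "j = b"; simp; fail | cases "i = b"; cases "j = a"; simp; fail)+
    then show ?thesis by (simp only: sum_subtractf sum.delta[OF finite] UNIV_I if_True)
  qed
  \<comment> \<open>Left multiplication puts row b into row a and minus row a into row b and clears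
    all others; doing it three times amounts to minus doing it once.\<close>
  have mult: "(?A ** X) $ i $ k = (if i = a then X $ b $ k else 0) - (if i = b then X $ a $ k else 0)" for X :: "real^'a^'a" and i k
    unfolding matrix_matrix_mult_def vec_lambda_beta by (rule delta)
  have "(?A ** ?A) $ a $ k = ?A $ b $ k" "(?A ** ?A) $ b $ k = - (?A $ a $ k)" for k
    unfolding mult using assms by simp_all
  then have "(?A ** (?A ** ?A)) $ i $ k = - ((if i = a then ?A $ a $ k else 0) + (if i = b then ?A $ b $ k else 0))" for i k
    unfolding mult[of "?A ** ?A"] using assms by simp
  moreover have "(if i = a then ?A $ a $ k else 0) + (if i = b then ?A $ b $ k else 0) = ?A $ i $ k" for i k
    using assms by (auto simp only: entry split: if_split; simp)
  ultimately show "?A ** (?A ** ?A) = - ?A" by (simp only: vec_eq_iff vector_uminus_component) blast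
  have "V \<bullet> ?A = (\<Sum>i\<in>UNIV. \<Sum>j\<in>UNIV. ?A $ i $ j * V $ i $ j)"
    by (subst inner_commute) (rule inner_matrix)
  also have "\<dots> = V $ a $ b - V $ b $ a"
    unfolding delta sum_subtractf by (simp only: sum.delta[OF finite] UNIV_I if_True)
  finally show "V \<bullet> ?A = V $ a $ b - V $ b $ a" .
qed

text \<open>Weak gradients see only almost everywhere classes; thus the gradient of a product that
  is the identity almost everywhere can be compared with that of a constant.\<close>

lemma weak_gradient_cong_AE:
  fixes u w :: "real^'n \<Rightarrow> 'b::euclidean_space"
  assumes U: "open U" and u: "has_weak_gradient u G U" and w: "has_weak_gradient w H U"
    and m: "u \<in> borel_measurable (lebesgue_on U)" "w \<in> borel_measurable (lebesgue_on U)"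
    and ae: "AE x in lebesgue_on U. u x = w x"
  shows "AE x in lebesgue_on U. G x = H x"
proof (rule weak_gradient_unique[OF U _ w])
  have "(\<integral>x. partial_deriv i \<phi> x *\<^sub>R w x \<partial>lebesgue_on U) = (\<integral>x. partial_deriv i \<phi> x *\<^sub>R u x \<partial>lebesgue_on U)"
    if "test_function U \<phi>" for \<phi> i
  proof (rule integral_cong_AE)
    have "continuous_on UNIV (partial_deriv i \<phi>)"
      using Ck_imp_continuous_on[OF Ck_grad_component[OF test_function_Ck[OF that, of "Suc 0"]], of UNIV i]
      by (simp add: partial_deriv_eq_grad[abs_def])
    note pm = continuous_measurable_lebesgue_on[OF this]
    show "(\<lambda>x. partial_deriv i \<phi> x *\<^sub>R w x) \<in> borel_measurable (lebesgue_on U)" by (rule borel_measurable_scaleR[OF pm m(2)])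
    show "(\<lambda>x. partial_deriv i \<phi> x *\<^sub>R u x) \<in> borel_measurable (lebesgue_on U)" by (rule borel_measurable_scaleR[OF pm m(1)])
    show "AE x in lebesgue_on U. partial_deriv i \<phi> x *\<^sub>R w x = partial_deriv i \<phi> x *\<^sub>R u x"
      using ae by eventually_elim simp
  qed
  then show "has_weak_gradient w G U" using u w unfolding has_weak_gradient_def by simp
qed

text \<open>Differentiating \<open>P\<^sup>T P = 1\<close>.\<close>

lemma gauge_gradient_skew:
  fixes P :: "real^2 \<Rightarrow> real^'m^'m"
  assumes "gauge_transform P G"
  shows "AE x in lebesgue_on disc. \<forall>i. transpose (transpose (P x) ** G x $ i) = - (transpose (P x) ** G x $ i)"
proof -
  let ?M = "lebesgue_on disc"
  have sg: "strong_gradient P G disc" and so: "AE x in ?M. P x \<in> SO_grp" using assms by (auto simp: gauge_transform_def)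
  let ?h = "\<lambda>A B :: real^'m^'m. transpose A ** B"
  have h: "bounded_bilinear ?h"
    by (rule bounded_bilinear.comp[OF bounded_bilinear_matrix_mult bounded_linear_transpose bounded_linear_ident])
  note w1 = strong_gradient_bilinear[OF disc_open_bounded h sg sg]
  note w2 = strong_gradient_weak[OF disc_open_bounded strong_gradient_C1[OF disc_open_bounded Ck_const[of _ "mat 1 :: real^'m^'m"]]]
  note Pm = square_integrable_measurable[OF strong_gradient_square_integrable(1)[OF sg]]
  have ae: "AE x in ?M. ?h (P x) (P x) = mat 1" using so by eventually_elim (rule SO_grpD(1))
  have "AE x in ?M. (\<chi> i. ?h (P x) (G x $ i) + ?h (G x $ i) (P x)) = grad (\<lambda>x. mat 1 :: real^'m^'m) x"
    by (rule weak_gradient_cong_AE[OF open_ball w1 w2 borel_measurable_bilinear_compose[OF h Pm Pm] borel_measurable_const ae])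
  then show ?thesis
  proof eventually_elim
    case (elim x)
    then have "(\<chi> i. ?h (P x) (G x $ i) + ?h (G x $ i) (P x)) = (0 :: real^'m^'m^2)" unfolding grad_const .
    from arg_cong[OF this, of "\<lambda>w. w $ i" for i] have "?h (P x) (G x $ i) + ?h (G x $ i) (P x) = 0" for i
      unfolding vec_lambda_beta zero_index .
    then show ?case
      by (simp add: matrix_transpose_mul transpose_transpose eq_neg_iff_add_eq_0 add.commute)
  qed
qed

section \<open>The Coulomb gauge\<close>

lemma form_mult_left_component: "form_mult_left Q W $ i = Q ** W $ i"
  by (simp add: form_mult_left_def)

text \<open>Pairing a skew matrix with the generator of the plane (a, b) gives twice its entry at
  (a, b); the diagonal vanishes by skewness.\<close>

lemma skew_eq_0:
  fixes V :: "real^'m^'m"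
  assumes "transpose V = - V" and "\<And>a b. a \<noteq> b \<Longrightarrow> V \<bullet> plane_generator a b = 0"
  shows "V = 0"
proof -
  have "V $ a $ b = - V $ b $ a" for a b
    using arg_cong[OF assms(1), of "\<lambda>W. W $ b $ a"] unfolding transpose_def by simp
  moreover have "V $ a $ b = V $ b $ a" if "a \<noteq> b" for a b
    using assms(2)[OF that] plane_generator(3)[OF that, of V] by simp
  ultimately have "V $ a $ b = 0" for a b by (cases "a = b") (smt (verit))+
  then show ?thesis by (simp add: vec_eq_iff)
qed

text \<open>The last conclusion is the Coulomb condition: tested with all C1 functions, it says that
  the transformed connection has zero divergence and zero normal component.\<close>

lemma Coulomb_gauge:
  fixes \<Omega> :: "real^2 \<Rightarrow> real^'m^'m^2"
  assumes \<Omega>: "square_integrable (lebesgue_on disc) \<Omega>" and so: "AE x in lebesgue_on disc. \<forall>i. \<Omega> x $ i \<in> so_alg"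
  obtains P G where "gauge_transform P G" "energy \<Omega> P G \<le> L2_norm (lebesgue_on disc) \<Omega>"
    "square_integrable (lebesgue_on disc) (\<lambda>x. form_mult_left (transpose (P x)) (gauge_form \<Omega> P G x))"
    "L2_norm (lebesgue_on disc) (\<lambda>x. form_mult_left (transpose (P x)) (gauge_form \<Omega> P G x)) = energy \<Omega> P G"
    "AE x in lebesgue_on disc. \<forall>i. form_mult_left (transpose (P x)) (gauge_form \<Omega> P G x) $ i \<in> so_alg"
    "\<And>f. Ck (Suc 0) f \<Longrightarrow> (\<integral>x. grad f x $ 1 *\<^sub>R form_mult_left (transpose (P x)) (gauge_form \<Omega> P G x) $ 1
       + grad f x $ 2 *\<^sub>R form_mult_left (transpose (P x)) (gauge_form \<Omega> P G x) $ 2 \<partial>lebesgue_on disc) = 0"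
proof -
  let ?M = "lebesgue_on disc"
  obtain P G where g: "gauge_transform P G"
    and min: "\<And>P' G'. gauge_transform P' G' \<Longrightarrow> energy \<Omega> P G \<le> energy \<Omega> P' G'"
    by (rule energy_minimiser[OF \<Omega>]) blast
  let ?X = "gauge_form \<Omega> P G"
  define \<omega> where "\<omega> x = form_mult_left (transpose (P x)) (?X x)" for x
  have sg: "strong_gradient P G disc" and SO: "AE x in ?M. P x \<in> SO_grp" using g by (auto simp: gauge_transform_def)
  have X: "square_integrable ?M ?X" by (rule gauge_form_square_integrable(2)[OF \<Omega> gauge_transform_relaxed[OF g]])
  have "energy \<Omega> P G \<le> energy \<Omega> (\<lambda>x. mat 1) (grad (\<lambda>x. mat 1))" by (rule min[OF gauge_transform_const])
  also have "gauge_form \<Omega> (\<lambda>x. mat 1) (grad (\<lambda>x. mat 1)) = \<Omega>"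
    by (rule ext) (simp add: gauge_form_def grad_const form_mult_right_def matrix_mul_rid)
  finally have e: "energy \<Omega> P G \<le> L2_norm ?M \<Omega>" .
  have \<omega>m: "\<omega> \<in> borel_measurable ?M"
    unfolding \<omega>_def
    by (rule borel_measurable_bilinear_compose[OF bounded_bilinear_form_mult_left
      square_integrable_measurable[OF square_integrable_linear[OF bounded_linear_transpose strong_gradient_square_integrable(1)[OF sg]]]
      square_integrable_measurable[OF X]])
  have n: "AE x in ?M. norm (\<omega> x) = norm (?X x)"
    using SO unfolding \<omega>_def by eventually_elim (rule norm_form_mult_left[OF SO_grpD(2)])
  have \<omega>: "square_integrable ?M \<omega>"
    by (rule square_integrable_bound(1)[OF X \<omega>m, of 1]) (use n in eventually_elim, simp)
  have "L2_norm ?M (\<lambda>x. norm (\<omega> x)) = L2_norm ?M (\<lambda>x. norm (?X x))"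
    by (rule L2_norm_cong_AE[OF _ _ n])
      (rule measurable_compose[OF \<omega>m borel_measurable_norm] measurable_compose[OF square_integrable_measurable[OF X] borel_measurable_norm])+
  then have N: "L2_norm ?M \<omega> = energy \<Omega> P G" by (simp add: L2_norm_def)
  \<comment> \<open>The derivative part is skew because P is a rotation almost everywhere, the other
    part is a conjugate of the skew form \<Omega>.\<close>
  have \<omega>_skew: "AE x in ?M. \<forall>i. transpose (\<omega> x $ i) = - \<omega> x $ i"
    using gauge_gradient_skew[OF g] so
  proof eventually_elim
    case (elim x)
    have "transpose (transpose (P x) ** (\<Omega> x $ i ** P x)) = - (transpose (P x) ** (\<Omega> x $ i ** P x))" for i
    proof -
      have "transpose (\<Omega> x $ i) = - \<Omega> x $ i" using elim(2) by (simp add: so_alg_def)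
      then show ?thesis by (simp add: matrix_transpose_mul transpose_transpose matrix_bilinear matrix_mul_assoc)
    qed
    moreover have "\<omega> x $ i = transpose (P x) ** G x $ i + transpose (P x) ** (\<Omega> x $ i ** P x)" for i
      by (simp add: \<omega>_def form_mult_left_component gauge_form_def form_mult_right_def matrix_bilinear)
    ultimately show ?case using elim(1) by (simp add: transpose_add)
  qed
  have div: "(\<integral>x. grad f x $ 1 *\<^sub>R \<omega> x $ 1 + grad f x $ 2 *\<^sub>R \<omega> x $ 2 \<partial>?M) = 0"
    if f: "Ck (Suc 0) f" for f :: "real^2 \<Rightarrow> real"
  \<comment> \<open>The integral is itself a skew matrix, so it is enough to pair it with the
    generators, the directions in which the energy was varied.\<close>
  proof (rule skew_eq_0)
    let ?F = "\<lambda>x. grad f x $ 1 *\<^sub>R \<omega> x $ 1 + grad f x $ 2 *\<^sub>R \<omega> x $ 2"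
    have "square_integrable ?M (\<lambda>x. grad f x $ i *\<^sub>R \<omega> x $ i)" for i
      by (rule continuous_bilinear_L2[OF bounded_ball bounded_bilinear_scaleR _ square_integrable_component[OF \<omega>]])
        (rule Ck_imp_continuous_on[OF Ck_grad_component[OF f]])
    then have "square_integrable ?M ?F" by (intro square_integrable_add)
    then have F: "integrable ?M ?F" by (rule disc_integrable)
    have "transpose (integral\<^sup>L ?M ?F) = (\<integral>x. transpose (?F x) \<partial>?M)"
      by (rule integral_bounded_linear[OF bounded_linear_transpose F, symmetric])
    also have "\<dots> = (\<integral>x. - ?F x \<partial>?M)"
    proof (rule integral_cong_AE)
      show "(\<lambda>x. transpose (?F x)) \<in> borel_measurable ?M"
        by (rule borel_measurable_integrable[OF integrable_bounded_linear[OF bounded_linear_transpose F]])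
      show "(\<lambda>x. - ?F x) \<in> borel_measurable ?M" by (rule borel_measurable_integrable[OF integrable_minus[OF F]])
      show "AE x in ?M. transpose (?F x) = - ?F x"
        using \<omega>_skew by eventually_elim (simp add: transpose_add transpose_scaleR)
    qed
    also have "\<dots> = - integral\<^sup>L ?M ?F" by (rule integral_minus)
    finally show "transpose (integral\<^sup>L ?M ?F) = - integral\<^sup>L ?M ?F" .
    fix a b :: 'm
    assume ab: "a \<noteq> b"
    let ?A = "plane_generator a b"
    have "integral\<^sup>L ?M ?F \<bullet> ?A = (\<integral>x. ?F x \<bullet> ?A \<partial>?M)" by (rule integral_inner_left[OF F, symmetric])
    \<comment> \<open>The transpose of P moves across the Frobenius inner product and becomes P in
      front of the generator, which is the integrand of the first variation.\<close>
    also have "(\<lambda>x. ?F x \<bullet> ?A) = (\<lambda>x. ?X x \<bullet> (\<chi> i. grad f x $ i *\<^sub>R (P x ** ?A)))"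
      by (rule ext) (simp add: inner_vec_def[of "gauge_form \<Omega> P G _"] sum_2 inner_add_left \<omega>_def form_mult_left_component inner_matrix_mult_left)
    also have "integral\<^sup>L ?M \<dots> = 0"
      by (rule energy_first_variation[OF \<Omega> plane_generator(1,2)[OF ab] g min f])
    finally show "integral\<^sup>L ?M ?F \<bullet> ?A = 0" .
  qed
  have "AE x in ?M. \<forall>i. \<omega> x $ i \<in> so_alg" using \<omega>_skew by (simp add: so_alg_def)
  from that[OF g e \<omega>[unfolded \<omega>_def] N[unfolded \<omega>_def] this[unfolded \<omega>_def] div[unfolded \<omega>_def]]
  show thesis .
qed

theorem corollary4:
  shows "\<exists>C::real. \<forall>\<Omega> :: real^2 \<Rightarrow> real^'m^'m^2. \<Omega> \<in> L2_so_form disc \<longrightarrow>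
    (\<exists>\<xi> S. \<xi> \<in> W12_into disc so_alg \<and> S \<in> W12_into disc SO_grp \<and>
       (AE x in lebesgue_on disc. \<forall>i.
          weak_perp_grad disc \<xi> x $ i =
            matrix_inv (S x) ** (weak_grad disc S x $ i) + matrix_inv (S x) ** (\<Omega> x $ i) ** S x) \<and>
       has_trace \<xi> (\<lambda>_. 0) \<and>
       W12_norm disc \<xi> + L2_norm (lebesgue_on disc) (weak_grad disc S)
         \<le> C * L2_norm (lebesgue_on disc) \<Omega>)"
proof (intro exI[of _ 5] allI impI)
  fix \<Omega> :: "real^2 \<Rightarrow> real^'m^'m^2"
  let ?M = "lebesgue_on disc"
  assume "\<Omega> \<in> L2_so_form disc"
  then have \<Omega>: "square_integrable ?M \<Omega>" and so: "AE x in ?M. \<forall>i. \<Omega> x $ i \<in> so_alg"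
    by (auto simp: L2_so_form_def)
  obtain P G where g: "gauge_transform P G" and e: "energy \<Omega> P G \<le> L2_norm ?M \<Omega>"
    and "square_integrable ?M (\<lambda>x. form_mult_left (transpose (P x)) (gauge_form \<Omega> P G x))"
    "L2_norm ?M (\<lambda>x. form_mult_left (transpose (P x)) (gauge_form \<Omega> P G x)) = energy \<Omega> P G"
    "AE x in ?M. \<forall>i. form_mult_left (transpose (P x)) (gauge_form \<Omega> P G x) $ i \<in> so_alg"
    "\<And>f. Ck (Suc 0) f \<Longrightarrow> (\<integral>x. grad f x $ 1 *\<^sub>R form_mult_left (transpose (P x)) (gauge_form \<Omega> P G x) $ 1
       + grad f x $ 2 *\<^sub>R form_mult_left (transpose (P x)) (gauge_form \<Omega> P G x) $ 2 \<partial>?M) = 0"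
    by (rule Coulomb_gauge[OF \<Omega> so]) blast
  moreover define \<omega> where "\<omega> x = form_mult_left (transpose (P x)) (gauge_form \<Omega> P G x)" for x
  ultimately have \<omega>: "square_integrable ?M \<omega>" and N: "L2_norm ?M \<omega> = energy \<Omega> P G"
    and \<omega>_so: "AE x in ?M. \<forall>i. \<omega> x $ i \<in> so_alg"
    and div: "\<And>f. Ck (Suc 0) f \<Longrightarrow> (\<integral>x. grad f x $ 1 *\<^sub>R \<omega> x $ 1 + grad f x $ 2 *\<^sub>R \<omega> x $ 2 \<partial>?M) = 0"
    by (simp_all only: \<omega>_def[abs_def])
  have P: "strong_gradient P G disc" and SO: "AE x in ?M. P x \<in> SO_grp" using g by (auto simp: gauge_transform_def)
  obtain \<xi> v where \<xi>: "strong_gradient \<xi> (\<lambda>x. rot (\<omega> x)) disc"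
    and v: "\<And>k::nat. smooth (v k)" "\<And>k x. 1 \<le> norm x \<Longrightarrow> v k x = 0"
    and vl: "(\<lambda>k. L2_norm ?M (\<lambda>x. v k x - \<xi> x)) \<longlonglongrightarrow> 0"
    and gl: "(\<lambda>k. L2_norm ?M (\<lambda>x. grad (v k) x - rot (\<omega> x))) \<longlonglongrightarrow> 0"
    and \<xi>_norm: "L2_norm ?M \<xi> \<le> 2 * L2_norm ?M \<omega>"
    and \<xi>_L: "\<And>L :: real^'m^'m \<Rightarrow> real^'m^'m. bounded_linear L \<Longrightarrow> AE x in ?M. L (\<omega> x $ 2) = 0 \<Longrightarrow> AE x in ?M. L (\<xi> x) = 0"
    by (rule weak_Poincare_lemma[OF \<omega> div]) blast+
  note \<xi>w = strong_gradient_W12[OF disc_open_bounded \<xi>] and Pw = strong_gradient_W12[OF disc_open_bounded P]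
  have "AE x in ?M. \<xi> x + transpose (\<xi> x) = 0"
  \<comment> \<open>Skewness of the potential is the vanishing of this linear map, inherited from
    the second component of \<omega>.\<close>
  proof (rule \<xi>_L)
    show "bounded_linear (\<lambda>A :: real^'m^'m. A + transpose A)"
      by (rule bounded_linear_add[OF bounded_linear_ident bounded_linear_transpose])
    show "AE x in ?M. \<omega> x $ 2 + transpose (\<omega> x $ 2) = 0"
      using \<omega>_so by eventually_elim (simp add: so_alg_def)
  qed
  then have "AE x in ?M. \<xi> x \<in> so_alg"
    by eventually_elim (simp add: so_alg_def eq_neg_iff_add_eq_0 add.commute)
  then have \<xi>_so: "\<xi> \<in> W12_into disc so_alg" using \<xi>w(1) by (simp add: W12_into_def)
  have P_SO: "P \<in> W12_into disc SO_grp" using Pw(1) SO by (simp add: W12_into_def)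
  have eq: "AE x in ?M. \<forall>i. weak_perp_grad disc \<xi> x $ i =
      matrix_inv (P x) ** (weak_grad disc P x $ i) + matrix_inv (P x) ** (\<Omega> x $ i) ** P x"
    using \<xi>w(2) Pw(2) SO
  proof eventually_elim
    case (elim x)
    \<comment> \<open>Taking the perpendicular gradient undoes \<open>rot\<close>.\<close>
    have "weak_perp_grad disc \<xi> x = \<omega> x"
      by (simp add: weak_perp_grad_def elim(1) vec_eq_iff[of _ "\<omega> x"] forall_2)
    moreover have "\<omega> x $ i = transpose (P x) ** G x $ i + transpose (P x) ** \<Omega> x $ i ** P x" for i
      by (simp add: \<omega>_def form_mult_left_component gauge_form_def form_mult_right_def matrix_bilinear matrix_mul_assoc)
    ultimately show ?case by (simp add: elim(2) matrix_inv_SO_grp[OF elim(3)])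
  qed
  \<comment> \<open>Poincare contributes 2 and the gradient, a rotated copy of \<omega>, contributes
    1; the norm of \<omega> is the energy, at most that of \<Omega>.\<close>
  have "W12_norm disc \<xi> \<le> L2_norm ?M \<xi> + L2_norm ?M (\<lambda>x. rot (\<omega> x))"
    unfolding W12_norm_def \<xi>w(4) by (rule sqrt_sum_squares_le_sum) simp_all
  also have "L2_norm ?M (\<lambda>x. rot (\<omega> x)) = L2_norm ?M \<omega>" by (simp add: L2_norm_def norm_rot)
  finally have 1: "W12_norm disc \<xi> \<le> 3 * L2_norm ?M \<Omega>" using \<xi>_norm N e by linarith
  note f = gauge_form_square_integrable(1)[OF \<Omega> gauge_transform_relaxed[OF g]]
  \<comment> \<open>The gradient is the gauge form minus \<Omega>P, and each of the two has norm at
    most that of \<Omega>.\<close>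
  have "L2_norm ?M G \<le> energy \<Omega> P G + L2_norm ?M (\<lambda>x. G x - gauge_form \<Omega> P G x)"
    by (rule L2_norm_triangle_sub[OF strong_gradient_square_integrable(2)[OF P]
      gauge_form_square_integrable(2)[OF \<Omega> gauge_transform_relaxed[OF g]]])
  also have "(\<lambda>x. G x - gauge_form \<Omega> P G x) = (\<lambda>x. - form_mult_right (\<Omega> x) (P x))"
    by (simp add: gauge_form_def)
  also have "L2_norm ?M \<dots> = L2_norm ?M \<Omega>"
    unfolding L2_norm_uminus by (rule L2_norm_form_mult_gauge[OF \<Omega> g])
  finally have 2: "L2_norm ?M (weak_grad disc P) \<le> 2 * L2_norm ?M \<Omega>" using e unfolding Pw(4) by linarith
  have "W12_norm disc \<xi> + L2_norm ?M (weak_grad disc P) \<le> 5 * L2_norm ?M \<Omega>" using 1 2 by linarith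
  then show "\<exists>\<xi> S. \<xi> \<in> W12_into disc so_alg \<and> S \<in> W12_into disc SO_grp \<and>
       (AE x in ?M. \<forall>i. weak_perp_grad disc \<xi> x $ i =
            matrix_inv (S x) ** (weak_grad disc S x $ i) + matrix_inv (S x) ** (\<Omega> x $ i) ** S x) \<and>
       has_trace \<xi> (\<lambda>_. 0) \<and>
       W12_norm disc \<xi> + L2_norm ?M (weak_grad disc S) \<le> 5 * L2_norm ?M \<Omega>"
    using \<xi>_so P_SO eq has_trace_zeroI[OF \<xi> v vl gl] by blast
qed

end
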